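(* Let $q\ge r\ge 1$ be integers, $v_x,v_y>0$ known, $v_0\ge v_x$, and $v_w=(1/v_x+1/v_y)^{-1}$. Assume that $q-r-1>0$. Let $\hat p_{GB}(Y\mid X)$ be the Bayesian predictive density with respect to the hierarchical prior with parameters $(a,b)$ defined in the context. Then $\hat p_{GB}(Y\mid X)$ is admissible and minimax relative to the Kullback-Leibler loss if $$a>0,\qquad b>2,\qquad a+b\le \frac{q-r-1}{2-v_w/v_0}-2r+2.$$ Moreover, there exist constants $a$ and $b$ satisfying these three conditions if $(-q+5r+1)/(2r)<v_w/v_0<1$.
   Context: Prediction problem: $X\mid\Theta\sim\mathcal N_{r\times q}(\Theta,v_xI_r\otimes I_q)$ and $Y\mid\Theta\sim\mathcal N_{r\times q}(\Theta,v_yI_r\otimes I_q)$ are independent given $\Theta$, i.e. $p(X\mid\Theta)=(2\pi v_x)^{-qr/2}\exp(-\|X-\Theta\|^2/(2v_x))$ and similarly $p(Y\mid\Theta)$ with $v_y$, where $\|A\|^2=\mathrm{tr}(AA^\top)$. The matrix $\Theta\in\mathbb R^{r\times q}$ is unknown. A predictive density $\hat p=\hat p(Y\mid X)$ is an estimate of the density $p(Y\mid\Theta)$ based on $X$. The Kullback-Leibler (KL) loss is $L_{KL}(\Theta,\hat p)=\int_{\mathbb R^{r\times q}}p(Y\mid\Theta)\log\frac{p(Y\mid\Theta)}{\hat p(Y\mid X)}\,dY$ and the risk is $R_{KL}(\Theta,\hat p)=\int_{\mathbb R^{r\times q}} p(X\mid\Theta)L_{KL}(\Theta,\hat p)\,dX$.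 $\hat p$ is minimax if $\sup_\Theta R_{KL}(\Theta,\hat p)=\inf_{\tilde p}\sup_\Theta R_{KL}(\Theta,\tilde p)$ over all predictive densities $\tilde p$; $\hat p$ is admissible if there is no predictive density $\tilde p$ with $R_{KL}(\Theta,\tilde p)\le R_{KL}(\Theta,\hat p)$ for all $\Theta$ and strict inequality for some $\Theta$. For a (proper or improper) prior density $\pi(\Theta)$ with $\int p(X\mid\Theta)\pi(\Theta)\,d\Theta<\infty$ for all $X$, the Bayesian predictive density is $\hat p_\pi(Y\mid X)=\dfrac{\int p(X\mid\Theta)p(Y\mid\Theta)\pi(\Theta)\,d\Theta}{\int p(X\mid\Theta)\pi(\Theta)\,d\Theta}$. Hierarchical prior: let $\mathcal R_r$ be the set of real symmetric $r\times r$ matrices $\Omega$ such that $\Omega$ and $I_r-\Omega$ are both positive definite. Given $\Omega\in\mathcal R_r$, $\Theta\sim\mathcal N_{r\times q}(0,v_0\Omega^{-1}(I_r-\Omega)\otimes I_q)$, with density $$\pi_1(\Theta\mid\Omega)=(2\pi v_0)^{-qr/2}|\Omega(I_r-\Omega)^{-1}|^{q/2}\exp\Big[-\frac1{2v_0}\mathrm{tr}\{\Omega(I_r-\Omega)^{-1}\Theta\Theta^\top\}\Big],$$ and the second-stage density on $\mathcal R_r$ is $\pi_{GB}(\Omega)=K_{a,b}|\Omega|^{a/2-1}|I_r-\Omega|^{b/2-1}$, with $K_{a,b}>0$ a (normalizing) constant. The prior is $\pi(\Theta)=\int_{\mathcal R_r}\pi_1(\Theta\mid\Omega)\pi_{GB}(\Omega)\,d\Omega$,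 and $\hat p_{GB}$ is the corresponding Bayesian predictive density. *)

theory Defs
  imports "HOL-Analysis.Analysis"
begin

text \<open>
  An \<open>r \<times> q\<close> matrix is an element of \<^typ>\<open>real^'q^'r\<close> with \<open>CARD('r) = r\<close> and
  \<open>CARD('q) = q\<close>; \<^const>\<open>norm\<close> on this type is the Frobenius norm, and \<^const>\<open>lborel\<close> is
  the product of the Lebesgue measures of the entries.
\<close>

lemma norm_eq_frobenius: "(norm A)\<^sup>2 = trace (A ** transpose A)" for A :: "real^'q^'r"
  by (simp add: power2_norm_eq_inner inner_vec_def trace_def matrix_matrix_mult_def transpose_def)

subsection \<open>Integrals of extended-real functions\<close>

text \<open>
  KL losses and risks may be \<open>\<infinity>\<close>, whereas the Bochner integral is \<open>0\<close> on non-integrable functions;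
  hence the integral of the positive part minus that of the negative part.
  For the KL loss of a predictive density the negative part is always integrable, because
  \<open>p * ln (p / g) \<ge> p - g\<close>, so \<open>\<infinity> - \<infinity>\<close> does not occur.
\<close>

definition ext_integral :: "'a measure \<Rightarrow> ('a \<Rightarrow> ereal) \<Rightarrow> ereal" where
  "ext_integral M f =
     enn2ereal (\<integral>\<^sup>+x. e2ennreal (f x) \<partial>M) - enn2ereal (\<integral>\<^sup>+x. e2ennreal (- f x) \<partial>M)"

subsection \<open>The prediction problem\<close>

definition normal_density_mat :: "real \<Rightarrow> real^'q^'r \<Rightarrow> real^'q^'r \<Rightarrow> real" where
  "normal_density_mat v \<Theta> X =
     (2 * pi * v) powr (- (real CARD('q) * real CARD('r)) / 2) * exp (- (norm (X - \<Theta>))\<^sup>2 / (2 * v))"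

definition predictive_density :: "(real^'q^'r \<Rightarrow> real^'q^'r \<Rightarrow> real) \<Rightarrow> bool" where
  "predictive_density p \<longleftrightarrow>
     (\<lambda>(X, Y). p X Y) \<in> borel_measurable (borel \<Otimes>\<^sub>M borel) \<and>
     (\<forall>X Y. 0 \<le> p X Y) \<and>
     (\<forall>X. (\<integral>\<^sup>+Y. ennreal (p X Y) \<partial>lborel) = 1)"

text \<open>\<open>g\<close> is the density used in place of the true density of \<open>Y\<close>. The true density is positive
  everywhere, so \<open>p * log (p / g) = \<infinity>\<close> wherever \<open>g\<close> vanishes.\<close>

definition KL_loss :: "real \<Rightarrow> real^'q^'r \<Rightarrow> (real^'q^'r \<Rightarrow> real) \<Rightarrow> ereal" where
  "KL_loss v\<^sub>y \<Theta> g =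
     ext_integral lborel (\<lambda>Y.
       if g Y = 0 then \<infinity>
       else ereal (normal_density_mat v\<^sub>y \<Theta> Y * ln (normal_density_mat v\<^sub>y \<Theta> Y / g Y)))"

definition KL_risk ::
    "real \<Rightarrow> real \<Rightarrow> real^'q^'r \<Rightarrow> (real^'q^'r \<Rightarrow> real^'q^'r \<Rightarrow> real) \<Rightarrow> ereal" where
  "KL_risk v\<^sub>x v\<^sub>y \<Theta> p =
     ext_integral lborel (\<lambda>X. ereal (normal_density_mat v\<^sub>x \<Theta> X) * KL_loss v\<^sub>y \<Theta> (p X))"

definition KL_minimax ::
    "real \<Rightarrow> real \<Rightarrow> (real^'q^'r \<Rightarrow> real^'q^'r \<Rightarrow> real) \<Rightarrow> bool" where
  "KL_minimax v\<^sub>x v\<^sub>y p \<longleftrightarrow>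
     predictive_density p \<and>
     (SUP \<Theta>. KL_risk v\<^sub>x v\<^sub>y \<Theta> p) =
       (INF p'\<in>{p' :: real^'q^'r \<Rightarrow> real^'q^'r \<Rightarrow> real. predictive_density p'}.
          SUP \<Theta>. KL_risk v\<^sub>x v\<^sub>y \<Theta> p')"

definition KL_admissible ::
    "real \<Rightarrow> real \<Rightarrow> (real^'q^'r \<Rightarrow> real^'q^'r \<Rightarrow> real) \<Rightarrow> bool" where
  "KL_admissible v\<^sub>x v\<^sub>y p \<longleftrightarrow>
     predictive_density p \<and>
     \<not> (\<exists>p'. predictive_density p' \<and>
            (\<forall>\<Theta>. KL_risk v\<^sub>x v\<^sub>y \<Theta> p' \<le> KL_risk v\<^sub>x v\<^sub>y \<Theta> p) \<and>
            (\<exists>\<Theta>. KL_risk v\<^sub>x v\<^sub>y \<Theta> p' < KL_risk v\<^sub>x v\<^sub>y \<Theta> p))"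

text \<open>A prior density may take the value \<open>\<infinity>\<close> (the hierarchical prior below can do so at
  rank-deficient \<open>\<Theta>\<close>), hence the codomain \<^typ>\<open>ennreal\<close>. If the marginal in the denominator is
  infinite, the quotient is \<open>0\<close>, which is not a \<^const>\<open>predictive_density\<close>.\<close>

definition bayes_predictive ::
    "real \<Rightarrow> real \<Rightarrow> (real^'q^'r \<Rightarrow> ennreal) \<Rightarrow> real^'q^'r \<Rightarrow> real^'q^'r \<Rightarrow> real" where
  "bayes_predictive v\<^sub>x v\<^sub>y \<pi> X Y =
     enn2real
       ((\<integral>\<^sup>+\<Theta>. ennreal (normal_density_mat v\<^sub>x \<Theta> X) * ennreal (normal_density_mat v\<^sub>y \<Theta> Y) * \<pi> \<Theta> \<partial>lborel)
        / (\<integral>\<^sup>+\<Theta>. ennreal (normal_density_mat v\<^sub>x \<Theta> X) * \<pi> \<Theta> \<partial>lborel))"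

subsection \<open>The hierarchical prior\<close>

definition sym_pos_def :: "real^'r^'r \<Rightarrow> bool" where
  "sym_pos_def A \<longleftrightarrow> transpose A = A \<and> (\<forall>x. x \<noteq> 0 \<longrightarrow> 0 < x \<bullet> (A *v x))"

definition unit_interval_mat :: "(real^'r^'r) set" where
  "unit_interval_mat = {\<Omega>. sym_pos_def \<Omega> \<and> sym_pos_def (mat 1 - \<Omega>)}"

text \<open>The measure \<open>d\<Omega> = \<Prod>\<^bsub>i \<le> j\<^esub> d\<omega>\<^bsub>ij\<^esub>\<close> on symmetric matrices. The free
  entries are indexed by the unordered pairs \<open>{i, j}\<close>, with \<open>i = j\<close> allowed, so that the index type
  needs no order. (\<^const>\<open>lborel\<close> on \<^typ>\<open>real^'r^'r\<close> would not do: symmetric matrices are a null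
  set when \<open>r \<ge> 2\<close>.)\<close>

definition sym_mat_of :: "('r set \<Rightarrow> real) \<Rightarrow> real^'r^'r" where
  "sym_mat_of f = (\<chi> i j. f {i, j})"

definition sym_lborel :: "(real^'r^'r) measure" where
  "sym_lborel = distr (Pi\<^sub>M {{i, j} | i j. True} (\<lambda>_. lborel)) borel sym_mat_of"

lemma measurable_sym_mat_of:
  "sym_mat_of \<in> Pi\<^sub>M {{i, j} | i j. True} (\<lambda>_. lborel) \<rightarrow>\<^sub>M (borel :: (real^'r^'r) measure)"
proof -
  have comp: "(\<lambda>f. f {i, j}) \<in> borel_measurable (Pi\<^sub>M {{i, j} | i j. True} (\<lambda>_. lborel :: real measure))"
    for i j :: 'r
  proof -
    have "(\<lambda>f. f {i, j}) \<in> Pi\<^sub>M {{i, j} | i j. True} (\<lambda>_. lborel :: real measure) \<rightarrow>\<^sub>M lborel"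
      by (rule measurable_component_singleton) blast
    then show ?thesis by simp
  qed
  show ?thesis
    unfolding sym_mat_of_def
    by (subst borel_measurable_euclidean_space)
       (use comp in \<open>auto simp: Basis_vec_def inner_axis\<close>)
qed

definition prior_stage1 :: "real \<Rightarrow> real^'r^'r \<Rightarrow> real^'q^'r \<Rightarrow> real" where
  "prior_stage1 v\<^sub>0 \<Omega> \<Theta> =
     (2 * pi * v\<^sub>0) powr (- (real CARD('q) * real CARD('r)) / 2)
     * det (\<Omega> ** matrix_inv (mat 1 - \<Omega>)) powr (real CARD('q) / 2)
     * exp (- (1 / (2 * v\<^sub>0)) * trace (\<Omega> ** matrix_inv (mat 1 - \<Omega>) ** \<Theta> ** transpose \<Theta>))"

definition prior_GB :: "real \<Rightarrow> real \<Rightarrow> real \<Rightarrow> real^'r^'r \<Rightarrow> real" where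
  "prior_GB K a b \<Omega> = K * det \<Omega> powr (a / 2 - 1) * det (mat 1 - \<Omega>) powr (b / 2 - 1)"

definition prior_hier :: "real \<Rightarrow> real \<Rightarrow> real \<Rightarrow> real \<Rightarrow> real^'q^'r \<Rightarrow> ennreal" where
  "prior_hier v\<^sub>0 K a b \<Theta> =
     (\<integral>\<^sup>+\<Omega>\<in>unit_interval_mat. ennreal (prior_stage1 v\<^sub>0 \<Omega> \<Theta> * prior_GB K a b \<Omega>) \<partial>sym_lborel)"

definition p_GB ::
    "real \<Rightarrow> real \<Rightarrow> real \<Rightarrow> real \<Rightarrow> real \<Rightarrow> real \<Rightarrow> real^'q^'r \<Rightarrow> real^'q^'r \<Rightarrow> real" where
  "p_GB v\<^sub>x v\<^sub>y v\<^sub>0 K a b = bayes_predictive v\<^sub>x v\<^sub>y (prior_hier v\<^sub>0 K a b)"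

end

theory Submission
  imports Defs "HOL-Probability.Probability"
begin

text \<open>
  The prior is proper, so the Bayesian predictive density is admissible as soon as its risk is bounded,
  and it is minimax if its risk is at most the constant risk of the predictive density
  of the uniform prior. Let \<open>m\<^sub>v\<close> be the marginal density under noise variance \<open>v\<close>. The difference of the
  two risks at \<open>\<Theta>\<close> is \<open>E ln m\<^sub>v(Z)\<close> with \<open>Z \<sim> N(\<Theta>, v I)\<close>, taken between \<open>v = v\<^sub>w\<close> and \<open>v = v\<^sub>x\<close>, so it suffices
  that this expectation decreases in \<open>v\<close>. Jensen's inequality for a tilted Gaussian reduces a step of size \<open>h\<close>
  to finding, for every \<open>w\<close>, a \<open>p\<close> with \<open>exp (h |p|\<^sup>2 / 2) m\<^bsub>v+2h\<^esub>(w + h p) \<le> m\<^sub>v(w)\<close>. For this \<open>m\<^sub>v\<close> is written as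
  a mixture, over positive definite \<open>H\<close>, of normal densities with covariance \<open>v I + H\<close>. With \<open>A\<close> the
  posterior mean of \<open>((v + 2h) I + H)\<^sup>-\<^sup>1\<close> at \<open>u\<close>, take \<open>p = A u\<close> and \<open>w = (I - h A) u\<close>, and bound \<open>m\<^sub>v(w) / m\<^bsub>v+2h\<^esub>(u)\<close> from
  below by Jensen's inequality after one of the substitutions \<open>H \<mapsto> H + 2h I\<close> and \<open>v I + H \<mapsto> (I - h A) ((v + 2h) I + H) (I - h A)\<close>.
  A convex combination of the two bounds gives the claim under the condition on \<open>a + b\<close>.
\<close>

section \<open>Symmetric positive definite matrices\<close>

text \<open>As h tends to 0, the inequality asked of p, optimised over p, says that the square root
  of m_v is superharmonic; the optimal p is minus the gradient of ln m_v. At variance v + 2h this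
  gradient at u is - A u, hence p = A u. Finite steps avoid differentiating under the integral. Of
  the 2h, one h is the step in v, the other the Gaussian noise in Jensen's inequality. Each step
  leaves errors of relative size \<epsilon> = h / (v + 2h); the strict inequality 2 \<kappa> < q - r
  - 1 with \<kappa> = a / 2 + b / 2 - 1 + r, which the bound on a + b provides, absorbs them. The
  first substitution yields about h |p|^2 but loses a multiple of the trace of A; the second
  preserves the quadratic form in u and gains a multiple of that trace, so neither suffices alone.
  The other obstacle is that risks and logarithmic integrals may be infinite: identities between
  them are stated additively for nonnegative extended integrals, with a constant C above the
  marginals making ln C - ln m nonnegative.\<close>

lemma matrix_add_rdistrib: "(B + C) ** A = B ** A + C ** A" for A :: "real^'p^'n"
  by (vector matrix_matrix_mult_def sum.distrib[symmetric] field_simps)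

lemma matrix_diff_ldistrib: "A ** (B - C) = A ** B - A ** C" for A :: "real^'n^'m"
  by (vector matrix_matrix_mult_def sum_subtractf[symmetric] field_simps)

lemma matrix_diff_rdistrib: "(B - C) ** A = B ** A - C ** A" for A :: "real^'p^'n"
  by (vector matrix_matrix_mult_def sum_subtractf[symmetric] field_simps)

lemma scaleR_matrix_left: "(k *\<^sub>R A) ** B = k *\<^sub>R (A ** B)" for A :: "real^'n^'m"
  by (simp add: scalar_matrix_assoc)

lemma scaleR_matrix_right: "A ** (k *\<^sub>R B) = k *\<^sub>R (A ** B)" for A :: "real^'n^'m"
  by (simp add: matrix_scalar_ac scalar_matrix_assoc)

lemma mat_scaleR: "mat c = c *\<^sub>R (mat 1 :: real^'n^'n)"
  by (simp add: mat_def vec_eq_iff)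

lemma mat_mult_left: "mat c ** A = c *\<^sub>R A" for A :: "real^'n^'m"
  by (subst mat_scaleR) (simp add: scaleR_matrix_left)

lemma mat_mult_right: "A ** mat c = c *\<^sub>R A" for A :: "real^'n^'m"
  by (subst mat_scaleR) (simp add: scaleR_matrix_right)

lemma transpose_add: "transpose (A + B) = transpose A + transpose B" for A :: "real^'n^'m"
  by (simp add: transpose_def vec_eq_iff)

lemma transpose_diff: "transpose (A - B) = transpose A - transpose B" for A :: "real^'n^'m"
  by (simp add: transpose_def vec_eq_iff)

lemma transpose_scaleR: "transpose (c *\<^sub>R A) = c *\<^sub>R transpose A" for A :: "real^'n^'m"
  by (simp add: transpose_def vec_eq_iff)

lemmas matrix_ring = matrix_add_ldistrib matrix_add_rdistrib matrix_diff_ldistrib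
  matrix_diff_rdistrib scaleR_matrix_left scaleR_matrix_right mat_mult_left mat_mult_right
  matrix_mul_assoc

lemmas transpose_ring = transpose_add transpose_diff transpose_scaleR transpose_mat
  matrix_transpose_mul transpose_transpose

lemma mat_diff: "mat a - mat b = (mat (a - b) :: real^'n^'n)"
  by (simp add: mat_def vec_eq_iff)

lemma mat_add: "mat a + mat b = (mat (a + b) :: real^'n^'n)"
  by (simp add: mat_def vec_eq_iff)

lemma mat_vector_mult: "mat c *v x = c *\<^sub>R x" for x :: "real^'n"
  by (subst mat_scaleR) (simp add: scaleR_matrix_vector_assoc[symmetric])

lemma inner_matrix_left: "x \<bullet> (M ** y) = (transpose M ** x) \<bullet> y"
  for x :: "real^'q^'m" and M :: "real^'n^'m"
proof -
  have "x \<bullet> (M ** y) = (\<Sum>i\<in>UNIV. \<Sum>j\<in>UNIV. \<Sum>k\<in>UNIV. x$i$j * (M$i$k * y$k$j))"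
    by (simp add: inner_vec_def matrix_matrix_mult_def sum_distrib_left)
  also have "\<dots> = (\<Sum>i\<in>UNIV. \<Sum>k\<in>UNIV. \<Sum>j\<in>UNIV. x$i$j * (M$i$k * y$k$j))"
    by (intro sum.cong refl sum.swap)
  also have "\<dots> = (\<Sum>k\<in>UNIV. \<Sum>i\<in>UNIV. \<Sum>j\<in>UNIV. x$i$j * (M$i$k * y$k$j))"
    by (rule sum.swap)
  also have "\<dots> = (\<Sum>k\<in>UNIV. \<Sum>j\<in>UNIV. \<Sum>i\<in>UNIV. x$i$j * (M$i$k * y$k$j))"
    by (intro sum.cong refl sum.swap)
  also have "\<dots> = (transpose M ** x) \<bullet> y"
    by (simp add: inner_vec_def matrix_matrix_mult_def transpose_def sum_distrib_right sum_distrib_left mult_ac)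
  finally show ?thesis .
qed

lemma inner_matrix_right: "x \<bullet> (y ** M) = (x ** transpose M) \<bullet> y"
  for x :: "real^'n^'m" and M :: "real^'n^'k"
proof -
  have "x \<bullet> (y ** M) = (\<Sum>i\<in>UNIV. \<Sum>j\<in>UNIV. \<Sum>k\<in>UNIV. x$i$j * (y$i$k * M$k$j))"
    by (simp add: inner_vec_def matrix_matrix_mult_def sum_distrib_left)
  also have "\<dots> = (\<Sum>i\<in>UNIV. \<Sum>k\<in>UNIV. \<Sum>j\<in>UNIV. x$i$j * (y$i$k * M$k$j))"
    by (intro sum.cong refl sum.swap)
  also have "\<dots> = (x ** transpose M) \<bullet> y"
    by (simp add: inner_vec_def matrix_matrix_mult_def transpose_def sum_distrib_right sum_distrib_left mult_ac)
  finally show ?thesis .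
qed

lemma inner_mat_one: "mat 1 \<bullet> X = trace X" for X :: "real^'n^'n"
  by (simp add: inner_vec_def mat_def trace_def if_distrib[of "\<lambda>c. c * _"] cong: if_cong)

lemma inner_matrix_vector: "x \<bullet> (M *v y) = (transpose M *v x) \<bullet> y" for M :: "real^'n^'m"
  by (metis dot_lmul_matrix inner_commute transpose_matrix_vector transpose_transpose)

section \<open>Spectral theorem for symmetric matrices\<close>

lemma zero_coeff_if_quadratic_nonneg:
  fixes a b :: real
  assumes "\<And>t. 0 \<le> 2 * t * a + t\<^sup>2 * b"
  shows "a = 0"
proof (rule ccontr)
  assume "a \<noteq> 0"
  \<comment> \<open>With c above 0 and b, the polynomial at t = - a / c equals a^2 (b / c - 2) / c,
    which is negative.\<close>
  define c where "c = \<bar>b\<bar> + 1"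
  have c: "c > 0" "b < c" by (auto simp: c_def)
  have "0 \<le> 2 * (- a / c) * a + (- a / c)\<^sup>2 * b" by (rule assms)
  also have "\<dots> = a\<^sup>2 * (b / c - 2) / c" using c by (simp add: field_simps power2_eq_square)
  finally have "0 \<le> a\<^sup>2 * (b / c - 2)" using c by (simp add: zero_le_divide_iff)
  moreover have "b / c - 2 < 0" using c by (simp add: field_simps)
  ultimately show False using \<open>a \<noteq> 0\<close> by (simp add: zero_le_mult_iff not_le)
qed

text \<open>The eigenvector e maximises the Rayleigh quotient over the unit sphere of V. The first
  variation makes l e - A e orthogonal to V; by invariance it also lies in V, so it
  vanishes.\<close>

lemma symmetric_eigenvector_in_subspace:
  fixes A :: "real^'n^'n"
  assumes sym: "transpose A = A" and V: "subspace V"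
    and inv: "\<And>x. x \<in> V \<Longrightarrow> A *v x \<in> V" and nt: "x0 \<in> V" "x0 \<noteq> 0"
  obtains e l where "e \<in> V" "norm e = 1" "A *v e = l *\<^sub>R e"
proof -
  let ?S = "V \<inter> sphere 0 1" and ?f = "\<lambda>x. x \<bullet> (A *v x)"
  have "compact ?S" using closed_subspace[OF V] by (intro closed_Int_compact) auto
  moreover have "(1 / norm x0) *\<^sub>R x0 \<in> ?S"
    using nt V by (auto simp: subspace_scale)
  moreover have "continuous_on ?S ?f"
    by (intro continuous_intros linear_continuous_on_compose[OF _ matrix_vector_mul_linear])
  ultimately obtain e where e: "e \<in> ?S" and max: "\<And>y. y \<in> ?S \<Longrightarrow> ?f y \<le> ?f e"
    using continuous_attains_sup[of ?S ?f] by blast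
  define l where "l = ?f e"
  have le: "?f x \<le> l * (x \<bullet> x)" if "x \<in> V" for x
  proof (cases "x = 0")
    case False
    then have "(1 / norm x) *\<^sub>R x \<in> ?S" using that V by (auto simp: subspace_scale)
    from max[OF this] have "?f x / (norm x)\<^sup>2 \<le> l"
      by (simp add: l_def matrix_vector_mult_scaleR power2_eq_square)
    then show ?thesis using False by (simp add: divide_le_eq power2_norm_eq_inner)
  qed simp
  have ee: "e \<bullet> e = 1" using e by (simp add: dot_square_norm)
  have orth: "(l *\<^sub>R e - A *v e) \<bullet> y = 0" if y: "y \<in> V" for y
  proof (rule zero_coeff_if_quadratic_nonneg)
    fix t :: real
    have "e + t *\<^sub>R y \<in> V" using e y V by (auto simp: subspace_add subspace_scale)
    from le[OF this] have "?f (e + t *\<^sub>R y) \<le> l * ((e + t *\<^sub>R y) \<bullet> (e + t *\<^sub>R y))" .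
    moreover have "e \<bullet> (A *v y) = (A *v e) \<bullet> y" by (simp add: inner_matrix_vector sym)
    ultimately show "0 \<le> 2 * t * ((l *\<^sub>R e - A *v e) \<bullet> y) + t\<^sup>2 * (l * (y \<bullet> y) - ?f y)"
      by (simp add: inner_add_left inner_add_right inner_diff_left matrix_vector_right_distrib
          matrix_vector_mult_scaleR ee l_def[symmetric] algebra_simps power2_eq_square inner_commute)
  qed
  have "l *\<^sub>R e - A *v e \<in> V" using e inv V by (auto simp: subspace_diff subspace_scale)
  from orth[OF this] have "A *v e = l *\<^sub>R e" by simp
  then show thesis using that[of e l] e by simp
qed

text \<open>Orthonormal eigenvectors are collected one at a time. By symmetry the orthogonal
  complement of those already found is invariant, and it is nontrivial as long as there are fewer of
  them than the dimension.\<close>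

theorem symmetric_matrix_spectral:
  fixes A :: "real^'n^'n"
  assumes sym: "transpose A = A"
  obtains Q d where "orthogonal_matrix Q" "A = Q ** (\<chi> i j. if i = j then d i else 0) ** transpose Q"
proof -
  define P where "P B \<longleftrightarrow> finite B \<and> pairwise orthogonal B \<and>
    (\<forall>b\<in>B. norm b = 1 \<and> (\<exists>l. A *v b = l *\<^sub>R b))" for B :: "(real^'n) set"
  have "k \<le> CARD('n) \<Longrightarrow> \<exists>B. P B \<and> card B = k" for k
  proof (induction k)
    case 0
    show ?case by (rule exI[of _ "{}"]) (simp add: P_def)
  next
    case (Suc k)
    then obtain B where B: "P B" "card B = k" by auto
    let ?V = "{x. \<forall>b\<in>B. b \<bullet> x = 0}"
    have V: "subspace ?V" by (auto simp: subspace_def inner_add_right)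
    have inv: "A *v x \<in> ?V" if "x \<in> ?V" for x
    proof -
      have "b \<bullet> (A *v x) = 0" if "b \<in> B" for b
      proof -
        obtain l where "A *v b = l *\<^sub>R b" using B \<open>b \<in> B\<close> by (auto simp: P_def)
        then show ?thesis using \<open>x \<in> ?V\<close> \<open>b \<in> B\<close> by (simp add: inner_matrix_vector sym)
      qed
      then show ?thesis by simp
    qed
    have "dim B \<le> k" using dim_le_card'[of B] B by (simp add: P_def)
    then have "dim B < DIM(real^'n)" using Suc by simp
    from orthogonal_to_subspace_exists[OF this]
    obtain x where x: "x \<noteq> 0" "\<And>y. y \<in> span B \<Longrightarrow> orthogonal x y" by blast
    then have "x \<in> ?V" by (auto simp: orthogonal_def inner_commute span_base)
    from symmetric_eigenvector_in_subspace[OF sym V inv this x(1)]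
    obtain e l where e: "e \<in> ?V" "norm e = 1" "A *v e = l *\<^sub>R e" by blast
    have "e \<notin> B" using e by (force simp: norm_eq_1)
    moreover have "P (insert e B)" using B e
      by (auto simp: P_def pairwise_insert orthogonal_def inner_commute)
    ultimately show ?case using B by (intro exI[of _ "insert e B"]) (auto simp: P_def)
  qed
  then obtain B where B: "P B" "card B = CARD('n)" by blast
  then obtain f where f: "bij_betw f (UNIV :: 'n set) B"
    by (metis P_def finite_class.finite_UNIV finite_same_card_bij)
  have fB: "f i \<in> B" for i using f by (auto simp: bij_betw_def)
  have "\<forall>i. \<exists>l. A *v f i = l *\<^sub>R f i" using fB B by (auto simp: P_def)
  then obtain d where d: "\<And>i. A *v f i = d i *\<^sub>R f i" by metis
  define Q :: "real^'n^'n" where "Q = (\<chi> i j. f j $ i)"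
  let ?D = "(\<chi> i j. if i = j then d i else 0) :: real^'n^'n"
  have n1: "norm (f i) = 1" for i using fB B by (auto simp: P_def)
  have orth: "orthogonal (f i) (f j)" if "i \<noteq> j" for i j
    using that B f fB unfolding P_def pairwise_def bij_betw_def inj_on_def by blast
  have Q: "orthogonal_matrix Q"
    using n1 orth by (simp add: orthogonal_matrix_orthonormal_columns column_def Q_def)
  have "(A ** Q) $ i $ j = (Q ** ?D) $ i $ j" for i j
  proof -
    have "(A ** Q) $ i $ j = (A *v f j) $ i"
      by (simp add: matrix_matrix_mult_def matrix_vector_mult_def Q_def)
    also have "\<dots> = d j * f j $ i" by (simp add: d)
    also have "\<dots> = (Q ** ?D) $ i $ j"
      by (simp add: matrix_matrix_mult_def Q_def if_distrib[of "\<lambda>c. _ * c"] cong: if_cong)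
    finally show ?thesis .
  qed
  then have "A ** Q = Q ** ?D" by (simp add: vec_eq_iff)
  then have "A = Q ** ?D ** transpose Q"
    using Q by (metis matrix_mul_assoc matrix_mul_rid orthogonal_matrix_def)
  with Q show thesis by (rule that)
qed

section \<open>Cones of semidefinite and definite matrices\<close>

definition psd :: "real^'n^'n \<Rightarrow> bool" where
  "psd A \<longleftrightarrow> transpose A = A \<and> (\<forall>x. 0 \<le> x \<bullet> (A *v x))"

lemma sym_pos_def_imp_psd: "sym_pos_def A \<Longrightarrow> psd A"
  unfolding sym_pos_def_def psd_def by (metis inner_zero_left less_eq_real_def)

lemma psdD: "psd A \<Longrightarrow> transpose A = A" "psd A \<Longrightarrow> 0 \<le> x \<bullet> (A *v x)"
  by (auto simp: psd_def)

lemma sym_pos_defD: "sym_pos_def A \<Longrightarrow> transpose A = A" "sym_pos_def A \<Longrightarrow> x \<noteq> 0 \<Longrightarrow> 0 < x \<bullet> (A *v x)"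
  by (auto simp: sym_pos_def_def)

lemma psd_add: "psd A \<Longrightarrow> psd B \<Longrightarrow> psd (A + B)"
  by (auto simp: psd_def transpose_add matrix_vector_mult_add_rdistrib inner_add_right)

lemma psd_scaleR: "psd A \<Longrightarrow> 0 \<le> c \<Longrightarrow> psd (c *\<^sub>R A)"
  by (auto simp: psd_def transpose_scaleR scaleR_matrix_vector_assoc[symmetric])

lemma sym_pos_def_add: "sym_pos_def A \<Longrightarrow> psd B \<Longrightarrow> sym_pos_def (A + B)"
  by (auto simp: psd_def sym_pos_def_def transpose_add matrix_vector_mult_add_rdistrib inner_add_right
      add_pos_nonneg)

lemma sym_pos_def_scaleR: "sym_pos_def A \<Longrightarrow> 0 < c \<Longrightarrow> sym_pos_def (c *\<^sub>R A)"
  by (auto simp: sym_pos_def_def transpose_scaleR scaleR_matrix_vector_assoc[symmetric])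

lemma sym_pos_def_mat: "0 < c \<Longrightarrow> sym_pos_def (mat c)"
  by (auto simp: sym_pos_def_def mat_vector_mult)

lemma psd_mat: "0 \<le> c \<Longrightarrow> psd (mat c)"
  by (auto simp: psd_def mat_vector_mult)

lemma sym_pos_def_mat_add: "sym_pos_def A \<Longrightarrow> 0 \<le> c \<Longrightarrow> sym_pos_def (mat c + A)"
  by (metis add.commute psd_mat sym_pos_def_add)

lemma psd_congruence: "psd A \<Longrightarrow> psd (M ** A ** transpose M)"
proof -
  assume A: "psd A"
  have "x \<bullet> ((M ** A ** transpose M) *v x) = (transpose M *v x) \<bullet> (A *v (transpose M *v x))" for x
    by (simp add: matrix_vector_mul_assoc[symmetric] inner_matrix_vector)
  then show ?thesis using A by (simp add: psd_def matrix_transpose_mul matrix_mul_assoc)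
qed

lemma psd_square: "psd (C ** transpose C)"
  using psd_congruence[OF psd_mat[of 1], of C] by simp

lemma sym_pos_def_congruence:
  fixes M :: "real^'n^'n"
  assumes A: "sym_pos_def A" and M: "invertible M"
  shows "sym_pos_def (M ** A ** transpose M)"
proof -
  have "x \<bullet> ((M ** A ** transpose M) *v x) = (transpose M *v x) \<bullet> (A *v (transpose M *v x))" for x
    by (simp add: matrix_vector_mul_assoc[symmetric] inner_matrix_vector)
  moreover have "transpose M *v x \<noteq> 0" if "x \<noteq> 0" for x
  proof -
    have "invertible (transpose M)" using M by (metis transpose_invertible)
    from inj_matrix_vector_mult[OF this] show ?thesis
      using that by (metis inj_eq matrix_vector_mult_0_right)
  qed
  ultimately show ?thesis using A by (simp add: sym_pos_def_def matrix_transpose_mul matrix_mul_assoc)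
qed

lemma matrix_inv_mult:
  fixes A :: "real^'n^'n"
  assumes "invertible A"
  shows "A ** matrix_inv A = mat 1" "matrix_inv A ** A = mat 1"
  using assms unfolding invertible_def matrix_inv_def by (metis (mono_tags, lifting) someI_ex)+

lemma matrix_inv_unique:
  fixes A :: "real^'n^'n"
  assumes "A ** B = mat 1"
  shows "matrix_inv A = B"
  by (metis assms invertible_def matrix_inv_mult(2) matrix_left_right_inverse matrix_mul_assoc
      matrix_mul_lid matrix_mul_rid)

lemma sym_pos_def_invertible: "sym_pos_def A \<Longrightarrow> invertible A"
  unfolding invertible_left_inverse matrix_left_invertible_ker
  by (metis inner_zero_right less_irrefl sym_pos_def_def)

lemma det_diagonal_matrix: "det (\<chi> i j. if i = j then d i else (0 :: real)) = (\<Prod>i\<in>UNIV. d i)"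
  by (subst det_diagonal) auto

lemma orthogonal_matrix_cancel:
  assumes "orthogonal_matrix Q"
  shows "transpose Q ** Q = mat 1" "Q ** transpose Q = mat 1"
    "transpose Q ** (Q ** X) = X" "Q ** (transpose Q ** X) = (X :: real^'m^'n)"
  using assms by (simp_all add: orthogonal_matrix_def matrix_mul_assoc)

lemma sym_pos_def_spectral:
  fixes A :: "real^'n^'n"
  assumes A: "sym_pos_def A"
  obtains Q d where "orthogonal_matrix Q" "\<And>i. 0 < d i"
    "A = Q ** (\<chi> i j. if i = j then d i else 0) ** transpose Q"
proof -
  obtain Q d where Q: "orthogonal_matrix Q" and eq: "A = Q ** (\<chi> i j. if i = j then d i else 0) ** transpose Q"
    using symmetric_matrix_spectral[of A] A by (auto simp: sym_pos_def_def)
  let ?D = "(\<chi> i j. if i = j then d i else 0) :: real^'n^'n"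
  have "?D = transpose Q ** A ** transpose (transpose Q)"
    by (simp add: eq matrix_mul_assoc[symmetric] orthogonal_matrix_cancel[OF Q])
  moreover have "invertible (transpose Q)" using Q by (auto simp: invertible_def orthogonal_matrix_def)
  ultimately have D: "sym_pos_def ?D" using sym_pos_def_congruence[OF A] by metis
  have "0 < d i" for i
  proof -
    have "0 < axis i 1 \<bullet> (?D *v axis i 1)" using D by (auto simp: sym_pos_def_def axis_eq_0_iff)
    also have "\<dots> = d i" by (simp add: inner_axis' matrix_vector_mult_basis column_def)
    finally show ?thesis .
  qed
  from Q this eq show thesis by (rule that)
qed

text \<open>C is Q times the square roots of the eigenvalues. It serves in place of a symmetric
  square root: it turns the quadratic form of A into a squared norm, and, when A is definite,
  congruence with its inverse turns A into the identity.\<close>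

lemma psd_factor:
  fixes A :: "real^'n^'n"
  assumes A: "psd A"
  obtains C :: "real^'n^'n" where "A = C ** transpose C"
proof -
  obtain Q d where Q: "orthogonal_matrix Q" and eq: "A = Q ** (\<chi> i j. if i = j then d i else 0) ** transpose Q"
    using symmetric_matrix_spectral[of A] A by (auto simp: psd_def)
  let ?D = "(\<chi> i j. if i = j then d i else 0) :: real^'n^'n"
  let ?E = "(\<chi> i j. if i = j then sqrt (d i) else 0) :: real^'n^'n"
  have "?D = transpose Q ** A ** transpose (transpose Q)"
    by (simp add: eq matrix_mul_assoc[symmetric] orthogonal_matrix_cancel[OF Q])
  then have D: "psd ?D" using psd_congruence[OF A] by metis
  have d: "0 \<le> d i" for i
  proof -
    have "0 \<le> axis i 1 \<bullet> (?D *v axis i 1)" using D by (auto simp: psd_def)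
    also have "\<dots> = d i" by (simp add: inner_axis' matrix_vector_mult_basis column_def)
    finally show ?thesis .
  qed
  have "?D = ?E ** transpose ?E"
    using d by (auto simp: vec_eq_iff matrix_matrix_mult_def transpose_def if_distrib[of "\<lambda>c. c * _"] cong: if_cong)
  then have "A = (Q ** ?E) ** transpose (Q ** ?E)"
    by (simp add: eq matrix_transpose_mul matrix_mul_assoc)
  then show thesis by (rule that)
qed

lemma sym_pos_def_det: "sym_pos_def A \<Longrightarrow> 0 < det A" for A :: "real^'n^'n"
proof -
  assume A: "sym_pos_def A"
  obtain C :: "real^'n^'n" where C: "A = C ** transpose C"
    by (rule psd_factor[OF sym_pos_def_imp_psd[OF A]])
  have "det A \<noteq> 0" using A sym_pos_def_invertible invertible_det_nz by blast
  moreover have "det A = (det C)\<^sup>2" by (simp add: C det_mul power2_eq_square)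
  ultimately show ?thesis by simp
qed

lemma sym_pos_def_factor:
  fixes A :: "real^'n^'n"
  assumes A: "sym_pos_def A"
  obtains C :: "real^'n^'n" where "A = C ** transpose C" "invertible C"
proof -
  obtain C :: "real^'n^'n" where C: "A = C ** transpose C"
    by (rule psd_factor[OF sym_pos_def_imp_psd[OF A]])
  have "det A = (det C)\<^sup>2" by (simp add: C det_mul power2_eq_square)
  then have "det C \<noteq> 0" using sym_pos_def_det[OF A] by auto
  then show thesis using that C invertible_det_nz by blast
qed

lemma sym_pos_def_matrix_inv:
  fixes A :: "real^'n^'n"
  assumes A: "sym_pos_def A"
  shows "sym_pos_def (matrix_inv A)"
proof -
  have i: "invertible A" by (rule sym_pos_def_invertible[OF A])
  have "transpose (matrix_inv A) ** A = mat 1"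
    using matrix_inv_mult(1)[OF i] A by (metis matrix_transpose_mul sym_pos_defD(1) transpose_mat)
  then have t: "transpose (matrix_inv A) = matrix_inv A"
    by (metis matrix_inv_unique matrix_left_right_inverse)
  have "invertible (matrix_inv A)" using matrix_inv_mult[OF i] invertible_def by blast
  from sym_pos_def_congruence[OF A this] show ?thesis
    by (simp add: t matrix_inv_mult[OF i])
qed

lemma matrix_inv_symmetric: "sym_pos_def A \<Longrightarrow> transpose (matrix_inv A) = matrix_inv A"
  using sym_pos_def_matrix_inv sym_pos_defD(1) by blast

lemma det_matrix_inv: "invertible A \<Longrightarrow> det (matrix_inv A) = inverse (det A)" for A :: "real^'n^'n"
  by (metis det_I det_mul inverse_unique matrix_inv_mult(1))

section \<open>Trace and determinant inequalities\<close>

lemma psd_quadratic_nonneg: "psd M \<Longrightarrow> 0 \<le> x \<bullet> (M ** x)" for x :: "real^'q^'n"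
proof -
  assume M: "psd M"
  obtain C :: "real^'n^'n" where C: "M = C ** transpose C" by (rule psd_factor[OF M])
  have "x \<bullet> (M ** x) = (transpose C ** x) \<bullet> (transpose C ** x)"
    by (simp add: C matrix_mul_assoc[symmetric] inner_matrix_left)
  then show ?thesis by simp
qed

text \<open>With P = C C^T the trace form becomes \<open>C \<bullet> (Z ** C)\<close>, a sum of
  values of the quadratic form of Z at the columns of C.\<close>

lemma psd_inner_nonneg:
  fixes P Z :: "real^'n^'n"
  assumes "psd P" "psd Z"
  shows "0 \<le> P \<bullet> Z"
proof -
  obtain C :: "real^'n^'n" where C: "P = C ** transpose C" by (rule psd_factor[OF assms(1)])
  have "P \<bullet> Z = Z \<bullet> (C ** transpose C)" by (simp add: C inner_commute)
  also have "\<dots> = (Z ** C) \<bullet> C" using inner_matrix_right[of Z C "transpose C"] by simp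
  also have "\<dots> = C \<bullet> (Z ** C)" by (rule inner_commute)
  finally show ?thesis using psd_quadratic_nonneg[OF assms(2)] by simp
qed

lemma psd_inner_mono: "psd P \<Longrightarrow> psd (Y - X) \<Longrightarrow> P \<bullet> X \<le> P \<bullet> Y"
  using psd_inner_nonneg[of P "Y - X"] by (simp add: inner_diff_right)

text \<open>In the eigenvalues d_i this is the product of the inequalities d_i \<le> exp (d_i -
  1).\<close>

lemma det_le_exp_trace:
  fixes A :: "real^'n^'n"
  assumes A: "sym_pos_def A"
  shows "det A \<le> exp (trace A - real CARD('n))"
proof -
  obtain Q d where Q: "orthogonal_matrix Q" "\<And>i. 0 < d i"
    and eq: "A = Q ** (\<chi> i j. if i = j then d i else 0) ** transpose Q"
    using sym_pos_def_spectral[OF A] by blast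
  let ?D = "(\<chi> i j. if i = j then d i else 0) :: real^'n^'n"
  have "det A = det Q * det (transpose Q) * det ?D" by (simp only: eq det_mul mult_ac)
  also have "det Q * det (transpose Q) = 1"
    using Q by (metis det_I det_mul orthogonal_matrix_def)
  finally have "det A = (\<Prod>i\<in>UNIV. d i)" by (simp add: det_diagonal_matrix)
  also have "\<dots> \<le> (\<Prod>i\<in>UNIV. exp (d i - 1))"
    using Q(2) by (intro prod_mono) (auto intro: less_imp_le simp: exp_ge_add_one_self[of "d _ - 1", simplified])
  also have "\<dots> = exp ((\<Sum>i\<in>UNIV. d i) - real CARD('n))"
    by (simp add: exp_sum[symmetric] sum_subtractf)
  also have "(\<Sum>i\<in>UNIV. d i) = trace ?D" by (simp add: trace_def)
  also have "trace ?D = trace A"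
    unfolding eq by (subst trace_mul_sym) (use Q in \<open>simp add: matrix_mul_assoc orthogonal_matrix_def\<close>)
  finally show ?thesis .
qed

lemma matrix_inv_inner_self: "sym_pos_def Q \<Longrightarrow> matrix_inv Q \<bullet> Q = real CARD('n)" for Q :: "real^'n^'n"
proof -
  assume Q: "sym_pos_def Q"
  have "matrix_inv Q \<bullet> Q = mat 1 \<bullet> (matrix_inv Q ** Q)"
    using inner_matrix_left[of "mat 1" "matrix_inv Q" Q] by (simp add: matrix_inv_symmetric[OF Q])
  also have "\<dots> = real CARD('n)"
    by (simp add: matrix_inv_mult[OF sym_pos_def_invertible[OF Q]] inner_mat_one trace_I)
  finally show ?thesis .
qed

text \<open>Concavity of ln det, whose gradient at Q is the inverse of Q. Congruence with the
  inverse of a factor C of Q moves Q to the identity, where the claim is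
  \<open>det_le_exp_trace\<close>.\<close>

theorem ln_det_tangent:
  fixes P Q :: "real^'n^'n"
  assumes P: "sym_pos_def P" and Q: "sym_pos_def Q"
  shows "ln (det P) \<le> ln (det Q) + matrix_inv Q \<bullet> (P - Q)"
proof -
  obtain C :: "real^'n^'n" where C: "Q = C ** transpose C" "invertible C" by (rule sym_pos_def_factor[OF Q])
  define D where "D = matrix_inv C"
  have DC: "D ** C = mat 1" "C ** D = mat 1" using matrix_inv_mult[OF C(2)] by (auto simp: D_def)
  have D: "invertible D" using DC invertible_def by blast
  have "Q ** (transpose D ** D) = mat 1"
  proof -
    have "transpose C ** transpose D = mat 1" using DC by (metis matrix_transpose_mul transpose_mat)
    then show ?thesis using DC by (metis C(1) matrix_mul_assoc matrix_mul_rid)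
  qed
  then have Qi: "matrix_inv Q = transpose D ** D" by (rule matrix_inv_unique)
  have "trace (D ** P ** transpose D) = matrix_inv Q \<bullet> P"
  proof -
    have "trace (D ** P ** transpose D) = mat 1 \<bullet> (D ** P ** transpose D)" by (simp add: inner_mat_one)
    also have "\<dots> = D \<bullet> (D ** P)" using inner_matrix_right[of "mat 1" "D ** P" "transpose D"] by simp
    also have "\<dots> = matrix_inv Q \<bullet> P" using inner_matrix_left[of D D P] by (simp add: Qi)
    finally show ?thesis .
  qed
  moreover have "matrix_inv Q \<bullet> Q = real CARD('n)" by (rule matrix_inv_inner_self[OF Q])
  moreover have "det (D ** P ** transpose D) \<le> exp (trace (D ** P ** transpose D) - real CARD('n))"
    by (intro det_le_exp_trace sym_pos_def_congruence P D)
  moreover have "det (D ** P ** transpose D) = det P / det Q"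
  proof -
    have "det D * det C = 1" using DC by (metis det_I det_mul)
    then have "det C \<noteq> 0" by auto
    then have "det D = 1 / det C" using \<open>det D * det C = 1\<close> by (simp add: eq_divide_eq)
    then show ?thesis using \<open>det C \<noteq> 0\<close> by (simp add: det_mul C(1))
  qed
  ultimately have "det P / det Q \<le> exp (matrix_inv Q \<bullet> (P - Q))" by (simp add: inner_diff_right)
  then have "ln (det P / det Q) \<le> matrix_inv Q \<bullet> (P - Q)"
    using sym_pos_def_det[OF P] sym_pos_def_det[OF Q] by (metis divide_pos_pos ln_exp ln_mono exp_gt_zero)
  then show ?thesis
    using sym_pos_def_det[OF P] sym_pos_def_det[OF Q] by (simp add: ln_div)
qed

text \<open>The tangent is taken at P + E, where the linear term is minus the trace form of two
  semidefinite matrices.\<close>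

lemma det_mono_psd:
  assumes P: "sym_pos_def P" and E: "psd E"
  shows "det P \<le> det (P + E)"
proof -
  have PE: "sym_pos_def (P + E)" by (rule sym_pos_def_add[OF P E])
  have "ln (det P) \<le> ln (det (P + E)) + matrix_inv (P + E) \<bullet> (P - (P + E))"
    by (rule ln_det_tangent[OF P PE])
  moreover have "0 \<le> matrix_inv (P + E) \<bullet> E"
    by (intro psd_inner_nonneg sym_pos_def_imp_psd sym_pos_def_matrix_inv PE E)
  ultimately have "ln (det P) \<le> ln (det (P + E))" by simp
  then show ?thesis using sym_pos_def_det[OF P] sym_pos_def_det[OF PE] by simp
qed

section \<open>Isotropic Gaussian densities\<close>

lemma nn_integral_lborel_affine:
  fixes t :: "'a::euclidean_space"
  assumes [measurable]: "F \<in> borel_measurable borel" and c: "c \<noteq> 0"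
  shows "ennreal (\<bar>c\<bar> ^ DIM('a)) * (\<integral>\<^sup>+x. F (t + c *\<^sub>R x) \<partial>lborel) = (\<integral>\<^sup>+x. F x \<partial>lborel)"
proof -
  have "(\<integral>\<^sup>+x. F x \<partial>lborel) = (\<integral>\<^sup>+x. F x \<partial>density (distr lborel borel (\<lambda>x. t + c *\<^sub>R x)) (\<lambda>_. ennreal (\<bar>c\<bar> ^ DIM('a))))"
    by (subst lborel_affine[OF c, of t]) (simp add: ennreal_power)
  also have "\<dots> = (\<integral>\<^sup>+x. ennreal (\<bar>c\<bar> ^ DIM('a)) * F (t + c *\<^sub>R x) \<partial>lborel)"
    by (simp add: nn_integral_density nn_integral_distr)
  finally show ?thesis by (simp add: nn_integral_cmult)
qed

lemma nn_integral_lborel_translate: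
  fixes t :: "'a::euclidean_space"
  assumes "F \<in> borel_measurable borel"
  shows "(\<integral>\<^sup>+x. F (x + t) \<partial>lborel) = (\<integral>\<^sup>+x. F x \<partial>lborel)"
  using nn_integral_lborel_affine[OF assms, of 1 t] by (simp add: add.commute)

lemma nn_integral_lborel_diff:
  fixes t :: "'a::euclidean_space"
  assumes "F \<in> borel_measurable borel"
  shows "(\<integral>\<^sup>+x. F (x - t) \<partial>lborel) = (\<integral>\<^sup>+x. F x \<partial>lborel)"
  using nn_integral_lborel_translate[OF assms, of "- t"] by simp

lemma nn_integral_lborel_reflect:
  fixes t :: "'a::euclidean_space"
  assumes "F \<in> borel_measurable borel"
  shows "(\<integral>\<^sup>+x. F (t - x) \<partial>lborel) = (\<integral>\<^sup>+x. F x \<partial>lborel)"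
  using nn_integral_lborel_affine[OF assms, of "-1" t] by simp

definition gauss :: "real \<Rightarrow> 'a::euclidean_space \<Rightarrow> real" where
  "gauss v x = (2 * pi * v) powr (- real DIM('a) / 2) * exp (- (norm x)\<^sup>2 / (2 * v))"

lemma gauss_pos: "0 < v \<Longrightarrow> 0 < gauss v x"
  by (simp add: gauss_def)

lemma gauss_nonneg [simp]: "0 \<le> gauss v x"
  by (simp add: gauss_def)

lemma gauss_minus [simp]: "gauss v (- x) = gauss v x"
  by (simp add: gauss_def)

lemma gauss_commute: "gauss v (x - y) = gauss v (y - x)"
  by (simp add: gauss_def norm_minus_commute)

lemma borel_measurable_gauss [measurable]: "gauss v \<in> borel_measurable borel"
  unfolding gauss_def by measurable

lemma norm_square_eq_sum: "(norm x)\<^sup>2 = (\<Sum>b\<in>Basis. (x \<bullet> b)\<^sup>2)" for x :: "'a::euclidean_space"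
  by (simp only: power2_norm_eq_inner euclidean_inner[of x x]) (simp add: power2_eq_square)

lemma gauss_eq_prod:
  fixes x :: "'a::euclidean_space"
  assumes v: "0 < v"
  shows "gauss v x = (\<Prod>b\<in>Basis. normal_density 0 (sqrt v) (x \<bullet> b))"
proof -
  have "(2 * pi * v) powr (- real DIM('a) / 2) = ((2 * pi * v) powr (- 1 / 2)) powr real DIM('a)"
    by (simp add: powr_powr)
  also have "\<dots> = ((2 * pi * v) powr (- 1 / 2)) ^ DIM('a)"
    using v by (subst powr_realpow) auto
  also have "(2 * pi * v) powr (- 1 / 2) = 1 / sqrt (2 * pi * v)"
    using v by (simp add: powr_minus powr_half_sqrt inverse_eq_divide)
  finally have "(2 * pi * v) powr (- real DIM('a) / 2) = (1 / sqrt (2 * pi * v)) ^ DIM('a)" .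
  moreover have "exp (- (norm x)\<^sup>2 / (2 * v)) = (\<Prod>b\<in>Basis. exp (- (x \<bullet> b)\<^sup>2 / (2 * v)))"
    by (subst exp_sum[symmetric])
      (auto simp: norm_square_eq_sum sum_negf sum_divide_distrib)
  ultimately show ?thesis using v
    by (simp add: gauss_def normal_density_def prod_dividef power_divide)
qed

lemma nn_integral_normal_density:
  assumes "0 < s"
  shows "(\<integral>\<^sup>+x. ennreal (normal_density 0 s x) \<partial>lborel) = 1"
  using assms integral_normal_density[of s 0] integrable_normal_density[of s 0]
  by (subst nn_integral_eq_integral) auto

lemma nn_integral_normal_density_square:
  assumes s: "0 < s"
  shows "(\<integral>\<^sup>+x. ennreal (normal_density 0 s x * x\<^sup>2) \<partial>lborel) = ennreal (s\<^sup>2)"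
proof -
  have "has_bochner_integral lborel (\<lambda>x. normal_density 0 s x * (x - 0) ^ (2 * 1)) (fact (2 * 1) / ((2 / s\<^sup>2) ^ 1 * fact 1))"
    by (rule normal_moment_even[OF s])
  then have "has_bochner_integral lborel (\<lambda>x. normal_density 0 s x * x\<^sup>2) (s\<^sup>2)" using s by simp
  then show ?thesis
    by (subst nn_integral_eq_integral) (auto simp: has_bochner_integral_iff)
qed

lemma nn_integral_gauss:
  assumes v: "0 < v"
  shows "(\<integral>\<^sup>+x. ennreal (gauss v (x :: 'a::euclidean_space)) \<partial>lborel) = 1"
proof -
  have "(\<integral>\<^sup>+x. ennreal (gauss v (x :: 'a)) \<partial>lborel)
      = (\<integral>\<^sup>+x. (\<Prod>b\<in>Basis. ennreal (normal_density 0 (sqrt v) (x \<bullet> (b :: 'a)))) \<partial>lborel)"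
    using v by (simp add: gauss_eq_prod prod_ennreal)
  also have "\<dots> = 1" using v
    by (subst nn_integral_lborel_prod) (auto simp: nn_integral_normal_density)
  finally show ?thesis .
qed

lemma nn_integral_gauss_diff:
  assumes "0 < v"
  shows "(\<integral>\<^sup>+x. ennreal (gauss v (x - c)) \<partial>lborel) = 1" "(\<integral>\<^sup>+x. ennreal (gauss v (c - x)) \<partial>lborel) = 1"
  using nn_integral_lborel_diff[of "\<lambda>x. ennreal (gauss v x)" c]
    nn_integral_lborel_reflect[of "\<lambda>x. ennreal (gauss v x)" c] nn_integral_gauss[OF assms] by simp_all

lemma nn_integral_gauss_component:
  fixes b :: "'a::euclidean_space"
  assumes v: "0 < v" and b: "b \<in> Basis"
  shows "(\<integral>\<^sup>+x. ennreal (gauss v x * (x \<bullet> b)\<^sup>2) \<partial>lborel) = ennreal v"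
proof -
  let ?f = "\<lambda>b' t. ennreal (normal_density 0 (sqrt v) t * (if b' = b then t\<^sup>2 else 1))"
  have "(\<integral>\<^sup>+x. ennreal (gauss v x * (x \<bullet> b)\<^sup>2) \<partial>lborel) = (\<integral>\<^sup>+x. (\<Prod>b'\<in>Basis. ?f b' (x \<bullet> b')) \<partial>lborel)"
  proof (rule nn_integral_cong)
    fix x :: 'a
    have "(\<Prod>b'\<in>Basis. ?f b' (x \<bullet> b'))
        = ennreal (\<Prod>b'\<in>Basis. normal_density 0 (sqrt v) (x \<bullet> b') * (if b' = b then (x \<bullet> b')\<^sup>2 else 1))"
      by (rule prod_ennreal) auto
    also have "\<dots> = ennreal (gauss v x * (x \<bullet> b)\<^sup>2)"
      using v b by (simp add: prod.distrib gauss_eq_prod prod.delta)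
    finally show "ennreal (gauss v x * (x \<bullet> b)\<^sup>2) = (\<Prod>b'\<in>Basis. ?f b' (x \<bullet> b'))" ..
  qed
  also have "\<dots> = (\<Prod>b'\<in>Basis. (\<integral>\<^sup>+t. ?f b' t \<partial>lborel))"
    by (rule nn_integral_lborel_prod) auto
  also have "\<dots> = (\<Prod>b'\<in>(Basis::'a set). if b' = b then ennreal v else 1)"
    using v nn_integral_normal_density_square[of "sqrt v"] nn_integral_normal_density[of "sqrt v"]
    by (intro prod.cong) auto
  finally show ?thesis using b by (simp add: prod.delta)
qed

lemma nn_integral_gauss_norm_square:
  fixes v :: real
  assumes v: "0 < v"
  shows "(\<integral>\<^sup>+x. ennreal (gauss v x * (norm (x :: 'a::euclidean_space))\<^sup>2) \<partial>lborel) = ennreal (DIM('a) * v)"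
proof -
  have "(\<integral>\<^sup>+x. ennreal (gauss v x * (norm (x :: 'a))\<^sup>2) \<partial>lborel)
      = (\<integral>\<^sup>+x. (\<Sum>b\<in>Basis. ennreal (gauss v x * (x \<bullet> (b::'a))\<^sup>2)) \<partial>lborel)"
  proof (rule nn_integral_cong)
    fix x :: 'a
    have "gauss v x * (norm x)\<^sup>2 = (\<Sum>b\<in>Basis. gauss v x * (x \<bullet> b)\<^sup>2)"
      by (simp add: norm_square_eq_sum sum_distrib_left)
    then show "ennreal (gauss v x * (norm x)\<^sup>2) = (\<Sum>b\<in>Basis. ennreal (gauss v x * (x \<bullet> (b::'a))\<^sup>2))"
      by (simp add: sum_ennreal)
  qed
  also have "\<dots> = (\<Sum>b\<in>(Basis::'a set). ennreal v)"
    by (subst nn_integral_sum) (auto simp: nn_integral_gauss_component[OF v])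
  also have "\<dots> = ennreal (DIM('a) * v)"
    using v by (simp add: ennreal_mult ennreal_of_nat_eq_real_of_nat)
  finally show ?thesis .
qed

lemma norm_parallelogram: "(norm (y + e))\<^sup>2 + (norm (e - y))\<^sup>2 = 2 * (norm y)\<^sup>2 + 2 * (norm e)\<^sup>2"
  for y e :: "'a::real_inner"
  by (simp only: power2_norm_eq_inner) (simp add: inner_add_left inner_add_right inner_diff_left inner_diff_right inner_commute)

text \<open>The cross term of the square is odd and has no sign. Since the density is even, the same
  integral is written once with y and once with - y; in the sum the parallelogram law leaves only
  squared norms, and the factor 2 is cancelled at the end.\<close>

lemma nn_integral_gauss_shifted_square:
  fixes c d :: "'a::euclidean_space" and v :: real
  assumes v: "0 < v"
  shows "(\<integral>\<^sup>+x. ennreal (gauss v (x - c) * (norm (x - d))\<^sup>2) \<partial>lborel) = ennreal (DIM('a) * v + (norm (c - d))\<^sup>2)"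
proof -
  let ?e = "c - d" and ?I = "\<integral>\<^sup>+x. ennreal (gauss v (x - c) * (norm (x - d))\<^sup>2) \<partial>lborel"
  have 1: "?I = (\<integral>\<^sup>+y. ennreal (gauss v y * (norm (y + ?e))\<^sup>2) \<partial>lborel)"
    by (subst nn_integral_lborel_diff[symmetric, of _ c]) (auto simp: algebra_simps)
  have 2: "?I = (\<integral>\<^sup>+y. ennreal (gauss v y * (norm (?e - y))\<^sup>2) \<partial>lborel)"
    unfolding 1 by (subst nn_integral_lborel_reflect[symmetric, of _ 0]) (auto simp: algebra_simps)
  have "?I + ?I = (\<integral>\<^sup>+y. ennreal (gauss v y * (norm (y + ?e))\<^sup>2) + ennreal (gauss v y * (norm (?e - y))\<^sup>2) \<partial>lborel)"
    by (subst nn_integral_add) (auto simp: 1[symmetric] 2[symmetric])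
  also have "\<dots> = (\<integral>\<^sup>+y. 2 * ennreal (gauss v y * (norm (y::'a))\<^sup>2) + ennreal (2 * (norm ?e)\<^sup>2) * ennreal (gauss v y) \<partial>lborel)"
  proof (rule nn_integral_cong)
    fix y :: 'a
    have "(norm (y + ?e))\<^sup>2 + (norm (?e - y))\<^sup>2 = 2 * (norm y)\<^sup>2 + 2 * (norm ?e)\<^sup>2"
      by (rule norm_parallelogram)
    then have "gauss v y * (norm (y + ?e))\<^sup>2 + gauss v y * (norm (?e - y))\<^sup>2
        = 2 * (gauss v y * (norm y)\<^sup>2) + 2 * (norm ?e)\<^sup>2 * gauss v y" by (simp only: distrib_left[symmetric]) (simp add: distrib_left mult_ac)
    moreover have "2 * ennreal (gauss v y * (norm y)\<^sup>2) = ennreal (2 * (gauss v y * (norm y)\<^sup>2))"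
      by (subst ennreal_mult) auto
    moreover have "ennreal (2 * (norm ?e)\<^sup>2) * ennreal (gauss v y) = ennreal (2 * (norm ?e)\<^sup>2 * gauss v y)"
      by (subst ennreal_mult) auto
    ultimately show "ennreal (gauss v y * (norm (y + ?e))\<^sup>2) + ennreal (gauss v y * (norm (?e - y))\<^sup>2)
        = 2 * ennreal (gauss v y * (norm y)\<^sup>2) + ennreal (2 * (norm ?e)\<^sup>2) * ennreal (gauss v y)"
      by (simp add: ennreal_plus[symmetric] del: ennreal_plus)
  qed
  also have "\<dots> = 2 * ennreal (DIM('a) * v) + ennreal (2 * (norm ?e)\<^sup>2)"
    using v by (subst nn_integral_add) (auto simp: nn_integral_cmult nn_integral_gauss_norm_square nn_integral_gauss)
  also have "2 * ennreal (DIM('a) * v) = ennreal (2 * (DIM('a) * v))"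
    using v by (subst ennreal_mult) auto
  also have "ennreal (2 * (DIM('a) * v)) + ennreal (2 * (norm ?e)\<^sup>2) = ennreal (2 * (DIM('a) * v + (norm ?e)\<^sup>2))"
    using v by (subst ennreal_plus[symmetric]) (auto simp: distrib_left)
  also have "\<dots> = 2 * ennreal (DIM('a) * v + (norm ?e)\<^sup>2)"
    using v by (subst ennreal_mult) auto
  finally have eq: "2 * ?I = 2 * ennreal (DIM('a) * v + (norm ?e)\<^sup>2)" by (simp only: mult_2)
  then show ?thesis by (subst (asm) ennreal_mult_cancel_left) auto
qed

text \<open>Completing the square in y: the two exponents add up to one centred at the
  precision-weighted mean of x and z, with harmonically combined variance, and the remainder is a
  density in x - z of variance s + t. This gives the convolution of two Gaussians, the posterior
  under a normal prior, and the pooling of X and Y into a single observation of \<Theta>.\<close>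

lemma gauss_mult:
  fixes x y z :: "'a::euclidean_space"
  assumes s: "0 < s" and t: "0 < t"
  shows "gauss s (x - y) * gauss t (z - y) =
    gauss (s + t) (x - z) * gauss (s * t / (s + t)) (y - (1 / (s + t)) *\<^sub>R (t *\<^sub>R x + s *\<^sub>R z))"
proof -
  let ?D = "- real DIM('a) / 2"
  define u w where "u = x - y" and "w = z - y"
  have xz: "x - z = u - w" by (simp add: u_def w_def)
  have ym: "y - (1 / (s + t)) *\<^sub>R (t *\<^sub>R x + s *\<^sub>R z) = - ((1 / (s + t)) *\<^sub>R (t *\<^sub>R u + s *\<^sub>R w))"
  proof -
    have "(1 / (s + t)) *\<^sub>R (t *\<^sub>R u + s *\<^sub>R w)
        = (1 / (s + t)) *\<^sub>R (t *\<^sub>R x + s *\<^sub>R z) - (1 / (s + t)) *\<^sub>R ((s + t) *\<^sub>R y)"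
      by (simp only: u_def w_def scaleR_diff_right[symmetric]) (simp add: algebra_simps)
    then show ?thesis using s t by simp
  qed
  have c: "(2 * pi * s) powr ?D * (2 * pi * t) powr ?D = (2 * pi * (s + t)) powr ?D * (2 * pi * (s * t / (s + t))) powr ?D"
  proof -
    have "(2 * pi * s) * (2 * pi * t) = (2 * pi * (s + t)) * (2 * pi * (s * t / (s + t)))"
      using s t by simp
    then show ?thesis using s t by (metis powr_mult)
  qed
  have "(norm u)\<^sup>2 / (2 * s) + (norm w)\<^sup>2 / (2 * t)
      = (norm (u - w))\<^sup>2 / (2 * (s + t)) + (norm ((1 / (s + t)) *\<^sub>R (t *\<^sub>R u + s *\<^sub>R w)))\<^sup>2 / (2 * (s * t / (s + t)))"
  proof -
    define a b c where "a = u \<bullet> u" "b = w \<bullet> w" "c = u \<bullet> w"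
    have n: "(norm ((1 / (s + t)) *\<^sub>R (t *\<^sub>R u + s *\<^sub>R w)))\<^sup>2 = (t\<^sup>2 * a + 2 * s * t * c + s\<^sup>2 * b) / (s + t)\<^sup>2"
    proof -
      have "(norm ((1 / (s + t)) *\<^sub>R (t *\<^sub>R u + s *\<^sub>R w)))\<^sup>2 = (1 / (s + t))\<^sup>2 * (norm (t *\<^sub>R u + s *\<^sub>R w))\<^sup>2"
        by (simp add: power_mult_distrib power_divide)
      also have "(norm (t *\<^sub>R u + s *\<^sub>R w))\<^sup>2 = t\<^sup>2 * a + 2 * s * t * c + s\<^sup>2 * b"
        by (simp only: power2_norm_eq_inner) (simp add: inner_add_left inner_add_right a_b_c_def inner_commute power2_eq_square algebra_simps)
      finally show ?thesis by (simp add: power_divide)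
    qed
    have m: "(norm (u - w))\<^sup>2 = a - 2 * c + b"
      by (simp add: power2_norm_eq_inner inner_diff_left inner_diff_right a_b_c_def inner_commute)
    have "a / (2 * s) + b / (2 * t) = (a - 2 * c + b) / (2 * (s + t))
      + (t\<^sup>2 * a + 2 * s * t * c + s\<^sup>2 * b) / (s + t)\<^sup>2 / (2 * (s * t / (s + t)))"
    proof -
      have "(t\<^sup>2 * a + 2 * s * t * c + s\<^sup>2 * b) / (s + t)\<^sup>2 / (2 * (s * t / (s + t)))
          = (t\<^sup>2 * a + 2 * s * t * c + s\<^sup>2 * b) / (2 * s * t * (s + t))"
        using s t by (simp add: power2_eq_square)
      moreover have "(a - 2 * c + b) / (2 * (s + t)) = (a - 2 * c + b) * (s * t) / (2 * s * t * (s + t))"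
        using s t by simp
      moreover have "a / (2 * s) = a * (t * (s + t)) / (2 * s * t * (s + t))" using s t by simp
      moreover have "b / (2 * t) = b * (s * (s + t)) / (2 * s * t * (s + t))" using s t by simp
      ultimately show ?thesis by (simp add: add_divide_distrib[symmetric] power2_eq_square algebra_simps)
    qed
    then show ?thesis by (simp only: n m) (simp add: a_b_c_def power2_norm_eq_inner)
  qed
  then have e: "exp (- (norm u)\<^sup>2 / (2 * s)) * exp (- (norm w)\<^sup>2 / (2 * t))
      = exp (- (norm (u - w))\<^sup>2 / (2 * (s + t))) * exp (- (norm ((1 / (s + t)) *\<^sub>R (t *\<^sub>R u + s *\<^sub>R w)))\<^sup>2 / (2 * (s * t / (s + t))))"
    by (simp only: exp_add[symmetric]) (simp only: minus_divide_left[symmetric] minus_add_distrib[symmetric])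
  show ?thesis
    unfolding gauss_def xz ym norm_minus_cancel u_def[symmetric] w_def[symmetric]
    using arg_cong2[OF c e, of "(*)"] by (simp only: mult_ac)
qed

lemma gauss_convolution:
  fixes x z :: "'a::euclidean_space"
  assumes s: "0 < s" and t: "0 < t"
  shows "(\<integral>\<^sup>+y. ennreal (gauss s (x - y)) * ennreal (gauss t (y - z)) \<partial>lborel) = ennreal (gauss (s + t) (x - z))"
proof -
  let ?m = "(1 / (s + t)) *\<^sub>R (t *\<^sub>R x + s *\<^sub>R z)"
  have "ennreal (gauss s (x - y)) * ennreal (gauss t (y - z))
      = ennreal (gauss (s + t) (x - z)) * ennreal (gauss (s * t / (s + t)) (y - ?m))" for y
    using gauss_mult[OF s t, of x y z] by (simp add: ennreal_mult[symmetric] gauss_commute[of t y z])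
  then show ?thesis
    using s t by (simp add: nn_integral_cmult nn_integral_gauss_diff)
qed

text \<open>An exponential tilt shifts the mean by h p and costs the moment generating function as a
  factor.\<close>

lemma gauss_tilt:
  fixes p x :: "'a::euclidean_space"
  assumes h: "0 < h"
  shows "gauss h x * exp (p \<bullet> x) = exp (h * (norm p)\<^sup>2 / 2) * gauss h (x - h *\<^sub>R p)"
proof -
  have n: "(norm (x - h *\<^sub>R p))\<^sup>2 = (norm x)\<^sup>2 - 2 * h * (p \<bullet> x) + h\<^sup>2 * (norm p)\<^sup>2"
    by (simp only: power2_norm_eq_inner) (simp add: inner_diff_left inner_diff_right inner_commute power2_eq_square algebra_simps)
  have "- (norm x)\<^sup>2 / (2 * h) + p \<bullet> x = h * (norm p)\<^sup>2 / 2 + - (norm (x - h *\<^sub>R p))\<^sup>2 / (2 * h)"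
    unfolding n using h by (simp add: field_simps power2_eq_square)
  then show ?thesis unfolding gauss_def
    by (simp add: exp_add[symmetric] mult_ac)
qed

lemma normal_density_mat_eq_gauss: "normal_density_mat v \<Theta> X = gauss v (X - \<Theta>)"
  by (simp add: normal_density_mat_def gauss_def mult.commute)

section \<open>Kullback-Leibler risk\<close>

text \<open>Adding \<open>t - s\<close>, which integrates to \<open>0\<close> for two densities, makes the integrand of the divergence
  nonnegative.\<close>

definition kl :: "real \<Rightarrow> real \<Rightarrow> ennreal" where
  "kl s t = (if t = 0 then \<infinity> else ennreal (s * ln (s / t) - s + t))"

lemma kl_real_nonneg:
  fixes s t :: real
  assumes "0 < s" "0 < t"
  shows "0 \<le> s * ln (s / t) - s + t"
proof -
  have "ln (t / s) \<le> t / s - 1" using assms by (intro ln_le_minus_one) simp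
  then have "s * ln (t / s) \<le> s * (t / s - 1)" using assms by (intro mult_left_mono) auto
  then show ?thesis using assms by (simp add: ln_div right_diff_distrib)
qed

text \<open>The case of equality in ln x \<le> x - 1, at x = t / s.\<close>

lemma kl_eq_0_imp_eq:
  assumes s: "0 < s" and t: "0 \<le> t" and 0: "kl s t = 0"
  shows "s = t"
proof -
  have t: "0 < t" using t 0 by (auto simp: kl_def split: if_splits)
  then have "s * ln (s / t) - s + t = 0"
    using 0 kl_real_nonneg[OF s t] by (simp add: kl_def ennreal_eq_0_iff)
  then have "s * ln (t / s) = s * (t / s - 1)" using s t by (simp add: ln_div right_diff_distrib)
  then have "ln (t / s) = t / s - 1" using s by simp
  then show ?thesis using ln_eq_minus_one[of "t / s"] s t by simp
qed

lemma borel_measurable_kl [measurable (raw)]: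
  assumes [measurable]: "f \<in> borel_measurable M" "g \<in> borel_measurable M"
  shows "(\<lambda>x. kl (f x) (g x)) \<in> borel_measurable M"
  unfolding kl_def by measurable

lemma mult_ln_le: "0 < s \<Longrightarrow> 0 < t \<Longrightarrow> s * ln (t / s) \<le> t" for s t :: real
  using kl_real_nonneg[of s t] by (simp add: ln_div right_diff_distrib)

lemma ennreal_add_right_cancel: "a + c = b + c \<Longrightarrow> c \<noteq> \<top> \<Longrightarrow> a = b" for a b c :: ennreal
  using ennreal_add_left_cancel[of c a b] by (simp add: add.commute)

lemma enn2ereal_add_diff: "b \<noteq> \<top> \<Longrightarrow> enn2ereal (a + b) - enn2ereal b = enn2ereal a"
proof -
  assume "b \<noteq> \<top>"
  then obtain r where r: "0 \<le> r" "b = ennreal r" by (cases b) auto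
  then show ?thesis by (cases "enn2ereal a") (auto simp: plus_ennreal.rep_eq)
qed

text \<open>Pointwise, f^+ + g = kl + f^- + \<phi>, where \<phi> is the true density and f the
  integrand of the loss; no term is subtracted, so this survives values \<infinity>. Integrating, g
  and \<phi> both contribute 1, which cancels. The negative part is at most g, hence of finite
  integral, and the difference in \<open>ext_integral\<close> is therefore the integral of
  \<open>kl\<close>.\<close>

lemma KL_loss_eq_kl:
  fixes g :: "real^'q^'r \<Rightarrow> real"
  assumes v: "0 < v" and gm[measurable]: "g \<in> borel_measurable borel" and g0: "\<And>Y. 0 \<le> g Y"
    and g1: "(\<integral>\<^sup>+Y. ennreal (g Y) \<partial>lborel) = 1"
  shows "KL_loss v \<Theta> g = enn2ereal (\<integral>\<^sup>+Y. kl (gauss v (Y - \<Theta>)) (g Y) \<partial>lborel)"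
proof -
  let ?\<phi> = "\<lambda>Y. gauss v (Y - \<Theta>)"
  let ?f = "\<lambda>Y. if g Y = 0 then \<infinity> else ereal (?\<phi> Y * ln (?\<phi> Y / g Y))"
  let ?P = "\<integral>\<^sup>+Y. e2ennreal (?f Y) \<partial>lborel" and ?M = "\<integral>\<^sup>+Y. e2ennreal (- ?f Y) \<partial>lborel"
  let ?K = "\<integral>\<^sup>+Y. kl (?\<phi> Y) (g Y) \<partial>lborel"
  have \<phi>: "0 < ?\<phi> Y" for Y by (rule gauss_pos[OF v])
  have pt: "e2ennreal (?f Y) + ennreal (g Y) = (kl (?\<phi> Y) (g Y) + e2ennreal (- ?f Y)) + ennreal (?\<phi> Y)" for Y
  proof (cases "g Y = 0")
    case True
    then show ?thesis by (simp add: kl_def e2ennreal_infty)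
  next
    case False
    then have gp: "0 < g Y" using g0[of Y] by simp
    define x where "x = ?\<phi> Y * ln (?\<phi> Y / g Y)"
    have nn: "0 \<le> x - ?\<phi> Y + g Y" unfolding x_def by (rule kl_real_nonneg[OF \<phi> gp])
    have "ennreal x + ennreal (g Y) = (ennreal (x - ?\<phi> Y + g Y) + ennreal (- x)) + ennreal (?\<phi> Y)"
    proof (cases "0 \<le> x")
      case True
      then show ?thesis using nn gp \<phi>[of Y]
        by (simp add: ennreal_neg ennreal_plus[symmetric] del: ennreal_plus)
    next
      case False
      then show ?thesis using nn gp \<phi>[of Y]
        by (simp add: ennreal_neg ennreal_plus[symmetric] del: ennreal_plus)
    qed
    then show ?thesis using gp by (simp add: kl_def x_def[symmetric] e2ennreal_ereal)
  qed
  have M: "?M \<le> 1"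
  proof -
    have "?M \<le> (\<integral>\<^sup>+Y. ennreal (g Y) \<partial>lborel)"
    proof (rule nn_integral_mono)
      fix Y
      show "e2ennreal (- ?f Y) \<le> ennreal (g Y)"
      proof (cases "g Y = 0")
        case False
        then have gp: "0 < g Y" using g0[of Y] by simp
        have "- (?\<phi> Y * ln (?\<phi> Y / g Y)) \<le> g Y"
          using mult_ln_le[OF \<phi>[of Y] gp] \<phi>[of Y] gp by (simp add: ln_div right_diff_distrib)
        then show ?thesis using gp by (simp add: e2ennreal_ereal ennreal_leI)
      qed (simp add: e2ennreal_neg)
    qed
    then show ?thesis by (simp add: g1)
  qed
  have "?P + 1 = (\<integral>\<^sup>+Y. e2ennreal (?f Y) + ennreal (g Y) \<partial>lborel)"
    by (subst nn_integral_add) (auto simp: g1)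
  also have "\<dots> = (\<integral>\<^sup>+Y. (kl (?\<phi> Y) (g Y) + e2ennreal (- ?f Y)) + ennreal (?\<phi> Y) \<partial>lborel)"
    by (simp only: pt)
  also have "\<dots> = (?K + ?M) + 1"
    by (subst nn_integral_add, simp, simp, subst nn_integral_add) (auto simp: nn_integral_gauss_diff[OF v])
  finally have "?P = ?K + ?M" by (rule ennreal_add_right_cancel) simp
  moreover have "?M \<noteq> \<top>" using M by (auto simp: top_unique)
  ultimately have "enn2ereal ?P - enn2ereal ?M = enn2ereal ?K" by (simp add: enn2ereal_add_diff)
  then show ?thesis unfolding KL_loss_def ext_integral_def normal_density_mat_eq_gauss .
qed

text \<open>A risk with values in \<open>ennreal\<close>, so that the orders of integration may be
  exchanged without integrability conditions.\<close>

definition kl_risk :: "real \<Rightarrow> real \<Rightarrow> 'a::euclidean_space \<Rightarrow> ('a \<Rightarrow> 'a \<Rightarrow> real) \<Rightarrow> ennreal" where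
  "kl_risk v\<^sub>x v\<^sub>y \<Theta> p =
    (\<integral>\<^sup>+X. ennreal (gauss v\<^sub>x (X - \<Theta>)) * (\<integral>\<^sup>+Y. kl (gauss v\<^sub>y (Y - \<Theta>)) (p X Y) \<partial>lborel) \<partial>lborel)"

lemma predictive_densityD:
  assumes "predictive_density p"
  shows "\<And>M f g. f \<in> borel_measurable M \<Longrightarrow> g \<in> borel_measurable M \<Longrightarrow> (\<lambda>x. p (f x) (g x)) \<in> borel_measurable M"
    and "\<And>X Y. 0 \<le> p X Y" and "\<And>X. (\<integral>\<^sup>+Y. ennreal (p X Y) \<partial>lborel) = 1"
proof -
  show "(\<lambda>x. p (f x) (g x)) \<in> borel_measurable M" if [measurable]: "f \<in> borel_measurable M" "g \<in> borel_measurable M" for M f g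
  proof -
    have [measurable]: "(\<lambda>(X, Y). p X Y) \<in> borel_measurable (borel \<Otimes>\<^sub>M borel)"
      using assms by (simp add: predictive_density_def)
    have "(\<lambda>x. (\<lambda>(X, Y). p X Y) (f x, g x)) \<in> borel_measurable M" by measurable
    then show ?thesis by simp
  qed
qed (use assms in \<open>auto simp: predictive_density_def\<close>)

lemma KL_risk_eq_kl_risk:
  fixes p :: "real^'q^'r \<Rightarrow> real^'q^'r \<Rightarrow> real"
  assumes vy: "0 < v\<^sub>y" and p: "predictive_density p"
  shows "KL_risk v\<^sub>x v\<^sub>y \<Theta> p = enn2ereal (kl_risk v\<^sub>x v\<^sub>y \<Theta> p)"
proof -
  have "KL_loss v\<^sub>y \<Theta> (p X) = enn2ereal (\<integral>\<^sup>+Y. kl (gauss v\<^sub>y (Y - \<Theta>)) (p X Y) \<partial>lborel)" for X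
  proof (rule KL_loss_eq_kl[OF vy _ predictive_densityD(2)[OF p] predictive_densityD(3)[OF p]])
    show "p X \<in> borel_measurable borel"
      by (rule predictive_densityD(1)[OF p, of "\<lambda>_. X" borel "\<lambda>Y. Y"]) measurable
  qed
  then have eq: "ereal (normal_density_mat v\<^sub>x \<Theta> X) * KL_loss v\<^sub>y \<Theta> (p X)
      = enn2ereal (ennreal (gauss v\<^sub>x (X - \<Theta>)) * (\<integral>\<^sup>+Y. kl (gauss v\<^sub>y (Y - \<Theta>)) (p X Y) \<partial>lborel))" for X
    by (simp add: normal_density_mat_eq_gauss times_ennreal.rep_eq)
  show ?thesis unfolding KL_risk_def ext_integral_def eq
    by (simp add: kl_risk_def e2ennreal_neg zero_ennreal.rep_eq)
qed

subsection \<open>Bayes risk\<close>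

text \<open>The Pythagorean identity for Bayes risks: s ln (s / p') = s ln (s / p) + s ln (p / p')
  with s the true density of Y, and averaging s over \<Theta> given X turns the last term into the
  divergence from p to p'. All logarithms are split into positive and negative parts so that only
  sums of nonnegative integrals occur; the finite prior mass permits cancellation.\<close>

theorem bayes_risk_decomposition:
  fixes \<pi> :: "real^'q^'r \<Rightarrow> ennreal" and p p' :: "real^'q^'r \<Rightarrow> real^'q^'r \<Rightarrow> real"
  assumes vx: "0 < v\<^sub>x" and vy: "0 < v\<^sub>y"
    and \<pi>[measurable]: "\<pi> \<in> borel_measurable borel" and fin: "(\<integral>\<^sup>+\<Theta>. \<pi> \<Theta> \<partial>lborel) \<noteq> \<top>"
    and p: "predictive_density p" and pos: "\<And>X Y. 0 < p X Y"
    and bayes: "\<And>X Y. (\<integral>\<^sup>+\<Theta>. ennreal (gauss v\<^sub>x (X - \<Theta>)) * ennreal (gauss v\<^sub>y (Y - \<Theta>)) * \<pi> \<Theta> \<partial>lborel)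
      = (\<integral>\<^sup>+\<Theta>. ennreal (gauss v\<^sub>x (X - \<Theta>)) * \<pi> \<Theta> \<partial>lborel) * ennreal (p X Y)"
    and p': "predictive_density p'"
  shows "(\<integral>\<^sup>+\<Theta>. \<pi> \<Theta> * kl_risk v\<^sub>x v\<^sub>y \<Theta> p' \<partial>lborel) = (\<integral>\<^sup>+\<Theta>. \<pi> \<Theta> * kl_risk v\<^sub>x v\<^sub>y \<Theta> p \<partial>lborel)
    + (\<integral>\<^sup>+X. (\<integral>\<^sup>+\<Theta>. ennreal (gauss v\<^sub>x (X - \<Theta>)) * \<pi> \<Theta> \<partial>lborel) * (\<integral>\<^sup>+Y. kl (p X Y) (p' X Y) \<partial>lborel) \<partial>lborel)"
proof -
  note pm[measurable (raw)] = predictive_densityD(1)[OF p] predictive_densityD(1)[OF p']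
  note p0 = predictive_densityD(2)[OF p] predictive_densityD(2)[OF p']
  note p1 = predictive_densityD(3)[OF p] predictive_densityD(3)[OF p']
  \<comment> \<open>Positive and negative part of ln (p / p'), with the value \<infinity> where p'
    vanishes. Neither depends on \<Theta>, which is why \<Theta> can be integrated out in
    \<open>TU\<close>.\<close>
  define L1 where "L1 X Y = (if p' X Y = 0 then \<infinity> else ennreal (ln (p X Y / p' X Y)))" for X Y
  define L2 where "L2 X Y = (if p' X Y = 0 then 0 else ennreal (ln (p' X Y / p X Y)))" for X Y
  have Lm[measurable (raw)]: "(\<lambda>x. L1 (f x) (g x)) \<in> borel_measurable M" "(\<lambda>x. L2 (f x) (g x)) \<in> borel_measurable M"
    if [measurable]: "f \<in> borel_measurable M" "g \<in> borel_measurable M" for f g and M :: "'z measure"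
    unfolding L1_def L2_def by measurable
  define T where "T F = (\<integral>\<^sup>+\<Theta>. \<pi> \<Theta> * (\<integral>\<^sup>+X. ennreal (gauss v\<^sub>x (X - \<Theta>)) * (\<integral>\<^sup>+Y. F \<Theta> X Y \<partial>lborel) \<partial>lborel) \<partial>lborel)"
    for F :: "real^'q^'r \<Rightarrow> real^'q^'r \<Rightarrow> real^'q^'r \<Rightarrow> ennreal"
  define m where "m X = (\<integral>\<^sup>+\<Theta>. ennreal (gauss v\<^sub>x (X - \<Theta>)) * \<pi> \<Theta> \<partial>lborel)" for X
  have mm[measurable]: "m \<in> borel_measurable borel" unfolding m_def by measurable
  define U where "U F = (\<integral>\<^sup>+X. m X * (\<integral>\<^sup>+Y. F X Y \<partial>lborel) \<partial>lborel)"
    for F :: "real^'q^'r \<Rightarrow> real^'q^'r \<Rightarrow> ennreal"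
  define c where "c = (\<integral>\<^sup>+\<Theta>. \<pi> \<Theta> \<partial>lborel)"
  have c: "c \<noteq> \<top>" using fin by (simp add: c_def)
  have cm: "(\<integral>\<^sup>+X. m X \<partial>lborel) = c"
  proof -
    have "(\<integral>\<^sup>+X. m X \<partial>lborel) = (\<integral>\<^sup>+\<Theta>. (\<integral>\<^sup>+X. ennreal (gauss v\<^sub>x (X - \<Theta>)) * \<pi> \<Theta> \<partial>lborel) \<partial>lborel)"
      unfolding m_def by (rule lborel_pair.Fubini') measurable
    also have "\<dots> = c" by (simp add: nn_integral_multc nn_integral_gauss_diff[OF vx] c_def)
    finally show ?thesis .
  qed
  have Tadd: "T (\<lambda>\<Theta> X Y. F \<Theta> X Y + G \<Theta> X Y) = T F + T G"
    if [measurable]: "(\<lambda>(\<Theta>, X, Y). F \<Theta> X Y) \<in> borel_measurable (borel \<Otimes>\<^sub>M borel \<Otimes>\<^sub>M borel)"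
      "(\<lambda>(\<Theta>, X, Y). G \<Theta> X Y) \<in> borel_measurable (borel \<Otimes>\<^sub>M borel \<Otimes>\<^sub>M borel)" for F G
  proof -
    define F' G' where "F' = (\<lambda>(\<Theta>, X, Y). F \<Theta> X Y)" and "G' = (\<lambda>(\<Theta>, X, Y). G \<Theta> X Y)"
    have [measurable]: "F' \<in> borel_measurable (borel \<Otimes>\<^sub>M borel \<Otimes>\<^sub>M borel)"
      "G' \<in> borel_measurable (borel \<Otimes>\<^sub>M borel \<Otimes>\<^sub>M borel)" unfolding F'_def G'_def by (rule that)+
    have eq: "F \<Theta> X Y = F' (\<Theta>, X, Y)" "G \<Theta> X Y = G' (\<Theta>, X, Y)" for \<Theta> X Y by (auto simp: F'_def G'_def)
    show ?thesis unfolding T_def eq by (simp add: nn_integral_add distrib_left)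
  qed
  have Uadd: "U (\<lambda>X Y. F X Y + G X Y) = U F + U G"
    if [measurable]: "(\<lambda>(X, Y). F X Y) \<in> borel_measurable (borel \<Otimes>\<^sub>M borel)"
      "(\<lambda>(X, Y). G X Y) \<in> borel_measurable (borel \<Otimes>\<^sub>M borel)" for F G
    unfolding U_def by (simp add: nn_integral_add distrib_left)
  have Tp: "T (\<lambda>\<Theta> X Y. ennreal (p X Y)) = c" "T (\<lambda>\<Theta> X Y. ennreal (p' X Y)) = c"
    unfolding T_def by (simp_all add: p1 nn_integral_gauss_diff[OF vx] c_def)
  have Up: "U (\<lambda>X Y. ennreal (p X Y)) = c" "U (\<lambda>X Y. ennreal (p' X Y)) = c"
    unfolding U_def by (simp_all add: p1 cm)
  \<comment> \<open>A factor L that does not involve \<Theta> sees the true density of Y only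
    through its posterior mean, which is p by \<open>bayes\<close>.\<close>
  have TU: "T (\<lambda>\<Theta> X Y. ennreal (gauss v\<^sub>y (Y - \<Theta>)) * L X Y) = U (\<lambda>X Y. ennreal (p X Y) * L X Y)"
    if [measurable]: "(\<lambda>(X, Y). L X Y) \<in> borel_measurable (borel \<Otimes>\<^sub>M borel)" for L
  proof -
    let ?F = "\<lambda>\<Theta> X Y. ennreal (gauss v\<^sub>x (X - \<Theta>)) * ennreal (gauss v\<^sub>y (Y - \<Theta>)) * \<pi> \<Theta> * L X Y"
    have "T (\<lambda>\<Theta> X Y. ennreal (gauss v\<^sub>y (Y - \<Theta>)) * L X Y) = (\<integral>\<^sup>+\<Theta>. (\<integral>\<^sup>+X. (\<integral>\<^sup>+Y. ?F \<Theta> X Y \<partial>lborel) \<partial>lborel) \<partial>lborel)"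
      unfolding T_def by (simp add: nn_integral_cmult[symmetric] mult_ac)
    also have "\<dots> = (\<integral>\<^sup>+X. (\<integral>\<^sup>+\<Theta>. (\<integral>\<^sup>+Y. ?F \<Theta> X Y \<partial>lborel) \<partial>lborel) \<partial>lborel)"
      by (rule lborel_pair.Fubini') measurable
    also have "\<dots> = (\<integral>\<^sup>+X. (\<integral>\<^sup>+Y. (\<integral>\<^sup>+\<Theta>. ?F \<Theta> X Y \<partial>lborel) \<partial>lborel) \<partial>lborel)"
      by (intro nn_integral_cong lborel_pair.Fubini') measurable
    also have "\<dots> = U (\<lambda>X Y. ennreal (p X Y) * L X Y)"
    proof -
      have "(\<integral>\<^sup>+\<Theta>. ?F \<Theta> X Y \<partial>lborel) = m X * (ennreal (p X Y) * L X Y)" for X Y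
      proof -
        have "(\<integral>\<^sup>+\<Theta>. ?F \<Theta> X Y \<partial>lborel)
          = (\<integral>\<^sup>+\<Theta>. ennreal (gauss v\<^sub>x (X - \<Theta>)) * ennreal (gauss v\<^sub>y (Y - \<Theta>)) * \<pi> \<Theta> \<partial>lborel) * L X Y"
          by (rule nn_integral_multc) measurable
        then show ?thesis unfolding bayes m_def by (simp only: mult.assoc)
      qed
      then show ?thesis unfolding U_def by (simp add: nn_integral_cmult)
    qed
    finally show ?thesis .
  qed
  \<comment> \<open>The splitting of the logarithm with every negative term moved to the other side.
    The next identity does the same for the divergence between p and p'.\<close>
  have pt1: "kl (gauss v\<^sub>y (Y - \<Theta>)) (p' X Y) + (ennreal (p X Y) + ennreal (gauss v\<^sub>y (Y - \<Theta>)) * L2 X Y)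
      = kl (gauss v\<^sub>y (Y - \<Theta>)) (p X Y) + (ennreal (p' X Y) + ennreal (gauss v\<^sub>y (Y - \<Theta>)) * L1 X Y)" for \<Theta> X Y
  proof (cases "p' X Y = 0")
    case True
    then show ?thesis using gauss_pos[OF vy, of "Y - \<Theta>"] by (simp add: kl_def L1_def ennreal_mult_top)
  next
    case False
    then have pp: "0 < p' X Y" using p0(2)[of X Y] by simp
    define s where "s = gauss v\<^sub>y (Y - \<Theta>)"
    have s: "0 < s" unfolding s_def by (rule gauss_pos[OF vy])
    let ?l = "ln (p X Y) - ln (p' X Y)"
    have L: "L1 X Y = ennreal ?l" "L2 X Y = ennreal (- ?l)" using pp pos[of X Y] by (auto simp: L1_def L2_def ln_div)
    have k: "kl s (p' X Y) = ennreal (s * (ln s - ln (p' X Y)) - s + p' X Y)" "0 \<le> s * (ln s - ln (p' X Y)) - s + p' X Y"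
      using pp s kl_real_nonneg[OF s pp] by (auto simp: kl_def ln_div)
    have k2: "kl s (p X Y) = ennreal (s * (ln s - ln (p X Y)) - s + p X Y)" "0 \<le> s * (ln s - ln (p X Y)) - s + p X Y"
      using pos[of X Y] s kl_real_nonneg[OF s pos[of X Y]] by (auto simp: kl_def ln_div)
    show ?thesis unfolding s_def[symmetric] L k(1) k2(1)
    proof (cases "0 \<le> ?l")
      case True
      have "ennreal s * ennreal ?l = ennreal (s * ?l)" using True s by (simp add: ennreal_mult)
      then show "ennreal (s * (ln s - ln (p' X Y)) - s + p' X Y) + (ennreal (p X Y) + ennreal s * ennreal (- ?l)) =
        ennreal (s * (ln s - ln (p X Y)) - s + p X Y) + (ennreal (p' X Y) + ennreal s * ennreal ?l)"
        using True s k(2) k2(2) pp pos[of X Y] 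
        by (simp add: ennreal_neg ennreal_plus[symmetric] del: ennreal_plus) (simp add: algebra_simps)
    next
      case False
      have "ennreal s * ennreal (- ?l) = ennreal (s * - ?l)" using False s by (simp add: ennreal_mult)
      then show "ennreal (s * (ln s - ln (p' X Y)) - s + p' X Y) + (ennreal (p X Y) + ennreal s * ennreal (- ?l)) =
        ennreal (s * (ln s - ln (p X Y)) - s + p X Y) + (ennreal (p' X Y) + ennreal s * ennreal ?l)"
        using False s k(2) k2(2) pp pos[of X Y] mult_pos_neg[of s ?l]
        by (simp add: ennreal_neg ennreal_plus[symmetric] del: ennreal_plus) (simp add: algebra_simps)
    qed
  qed
  have pt2: "ennreal (p X Y) * L1 X Y + ennreal (p' X Y)
      = kl (p X Y) (p' X Y) + (ennreal (p X Y) + ennreal (p X Y) * L2 X Y)" for X Y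
  proof (cases "p' X Y = 0")
    case True
    then show ?thesis using pos[of X Y] by (simp add: kl_def L1_def ennreal_mult_top)
  next
    case False
    then have pp: "0 < p' X Y" using p0(2)[of X Y] by simp
    define s where "s = p X Y"
    have s: "0 < s" unfolding s_def by (rule pos)
    let ?l = "ln s - ln (p' X Y)"
    have L: "L1 X Y = ennreal ?l" "L2 X Y = ennreal (- ?l)" using pp pos[of X Y] by (auto simp: L1_def L2_def ln_div s_def)
    have k: "kl s (p' X Y) = ennreal (s * ?l - s + p' X Y)" "0 \<le> s * ?l - s + p' X Y"
      using pp s kl_real_nonneg[OF s pp] by (auto simp: kl_def ln_div)
    show ?thesis unfolding s_def[symmetric] L k(1)
    proof (cases "0 \<le> ?l")
      case True
      have "ennreal s * ennreal ?l = ennreal (s * ?l)" using True s by (simp add: ennreal_mult)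
      then show "ennreal s * ennreal ?l + ennreal (p' X Y) =
        ennreal (s * ?l - s + p' X Y) + (ennreal s + ennreal s * ennreal (- ?l))"
        using True s k(2) pp
        by (simp add: ennreal_neg ennreal_plus[symmetric] del: ennreal_plus)
    next
      case False
      have "ennreal s * ennreal (- ?l) = ennreal (s * - ?l)" using False s by (simp add: ennreal_mult)
      then show "ennreal s * ennreal ?l + ennreal (p' X Y) =
        ennreal (s * ?l - s + p' X Y) + (ennreal s + ennreal s * ennreal (- ?l))"
        using False s k(2) pp mult_pos_neg[of s ?l]
        by (simp add: ennreal_neg ennreal_plus[symmetric] del: ennreal_plus) (simp add: algebra_simps)
    qed
  qed
  define K1 where "K1 = T (\<lambda>\<Theta> X Y. kl (gauss v\<^sub>y (Y - \<Theta>)) (p' X Y))"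
  define K2 where "K2 = T (\<lambda>\<Theta> X Y. kl (gauss v\<^sub>y (Y - \<Theta>)) (p X Y))"
  define U1 where "U1 = U (\<lambda>X Y. ennreal (p X Y) * L1 X Y)"
  define U2 where "U2 = U (\<lambda>X Y. ennreal (p X Y) * L2 X Y)"
  define UK where "UK = U (\<lambda>X Y. kl (p X Y) (p' X Y))"
  have "K1 + (c + U2) = T (\<lambda>\<Theta> X Y. kl (gauss v\<^sub>y (Y - \<Theta>)) (p' X Y) + (ennreal (p X Y) + ennreal (gauss v\<^sub>y (Y - \<Theta>)) * L2 X Y))"
    by (simp add: Tadd Tp TU K1_def U2_def)
  also have "\<dots> = K2 + (c + U1)" unfolding pt1 by (simp add: Tadd Tp TU K2_def U1_def)
  finally have e1: "K1 + (c + U2) = K2 + (c + U1)" .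
  have "U1 + c = U (\<lambda>X Y. ennreal (p X Y) * L1 X Y + ennreal (p' X Y))" by (simp add: Uadd Up U1_def)
  also have "\<dots> = UK + (c + U2)" unfolding pt2 by (simp add: Uadd Up UK_def U2_def)
  finally have e2: "U1 + c = UK + (c + U2)" .
  \<comment> \<open>The negative part contributes at most the integral of p', that is c; this
    finiteness justifies the final cancellation.\<close>
  have "U2 \<le> U (\<lambda>X Y. ennreal (p' X Y))"
    unfolding U2_def U_def
  proof (intro nn_integral_mono mult_left_mono)
    fix X Y
    show "ennreal (p X Y) * L2 X Y \<le> ennreal (p' X Y)"
    proof (cases "p' X Y = 0")
      case False
      then have pp: "0 < p' X Y" using p0(2)[of X Y] by simp
      have "ennreal (p X Y) * L2 X Y = ennreal (p X Y * ln (p' X Y / p X Y))"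
        using pp p0(1)[of X Y] by (simp add: L2_def ennreal_mult')
      then show ?thesis using mult_ln_le[OF pos pp] by (simp add: ennreal_leI)
    qed (simp add: L2_def)
  qed auto
  then have U2: "U2 \<noteq> \<top>" using c by (auto simp: Up top_unique)
  have "K1 + (c + U2) = (K2 + UK) + (c + U2)" using e1 e2 by (simp add: ac_simps)
  then have "K1 = K2 + UK" by (rule ennreal_add_right_cancel) (use c U2 in simp)
  then show ?thesis by (simp add: K1_def K2_def UK_def T_def U_def kl_risk_def m_def)
qed

text \<open>A dominating p' has no larger Bayes risk. The Bayes risk of p is finite, because the
  prior has finite mass and the risk is bounded, so the decomposition forces the divergence term to
  vanish. As the marginal of X is positive, p' agrees with p almost everywhere; then the two risks
  agree at every \<Theta>, against the strict inequality.\<close>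

theorem proper_bayes_admissible:
  fixes \<pi> :: "real^'q^'r \<Rightarrow> ennreal" and p :: "real^'q^'r \<Rightarrow> real^'q^'r \<Rightarrow> real"
  assumes vx: "0 < v\<^sub>x" and vy: "0 < v\<^sub>y"
    and \<pi>[measurable]: "\<pi> \<in> borel_measurable borel" and fin: "(\<integral>\<^sup>+\<Theta>. \<pi> \<Theta> \<partial>lborel) \<noteq> \<top>"
    and p: "predictive_density p" and pos: "\<And>X Y. 0 < p X Y"
    and bayes: "\<And>X Y. (\<integral>\<^sup>+\<Theta>. ennreal (gauss v\<^sub>x (X - \<Theta>)) * ennreal (gauss v\<^sub>y (Y - \<Theta>)) * \<pi> \<Theta> \<partial>lborel)
      = (\<integral>\<^sup>+\<Theta>. ennreal (gauss v\<^sub>x (X - \<Theta>)) * \<pi> \<Theta> \<partial>lborel) * ennreal (p X Y)"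
    and mpos: "\<And>X. (\<integral>\<^sup>+\<Theta>. ennreal (gauss v\<^sub>x (X - \<Theta>)) * \<pi> \<Theta> \<partial>lborel) \<noteq> 0"
    and bound: "\<And>\<Theta>. kl_risk v\<^sub>x v\<^sub>y \<Theta> p \<le> ennreal R"
  shows "KL_admissible v\<^sub>x v\<^sub>y p"
  unfolding KL_admissible_def
proof (intro conjI p notI)
  assume "\<exists>p'. predictive_density p' \<and>
            (\<forall>\<Theta>. KL_risk v\<^sub>x v\<^sub>y \<Theta> p' \<le> KL_risk v\<^sub>x v\<^sub>y \<Theta> p) \<and>
            (\<exists>\<Theta>. KL_risk v\<^sub>x v\<^sub>y \<Theta> p' < KL_risk v\<^sub>x v\<^sub>y \<Theta> p)"
  then obtain p' \<Theta>0 where p': "predictive_density p'"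
    and le: "\<And>\<Theta>. KL_risk v\<^sub>x v\<^sub>y \<Theta> p' \<le> KL_risk v\<^sub>x v\<^sub>y \<Theta> p"
    and less: "KL_risk v\<^sub>x v\<^sub>y \<Theta>0 p' < KL_risk v\<^sub>x v\<^sub>y \<Theta>0 p" by blast
  have [measurable (raw)]: "f \<in> borel_measurable M \<Longrightarrow> g \<in> borel_measurable M \<Longrightarrow> (\<lambda>x. p (f x) (g x)) \<in> borel_measurable M"
    "f \<in> borel_measurable M \<Longrightarrow> g \<in> borel_measurable M \<Longrightarrow> (\<lambda>x. p' (f x) (g x)) \<in> borel_measurable M"
    for f g and M :: "'z measure"
    by (auto intro: predictive_densityD(1)[OF p] predictive_densityD(1)[OF p'])
  have le': "kl_risk v\<^sub>x v\<^sub>y \<Theta> p' \<le> kl_risk v\<^sub>x v\<^sub>y \<Theta> p" for \<Theta>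
    using le[of \<Theta>] by (simp add: KL_risk_eq_kl_risk[OF vy] p p' less_eq_ennreal.rep_eq)
  define m where "m X = (\<integral>\<^sup>+\<Theta>. ennreal (gauss v\<^sub>x (X - \<Theta>)) * \<pi> \<Theta> \<partial>lborel)" for X
  have [measurable]: "m \<in> borel_measurable borel" unfolding m_def by measurable
  let ?A = "\<integral>\<^sup>+\<Theta>. \<pi> \<Theta> * kl_risk v\<^sub>x v\<^sub>y \<Theta> p \<partial>lborel"
  let ?B = "\<integral>\<^sup>+X. m X * (\<integral>\<^sup>+Y. kl (p X Y) (p' X Y) \<partial>lborel) \<partial>lborel"
  have "?A \<le> (\<integral>\<^sup>+\<Theta>. \<pi> \<Theta> * ennreal R \<partial>lborel)" by (intro nn_integral_mono mult_left_mono bound) auto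
  also have "\<dots> < \<top>" using fin by (simp add: nn_integral_multc ennreal_mult_less_top less_top)
  finally have A: "?A \<noteq> \<top>" by simp
  have "?A + ?B = (\<integral>\<^sup>+\<Theta>. \<pi> \<Theta> * kl_risk v\<^sub>x v\<^sub>y \<Theta> p' \<partial>lborel)"
    unfolding m_def by (rule bayes_risk_decomposition[symmetric, OF vx vy \<pi> fin p pos bayes p'])
  also have "\<dots> \<le> ?A + 0" using le' by (auto intro!: nn_integral_mono mult_left_mono)
  finally have "?A + ?B \<le> ?A + 0" .
  then have "?B = 0" using A unfolding ennreal_add_left_cancel_le by simp
  then have "AE X in lborel. m X * (\<integral>\<^sup>+Y. kl (p X Y) (p' X Y) \<partial>lborel) = 0"
    by (subst (asm) nn_integral_0_iff_AE) auto
  then have ae: "AE X in lborel. AE Y in lborel. p X Y = p' X Y"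
  proof eventually_elim
    case (elim X)
    then have "(\<integral>\<^sup>+Y. kl (p X Y) (p' X Y) \<partial>lborel) = 0" using mpos[of X] by (simp add: m_def)
    then have "AE Y in lborel. kl (p X Y) (p' X Y) = 0" by (subst (asm) nn_integral_0_iff_AE) auto
    then show ?case
      by eventually_elim (use pos predictive_densityD(2)[OF p'] kl_eq_0_imp_eq in blast)
  qed
  have "kl_risk v\<^sub>x v\<^sub>y \<Theta>0 p' = kl_risk v\<^sub>x v\<^sub>y \<Theta>0 p"
    unfolding kl_risk_def
  proof (rule nn_integral_cong_AE)
    show "AE X in lborel. ennreal (gauss v\<^sub>x (X - \<Theta>0)) * (\<integral>\<^sup>+Y. kl (gauss v\<^sub>y (Y - \<Theta>0)) (p' X Y) \<partial>lborel)
      = ennreal (gauss v\<^sub>x (X - \<Theta>0)) * (\<integral>\<^sup>+Y. kl (gauss v\<^sub>y (Y - \<Theta>0)) (p X Y) \<partial>lborel)"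
      using ae
    proof eventually_elim
      case (elim X)
      then have "AE Y in lborel. kl (gauss v\<^sub>y (Y - \<Theta>0)) (p' X Y) = kl (gauss v\<^sub>y (Y - \<Theta>0)) (p X Y)"
        by eventually_elim simp
      then show ?case by (simp cong: nn_integral_cong_AE)
    qed
  qed
  then show False using less by (simp add: KL_risk_eq_kl_risk[OF vy] p p')
qed

subsection \<open>The minimax risk\<close>

text \<open>The divergence between two isotropic normal laws. Its constant - D / 2 stands on the
  left as + D / 2, and v \<le> \<sigma> makes the logarithm nonnegative, so that the formula
  involves no subtraction.\<close>

lemma gauss_kl_integral:
  fixes \<Theta> c :: "'a::euclidean_space"
  assumes v: "0 < v" and \<sigma>: "v \<le> \<sigma>"
  shows "(\<integral>\<^sup>+Y. kl (gauss v (Y - \<Theta>)) (gauss \<sigma> (Y - c)) \<partial>lborel) + ennreal (real DIM('a) / 2)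
    = ennreal (real DIM('a) / 2 * ln (\<sigma> / v)) + ennreal (1 / (2 * \<sigma>)) * ennreal (real DIM('a) * v + (norm (\<Theta> - c))\<^sup>2)"
proof -
  let ?D = "real DIM('a)"
  have s: "0 < \<sigma>" using v \<sigma> by simp
  define k where "k = ?D / 2 * ln (\<sigma> / v)"
  have k: "0 \<le> k" using v \<sigma> by (simp add: k_def)
  let ?K = "\<lambda>Y. kl (gauss v (Y - \<Theta>)) (gauss \<sigma> (Y - c))"
  have lng: "ln (gauss u x) = - ?D / 2 * ln (2 * pi * u) - (norm x)\<^sup>2 / (2 * u)" if "0 < u" for u and x :: 'a
    using that by (simp add: gauss_def ln_mult ln_powr)
  have pt: "?K Y + ennreal (1 / (2 * v)) * ennreal (gauss v (Y - \<Theta>) * (norm (Y - \<Theta>))\<^sup>2) + ennreal (gauss v (Y - \<Theta>))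
      = ennreal k * ennreal (gauss v (Y - \<Theta>)) + ennreal (1 / (2 * \<sigma>)) * ennreal (gauss v (Y - \<Theta>) * (norm (Y - c))\<^sup>2)
        + ennreal (gauss \<sigma> (Y - c))" for Y
  proof -
    let ?g = "gauss v (Y - \<Theta>)" and ?h = "gauss \<sigma> (Y - c)"
    have g: "0 < ?g" "0 < ?h" using v s by (auto intro: gauss_pos)
    have lq: "ln (?g / ?h) = k - (norm (Y - \<Theta>))\<^sup>2 / (2 * v) + (norm (Y - c))\<^sup>2 / (2 * \<sigma>)"
      using g v s by (simp add: ln_div lng k_def ln_mult algebra_simps add_divide_distrib diff_divide_distrib)
    have "?g * ln (?g / ?h) - ?g + ?h + 1 / (2 * v) * (?g * (norm (Y - \<Theta>))\<^sup>2) + ?g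
        = k * ?g + 1 / (2 * \<sigma>) * (?g * (norm (Y - c))\<^sup>2) + ?h"
      unfolding lq by (simp add: algebra_simps)
    moreover have "0 \<le> ?g * ln (?g / ?h) - ?g + ?h" by (rule kl_real_nonneg[OF g])
    moreover have "?K Y + ennreal (1 / (2 * v)) * ennreal (?g * (norm (Y - \<Theta>))\<^sup>2) + ennreal ?g
        = ennreal (?g * ln (?g / ?h) - ?g + ?h + 1 / (2 * v) * (?g * (norm (Y - \<Theta>))\<^sup>2) + ?g)"
      using g v kl_real_nonneg[OF g]
      by (simp add: kl_def ennreal_mult[symmetric] ennreal_plus[symmetric] del: ennreal_plus)
    moreover have "ennreal k * ennreal ?g + ennreal (1 / (2 * \<sigma>)) * ennreal (?g * (norm (Y - c))\<^sup>2) + ennreal ?h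
        = ennreal (k * ?g + 1 / (2 * \<sigma>) * (?g * (norm (Y - c))\<^sup>2) + ?h)"
      using g k s by (simp add: ennreal_mult[symmetric] ennreal_plus[symmetric] del: ennreal_plus)
    ultimately show ?thesis by (simp only:)
  qed
  let ?I = "\<integral>\<^sup>+Y. ?K Y \<partial>lborel"
  have "?I + ennreal (1 / (2 * v)) * ennreal (?D * v + (norm (\<Theta> - \<Theta>))\<^sup>2) + 1
      = (\<integral>\<^sup>+Y. ?K Y + ennreal (1 / (2 * v)) * ennreal (gauss v (Y - \<Theta>) * (norm (Y - \<Theta>))\<^sup>2) + ennreal (gauss v (Y - \<Theta>)) \<partial>lborel)"
    by (simp add: nn_integral_add nn_integral_cmult nn_integral_gauss_shifted_square[OF v] nn_integral_gauss_diff[OF v] del: diff_self)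
  also have "\<dots> = (\<integral>\<^sup>+Y. ennreal k * ennreal (gauss v (Y - \<Theta>)) + ennreal (1 / (2 * \<sigma>)) * ennreal (gauss v (Y - \<Theta>) * (norm (Y - c))\<^sup>2)
        + ennreal (gauss \<sigma> (Y - c)) \<partial>lborel)" by (simp only: pt)
  also have "\<dots> = ennreal k + ennreal (1 / (2 * \<sigma>)) * ennreal (?D * v + (norm (\<Theta> - c))\<^sup>2) + 1"
    by (simp add: nn_integral_add nn_integral_cmult nn_integral_gauss_shifted_square[OF v] nn_integral_gauss_diff[OF v] nn_integral_gauss_diff[OF s])
  finally have "?I + ennreal (1 / (2 * v)) * ennreal (?D * v + (norm (\<Theta> - \<Theta>))\<^sup>2)
      = ennreal k + ennreal (1 / (2 * \<sigma>)) * ennreal (?D * v + (norm (\<Theta> - c))\<^sup>2)"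
    by (rule ennreal_add_right_cancel) simp
  moreover have "ennreal (1 / (2 * v)) * ennreal (?D * v + (norm (\<Theta> - \<Theta>))\<^sup>2) = ennreal (?D / 2)"
    using v by (simp add: ennreal_mult[symmetric])
  ultimately show ?thesis by (simp add: k_def)
qed

text \<open>The mean over X of the previous formula at c = s X. Since \<Theta> - s X is - s times X
  - \<Theta> / s, the second moment around \<Theta> / s is all that is required. The value s = 1
  belongs to the uniform prior and s < 1 to the normal priors in the lower bound.\<close>

lemma kl_risk_gauss:
  fixes \<Theta> :: "'a::euclidean_space"
  assumes vx: "0 < v\<^sub>x" and vy: "0 < v\<^sub>y" and \<sigma>: "v\<^sub>y \<le> \<sigma>" and s: "s \<noteq> 0"
  shows "kl_risk v\<^sub>x v\<^sub>y \<Theta> (\<lambda>X Y. gauss \<sigma> (Y - s *\<^sub>R X)) + ennreal (real DIM('a) / 2)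
    = ennreal (real DIM('a) / 2 * ln (\<sigma> / v\<^sub>y)) + ennreal (1 / (2 * \<sigma>)) *
       ennreal (real DIM('a) * v\<^sub>y + s\<^sup>2 * (real DIM('a) * v\<^sub>x) + (1 - s)\<^sup>2 * (norm \<Theta>)\<^sup>2)"
proof -
  let ?D = "real DIM('a)"
  define k where "k = ?D / 2 * ln (\<sigma> / v\<^sub>y)"
  have [measurable]: "(\<lambda>X. \<integral>\<^sup>+Y. kl (gauss v\<^sub>y (Y - \<Theta>)) (gauss \<sigma> (Y - s *\<^sub>R X)) \<partial>lborel) \<in> borel_measurable borel"
    by measurable
  have sq: "(norm (\<Theta> - s *\<^sub>R X))\<^sup>2 = s\<^sup>2 * (norm (X - (1 / s) *\<^sub>R \<Theta>))\<^sup>2" for X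
  proof -
    have "\<Theta> - s *\<^sub>R X = (- s) *\<^sub>R (X - (1 / s) *\<^sub>R \<Theta>)" using s by (simp add: scaleR_diff_right)
    then show ?thesis by (simp only: norm_scaleR power_mult_distrib) simp
  qed
  have e: "(norm (\<Theta> - (1 / s) *\<^sub>R \<Theta>))\<^sup>2 * s\<^sup>2 = (1 - s)\<^sup>2 * (norm \<Theta>)\<^sup>2"
  proof -
    have "s *\<^sub>R (\<Theta> - (1 / s) *\<^sub>R \<Theta>) = (s - 1) *\<^sub>R \<Theta>" using s by (simp add: algebra_simps)
    then have "(norm (s *\<^sub>R (\<Theta> - (1 / s) *\<^sub>R \<Theta>)))\<^sup>2 = (norm ((s - 1) *\<^sub>R \<Theta>))\<^sup>2" by simp
    then show ?thesis by (simp only: norm_scaleR power_mult_distrib power2_abs) (simp add: power2_commute[of s 1] mult.commute)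
  qed
  have "kl_risk v\<^sub>x v\<^sub>y \<Theta> (\<lambda>X Y. gauss \<sigma> (Y - s *\<^sub>R X)) + ennreal (?D / 2)
      = (\<integral>\<^sup>+X. ennreal (gauss v\<^sub>x (X - \<Theta>)) * ((\<integral>\<^sup>+Y. kl (gauss v\<^sub>y (Y - \<Theta>)) (gauss \<sigma> (Y - s *\<^sub>R X)) \<partial>lborel) + ennreal (?D / 2)) \<partial>lborel)"
    unfolding kl_risk_def distrib_left
    by (subst nn_integral_add) (auto simp: nn_integral_multc nn_integral_gauss_diff[OF vx])
  also have "\<dots> = (\<integral>\<^sup>+X. ennreal (k + ?D * v\<^sub>y / (2 * \<sigma>)) * ennreal (gauss v\<^sub>x (X - \<Theta>))
        + ennreal (s\<^sup>2 / (2 * \<sigma>)) * ennreal (gauss v\<^sub>x (X - \<Theta>) * (norm (X - (1 / s) *\<^sub>R \<Theta>))\<^sup>2) \<partial>lborel)"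
  proof (rule nn_integral_cong)
    fix X
    have k: "0 \<le> k" using vy \<sigma> by (simp add: k_def)
    have "gauss v\<^sub>x (X - \<Theta>) * (k + 1 / (2 * \<sigma>) * (?D * v\<^sub>y + s\<^sup>2 * (norm (X - (1 / s) *\<^sub>R \<Theta>))\<^sup>2))
      = (k + ?D * v\<^sub>y / (2 * \<sigma>)) * gauss v\<^sub>x (X - \<Theta>) + s\<^sup>2 / (2 * \<sigma>) * (gauss v\<^sub>x (X - \<Theta>) * (norm (X - (1 / s) *\<^sub>R \<Theta>))\<^sup>2)"
      by (simp add: distrib_left distrib_right mult_ac)
    then show "ennreal (gauss v\<^sub>x (X - \<Theta>)) * ((\<integral>\<^sup>+Y. kl (gauss v\<^sub>y (Y - \<Theta>)) (gauss \<sigma> (Y - s *\<^sub>R X)) \<partial>lborel) + ennreal (?D / 2))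
      = ennreal (k + ?D * v\<^sub>y / (2 * \<sigma>)) * ennreal (gauss v\<^sub>x (X - \<Theta>))
        + ennreal (s\<^sup>2 / (2 * \<sigma>)) * ennreal (gauss v\<^sub>x (X - \<Theta>) * (norm (X - (1 / s) *\<^sub>R \<Theta>))\<^sup>2)"
      unfolding gauss_kl_integral[OF vy \<sigma>] sq k_def[symmetric]
      using k vy \<sigma> by (simp add: ennreal_mult[symmetric] ennreal_plus[symmetric] del: ennreal_plus)
  qed
  also have "\<dots> = ennreal (k + ?D * v\<^sub>y / (2 * \<sigma>)) + ennreal (s\<^sup>2 / (2 * \<sigma>)) * ennreal (?D * v\<^sub>x + (norm (\<Theta> - (1 / s) *\<^sub>R \<Theta>))\<^sup>2)"
    by (simp add: nn_integral_add nn_integral_cmult nn_integral_gauss_shifted_square[OF vx] nn_integral_gauss_diff[OF vx])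
  also have "\<dots> = ennreal k + ennreal (1 / (2 * \<sigma>)) * ennreal (?D * v\<^sub>y + s\<^sup>2 * (?D * v\<^sub>x) + (1 - s)\<^sup>2 * (norm \<Theta>)\<^sup>2)"
  proof -
    have "0 \<le> k" using vy \<sigma> by (simp add: k_def)
    moreover have "k + ?D * v\<^sub>y / (2 * \<sigma>) + s\<^sup>2 / (2 * \<sigma>) * (?D * v\<^sub>x + (norm (\<Theta> - (1 / s) *\<^sub>R \<Theta>))\<^sup>2)
      = k + 1 / (2 * \<sigma>) * (?D * v\<^sub>y + s\<^sup>2 * (?D * v\<^sub>x) + (1 - s)\<^sup>2 * (norm \<Theta>)\<^sup>2)"
      unfolding e[symmetric] by (simp add: distrib_left add_divide_distrib mult_ac)
    ultimately show ?thesis using vx vy \<sigma>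
      by (simp add: ennreal_mult[symmetric] ennreal_plus[symmetric] del: ennreal_plus)
  qed
  finally show ?thesis by (simp add: k_def)
qed

lemma kl_risk_uniform_prior:
  fixes \<Theta> :: "'a::euclidean_space"
  assumes vx: "0 < v\<^sub>x" and vy: "0 < v\<^sub>y"
  shows "kl_risk v\<^sub>x v\<^sub>y \<Theta> (\<lambda>X Y. gauss (v\<^sub>x + v\<^sub>y) (Y - X)) = ennreal (real DIM('a) / 2 * ln ((v\<^sub>x + v\<^sub>y) / v\<^sub>y))"
proof -
  have "ennreal (1 / (2 * (v\<^sub>x + v\<^sub>y))) * ennreal (real DIM('a) * v\<^sub>y + 1\<^sup>2 * (real DIM('a) * v\<^sub>x) + (1 - 1)\<^sup>2 * (norm \<Theta>)\<^sup>2)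
      = ennreal (real DIM('a) / 2)"
  proof -
    define V where "V = v\<^sub>x + v\<^sub>y"
    have V: "0 < V" using vx vy by (simp add: V_def)
    have "real DIM('a) * v\<^sub>y + 1\<^sup>2 * (real DIM('a) * v\<^sub>x) + (1 - 1)\<^sup>2 * (norm \<Theta>)\<^sup>2 = real DIM('a) * V"
      by (simp add: V_def distrib_left)
    then show ?thesis unfolding V_def[symmetric] using V
      by (simp only: ennreal_mult[symmetric, of "1 / (2 * V)" "real DIM('a) * V"]) (subst ennreal_mult[symmetric], auto)
  qed
  then have "kl_risk v\<^sub>x v\<^sub>y \<Theta> (\<lambda>X Y. gauss (v\<^sub>x + v\<^sub>y) (Y - 1 *\<^sub>R X)) + ennreal (real DIM('a) / 2)
    = ennreal (real DIM('a) / 2 * ln ((v\<^sub>x + v\<^sub>y) / v\<^sub>y)) + ennreal (real DIM('a) / 2)"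
    using kl_risk_gauss[OF vx vy, of "v\<^sub>x + v\<^sub>y" 1 \<Theta>] vx by simp
  from ennreal_add_right_cancel[OF this] show ?thesis by simp
qed

lemma measurable_kl_risk [measurable]:
  fixes p :: "real^'q^'r \<Rightarrow> real^'q^'r \<Rightarrow> real"
  assumes p: "predictive_density p"
  shows "(\<lambda>\<Theta>. kl_risk v\<^sub>x v\<^sub>y \<Theta> p) \<in> borel_measurable borel"
proof -
  note [measurable (raw)] = predictive_densityD(1)[OF p]
  show ?thesis unfolding kl_risk_def by measurable
qed

text \<open>The priors N(0, \<tau> I) are asymptotically least favourable: the supremum of a risk is
  at least its average under the prior, hence at least the Bayes risk D / 2 ln (\<sigma> /
  \<open>v\<^sub>y\<close>), and \<sigma> tends to \<open>v\<^sub>x + v\<^sub>y\<close> as \<tau>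
  grows.\<close>

theorem minimax_lower_bound:
  fixes p' :: "real^'q^'r \<Rightarrow> real^'q^'r \<Rightarrow> real"
  assumes vx: "0 < v\<^sub>x" and vy: "0 < v\<^sub>y" and p': "predictive_density p'"
  shows "ennreal (real DIM(real^'q^'r) / 2 * ln ((v\<^sub>x + v\<^sub>y) / v\<^sub>y)) \<le> (SUP \<Theta>. kl_risk v\<^sub>x v\<^sub>y \<Theta> p')"
proof -
  let ?D = "real DIM(real^'q^'r)" and ?S = "SUP \<Theta>. kl_risk v\<^sub>x v\<^sub>y \<Theta> p'"
  have main: "ennreal (?D / 2 * ln ((v\<^sub>y + \<tau> / (\<tau> + v\<^sub>x) * v\<^sub>x) / v\<^sub>y)) \<le> ?S" if \<tau>: "0 < \<tau>" for \<tau>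
  proof -
    \<comment> \<open>The shrinkage factor: given X, the posterior is N(s X, s
      \<open>v\<^sub>x\<close> I), and the Bayesian predictive density is N(s X, \<sigma>
      I).\<close>
    define s where "s = \<tau> / (\<tau> + v\<^sub>x)"
    have s: "0 < s" using \<tau> vx by (simp add: s_def)
    define \<sigma> where "\<sigma> = v\<^sub>y + s * v\<^sub>x"
    have \<sigma>: "v\<^sub>y \<le> \<sigma>" "0 < \<sigma>" using s vx vy by (auto simp: \<sigma>_def add_pos_pos)
    let ?p = "\<lambda>X Y :: real^'q^'r. gauss \<sigma> (Y - s *\<^sub>R X)" and ?\<pi> = "\<lambda>\<Theta> :: real^'q^'r. ennreal (gauss \<tau> \<Theta>)"
    have p: "predictive_density ?p"
      unfolding predictive_density_def using \<sigma> by (auto simp: nn_integral_gauss_diff)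
    have f: "gauss v\<^sub>x (X - \<Theta>) * gauss \<tau> \<Theta> = gauss (v\<^sub>x + \<tau>) X * gauss (s * v\<^sub>x) (\<Theta> - s *\<^sub>R X)" for X \<Theta> :: "real^'q^'r"
      using gauss_mult[OF vx \<tau>, of X \<Theta> 0] by (simp add: s_def mult.commute add.commute)
    have m: "(\<integral>\<^sup>+\<Theta>. ennreal (gauss v\<^sub>x (X - \<Theta>)) * ?\<pi> \<Theta> \<partial>lborel) = ennreal (gauss (v\<^sub>x + \<tau>) X)" for X
      using s vx by (simp add: ennreal_mult[symmetric] f) (simp add: ennreal_mult nn_integral_cmult nn_integral_gauss_diff)
    have j: "(\<integral>\<^sup>+\<Theta>. ennreal (gauss v\<^sub>x (X - \<Theta>)) * ennreal (gauss v\<^sub>y (Y - \<Theta>)) * ?\<pi> \<Theta> \<partial>lborel)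
        = (\<integral>\<^sup>+\<Theta>. ennreal (gauss v\<^sub>x (X - \<Theta>)) * ?\<pi> \<Theta> \<partial>lborel) * ennreal (?p X Y)" for X Y
    proof -
      have "ennreal (gauss v\<^sub>x (X - \<Theta>)) * ennreal (gauss v\<^sub>y (Y - \<Theta>)) * ?\<pi> \<Theta>
        = ennreal (gauss (v\<^sub>x + \<tau>) X) * (ennreal (gauss v\<^sub>y (Y - \<Theta>)) * ennreal (gauss (s * v\<^sub>x) (\<Theta> - s *\<^sub>R X)))" for \<Theta>
        using arg_cong[OF f[of X \<Theta>], of "\<lambda>z. ennreal (z * gauss v\<^sub>y (Y - \<Theta>))"] by (simp add: ennreal_mult mult_ac)
      then show ?thesis unfolding m using s vx vy by (simp add: nn_integral_cmult gauss_convolution \<sigma>_def)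
    qed
    have "(\<integral>\<^sup>+\<Theta>. ?\<pi> \<Theta> * kl_risk v\<^sub>x v\<^sub>y \<Theta> ?p \<partial>lborel) + ennreal (?D / 2)
        = (\<integral>\<^sup>+\<Theta>. ?\<pi> \<Theta> * (kl_risk v\<^sub>x v\<^sub>y \<Theta> ?p + ennreal (?D / 2)) \<partial>lborel)"
      unfolding distrib_left using \<tau> p by (simp add: nn_integral_add nn_integral_multc nn_integral_gauss)
    also have "\<dots> = (\<integral>\<^sup>+\<Theta>. ennreal (?D / 2 * ln (\<sigma> / v\<^sub>y) + 1 / (2 * \<sigma>) * (?D * v\<^sub>y + s\<^sup>2 * (?D * v\<^sub>x))) * ?\<pi> \<Theta>
        + ennreal ((1 - s)\<^sup>2 / (2 * \<sigma>)) * ennreal (gauss \<tau> \<Theta> * (norm \<Theta>)\<^sup>2) \<partial>lborel)"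
    proof (rule nn_integral_cong)
      fix \<Theta> :: "real^'q^'r"
      define k where "k = ?D / 2 * ln (\<sigma> / v\<^sub>y)"
      have k: "0 \<le> k" using vy \<sigma> by (simp add: k_def)
      have "kl_risk v\<^sub>x v\<^sub>y \<Theta> ?p + ennreal (?D / 2) = ennreal k + ennreal (1 / (2 * \<sigma>)) *
         ennreal (?D * v\<^sub>y + s\<^sup>2 * (?D * v\<^sub>x) + (1 - s)\<^sup>2 * (norm \<Theta>)\<^sup>2)"
        unfolding k_def using s by (intro kl_risk_gauss vx vy \<sigma>) auto
      also have "\<dots> = ennreal (k + 1 / (2 * \<sigma>) * (?D * v\<^sub>y + s\<^sup>2 * (?D * v\<^sub>x) + (1 - s)\<^sup>2 * (norm \<Theta>)\<^sup>2))"
        using k vx vy \<sigma> by (simp add: ennreal_mult[symmetric] ennreal_plus[symmetric] del: ennreal_plus)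
      finally have "?\<pi> \<Theta> * (kl_risk v\<^sub>x v\<^sub>y \<Theta> ?p + ennreal (?D / 2))
        = ennreal (gauss \<tau> \<Theta> * (k + 1 / (2 * \<sigma>) * (?D * v\<^sub>y + s\<^sup>2 * (?D * v\<^sub>x) + (1 - s)\<^sup>2 * (norm \<Theta>)\<^sup>2)))"
        using k vx vy \<sigma> by (subst ennreal_mult) auto
      also have "gauss \<tau> \<Theta> * (k + 1 / (2 * \<sigma>) * (?D * v\<^sub>y + s\<^sup>2 * (?D * v\<^sub>x) + (1 - s)\<^sup>2 * (norm \<Theta>)\<^sup>2))
        = (k + 1 / (2 * \<sigma>) * (?D * v\<^sub>y + s\<^sup>2 * (?D * v\<^sub>x))) * gauss \<tau> \<Theta> + (1 - s)\<^sup>2 / (2 * \<sigma>) * (gauss \<tau> \<Theta> * (norm \<Theta>)\<^sup>2)"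
        by (simp add: distrib_left distrib_right add_divide_distrib mult_ac)
      finally show "?\<pi> \<Theta> * (kl_risk v\<^sub>x v\<^sub>y \<Theta> ?p + ennreal (?D / 2))
        = ennreal (?D / 2 * ln (\<sigma> / v\<^sub>y) + 1 / (2 * \<sigma>) * (?D * v\<^sub>y + s\<^sup>2 * (?D * v\<^sub>x))) * ?\<pi> \<Theta>
        + ennreal ((1 - s)\<^sup>2 / (2 * \<sigma>)) * ennreal (gauss \<tau> \<Theta> * (norm \<Theta>)\<^sup>2)"
        unfolding k_def[symmetric]
        using k vx vy \<sigma> by (simp add: ennreal_mult[symmetric] ennreal_plus[symmetric] del: ennreal_plus)
    qed
    also have "\<dots> = ennreal (?D / 2 * ln (\<sigma> / v\<^sub>y) + 1 / (2 * \<sigma>) * (?D * v\<^sub>y + s\<^sup>2 * (?D * v\<^sub>x)))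
        + ennreal ((1 - s)\<^sup>2 / (2 * \<sigma>)) * ennreal (?D * \<tau>)"
      using \<tau> by (simp add: nn_integral_add nn_integral_cmult nn_integral_gauss nn_integral_gauss_norm_square)
    also have "\<dots> = ennreal (?D / 2 * ln (\<sigma> / v\<^sub>y)) + ennreal (?D / 2)"
    proof -
      \<comment> \<open>By this identity the variance of Y, the variance of s X and the averaged
        squared bias add up to \<sigma>, so the quadratic terms of the Bayes risk collapse to D /
        2.\<close>
      have "s * v\<^sub>x = (1 - s) * \<tau>" using \<tau> vx by (simp add: s_def field_simps)
      then have "s\<^sup>2 * v\<^sub>x + (1 - s)\<^sup>2 * \<tau> = s * ((1 - s) * \<tau>) + (1 - s) * ((1 - s) * \<tau>)"
        by (simp add: power2_eq_square mult.assoc)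
      also have "\<dots> = s * v\<^sub>x" by (simp add: \<open>s * v\<^sub>x = (1 - s) * \<tau>\<close> algebra_simps)
      finally have "v\<^sub>y + s\<^sup>2 * v\<^sub>x + (1 - s)\<^sup>2 * \<tau> = \<sigma>" by (simp add: \<sigma>_def)
      moreover have "1 / (2 * \<sigma>) * (?D * v\<^sub>y + s\<^sup>2 * (?D * v\<^sub>x)) + (1 - s)\<^sup>2 / (2 * \<sigma>) * (?D * \<tau>)
        = ?D / (2 * \<sigma>) * (v\<^sub>y + s\<^sup>2 * v\<^sub>x + (1 - s)\<^sup>2 * \<tau>)" by (simp add: distrib_left add_divide_distrib mult_ac)
      ultimately have "1 / (2 * \<sigma>) * (?D * v\<^sub>y + s\<^sup>2 * (?D * v\<^sub>x)) + (1 - s)\<^sup>2 / (2 * \<sigma>) * (?D * \<tau>) = ?D / 2"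
        using \<sigma> by simp
      then show ?thesis using \<sigma> vx vy \<tau>
        by (simp add: ennreal_mult[symmetric] ennreal_plus[symmetric] add.assoc del: ennreal_plus)
    qed
    finally have "(\<integral>\<^sup>+\<Theta>. ?\<pi> \<Theta> * kl_risk v\<^sub>x v\<^sub>y \<Theta> ?p \<partial>lborel) = ennreal (?D / 2 * ln (\<sigma> / v\<^sub>y))"
      by (rule ennreal_add_right_cancel) simp
    then have "ennreal (?D / 2 * ln (\<sigma> / v\<^sub>y)) \<le> (\<integral>\<^sup>+\<Theta>. ?\<pi> \<Theta> * kl_risk v\<^sub>x v\<^sub>y \<Theta> p' \<partial>lborel)"
      using bayes_risk_decomposition[OF vx vy _ _ p _ j p'] \<tau> \<sigma> by (simp add: nn_integral_gauss gauss_pos)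
    also have "\<dots> \<le> (\<integral>\<^sup>+\<Theta>. ?\<pi> \<Theta> * ?S \<partial>lborel)"
      by (intro nn_integral_mono mult_left_mono SUP_upper) auto
    also have "\<dots> = ?S" using \<tau> by (simp add: nn_integral_multc nn_integral_gauss)
    finally show ?thesis by (simp add: \<sigma>_def s_def)
  qed
  have "((\<lambda>\<tau>. 1 - v\<^sub>x / (v\<^sub>x + \<tau>)) \<longlongrightarrow> 1 - 0) at_top"
    by (intro tendsto_intros tendsto_divide_0[OF tendsto_const] filterlim_at_top_imp_at_infinity
        filterlim_tendsto_add_at_top[OF tendsto_const] filterlim_ident)
  then have l1: "((\<lambda>\<tau>. 1 - v\<^sub>x / (v\<^sub>x + \<tau>)) \<longlongrightarrow> 1) at_top" by simp
  have ev: "\<forall>\<^sub>F \<tau> in at_top. 1 - v\<^sub>x / (v\<^sub>x + \<tau>) = \<tau> / (\<tau> + v\<^sub>x)"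
    using eventually_gt_at_top[of 0] by eventually_elim (use vx in \<open>simp add: field_simps\<close>)
  have "((\<lambda>\<tau>. \<tau> / (\<tau> + v\<^sub>x)) \<longlongrightarrow> 1) at_top" by (rule Lim_transform_eventually[OF l1 ev])
  then have "((\<lambda>\<tau>. ennreal (?D / 2 * ln ((v\<^sub>y + \<tau> / (\<tau> + v\<^sub>x) * v\<^sub>x) / v\<^sub>y)))
      \<longlongrightarrow> ennreal (?D / 2 * ln ((v\<^sub>y + 1 * v\<^sub>x) / v\<^sub>y))) at_top"
    using vx vy by (intro tendsto_intros) auto
  then have "ennreal (?D / 2 * ln ((v\<^sub>y + 1 * v\<^sub>x) / v\<^sub>y)) \<le> ?S"
  proof (rule tendsto_upperbound)
    show "\<forall>\<^sub>F \<tau> in at_top. ennreal (?D / 2 * ln ((v\<^sub>y + \<tau> / (\<tau> + v\<^sub>x) * v\<^sub>x) / v\<^sub>y)) \<le> ?S"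
      using eventually_gt_at_top[of 0] by eventually_elim (rule main)
  qed simp
  then show ?thesis by (simp add: add.commute)
qed

text \<open>The constant risk of the uniform prior is a lower bound for every maximal risk; a
  density whose risk never exceeds it attains the infimum.\<close>

theorem minimax_if_bounded_by_uniform_prior:
  fixes p :: "real^'q^'r \<Rightarrow> real^'q^'r \<Rightarrow> real"
  assumes vx: "0 < v\<^sub>x" and vy: "0 < v\<^sub>y" and p: "predictive_density p"
    and bound: "\<And>\<Theta>. kl_risk v\<^sub>x v\<^sub>y \<Theta> p \<le> ennreal (real DIM(real^'q^'r) / 2 * ln ((v\<^sub>x + v\<^sub>y) / v\<^sub>y))"
  shows "KL_minimax v\<^sub>x v\<^sub>y p"
proof -
  let ?R = "ennreal (real DIM(real^'q^'r) / 2 * ln ((v\<^sub>x + v\<^sub>y) / v\<^sub>y))"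
  have le: "(SUP \<Theta>. KL_risk v\<^sub>x v\<^sub>y \<Theta> p) \<le> enn2ereal ?R"
    by (intro SUP_least) (use bound in \<open>simp add: KL_risk_eq_kl_risk[OF vy p] less_eq_ennreal.rep_eq\<close>)
  have ge: "enn2ereal ?R \<le> (SUP \<Theta>. KL_risk v\<^sub>x v\<^sub>y \<Theta> p')" if p': "predictive_density p'"
    for p' :: "real^'q^'r \<Rightarrow> real^'q^'r \<Rightarrow> real"
  proof -
    have "enn2ereal ?R \<le> enn2ereal (SUP \<Theta>. kl_risk v\<^sub>x v\<^sub>y \<Theta> p')"
      using minimax_lower_bound[OF vx vy p'] by (simp add: less_eq_ennreal.rep_eq)
    also have "\<dots> \<le> (SUP \<Theta>. KL_risk v\<^sub>x v\<^sub>y \<Theta> p')"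
    proof -
      let ?S = "SUP \<Theta>. KL_risk v\<^sub>x v\<^sub>y \<Theta> p'"
      have nn: "0 \<le> ?S" by (rule SUP_upper2[of 0]) (auto simp: KL_risk_eq_kl_risk[OF vy p'])
      have "(SUP \<Theta>. kl_risk v\<^sub>x v\<^sub>y \<Theta> p') \<le> e2ennreal ?S"
      proof (rule SUP_least)
        fix \<Theta>
        have "enn2ereal (kl_risk v\<^sub>x v\<^sub>y \<Theta> p') \<le> ?S"
          unfolding KL_risk_eq_kl_risk[OF vy p', symmetric] by (rule SUP_upper) simp
        then show "kl_risk v\<^sub>x v\<^sub>y \<Theta> p' \<le> e2ennreal ?S"
          using nn by (simp add: less_eq_ennreal.rep_eq enn2ereal_e2ennreal)
      qed
      then show ?thesis using nn by (simp add: less_eq_ennreal.rep_eq enn2ereal_e2ennreal)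
    qed
    finally show ?thesis .
  qed
  have "(SUP \<Theta>. KL_risk v\<^sub>x v\<^sub>y \<Theta> p) =
       (INF p'\<in>{p' :: real^'q^'r \<Rightarrow> real^'q^'r \<Rightarrow> real. predictive_density p'}. SUP \<Theta>. KL_risk v\<^sub>x v\<^sub>y \<Theta> p')"
  proof (rule antisym)
    show "(SUP \<Theta>. KL_risk v\<^sub>x v\<^sub>y \<Theta> p) \<le>
       (INF p'\<in>{p' :: real^'q^'r \<Rightarrow> real^'q^'r \<Rightarrow> real. predictive_density p'}. SUP \<Theta>. KL_risk v\<^sub>x v\<^sub>y \<Theta> p')"
      by (intro INF_greatest order_trans[OF le] ge) auto
    show "(INF p'\<in>{p' :: real^'q^'r \<Rightarrow> real^'q^'r \<Rightarrow> real. predictive_density p'}. SUP \<Theta>. KL_risk v\<^sub>x v\<^sub>y \<Theta> p')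
      \<le> (SUP \<Theta>. KL_risk v\<^sub>x v\<^sub>y \<Theta> p)"
      by (rule INF_lower) (simp add: p)
  qed
  with p show ?thesis by (simp add: KL_minimax_def)
qed

section \<open>Changes of variables on product spaces\<close>

abbreviation lborel_Pi :: "'i set \<Rightarrow> ('i \<Rightarrow> real) measure" where
  "lborel_Pi I \<equiv> Pi\<^sub>M I (\<lambda>_. lborel)"

interpretation lborel_product: product_sigma_finite "\<lambda>_. lborel :: real measure"
  by standard

lemma borel_measurable_lborel_Pi_component:
  "i \<in> I \<Longrightarrow> (\<lambda>f. f i) \<in> borel_measurable (lborel_Pi I)"
  using measurable_component_singleton[of i I "\<lambda>_. lborel :: real measure"] by simp

lemma measurable_lborel_Pi_fun_upd:
  assumes "p \<in> I" "g \<in> N \<rightarrow>\<^sub>M lborel_Pi I" "h \<in> borel_measurable N"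
  shows "(\<lambda>x. (g x)(p := h x)) \<in> N \<rightarrow>\<^sub>M lborel_Pi I"
  using assms by (intro measurable_fun_upd[where J = I]) auto

text \<open>Integration over the coordinate p comes first; for fixed other coordinates \<alpha> and
  \<gamma> are constants and the substitution is one-dimensional.\<close>

lemma nn_integral_affine_coordinate:
  fixes \<alpha> \<gamma> :: "('i \<Rightarrow> real) \<Rightarrow> real"
  assumes I: "finite I" "p \<in> I"
    and [measurable]: "\<alpha> \<in> borel_measurable (lborel_Pi I)" "\<gamma> \<in> borel_measurable (lborel_Pi I)"
    and indep: "\<And>f x. \<alpha> (f(p := x)) = \<alpha> f" "\<And>f x. \<gamma> (f(p := x)) = \<gamma> f"
    and nz: "\<And>f. \<alpha> f \<noteq> 0"
    and F[measurable]: "F \<in> borel_measurable (lborel_Pi I)"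
  shows "(\<integral>\<^sup>+f. ennreal \<bar>\<alpha> f\<bar> * F (f(p := \<alpha> f * f p + \<gamma> f)) \<partial>lborel_Pi I) = (\<integral>\<^sup>+f. F f \<partial>lborel_Pi I)"
proof -
  define J where "J = I - {p}"
  have J: "finite J" "p \<notin> J" and IJ: "I = insert p J" using I by (auto simp: J_def)
  note [measurable] = borel_measurable_lborel_Pi_component[OF I(2)]
  have [measurable]: "(\<lambda>f. f(p := \<alpha> f * f p + \<gamma> f)) \<in> lborel_Pi I \<rightarrow>\<^sub>M lborel_Pi I"
    by (intro measurable_lborel_Pi_fun_upd I) measurable
  let ?G = "\<lambda>f. ennreal \<bar>\<alpha> f\<bar> * F (f(p := \<alpha> f * f p + \<gamma> f))"
  have G: "?G \<in> borel_measurable (lborel_Pi (insert p J))" unfolding IJ[symmetric] by measurable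
  have F': "F \<in> borel_measurable (lborel_Pi (insert p J))" using F by (simp add: IJ)
  have "(\<integral>\<^sup>+f. ?G f \<partial>lborel_Pi I) = (\<integral>\<^sup>+f. (\<integral>\<^sup>+y. ?G (f(p := y)) \<partial>lborel) \<partial>lborel_Pi J)"
    unfolding IJ by (rule lborel_product.product_nn_integral_insert[OF J G])
  also have "\<dots> = (\<integral>\<^sup>+f. (\<integral>\<^sup>+y. F (f(p := y)) \<partial>lborel) \<partial>lborel_Pi J)"
  proof (rule nn_integral_cong)
    fix f assume f: "f \<in> space (lborel_Pi J)"
    define g where "g y = F (f(p := y))" for y
    have gm: "g \<in> borel_measurable borel"
    proof -
      have "(\<lambda>y. f(p := y)) \<in> borel \<rightarrow>\<^sub>M lborel_Pi I"
        by (rule measurable_fun_upd[where J = J, OF _ measurable_const[OF f]]) (auto simp: IJ)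
      from measurable_compose[OF this F] show ?thesis by (simp add: g_def[abs_def])
    qed
    have "(\<integral>\<^sup>+y. ?G (f(p := y)) \<partial>lborel) = (\<integral>\<^sup>+y. ennreal \<bar>\<alpha> f\<bar> * g (\<gamma> f + \<alpha> f * y) \<partial>lborel)"
      by (simp add: indep add.commute g_def)
    also have "\<dots> = ennreal \<bar>\<alpha> f\<bar> * (\<integral>\<^sup>+y. g (\<gamma> f + \<alpha> f * y) \<partial>lborel)"
    proof -
      have "(\<lambda>y. g (d + c * y)) \<in> borel_measurable lborel" for c d
        by (rule measurable_compose[OF _ gm]) simp
      then show ?thesis by (rule nn_integral_cmult)
    qed
    also have "\<dots> = (\<integral>\<^sup>+y. F (f(p := y)) \<partial>lborel)"
      using nn_integral_real_affine[OF gm, of "\<alpha> f" "\<gamma> f"] nz by (simp add: g_def)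
    finally show "(\<integral>\<^sup>+y. ?G (f(p := y)) \<partial>lborel) = (\<integral>\<^sup>+y. F (f(p := y)) \<partial>lborel)" .
  qed
  also have "\<dots> = (\<integral>\<^sup>+f. F f \<partial>lborel_Pi I)"
    unfolding IJ by (rule lborel_product.product_nn_integral_insert[OF J F', symmetric])
  finally show ?thesis .
qed

text \<open>A triangular substitution: the coefficients depend only on coordinates outside C, so
  changing the coordinates in C one after another leaves them intact and the factors
  multiply.\<close>

lemma nn_integral_affine_block:
  fixes \<alpha> \<gamma> :: "'i \<Rightarrow> ('i \<Rightarrow> real) \<Rightarrow> real"
  assumes I: "finite I" "C \<subseteq> I"
    and meas: "\<And>p. p \<in> C \<Longrightarrow> \<alpha> p \<in> borel_measurable (lborel_Pi I)" "\<And>p. p \<in> C \<Longrightarrow> \<gamma> p \<in> borel_measurable (lborel_Pi I)"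
    and indep: "\<And>p f g. p \<in> C \<Longrightarrow> (\<And>i. i \<notin> C \<Longrightarrow> f i = g i) \<Longrightarrow> \<alpha> p f = \<alpha> p g"
      "\<And>p f g. p \<in> C \<Longrightarrow> (\<And>i. i \<notin> C \<Longrightarrow> f i = g i) \<Longrightarrow> \<gamma> p f = \<gamma> p g"
    and nz: "\<And>p f. p \<in> C \<Longrightarrow> \<alpha> p f \<noteq> 0"
    and F: "F \<in> borel_measurable (lborel_Pi I)"
  shows "(\<integral>\<^sup>+f. ennreal (\<Prod>p\<in>C. \<bar>\<alpha> p f\<bar>) * F (\<lambda>p. if p \<in> C then \<alpha> p f * f p + \<gamma> p f else f p) \<partial>lborel_Pi I)
    = (\<integral>\<^sup>+f. F f \<partial>lborel_Pi I)"
proof -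
  define T where "T B f = (\<lambda>p. if p \<in> B then \<alpha> p f * f p + \<gamma> p f else f p)" for B f
  have "finite C" using I finite_subset by blast
  have "B \<subseteq> C \<Longrightarrow> F \<in> borel_measurable (lborel_Pi I) \<Longrightarrow>
      (\<integral>\<^sup>+f. ennreal (\<Prod>p\<in>B. \<bar>\<alpha> p f\<bar>) * F (T B f) \<partial>lborel_Pi I) = (\<integral>\<^sup>+f. F f \<partial>lborel_Pi I)"
    if "finite B" for B F
    using that
  proof (induction B arbitrary: F)
    case empty
    then show ?case by (simp add: T_def)
  next
    case (insert p B)
    note [measurable] = insert.prems(2)
    have p: "p \<in> C" "p \<in> I" using insert I by auto
    have [measurable]: "\<alpha> p \<in> borel_measurable (lborel_Pi I)" "\<gamma> p \<in> borel_measurable (lborel_Pi I)"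
      using meas p by auto
    note [measurable] = borel_measurable_lborel_Pi_component[OF p(2)]
    have [measurable]: "(\<lambda>f. f(p := \<alpha> p f * f p + \<gamma> p f)) \<in> lborel_Pi I \<rightarrow>\<^sub>M lborel_Pi I"
      by (intro measurable_lborel_Pi_fun_upd p) measurable
    define G where "G f = ennreal \<bar>\<alpha> p f\<bar> * F (f(p := \<alpha> p f * f p + \<gamma> p f))" for f
    have [measurable]: "G \<in> borel_measurable (lborel_Pi I)" unfolding G_def by measurable
    have "(\<integral>\<^sup>+f. F f \<partial>lborel_Pi I) = (\<integral>\<^sup>+f. G f \<partial>lborel_Pi I)"
      unfolding G_def
    proof (rule nn_integral_affine_coordinate[symmetric])
      show "\<alpha> p (f(p := x)) = \<alpha> p f" for f x by (rule indep(1)) (use p in auto)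
      show "\<gamma> p (f(p := x)) = \<gamma> p f" for f x by (rule indep(2)) (use p in auto)
    qed (use p I nz in auto)
    also have "\<dots> = (\<integral>\<^sup>+f. ennreal (\<Prod>p\<in>B. \<bar>\<alpha> p f\<bar>) * G (T B f) \<partial>lborel_Pi I)"
      using insert by simp
    also have "\<dots> = (\<integral>\<^sup>+f. ennreal (\<Prod>p\<in>insert p B. \<bar>\<alpha> p f\<bar>) * F (T (insert p B) f) \<partial>lborel_Pi I)"
    proof (rule nn_integral_cong)
      fix f
      have a: "\<alpha> p (T B f) = \<alpha> p f" by (rule indep(1)) (use p insert in \<open>auto simp: T_def\<close>)
      have g: "\<gamma> p (T B f) = \<gamma> p f" by (rule indep(2)) (use p insert in \<open>auto simp: T_def\<close>)
      have "(T B f)(p := \<alpha> p f * T B f p + \<gamma> p f) = T (insert p B) f"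
        using insert by (auto simp: T_def fun_eq_iff)
      then have "G (T B f) = ennreal \<bar>\<alpha> p f\<bar> * F (T (insert p B) f)" by (simp add: G_def a g)
      then show "ennreal (\<Prod>p\<in>B. \<bar>\<alpha> p f\<bar>) * G (T B f) = ennreal (\<Prod>p\<in>insert p B. \<bar>\<alpha> p f\<bar>) * F (T (insert p B) f)"
        using insert by (simp add: ennreal_mult prod_nonneg mult_ac)
    qed
    finally show ?case by simp
  qed
  from this[OF \<open>finite C\<close> subset_refl F] show ?thesis by (simp add: T_def)
qed

text \<open>The image of the product measure under the permutation has the right value on every box,
  because the product over coordinates is only reordered.\<close>

lemma nn_integral_permute_coordinates:
  assumes I: "finite I" and \<sigma>: "bij_betw \<sigma> I I" and [measurable]: "F \<in> borel_measurable (lborel_Pi I)"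
  shows "(\<integral>\<^sup>+f. F (\<lambda>p\<in>I. f (\<sigma> p)) \<partial>lborel_Pi I) = (\<integral>\<^sup>+f. F f \<partial>lborel_Pi I)"
proof -
  have \<sigma>I: "\<sigma> p \<in> I" if "p \<in> I" for p using \<sigma> that by (auto simp: bij_betw_def)
  have m[measurable]: "(\<lambda>f. \<lambda>p\<in>I. f (\<sigma> p)) \<in> lborel_Pi I \<rightarrow>\<^sub>M lborel_Pi I"
    using \<sigma>I by (intro measurable_restrict measurable_component_singleton) auto
  have "distr (lborel_Pi I) (lborel_Pi I) (\<lambda>f. \<lambda>p\<in>I. f (\<sigma> p)) = lborel_Pi I"
  proof (rule lborel_product.PiM_eqI[OF I])
    fix A :: "'a \<Rightarrow> real set" assume A: "\<And>i. i \<in> I \<Longrightarrow> A i \<in> sets lborel"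
    define B where "B p = A (inv_into I \<sigma> p)" for p
    have inv: "inv_into I \<sigma> p \<in> I" "\<sigma> (inv_into I \<sigma> p) = p" if "p \<in> I" for p
      using \<sigma> that by (auto simp: bij_betw_def inv_into_into f_inv_into_f)
    have inv2: "inv_into I \<sigma> (\<sigma> p) = p" if "p \<in> I" for p using \<sigma> that by (auto simp: bij_betw_def)
    have B: "B p \<in> sets lborel" if "p \<in> I" for p unfolding B_def by (intro A inv that)
    have "Pi\<^sub>E I A \<in> sets (lborel_Pi I)" using A I by (intro sets_PiM_I_finite) auto
    then have "emeasure (distr (lborel_Pi I) (lborel_Pi I) (\<lambda>f. \<lambda>p\<in>I. f (\<sigma> p))) (Pi\<^sub>E I A)
      = emeasure (lborel_Pi I) ((\<lambda>f. \<lambda>p\<in>I. f (\<sigma> p)) -` Pi\<^sub>E I A \<inter> space (lborel_Pi I))"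
      by (rule emeasure_distr[OF m])
    also have "(\<lambda>f. \<lambda>p\<in>I. f (\<sigma> p)) -` Pi\<^sub>E I A \<inter> space (lborel_Pi I) = Pi\<^sub>E I B"
    proof (intro set_eqI iffI)
      fix f assume "f \<in> (\<lambda>f. \<lambda>p\<in>I. f (\<sigma> p)) -` Pi\<^sub>E I A \<inter> space (lborel_Pi I)"
      then have f: "\<And>p. p \<in> I \<Longrightarrow> f (\<sigma> p) \<in> A p" "f \<in> extensional I"
        by (auto simp: PiE_iff space_PiM)
      have "f p \<in> B p" if "p \<in> I" for p using f(1)[of "inv_into I \<sigma> p"] inv[OF that] by (simp add: B_def)
      with f(2) show "f \<in> Pi\<^sub>E I B" by (simp add: PiE_iff)
    next
      fix f assume f: "f \<in> Pi\<^sub>E I B"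
      then have "f (\<sigma> p) \<in> A p" if "p \<in> I" for p using \<sigma>I[OF that] inv2[OF that] by (auto simp: PiE_iff B_def)
      then show "f \<in> (\<lambda>f. \<lambda>p\<in>I. f (\<sigma> p)) -` Pi\<^sub>E I A \<inter> space (lborel_Pi I)"
        using f by (auto simp: PiE_iff space_PiM)
    qed
    also have "emeasure (lborel_Pi I) (Pi\<^sub>E I B) = (\<Prod>p\<in>I. emeasure lborel (B p))"
      using I B by (rule lborel_product.emeasure_PiM)
    also have "\<dots> = (\<Prod>p\<in>I. emeasure lborel (B (\<sigma> p)))"
      by (rule prod.reindex_bij_betw[OF \<sigma>, symmetric])
    also have "\<dots> = (\<Prod>p\<in>I. emeasure lborel (A p))"
      by (intro prod.cong) (auto simp: B_def inv2)
    finally show "emeasure (distr (lborel_Pi I) (lborel_Pi I) (\<lambda>f. \<lambda>p\<in>I. f (\<sigma> p))) (Pi\<^sub>E I A) = (\<Prod>p\<in>I. emeasure lborel (A p))" .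
  qed simp
  then have "(\<integral>\<^sup>+f. F f \<partial>lborel_Pi I) = (\<integral>\<^sup>+f. F f \<partial>distr (lborel_Pi I) (lborel_Pi I) (\<lambda>f. \<lambda>p\<in>I. f (\<sigma> p)))" by simp
  also have "\<dots> = (\<integral>\<^sup>+f. F (\<lambda>p\<in>I. f (\<sigma> p)) \<partial>lborel_Pi I)" by (rule nn_integral_distr) measurable
  finally show ?thesis ..
qed

text \<open>Gauss elimination reduces a Jacobian that is multiplicative in the matrix to elementary matrices.\<close>

lemma jacobian_by_elementary_matrices:
  fixes T :: "real^'n^'n \<Rightarrow> 'b \<Rightarrow> 'b" and e :: nat
  assumes meas: "\<And>M. T M \<in> \<mu> \<rightarrow>\<^sub>M \<mu>" and comp: "\<And>A B x. x \<in> space \<mu> \<Longrightarrow> T (A ** B) x = T A (T B x)"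
    and one: "\<And>x. x \<in> space \<mu> \<Longrightarrow> T (mat 1) x = x"
    and diag: "\<And>k c F. c \<noteq> 0 \<Longrightarrow> F \<in> borel_measurable \<mu> \<Longrightarrow>
      ennreal (\<bar>c\<bar> ^ e) * (\<integral>\<^sup>+x. F (T (\<chi> i j. if i = j then (if i = k then c else 1) else 0) x) \<partial>\<mu>) = (\<integral>\<^sup>+x. F x \<partial>\<mu>)"
    and swap: "\<And>m n F. m \<noteq> n \<Longrightarrow> F \<in> borel_measurable \<mu> \<Longrightarrow>
      (\<integral>\<^sup>+x. F (T (\<chi> i j. mat 1 $ i $ Transposition.transpose m n j) x) \<partial>\<mu>) = (\<integral>\<^sup>+x. F x \<partial>\<mu>)"
    and shear: "\<And>m n F. m \<noteq> n \<Longrightarrow> F \<in> borel_measurable \<mu> \<Longrightarrow>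
      (\<integral>\<^sup>+x. F (T (\<chi> i j. of_bool (i = m \<and> j = n \<or> i = j)) x) \<partial>\<mu>) = (\<integral>\<^sup>+x. F x \<partial>\<mu>)"
    and "det M \<noteq> 0" and "F \<in> borel_measurable \<mu>"
  shows "ennreal (\<bar>det M\<bar> ^ e) * (\<integral>\<^sup>+x. F (T M x) \<partial>\<mu>) = (\<integral>\<^sup>+x. F x \<partial>\<mu>)"
proof -
  \<comment> \<open>Singular matrices satisfy P vacuously, so the induction over elementary matrices
    can pass through products that contain them.\<close>
  define P where "P M \<longleftrightarrow> (det M \<noteq> 0 \<longrightarrow> (\<forall>F\<in>borel_measurable \<mu>.
    ennreal (\<bar>det M\<bar> ^ e) * (\<integral>\<^sup>+x. F (T M x) \<partial>\<mu>) = (\<integral>\<^sup>+x. F x \<partial>\<mu>)))" for M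
  have mult: "P (A ** B)" if A: "P A" and B: "P B" for A B
    unfolding P_def
  proof (intro impI ballI)
    fix F :: "'b \<Rightarrow> ennreal" assume nz: "det (A ** B) \<noteq> 0" and F: "F \<in> borel_measurable \<mu>"
    have FA: "(\<lambda>x. F (T A x)) \<in> borel_measurable \<mu>" using F meas by measurable
    have "(\<integral>\<^sup>+x. F (T (A ** B) x) \<partial>\<mu>) = (\<integral>\<^sup>+x. F (T A (T B x)) \<partial>\<mu>)"
      by (intro nn_integral_cong) (simp add: comp)
    then have "ennreal (\<bar>det (A ** B)\<bar> ^ e) * (\<integral>\<^sup>+x. F (T (A ** B) x) \<partial>\<mu>)
      = ennreal (\<bar>det A\<bar> ^ e) * (ennreal (\<bar>det B\<bar> ^ e) * (\<integral>\<^sup>+x. F (T A (T B x)) \<partial>\<mu>))"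
      by (simp add: det_mul abs_mult power_mult_distrib ennreal_mult mult.assoc)
    also have "\<dots> = ennreal (\<bar>det A\<bar> ^ e) * (\<integral>\<^sup>+x. F (T A x) \<partial>\<mu>)"
    proof -
      have "ennreal (\<bar>det B\<bar> ^ e) * (\<integral>\<^sup>+x. F (T A (T B x)) \<partial>\<mu>) = (\<integral>\<^sup>+x. F (T A x) \<partial>\<mu>)"
      proof -
        have "det B \<noteq> 0" using nz by (simp add: det_mul)
        then have "\<forall>F\<in>borel_measurable \<mu>. ennreal (\<bar>det B\<bar> ^ e) * (\<integral>\<^sup>+x. F (T B x) \<partial>\<mu>) = (\<integral>\<^sup>+x. F x \<partial>\<mu>)"
          using B unfolding P_def by blast
        from bspec[OF this FA] show ?thesis .
      qed
      then show ?thesis by simp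
    qed
    also have "\<dots> = (\<integral>\<^sup>+x. F x \<partial>\<mu>)" using A F nz unfolding P_def by (simp add: det_mul)
    finally show "ennreal (\<bar>det (A ** B)\<bar> ^ e) * (\<integral>\<^sup>+x. F (T (A ** B) x) \<partial>\<mu>) = (\<integral>\<^sup>+x. F x \<partial>\<mu>)" .
  qed
  have "P M"
  proof (rule induct_matrix_elementary_alt[of P, OF mult])
    show "P A" if "row i A = 0" for A i using det_zero_row(1)[OF that] by (simp add: P_def)
    show "P A" if A: "\<And>i j. i \<noteq> j \<Longrightarrow> A $ i $ j = 0" for A
    proof (cases "det A = 0")
      case False
      then have nz: "A $ i $ i \<noteq> 0" for i using det_diagonal[OF A] by auto
      define D where "D S = (\<chi> i j. if i = j then (if i \<in> S then A $ i $ i else 1) else 0)" for S :: "'n set"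
      have "P (D S)" if "finite S" for S
        using that
      proof (induction S)
        case empty
        have "D {} = mat 1" by (simp add: D_def mat_def vec_eq_iff)
        then show ?case by (simp add: P_def one cong: nn_integral_cong)
      next
        case (insert k S)
        let ?E = "(\<chi> i j. if i = j then (if i = k then A $ k $ k else 1) else 0) :: real^'n^'n"
        have "D (insert k S) = ?E ** D S"
          using insert by (auto simp: vec_eq_iff D_def matrix_matrix_mult_def if_distrib[of "\<lambda>x. x * _"] cong: if_cong)
        moreover have "P ?E"
        proof -
          have "det ?E = (\<Prod>i\<in>UNIV. if i = k then A $ k $ k else 1)" by (rule det_diagonal_matrix)
          also have "\<dots> = A $ k $ k" by (simp add: prod.delta)
          finally show ?thesis unfolding P_def using diag[OF nz[of k], of _ k] by simp
        qed
        ultimately show ?case using insert mult by simp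
      qed
      then have "P (D UNIV)" by simp
      moreover have "D UNIV = A" using A by (auto simp: vec_eq_iff D_def)
      ultimately show ?thesis by simp
    qed (simp add: P_def)
    show "P (\<chi> i j. mat 1 $ i $ Transposition.transpose m n j)" if mn: "m \<noteq> n" for m n
    proof -
      have "det ((\<chi> i j. mat 1 $ i $ Transposition.transpose m n j) :: real^'n^'n)
        = of_int (sign (Transposition.transpose m n)) * det (mat 1 :: real^'n^'n)"
        by (rule det_permute_columns) (simp add: permutes_swap_id)
      then have "\<bar>det ((\<chi> i j. mat 1 $ i $ Transposition.transpose m n j) :: real^'n^'n)\<bar> = 1"
        by (auto simp: sign_def)
      then show ?thesis unfolding P_def using swap[OF mn] by simp
    qed
    show "P (\<chi> i j. of_bool (i = m \<and> j = n \<or> i = j))" if mn: "m \<noteq> n" for m n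
    proof -
      have "(\<chi> i j. of_bool (i = m \<and> j = n \<or> i = j))
        = ((\<chi> k. if k = m then row m (mat 1) + 1 *s row n (mat 1) else row k (mat 1)) :: real^'n^'n)"
        using mn by (auto simp: vec_eq_iff row_def mat_def)
      then have "det ((\<chi> i j. of_bool (i = m \<and> j = n \<or> i = j)) :: real^'n^'n) = 1"
        using det_row_operation[OF mn, of "mat 1 :: real^'n^'n" 1] by simp
      then show ?thesis unfolding P_def using shear[OF mn] by simp
    qed
  qed
  then show ?thesis using assms(7,8) by (simp add: P_def)
qed

section \<open>Lebesgue measure on symmetric matrices\<close>

abbreviation pairs :: "'r::finite set set" where
  "pairs \<equiv> {{i, j} | i j. True}"

lemma finite_pairs: "finite (pairs :: 'r::finite set set)"
  by (rule finite_subset[of _ UNIV]) auto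

lemma doubleton_in_pairs [simp]: "{i, j} \<in> pairs" by blast
lemma singleton_in_pairs [simp]: "{i} \<in> pairs" by (metis (mono_tags, lifting) insert_absorb2 mem_Collect_eq)

lemma sym_mat_of_nth [simp]: "sym_mat_of f $ i $ j = f {i, j}"
  by (simp add: sym_mat_of_def)

lemma transpose_sym_mat_of [simp]: "transpose (sym_mat_of f) = sym_mat_of f"
  by (simp add: transpose_def vec_eq_iff insert_commute)

lemma measurable_sym_mat_of' [measurable]: "sym_mat_of \<in> lborel_Pi pairs \<rightarrow>\<^sub>M borel"
  by (rule measurable_sym_mat_of)

lemma sets_sym_lborel [simp, measurable_cong]: "sets sym_lborel = sets borel"
  by (simp add: sym_lborel_def)

lemma space_sym_lborel [simp]: "space sym_lborel = UNIV"
  by (simp add: sym_lborel_def)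

lemma nn_integral_sym_lborel:
  assumes "F \<in> borel_measurable borel"
  shows "(\<integral>\<^sup>+X. F X \<partial>sym_lborel) = (\<integral>\<^sup>+f. F (sym_mat_of f) \<partial>lborel_Pi pairs)"
  unfolding sym_lborel_def using assms measurable_sym_mat_of by (intro nn_integral_distr) auto

lemma borel_measurable_comp_sym_mat_of:
  "F \<in> borel_measurable borel \<Longrightarrow> (\<lambda>f. F (sym_mat_of f)) \<in> borel_measurable (lborel_Pi pairs)"
  by (rule measurable_compose[OF measurable_sym_mat_of])

lemma AE_sym_lborel_symmetric: "AE X in sym_lborel. transpose X = (X :: real^'r^'r)"
proof -
  have "closed {X :: real^'r^'r. transpose X = X}"
    unfolding transpose_def by (intro closed_Collect_eq continuous_intros)
  then have "{X \<in> space borel. transpose X = (X :: real^'r^'r)} \<in> sets borel" by (simp add: borel_closed)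
  then show ?thesis
    unfolding sym_lborel_def by (subst AE_distr_iff[OF measurable_sym_mat_of]) auto
qed

lemma nn_integral_sym_cong:
  assumes "\<And>X. transpose X = X \<Longrightarrow> F X = G X"
  shows "(\<integral>\<^sup>+X. F X \<partial>sym_lborel) = (\<integral>\<^sup>+X. G X \<partial>sym_lborel)"
  by (rule nn_integral_cong_AE) (use AE_sym_lborel_symmetric in \<open>eventually_elim, auto intro: assms\<close>)

lemma symmetric_imp_sym_mat_of:
  assumes "transpose S = S"
  obtains t where "S = sym_mat_of t"
proof -
  have S: "S $ i $ j = S $ j $ i" for i j using assms by (simp add: transpose_def vec_eq_iff)
  \<comment> \<open>By the symmetry of S, the chosen entry does not depend on the order in which the
    pair is listed.\<close>
  define t where "t p = (SOME x. \<exists>i j. p = {i, j} \<and> x = S $ i $ j)" for p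
  have "t {i, j} = S $ i $ j" for i j
    unfolding t_def by (rule some1_equality) (auto simp: doubleton_eq_iff S)
  then show thesis by (intro that[of t]) (simp add: vec_eq_iff)
qed

lemma nn_integral_sym_translate:
  fixes S :: "real^'r^'r"
  assumes F[measurable]: "F \<in> borel_measurable borel" and S: "transpose S = S"
  shows "(\<integral>\<^sup>+X. F (X + S) \<partial>sym_lborel) = (\<integral>\<^sup>+X. F X \<partial>sym_lborel)"
proof -
  obtain t where t: "S = sym_mat_of t" by (rule symmetric_imp_sym_mat_of[OF S])
  have "(\<integral>\<^sup>+f. ennreal (\<Prod>p\<in>(pairs :: 'r set set). \<bar>1\<bar>) * F (sym_mat_of (\<lambda>p. if p \<in> pairs then 1 * f p + t p else f p)) \<partial>lborel_Pi pairs)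
    = (\<integral>\<^sup>+f. F (sym_mat_of f) \<partial>lborel_Pi pairs)"
    by (rule nn_integral_affine_block[OF _ _ _ _ _ _ _ borel_measurable_comp_sym_mat_of[OF F]]) (auto simp: finite_pairs)
  moreover have "sym_mat_of (\<lambda>p. if p \<in> pairs then 1 * f p + t p else f p) = sym_mat_of f + S" for f
    by (auto simp: vec_eq_iff t)
  ultimately show ?thesis by (simp add: nn_integral_sym_lborel)
qed

lemma nn_integral_sym_reflect:
  fixes F :: "real^'r^'r \<Rightarrow> ennreal"
  assumes F[measurable]: "F \<in> borel_measurable borel"
  shows "(\<integral>\<^sup>+X. F (- X) \<partial>sym_lborel) = (\<integral>\<^sup>+X. F X \<partial>sym_lborel)"
proof -
  have "(\<integral>\<^sup>+f. ennreal (\<Prod>p\<in>(pairs :: 'r set set). \<bar>-1\<bar>) * F (sym_mat_of (\<lambda>p. if p \<in> pairs then -1 * f p + 0 else f p)) \<partial>lborel_Pi pairs)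
    = (\<integral>\<^sup>+f. F (sym_mat_of f) \<partial>lborel_Pi pairs)"
    by (rule nn_integral_affine_block[OF _ _ _ _ _ _ _ borel_measurable_comp_sym_mat_of[OF F]]) (auto simp: finite_pairs)
  moreover have "sym_mat_of (\<lambda>p. if p \<in> pairs then -1 * f p + 0 else f p) = - sym_mat_of f" for f :: "'r set \<Rightarrow> real"
    by (auto simp: vec_eq_iff)
  ultimately show ?thesis by (simp add: nn_integral_sym_lborel)
qed

section \<open>Continuity and measurability of matrix operations\<close>

lemma continuous_on_matrix_mult [continuous_intros]:
  fixes f :: "'a::topological_space \<Rightarrow> real^'n^'m" and g :: "'a \<Rightarrow> real^'k^'n"
  assumes "continuous_on S f" "continuous_on S g"
  shows "continuous_on S (\<lambda>x. f x ** g x)"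
  unfolding matrix_matrix_mult_def by (intro continuous_intros assms)

lemma continuous_on_transpose [continuous_intros]:
  fixes f :: "'a::topological_space \<Rightarrow> real^'n^'m"
  assumes "continuous_on S f"
  shows "continuous_on S (\<lambda>x. transpose (f x))"
  unfolding transpose_def by (intro continuous_intros assms)

lemma continuous_on_det [continuous_intros]:
  fixes f :: "'a::topological_space \<Rightarrow> real^'n^'n"
  assumes "continuous_on S f"
  shows "continuous_on S (\<lambda>x. det (f x))"
  unfolding det_def by (intro continuous_intros assms)

lemma continuous_on_matrix_vector_mult [continuous_intros]:
  fixes f :: "'a::topological_space \<Rightarrow> real^'n^'m" and g :: "'a \<Rightarrow> real^'n"
  assumes "continuous_on S f" "continuous_on S g"
  shows "continuous_on S (\<lambda>x. f x *v g x)"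
  unfolding matrix_vector_mult_def by (intro continuous_intros assms)

lemma borel_measurable_matrix_mult [measurable (raw)]:
  fixes f :: "'a \<Rightarrow> real^'n^'m" and g :: "'a \<Rightarrow> real^'k^'n"
  assumes "f \<in> borel_measurable M" "g \<in> borel_measurable M"
  shows "(\<lambda>x. f x ** g x) \<in> borel_measurable M"
  by (rule borel_measurable_continuous_Pair[OF assms]) (intro continuous_intros)

lemma borel_measurable_transpose [measurable (raw)]:
  fixes f :: "'a \<Rightarrow> real^'n^'m"
  assumes "f \<in> borel_measurable M"
  shows "(\<lambda>x. transpose (f x)) \<in> borel_measurable M"
  by (rule borel_measurable_continuous_on[OF _ assms]) (intro continuous_intros)

lemma borel_measurable_det [measurable (raw)]:
  fixes f :: "'a \<Rightarrow> real^'n^'n"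
  assumes "f \<in> borel_measurable M"
  shows "(\<lambda>x. det (f x)) \<in> borel_measurable M"
  by (rule borel_measurable_continuous_on[OF _ assms]) (intro continuous_intros)

lemma borel_measurable_vec_nth' [measurable (raw)]:
  fixes f :: "'a \<Rightarrow> 'b::euclidean_space^'n"
  assumes "f \<in> borel_measurable M"
  shows "(\<lambda>x. f x $ i) \<in> borel_measurable M"
  by (rule borel_measurable_continuous_on[OF _ assms]) (intro continuous_intros)

text \<open>Scaling row and column k by c multiplies the r - 1 free entries {k, j} by c and the
  diagonal entry by c^2, hence the exponent r + 1. Swaps permute the free entries and shears
  translate them, so both preserve the measure.\<close>

theorem nn_integral_sym_congruence:
  fixes M :: "real^'r^'r"
  assumes M: "det M \<noteq> 0" and F: "F \<in> borel_measurable borel"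
  shows "ennreal (\<bar>det M\<bar> ^ (CARD('r) + 1)) * (\<integral>\<^sup>+X. F (M ** X ** transpose M) \<partial>sym_lborel) = (\<integral>\<^sup>+X. F X \<partial>sym_lborel)"
proof (rule jacobian_by_elementary_matrices[where T = "\<lambda>M X. M ** X ** transpose M" and \<mu> = sym_lborel])
  show "(\<lambda>X. A ** X ** transpose A) \<in> sym_lborel \<rightarrow>\<^sub>M sym_lborel" for A :: "real^'r^'r" by measurable
  show "A ** B ** X ** transpose (A ** B) = A ** (B ** X ** transpose B) ** transpose A" for A B X :: "real^'r^'r"
    by (simp add: matrix_transpose_mul matrix_mul_assoc)
  show "det M \<noteq> 0" by (rule M)
  show "F \<in> borel_measurable sym_lborel" using F by simp
next
  fix k :: 'r and c :: real and F :: "real^'r^'r \<Rightarrow> ennreal"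
  assume c: "c \<noteq> 0" and "F \<in> borel_measurable sym_lborel"
  then have [measurable]: "F \<in> borel_measurable borel" by simp
  let ?D = "(\<chi> i j. if i = j then (if i = k then c else 1) else 0) :: real^'r^'r"
  \<comment> \<open>The free entries that involve the index k; \<open>a\<close> is the factor by
    which each of them is scaled.\<close>
  define C where "C = (\<lambda>j. {k, j}) ` UNIV"
  define a where "a p = (if p = {k} then c\<^sup>2 else c)" for p
  have C: "C \<subseteq> pairs" by (auto simp: C_def)
  have inj: "inj (\<lambda>j. {k, j})" by (auto simp: inj_def doubleton_eq_iff)
  have "(\<Prod>p\<in>C. \<bar>a p\<bar>) = (\<Prod>j\<in>UNIV. \<bar>a {k, j}\<bar>)" unfolding C_def by (rule prod.reindex[OF inj, unfolded o_def])
  also have "\<dots> = (\<Prod>j\<in>UNIV. \<bar>c\<bar> * (if j = k then \<bar>c\<bar> else 1))"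
    by (intro prod.cong) (auto simp: a_def power2_eq_square abs_mult)
  also have "\<dots> = \<bar>c\<bar> ^ (CARD('r) + 1)" by (simp add: prod.distrib prod.delta mult.commute)
  finally have jac: "(\<Prod>p\<in>C. \<bar>a p\<bar>) = \<bar>c\<bar> ^ (CARD('r) + 1)" .
  have tr: "sym_mat_of (\<lambda>p. if p \<in> C then a p * f p + 0 else f p) = ?D ** sym_mat_of f ** transpose ?D" for f
  proof -
    have e: "(?D ** X ** transpose ?D) $ i $ j = (if i = k then c else 1) * (if j = k then c else 1) * X $ i $ j" for X i j
      by (simp add: matrix_matrix_mult_def transpose_def if_distrib[of "\<lambda>x. x * _"] if_distrib[of "\<lambda>x. _ * x"] cong: if_cong)
    have m: "{i, j} \<in> C \<longleftrightarrow> i = k \<or> j = k" for i j by (auto simp: C_def doubleton_eq_iff)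
    show ?thesis unfolding vec_eq_iff e
      by (auto simp: m a_def power2_eq_square)
  qed
  have "(\<integral>\<^sup>+f. ennreal (\<Prod>p\<in>C. \<bar>a p\<bar>) * F (sym_mat_of (\<lambda>p. if p \<in> C then a p * f p + 0 else f p)) \<partial>lborel_Pi pairs)
    = (\<integral>\<^sup>+f. F (sym_mat_of f) \<partial>lborel_Pi pairs)"
    by (rule nn_integral_affine_block[OF _ _ _ _ _ _ _ borel_measurable_comp_sym_mat_of])
      (use C c in \<open>auto simp: finite_pairs a_def\<close>)
  then show "ennreal (\<bar>c\<bar> ^ (CARD('r) + 1)) * (\<integral>\<^sup>+X. F (?D ** X ** transpose ?D) \<partial>sym_lborel) = (\<integral>\<^sup>+X. F X \<partial>sym_lborel)"
  proof -
    have m: "(\<lambda>X. F (?D ** X ** transpose ?D)) \<in> borel_measurable borel" by measurable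
    assume "(\<integral>\<^sup>+f. ennreal (\<Prod>p\<in>C. \<bar>a p\<bar>) * F (sym_mat_of (\<lambda>p. if p \<in> C then a p * f p + 0 else f p)) \<partial>lborel_Pi pairs)
      = (\<integral>\<^sup>+f. F (sym_mat_of f) \<partial>lborel_Pi pairs)"
    then show ?thesis
      unfolding jac tr nn_integral_cmult[OF borel_measurable_comp_sym_mat_of[OF m]]
      by (simp add: nn_integral_sym_lborel m)
  qed
next
  fix m n :: 'r and F :: "real^'r^'r \<Rightarrow> ennreal"
  assume "m \<noteq> n" and "F \<in> borel_measurable sym_lborel"
  then have [measurable]: "F \<in> borel_measurable borel" by simp
  let ?\<pi> = "Transposition.transpose m n"
  let ?S = "(\<chi> i j. mat 1 $ i $ ?\<pi> j) :: real^'r^'r"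
  have S: "(?S ** X) $ i $ j = X $ ?\<pi> i $ j" for X :: "real^'r^'r" and i j
  proof -
    have "(?S ** X) $ i $ j = (\<Sum>l\<in>UNIV. if ?\<pi> i = l then X $ l $ j else 0)"
      unfolding matrix_matrix_mult_def mat_def
      by (auto intro!: sum.cong simp: transpose_eq_iff)
    then show ?thesis by simp
  qed
  have "(X ** transpose ?S) = transpose (?S ** transpose X)" for X :: "real^'r^'r" by (simp add: matrix_transpose_mul)
  then have S2: "(X ** transpose ?S) $ i $ j = X $ i $ ?\<pi> j" for X :: "real^'r^'r" and i j
    by (simp add: transpose_def S)
  have bij: "bij_betw (\<lambda>p. ?\<pi> ` p) pairs pairs"
    by (rule bij_betw_byWitness[where f' = "\<lambda>p. ?\<pi> ` p"]) (auto simp: image_image)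
  have tr: "sym_mat_of (\<lambda>p\<in>pairs. f (?\<pi> ` p)) = ?S ** sym_mat_of f ** transpose ?S" for f
    unfolding vec_eq_iff S2 S by auto
  have "(\<integral>\<^sup>+f. F (sym_mat_of (\<lambda>p\<in>pairs. f (?\<pi> ` p))) \<partial>lborel_Pi pairs) = (\<integral>\<^sup>+f. F (sym_mat_of f) \<partial>lborel_Pi pairs)"
    by (rule nn_integral_permute_coordinates[OF finite_pairs bij]) measurable
  then show "(\<integral>\<^sup>+X. F (?S ** X ** transpose ?S) \<partial>sym_lborel) = (\<integral>\<^sup>+X. F X \<partial>sym_lborel)"
    unfolding tr by (simp add: nn_integral_sym_lborel)
next
  fix m n :: 'r and F :: "real^'r^'r \<Rightarrow> ennreal"
  assume mn: "m \<noteq> n" and "F \<in> borel_measurable sym_lborel"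
  then have [measurable]: "F \<in> borel_measurable borel" by simp
  let ?E = "(\<chi> i j. of_bool (i = m \<and> j = n \<or> i = j)) :: real^'r^'r"
  have E: "(?E ** X) $ i $ j = X $ i $ j + (if i = m then X $ n $ j else 0)" for X :: "real^'r^'r" and i j
  proof -
    have "(?E ** X) $ i $ j = (\<Sum>l\<in>UNIV. (if l = i then X $ l $ j else 0) + (if l = n then (if i = m then X $ l $ j else 0) else 0))"
      unfolding matrix_matrix_mult_def using mn by (auto intro!: sum.cong)
    then show ?thesis by (simp add: sum.distrib)
  qed
  have E2: "(X ** transpose ?E) $ i $ j = X $ i $ j + (if j = m then X $ i $ n else 0)" for X :: "real^'r^'r" and i j
  proof -
    have "transpose (?E ** transpose X) = X ** transpose ?E"
      by (subst matrix_transpose_mul) (simp only: transpose_transpose)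
    then have "(X ** transpose ?E) $ i $ j = transpose (?E ** transpose X) $ i $ j" by (simp only:)
    also have "\<dots> = (?E ** transpose X) $ j $ i" unfolding transpose_def[of "?E ** transpose X"] by (simp only: vec_lambda_beta)
    finally have "(X ** transpose ?E) $ i $ j = (?E ** transpose X) $ j $ i" .
    then show ?thesis unfolding E by (simp add: transpose_def)
  qed
  define C where "C = (\<lambda>j. {m, j}) ` (UNIV - {m})"
  have m: "{i, j} \<in> C \<longleftrightarrow> i \<noteq> j \<and> (i = m \<or> j = m)" for i j
  proof
    assume "{i, j} \<in> C"
    then obtain l where l: "l \<noteq> m" "{i, j} = {m, l}" unfolding C_def by blast
    from l(2) have "i = m \<and> j = l \<or> i = l \<and> j = m" by (simp only: doubleton_eq_iff)
    with l(1) show "i \<noteq> j \<and> (i = m \<or> j = m)" by blast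
  next
    assume a: "i \<noteq> j \<and> (i = m \<or> j = m)"
    then have "{i, j} = {m, if i = m then j else i}" by auto
    moreover have "(if i = m then j else i) \<in> UNIV - {m}" using a by auto
    ultimately show "{i, j} \<in> C" unfolding C_def by (rule image_eqI)
  qed
  have m1: "{i} \<notin> C" for i using m[of i i] by simp
  \<comment> \<open>For p = {m, j} this is the entry {n, j} that the shear adds to it. The diagonal
    entry {m} receives 2 x_mn + x_nn and depends on {m, n}, which itself changes; therefore
    \<open>T1\<close> treats it first, in a block of its own, and \<open>T2\<close> treats the
    remaining entries.\<close>
  define g where "g p f = f (insert n (p - {m}))" for p and f :: "'r set \<Rightarrow> real"
  define T1 where "T1 f = (\<lambda>p. if p \<in> {{m}} then 1 * f p + (2 * f {m, n} + f {n}) else f p)" for f :: "'r set \<Rightarrow> real"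
  define T2 where "T2 f = (\<lambda>p. if p \<in> C then 1 * f p + g p f else f p)" for f :: "'r set \<Rightarrow> real"
  have comps: "(\<lambda>f. f p) \<in> borel_measurable (lborel_Pi pairs)" if "p \<in> pairs" for p :: "'r set"
    by (rule borel_measurable_lborel_Pi_component[OF that])
  have gC: "insert n (p - {m}) \<in> pairs \<and> insert n (p - {m}) \<notin> C" if pC: "p \<in> C" for p
  proof -
    obtain j where j: "p = {m, j}" "j \<noteq> m" using pC unfolding C_def by blast
    then have "insert n (p - {m}) = {n, j}" by auto
    then show ?thesis using j mn by (auto simp: m)
  qed
  have tr: "sym_mat_of (T2 (T1 f)) = ?E ** sym_mat_of f ** transpose ?E" for f
  proof -
    have "T2 (T1 f) {i, j} = f {i, j} + (if i = m then f {n, j} else 0) + (if j = m then f {i, n} + (if i = m then f {n} else 0) else 0)" for i j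
    proof (cases "i = m"; cases "j = m")
      assume "i = m" "j = m"
      then show ?thesis by (simp add: T2_def T1_def m1 insert_commute)
    next
      assume a: "i = m" "j \<noteq> m"
      then have "insert n ({m, j} - {m}) = {n, j}" by auto
      then show ?thesis using a mn by (auto simp: T2_def T1_def m g_def doubleton_eq_iff)
    next
      assume a: "i \<noteq> m" "j = m"
      then have "insert n ({i, m} - {m}) = {i, n}" by auto
      then show ?thesis using a mn by (auto simp: T2_def T1_def m g_def doubleton_eq_iff)
    next
      assume "i \<noteq> m" "j \<noteq> m"
      then show ?thesis by (simp add: T2_def T1_def m doubleton_eq_iff)
    qed
    then show ?thesis unfolding vec_eq_iff E2 E by auto
  qed
  have [measurable]: "T2 \<in> lborel_Pi pairs \<rightarrow>\<^sub>M lborel_Pi pairs"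
  proof -
    have "(\<lambda>f. \<lambda>p\<in>pairs. T2 f p) \<in> lborel_Pi pairs \<rightarrow>\<^sub>M lborel_Pi pairs"
    proof (rule measurable_restrict)
      fix p :: "'r set" assume p: "p \<in> pairs"
      show "(\<lambda>f. T2 f p) \<in> lborel_Pi pairs \<rightarrow>\<^sub>M lborel"
        using gC[of p] p comps unfolding T2_def g_def by (cases "p \<in> C") auto
    qed
    moreover have "(\<lambda>p\<in>pairs. T2 f p) = T2 f" if "f \<in> space (lborel_Pi pairs)" for f
      using that by (auto simp: space_PiM PiE_iff extensional_def T2_def C_def fun_eq_iff restrict_def)
    ultimately show ?thesis by (subst measurable_cong) auto
  qed
  have "(\<integral>\<^sup>+f. F (sym_mat_of f) \<partial>lborel_Pi pairs) = (\<integral>\<^sup>+f. ennreal (\<Prod>p\<in>C. \<bar>1\<bar>) * F (sym_mat_of (T2 f)) \<partial>lborel_Pi pairs)"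
    unfolding T2_def
  proof (rule nn_integral_affine_block[symmetric, OF finite_pairs _ _ _ _ _ _ borel_measurable_comp_sym_mat_of])
    show "C \<subseteq> pairs" by (auto simp: C_def)
    show "g p \<in> borel_measurable (lborel_Pi pairs)" if "p \<in> C" for p
      unfolding g_def using comps gC[OF that] by blast
    show "g p f = g p f'" if "p \<in> C" "\<And>i. i \<notin> C \<Longrightarrow> f i = f' i" for p f f'
      unfolding g_def using gC[OF that(1)] that(2) by blast
  qed auto
  also have "\<dots> = (\<integral>\<^sup>+f. F (sym_mat_of (T2 f)) \<partial>lborel_Pi pairs)" by simp
  also have "\<dots> = (\<integral>\<^sup>+f. ennreal (\<Prod>p\<in>{{m}}. \<bar>1\<bar>) * F (sym_mat_of (T2 (T1 f))) \<partial>lborel_Pi pairs)"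
    unfolding T1_def
  proof (rule nn_integral_affine_block[symmetric, OF finite_pairs])
    show "{{m}} \<subseteq> pairs" by auto
    have "(\<lambda>f. f {m, n}) \<in> borel_measurable (lborel_Pi pairs)" "(\<lambda>f. f {n}) \<in> borel_measurable (lborel_Pi pairs)"
      by (rule comps, rule doubleton_in_pairs) (rule comps, rule singleton_in_pairs)
    then show "(\<lambda>f. 2 * f {m, n} + f {n}) \<in> borel_measurable (lborel_Pi pairs)" by simp
    show "(\<lambda>f. F (sym_mat_of (T2 f))) \<in> borel_measurable (lborel_Pi pairs)" by measurable
    show "2 * f {m, n} + f {n} = 2 * f' {m, n} + f' {n}" if "\<And>i. i \<notin> {{m}} \<Longrightarrow> f i = f' i" for f f' :: "'r set \<Rightarrow> real"
      using mn that[of "{m, n}"] that[of "{n}"] by (simp add: doubleton_eq_iff)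
  qed auto
  finally show "(\<integral>\<^sup>+X. F (?E ** X ** transpose ?E) \<partial>sym_lborel) = (\<integral>\<^sup>+X. F X \<partial>sym_lborel)"
    unfolding tr by (simp add: nn_integral_sym_lborel)
qed simp

text \<open>Each of the q columns is multiplied by M separately, hence the exponent q. On elementary
  matrices the coordinates are the standard basis matrices, and the argument is the one for
  symmetric matrices with rows in place of rows and columns.\<close>

theorem nn_integral_matrix_mult_left:
  fixes M :: "real^'r^'r" and F :: "real^'q^'r \<Rightarrow> ennreal"
  assumes M: "det M \<noteq> 0" and F: "F \<in> borel_measurable borel"
  shows "ennreal (\<bar>det M\<bar> ^ CARD('q)) * (\<integral>\<^sup>+X. F (M ** X) \<partial>lborel) = (\<integral>\<^sup>+X. F X \<partial>lborel)"
proof -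
  let ?B = "Basis :: (real^'q^'r) set"
  define e where "e i j = (axis i (axis j 1) :: real^'q^'r)" for i j
  define V where "V f = (\<Sum>b\<in>?B. f b *\<^sub>R b)" for f
  have eB: "e i j \<in> ?B" for i j by (auto simp: e_def Basis_vec_def)
  have Be: "\<exists>i j. b = e i j" if "b \<in> ?B" for b using that by (auto simp: e_def Basis_vec_def)
  have ee: "e i j = e i' j' \<longleftrightarrow> i = i' \<and> j = j'" for i j i' j' by (auto simp: e_def axis_eq_axis)
  have Vn: "V f $ i $ j = f (e i j)" for f i j
  proof -
    have "V f $ i $ j = V f \<bullet> e i j" by (simp add: e_def inner_axis)
    also have "\<dots> = f (e i j)" unfolding V_def by (rule inner_sum_left_Basis[OF eB])
    finally show ?thesis .
  qed
  have Vm[measurable]: "V \<in> lborel_Pi ?B \<rightarrow>\<^sub>M borel"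
    unfolding V_def using borel_measurable_lborel_Pi_component by (intro borel_measurable_sum borel_measurable_scaleR) auto
  have int: "(\<integral>\<^sup>+X. G X \<partial>lborel) = (\<integral>\<^sup>+f. G (V f) \<partial>lborel_Pi ?B)" if [measurable]: "G \<in> borel_measurable borel" for G
    by (subst lborel_eq) (simp add: nn_integral_distr V_def[symmetric] Vm[unfolded V_def[abs_def]])
  have comps: "(\<lambda>f. f p) \<in> borel_measurable (lborel_Pi ?B)" if "p \<in> ?B" for p
    by (rule borel_measurable_lborel_Pi_component[OF that])
  show ?thesis
  proof (rule jacobian_by_elementary_matrices[where T = "\<lambda>M X. M ** X" and \<mu> = lborel])
    show "(\<lambda>X. A ** X) \<in> lborel \<rightarrow>\<^sub>M lborel" for A :: "real^'r^'r" by measurable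
    show "A ** B ** X = A ** (B ** X)" for A B :: "real^'r^'r" and X :: "real^'q^'r" by (simp add: matrix_mul_assoc)
    show "det M \<noteq> 0" by (rule M)
    show "F \<in> borel_measurable lborel" using F by simp
  next
    fix k :: 'r and c :: real and F :: "real^'q^'r \<Rightarrow> ennreal"
    assume c: "c \<noteq> 0" and "F \<in> borel_measurable lborel"
    then have [measurable]: "F \<in> borel_measurable borel" by simp
    let ?D = "(\<chi> i j. if i = j then (if i = k then c else 1) else 0) :: real^'r^'r"
    define C where "C = e k ` UNIV"
    have C: "C \<subseteq> ?B" by (auto simp: C_def eB)
    have "card C = CARD('q)" unfolding C_def by (intro card_image) (auto simp: inj_def ee)
    then have jac: "(\<Prod>p\<in>C. \<bar>c\<bar>) = \<bar>c\<bar> ^ CARD('q)" by simp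
    have tr: "V (\<lambda>p. if p \<in> C then c * f p + 0 else f p) = ?D ** V f" for f
    proof -
      have "(?D ** X) $ i $ j = (if i = k then c else 1) * X $ i $ j" for X :: "real^'q^'r" and i j
        by (simp add: matrix_matrix_mult_def if_distrib[of "\<lambda>x. x * _"] cong: if_cong)
      moreover have "e i j \<in> C \<longleftrightarrow> i = k" for i j by (auto simp: C_def ee)
      ultimately show ?thesis unfolding vec_eq_iff by (simp add: Vn)
    qed
    have "(\<integral>\<^sup>+f. ennreal (\<Prod>p\<in>C. \<bar>c\<bar>) * F (V (\<lambda>p. if p \<in> C then c * f p + 0 else f p)) \<partial>lborel_Pi ?B)
      = (\<integral>\<^sup>+f. F (V f) \<partial>lborel_Pi ?B)"
      by (rule nn_integral_affine_block) (use C c in auto)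
    then show "ennreal (\<bar>c\<bar> ^ CARD('q)) * (\<integral>\<^sup>+X. F (?D ** X) \<partial>lborel) = (\<integral>\<^sup>+X. F X \<partial>lborel)"
      unfolding jac tr by (simp add: int nn_integral_cmult)
  next
    fix m n :: 'r and F :: "real^'q^'r \<Rightarrow> ennreal"
    assume "m \<noteq> n" and "F \<in> borel_measurable lborel"
    then have [measurable]: "F \<in> borel_measurable borel" by simp
    let ?\<pi> = "Transposition.transpose m n"
    let ?S = "(\<chi> i j. mat 1 $ i $ ?\<pi> j) :: real^'r^'r"
    have S: "(?S ** X) $ i $ j = X $ ?\<pi> i $ j" for X :: "real^'q^'r" and i j
    proof -
      have "(?S ** X) $ i $ j = (\<Sum>l\<in>UNIV. if ?\<pi> i = l then X $ l $ j else 0)"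
        unfolding matrix_matrix_mult_def mat_def
        by (auto intro!: sum.cong simp: transpose_eq_iff)
      then show ?thesis by simp
    qed
    define \<sigma> where "\<sigma> b = ((\<chi> i. b $ ?\<pi> i) :: real^'q^'r)" for b
    have \<sigma>e: "\<sigma> (e i j) = e (?\<pi> i) j" for i j by (auto simp: \<sigma>_def e_def axis_def vec_eq_iff transpose_eq_iff)
    have "\<sigma> b \<in> ?B" if "b \<in> ?B" for b using Be[OF that] eB by (auto simp: \<sigma>e)
    moreover have "\<sigma> (\<sigma> b) = b" for b by (simp add: \<sigma>_def vec_eq_iff)
    ultimately have bij: "bij_betw \<sigma> ?B ?B"
      by (intro bij_betw_byWitness[where f' = \<sigma>]) auto
    have tr: "V (\<lambda>p\<in>?B. f (\<sigma> p)) = ?S ** V f" for f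
      unfolding vec_eq_iff S by (simp add: Vn eB \<sigma>e)
    have "(\<integral>\<^sup>+f. F (V (\<lambda>p\<in>?B. f (\<sigma> p))) \<partial>lborel_Pi ?B) = (\<integral>\<^sup>+f. F (V f) \<partial>lborel_Pi ?B)"
      by (rule nn_integral_permute_coordinates[OF finite_Basis bij]) measurable
    then show "(\<integral>\<^sup>+X. F (?S ** X) \<partial>lborel) = (\<integral>\<^sup>+X. F X \<partial>lborel)"
      unfolding tr by (simp add: int)
  next
    fix m n :: 'r and F :: "real^'q^'r \<Rightarrow> ennreal"
    assume mn: "m \<noteq> n" and "F \<in> borel_measurable lborel"
    then have [measurable]: "F \<in> borel_measurable borel" by simp
    let ?E = "(\<chi> i j. of_bool (i = m \<and> j = n \<or> i = j)) :: real^'r^'r"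
    have E: "(?E ** X) $ i $ j = X $ i $ j + (if i = m then X $ n $ j else 0)" for X :: "real^'q^'r" and i j
    proof -
      have "(?E ** X) $ i $ j = (\<Sum>l\<in>UNIV. (if l = i then X $ l $ j else 0) + (if l = n then (if i = m then X $ l $ j else 0) else 0))"
        unfolding matrix_matrix_mult_def using mn by (auto intro!: sum.cong)
      then show ?thesis by (simp add: sum.distrib)
    qed
    define C where "C = e m ` UNIV"
    define \<sigma> where "\<sigma> b = (axis n (b $ m) :: real^'q^'r)" for b :: "real^'q^'r"
    have C: "C \<subseteq> ?B" by (auto simp: C_def eB)
    have \<sigma>: "\<sigma> (e m j) = e n j" for j by (simp add: \<sigma>_def e_def axis_def)
    have \<sigma>C: "\<sigma> b \<in> ?B \<and> \<sigma> b \<notin> C" if "b \<in> C" for b using that mn by (auto simp: C_def \<sigma> eB ee)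
    have tr: "V (\<lambda>p. if p \<in> C then 1 * f p + f (\<sigma> p) else f p) = ?E ** V f" for f
    proof -
      have "e i j \<in> C \<longleftrightarrow> i = m" for i j by (auto simp: C_def ee)
      then show ?thesis unfolding vec_eq_iff E by (auto simp: Vn \<sigma>)
    qed
    have "(\<integral>\<^sup>+f. ennreal (\<Prod>p\<in>C. \<bar>1\<bar>) * F (V (\<lambda>p. if p \<in> C then 1 * f p + f (\<sigma> p) else f p)) \<partial>lborel_Pi ?B)
      = (\<integral>\<^sup>+f. F (V f) \<partial>lborel_Pi ?B)"
      by (rule nn_integral_affine_block) (use C \<sigma>C comps in auto)
    then show "(\<integral>\<^sup>+X. F (?E ** X) \<partial>lborel) = (\<integral>\<^sup>+X. F X \<partial>lborel)"
      unfolding tr by (simp add: int)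
  qed simp
qed

section \<open>Inversion of symmetric positive definite matrices\<close>

lemma borel_measurable_mat_lambda:
  fixes g :: "'a \<Rightarrow> 'm::finite \<Rightarrow> 'n::finite \<Rightarrow> real"
  assumes "\<And>i j. (\<lambda>x. g x i j) \<in> borel_measurable M"
  shows "(\<lambda>x. (\<chi> i j. g x i j)) \<in> borel_measurable M"
  by (subst borel_measurable_euclidean_space) (use assms in \<open>auto simp: Basis_vec_def inner_axis\<close>)

text \<open>The sign makes the map x \<mapsto> - 1 / x increasing on the positive half-line, with
  derivative 1 / x^2. Substitution on compact intervals and monotone convergence on both sides give
  the claim.\<close>

lemma nn_integral_neg_inverse:
  fixes g :: "real \<Rightarrow> ennreal"
  assumes [measurable]: "g \<in> borel_measurable borel"
  shows "(\<integral>\<^sup>+x. ennreal (1 / x\<^sup>2) * g (- 1 / x) * indicator {0<..} x \<partial>lborel) = (\<integral>\<^sup>+y. g y * indicator {..<0} y \<partial>lborel)"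
proof -
  \<comment> \<open>The endpoints are reciprocal to each other, so the map carries [a n, b n]
    exactly onto its reflection.\<close>
  define a where "a n = 1 / (real n + 2)" for n
  define b where "b n = real n + 2" for n
  have ab: "0 < a n" "a n < b n" "- 1 / a n = - b n" "- 1 / b n = - a n" for n
  proof -
    show "0 < a n" by (simp add: a_def)
    have "a n < 1" by (simp add: a_def divide_less_eq)
    then show "a n < b n" by (simp add: b_def)
  qed (simp_all add: a_def b_def)
  have anti: "a n \<le> a m" "b m \<le> b n" if "m \<le> n" for m n using that by (auto simp: a_def b_def frac_le)
  have ev: "eventually (\<lambda>n. x \<in> {a n..b n}) sequentially" if x: "0 < x" for x
  proof -
    obtain N :: nat where N: "max x (1 / x) < real N" using reals_Archimedean2 by blast
    show ?thesis
    proof (rule eventually_sequentiallyI[of N])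
      fix n assume n: "N \<le> n"
      have "1 / x \<le> b n" "x \<le> b n" using N n by (auto simp: b_def)
      moreover have "1 / b n \<le> x" using \<open>1 / x \<le> b n\<close> x by (simp add: field_simps b_def)
      ultimately show "x \<in> {a n..b n}" by (simp add: a_def b_def)
    qed
  qed
  have eq: "(\<integral>\<^sup>+y. g y * indicator {- b n..- a n} y \<partial>lborel)
      = (\<integral>\<^sup>+x. g (- 1 / x) * ennreal (1 / x\<^sup>2) * indicator {a n..b n} x \<partial>lborel)" for n
  proof -
    have "(\<integral>\<^sup>+x. g x * indicator {- 1 / a n..- 1 / b n} x \<partial>lborel) =
             (\<integral>\<^sup>+x. g (- 1 / x) * ennreal (1 / x\<^sup>2) * indicator {a n..b n} x \<partial>lborel)"
    proof (rule nn_integral_substitution_aux)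
      show "((\<lambda>x. - 1 / x) has_real_derivative 1 / x\<^sup>2) (at x)" if "x \<in> {a n..b n}" for x
        using that ab(1)[of n] by (auto intro!: derivative_eq_intros simp: power2_eq_square)
      have "x \<noteq> 0" if "x \<in> {a n..b n}" for x using that ab(1)[of n] by auto
      then show "continuous_on {a n..b n} (\<lambda>x. 1 / x\<^sup>2)" by (intro continuous_intros) auto
    qed (use ab in auto)
    then show ?thesis by (simp only: ab)
  qed
  have l1: "(\<lambda>n. \<integral>\<^sup>+y. g y * indicator {- b n..- a n} y \<partial>lborel) \<longlonglongrightarrow> (\<integral>\<^sup>+y. g y * indicator {..<0} y \<partial>lborel)"
  proof (rule nn_integral_LIMSEQ)
    show "incseq (\<lambda>n y. g y * indicator {- b n..- a n} y)"
    proof (rule incseq_SucI, rule le_funI)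
      fix n y
      show "g y * indicator {- b n..- a n} y \<le> g y * indicator {- b (Suc n)..- a (Suc n)} y"
        using anti[of n "Suc n"] by (intro mult_left_mono) (auto split: split_indicator)
    qed
    show "(\<lambda>n. g y * indicator {- b n..- a n} y) \<longlonglongrightarrow> g y * indicator {..<0} y" for y
    proof (cases "y < 0")
      case True
      have "eventually (\<lambda>n. - y \<in> {a n..b n}) sequentially" by (rule ev) (use True in simp)
      then have "eventually (\<lambda>n. g y * indicator {- b n..- a n} y = g y * indicator {..<0} y) sequentially"
        by eventually_elim (use True in \<open>auto split: split_indicator\<close>)
      then show ?thesis by (rule tendsto_eventually)
    next
      case False
      have "g y * indicator {- b n..- a n} y = g y * indicator {..<0} y" for n
        using False ab(1)[of n] by (auto split: split_indicator)
      then show ?thesis by simp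
    qed
  qed auto
  have l2: "(\<lambda>n. \<integral>\<^sup>+x. g (- 1 / x) * ennreal (1 / x\<^sup>2) * indicator {a n..b n} x \<partial>lborel)
      \<longlonglongrightarrow> (\<integral>\<^sup>+x. g (- 1 / x) * ennreal (1 / x\<^sup>2) * indicator {0<..} x \<partial>lborel)"
  proof (rule nn_integral_LIMSEQ)
    show "incseq (\<lambda>n x. g (- 1 / x) * ennreal (1 / x\<^sup>2) * indicator {a n..b n} x)"
    proof (rule incseq_SucI, rule le_funI)
      fix n y
      show "g (- 1 / y) * ennreal (1 / y\<^sup>2) * indicator {a n..b n} y \<le> g (- 1 / y) * ennreal (1 / y\<^sup>2) * indicator {a (Suc n)..b (Suc n)} y"
        using anti[of n "Suc n"] by (intro mult_left_mono) (auto split: split_indicator)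
    qed
    show "(\<lambda>n. g (- 1 / x) * ennreal (1 / x\<^sup>2) * indicator {a n..b n} x) \<longlonglongrightarrow> g (- 1 / x) * ennreal (1 / x\<^sup>2) * indicator {0<..} x" for x
    proof (cases "0 < x")
      case True
      have "eventually (\<lambda>n. g (- 1 / x) * ennreal (1 / x\<^sup>2) * indicator {a n..b n} x
          = g (- 1 / x) * ennreal (1 / x\<^sup>2) * indicator {0<..} x) sequentially"
        using ev[OF True] by eventually_elim (use True in \<open>auto split: split_indicator\<close>)
      then show ?thesis by (rule tendsto_eventually)
    next
      case False
      have "indicator {a n..b n} x = (0::ennreal)" for n
        using False ab(1)[of n] by (auto split: split_indicator)
      then show ?thesis using False by simp
    qed
  qed auto
  show ?thesis using LIMSEQ_unique[OF l1 l2[folded eq]] by (simp add: mult_ac)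
qed

lemma nn_integral_neg_inverse_coordinate:
  assumes I: "finite I" "p \<in> I" and F[measurable]: "F \<in> borel_measurable (lborel_Pi I)"
  shows "(\<integral>\<^sup>+f. ennreal (1 / (f p)\<^sup>2) * F (f(p := - 1 / f p)) * indicator {0<..} (f p) \<partial>lborel_Pi I)
    = (\<integral>\<^sup>+f. F f * indicator {..<0} (f p) \<partial>lborel_Pi I)"
proof -
  define J where "J = I - {p}"
  have J: "finite J" "p \<notin> J" and IJ: "I = insert p J" using I by (auto simp: J_def)
  note [measurable] = borel_measurable_lborel_Pi_component[OF I(2)]
  have [measurable]: "(\<lambda>f. f(p := - 1 / f p)) \<in> lborel_Pi I \<rightarrow>\<^sub>M lborel_Pi I"
    by (intro measurable_lborel_Pi_fun_upd I) measurable
  let ?G = "\<lambda>f. ennreal (1 / (f p)\<^sup>2) * F (f(p := - 1 / f p)) * indicator {0<..} (f p)"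
  let ?H = "\<lambda>f. F f * indicator {..<0} (f p)"
  have G: "?G \<in> borel_measurable (lborel_Pi (insert p J))" unfolding IJ[symmetric] by measurable
  have H: "?H \<in> borel_measurable (lborel_Pi (insert p J))" unfolding IJ[symmetric] by measurable
  have "(\<integral>\<^sup>+f. ?G f \<partial>lborel_Pi I) = (\<integral>\<^sup>+f. (\<integral>\<^sup>+y. ?G (f(p := y)) \<partial>lborel) \<partial>lborel_Pi J)"
    unfolding IJ by (rule lborel_product.product_nn_integral_insert[OF J G])
  also have "\<dots> = (\<integral>\<^sup>+f. (\<integral>\<^sup>+y. ?H (f(p := y)) \<partial>lborel) \<partial>lborel_Pi J)"
  proof (rule nn_integral_cong)
    fix f assume f: "f \<in> space (lborel_Pi J)"
    define g where "g y = F (f(p := y))" for y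
    have gm: "g \<in> borel_measurable borel"
    proof -
      have "(\<lambda>y. f(p := y)) \<in> borel \<rightarrow>\<^sub>M lborel_Pi I"
        by (rule measurable_fun_upd[where J = J, OF _ measurable_const[OF f]]) (auto simp: IJ)
      from measurable_compose[OF this F] show ?thesis by (simp add: g_def[abs_def])
    qed
    show "(\<integral>\<^sup>+y. ?G (f(p := y)) \<partial>lborel) = (\<integral>\<^sup>+y. ?H (f(p := y)) \<partial>lborel)"
      using nn_integral_neg_inverse[OF gm] by (simp add: g_def)
  qed
  also have "\<dots> = (\<integral>\<^sup>+f. ?H f \<partial>lborel_Pi I)"
    unfolding IJ by (rule lborel_product.product_nn_integral_insert[OF J H, symmetric])
  finally show ?thesis .
qed

lemma measurable_affine_block:
  fixes \<alpha> \<gamma> :: "'i \<Rightarrow> ('i \<Rightarrow> real) \<Rightarrow> real"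
  assumes C: "C \<subseteq> I"
    and meas: "\<And>p. p \<in> C \<Longrightarrow> \<alpha> p \<in> borel_measurable (lborel_Pi I)" "\<And>p. p \<in> C \<Longrightarrow> \<gamma> p \<in> borel_measurable (lborel_Pi I)"
  shows "(\<lambda>f p. if p \<in> C then \<alpha> p f * f p + \<gamma> p f else f p) \<in> lborel_Pi I \<rightarrow>\<^sub>M lborel_Pi I"
proof -
  let ?T = "\<lambda>f p. if p \<in> C then \<alpha> p f * f p + \<gamma> p f else f p"
  have "(\<lambda>f. \<lambda>p\<in>I. ?T f p) \<in> lborel_Pi I \<rightarrow>\<^sub>M lborel_Pi I"
  proof (rule measurable_restrict)
    fix p assume p: "p \<in> I"
    show "(\<lambda>f. ?T f p) \<in> lborel_Pi I \<rightarrow>\<^sub>M lborel"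
      using meas[of p] borel_measurable_lborel_Pi_component[OF p] by (cases "p \<in> C") auto
  qed
  moreover have "(\<lambda>p\<in>I. ?T f p) = ?T f" if "f \<in> space (lborel_Pi I)" for f
  proof
    fix p show "(\<lambda>p\<in>I. ?T f p) p = ?T f p"
      using that C by (auto simp: space_PiM PiE_iff extensional_def)
  qed
  ultimately show ?thesis by (subst measurable_cong) auto
qed

text \<open>The symmetric sweep operator: sweeping over all indices turns \<open>X\<close> into \<open>- X\<^sup>-\<^sup>1\<close>.\<close>

definition sweep :: "'r \<Rightarrow> real^'r^'r \<Rightarrow> real^'r^'r" where
  "sweep k Y = (\<chi> i j. if i = k then (if j = k then - 1 / Y$k$k else Y$k$j / Y$k$k)
    else if j = k then Y$i$k / Y$k$k else Y$i$j - Y$i$k * Y$k$j / Y$k$k)"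

lemma measurable_sweep [measurable]: "sweep k \<in> borel \<rightarrow>\<^sub>M borel"
  unfolding sweep_def by (rule borel_measurable_mat_lambda) measurable

text \<open>With pivot y = Y_kk, a sweep factors into a translation of the entries outside row and
  column k, a scaling of the r - 1 off-diagonal entries of row k by 1 / y, and the inversion of the
  pivot with factor 1 / y^2. Together they give y^(-(r + 1)).\<close>

lemma nn_integral_sweep:
  fixes k :: "'r::finite" and F :: "real^'r^'r \<Rightarrow> ennreal"
  assumes [measurable]: "F \<in> borel_measurable borel"
  shows "(\<integral>\<^sup>+Y. ennreal (1 / (Y$k$k) ^ (CARD('r) + 1)) * F (sweep k Y) * indicator {0<..} (Y$k$k) \<partial>sym_lborel)
    = (\<integral>\<^sup>+Y. F Y * indicator {..<0} (Y$k$k) \<partial>sym_lborel)"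
proof -
  let ?P = "lborel_Pi (pairs :: 'r set set)"
  have comps: "(\<lambda>f. f p) \<in> borel_measurable ?P" if "p \<in> pairs" for p :: "'r set"
    by (rule borel_measurable_lborel_Pi_component[OF that])
  have [measurable]: "(\<lambda>f. f {i, j}) \<in> borel_measurable ?P" for i j :: 'r
    by (rule comps, rule doubleton_in_pairs)
  have [measurable]: "(\<lambda>f. f {i}) \<in> borel_measurable ?P" for i :: 'r
    by (rule comps, rule singleton_in_pairs)
  \<comment> \<open>The value 1 at a zero pivot keeps the scaling invertible everywhere, as the
    block substitution demands; the indicator of a positive pivot hides it.\<close>
  define \<alpha> where "\<alpha> f = (if f {k} = 0 then 1 else 1 / f {k})" for f :: "'r set \<Rightarrow> real"
  define B where "B = (\<lambda>j. {k, j}) ` (UNIV - {k})"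
  \<comment> \<open>An arbitrary ordering of the unordered pair. The product of the entries {k, i}
    and {k, j} in \<gamma> is symmetric in i and j, so the choice does not affect its value.\<close>
  define rep where "rep p = (SOME x. p = {fst x, snd x})" for p :: "'r set"
  have rep: "p = {fst (rep p), snd (rep p)}" if "p \<in> pairs" for p
  proof -
    have "\<exists>x. p = {fst x, snd x}" using that by auto
    then show ?thesis unfolding rep_def by (rule someI_ex)
  qed
  define C where "C = {p \<in> pairs. k \<notin> p}"
  define \<gamma> where "\<gamma> p f = - (f {k, fst (rep p)} * f {k, snd (rep p)} / f {k})" for p and f :: "'r set \<Rightarrow> real"
  define TB where "TB f = (\<lambda>p. if p \<in> B then \<alpha> f * f p + 0 else f p)" for f
  define TC where "TC f = (\<lambda>p. if p \<in> C then 1 * f p + \<gamma> p f else f p)" for f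
  have \<alpha>m[measurable]: "\<alpha> \<in> borel_measurable ?P" unfolding \<alpha>_def by measurable
  have \<gamma>m[measurable]: "\<gamma> p \<in> borel_measurable ?P" for p unfolding \<gamma>_def by measurable
  have BP: "B \<subseteq> pairs" and CP: "C \<subseteq> pairs" by (auto simp: B_def C_def)
  have TBm[measurable]: "TB \<in> ?P \<rightarrow>\<^sub>M ?P" unfolding TB_def by (rule measurable_affine_block[OF BP]) (rule \<alpha>m, simp)
  have TCm[measurable]: "TC \<in> ?P \<rightarrow>\<^sub>M ?P" unfolding TC_def by (rule measurable_affine_block[OF CP]) (simp, rule \<gamma>m)
  have mB: "{i, j} \<in> B \<longleftrightarrow> i \<noteq> j \<and> (i = k \<or> j = k)" for i j
  proof
    assume "{i, j} \<in> B"
    then obtain l where l: "l \<noteq> k" "{i, j} = {k, l}" unfolding B_def by blast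
    from l(2) have "i = k \<and> j = l \<or> i = l \<and> j = k" by (simp only: doubleton_eq_iff)
    with l(1) show "i \<noteq> j \<and> (i = k \<or> j = k)" by blast
  next
    assume a: "i \<noteq> j \<and> (i = k \<or> j = k)"
    then have "{i, j} = {k, if i = k then j else i}" by auto
    moreover have "(if i = k then j else i) \<in> UNIV - {k}" using a by auto
    ultimately show "{i, j} \<in> B" unfolding B_def by (rule image_eqI)
  qed
  have mB1: "{i} \<notin> B" for i using mB[of i i] by simp
  have mC: "{i, j} \<in> C \<longleftrightarrow> i \<noteq> k \<and> j \<noteq> k" for i j by (auto simp: C_def)
  have mC1: "{k} \<notin> C" by (simp add: C_def)
  have cardB: "card B = CARD('r) - 1"
  proof -
    have "inj_on (\<lambda>j. {k, j}) (UNIV - {k})" by (auto simp: inj_on_def doubleton_eq_iff)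
    then show ?thesis by (simp add: B_def card_image card_Diff_singleton)
  qed
  have upd[measurable]: "(\<lambda>f. f({k} := - 1 / f {k})) \<in> ?P \<rightarrow>\<^sub>M ?P"
    by (intro measurable_lborel_Pi_fun_upd singleton_in_pairs) measurable
  define G1 where "G1 f = ennreal (1 / (f {k})\<^sup>2) * F (sym_mat_of (f({k} := - 1 / f {k}))) * indicator {0<..} (f {k})" for f
  have G1m[measurable]: "G1 \<in> borel_measurable ?P" unfolding G1_def by measurable
  define G2 where "G2 f = ennreal (\<Prod>p\<in>B. \<bar>\<alpha> f\<bar>) * G1 (TB f)" for f
  have G2m[measurable]: "G2 \<in> borel_measurable ?P" unfolding G2_def by measurable
  have \<gamma>C: "{k, fst (rep p)} \<notin> C \<and> {k, snd (rep p)} \<notin> C" for p by (simp add: mC)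
  have "(\<integral>\<^sup>+Y. F Y * indicator {..<0} (Y$k$k) \<partial>sym_lborel) = (\<integral>\<^sup>+f. F (sym_mat_of f) * indicator {..<0} (f {k}) \<partial>?P)"
    by (subst nn_integral_sym_lborel) auto
  also have "\<dots> = (\<integral>\<^sup>+f. G1 f \<partial>?P)"
    unfolding G1_def by (rule nn_integral_neg_inverse_coordinate[symmetric, OF finite_pairs singleton_in_pairs]) measurable
  also have "\<dots> = (\<integral>\<^sup>+f. G2 f \<partial>?P)"
    unfolding G2_def TB_def
  proof (rule nn_integral_affine_block[symmetric, OF finite_pairs BP])
    show "\<alpha> f = \<alpha> g" if "\<And>i. i \<notin> B \<Longrightarrow> f i = g i" for f g
      using that[OF mB1[of k]] by (simp add: \<alpha>_def)
    show "\<alpha> f \<noteq> 0" for f by (simp add: \<alpha>_def)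
    show "\<alpha> \<in> borel_measurable ?P" by (rule \<alpha>m)
    show "G1 \<in> borel_measurable ?P" by (rule G1m)
  qed auto
  also have "\<dots> = (\<integral>\<^sup>+f. ennreal (\<Prod>p\<in>C. \<bar>1\<bar>) * G2 (TC f) \<partial>?P)"
    unfolding TC_def
  proof (rule nn_integral_affine_block[symmetric, OF finite_pairs CP])
    show "\<gamma> p f = \<gamma> p g" if "\<And>i. i \<notin> C \<Longrightarrow> f i = g i" for p f g
      using \<gamma>C[of p] that mC1 unfolding \<gamma>_def by simp
    show "\<gamma> p \<in> borel_measurable ?P" for p by (rule \<gamma>m)
    show "G2 \<in> borel_measurable ?P" by (rule G2m)
  qed auto
  \<comment> \<open>The maps act in the order translation, scaling, inversion, so that each of the
    first two still sees the original pivot and the translation sees the unscaled row k.\<close>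
  also have "\<dots> = (\<integral>\<^sup>+f. ennreal (1 / (sym_mat_of f$k$k) ^ (CARD('r) + 1)) * F (sweep k (sym_mat_of f)) * indicator {0<..} (sym_mat_of f$k$k) \<partial>?P)"
  proof (rule nn_integral_cong)
    fix f :: "'r set \<Rightarrow> real"
    show "ennreal (\<Prod>p\<in>C. \<bar>1\<bar>) * G2 (TC f) = ennreal (1 / (sym_mat_of f$k$k) ^ (CARD('r) + 1)) * F (sweep k (sym_mat_of f)) * indicator {0<..} (sym_mat_of f$k$k)"
    proof (cases "0 < f {k}")
      case False
      then show ?thesis by (simp add: G2_def G1_def TB_def TC_def mB1 mC1)
    next
      case True
      have k1: "TC f {k} = f {k}" "TB (TC f) {k} = f {k}" by (simp_all add: TB_def TC_def mB1 mC1)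
      have a: "\<alpha> (TC f) = 1 / f {k}" using True by (simp add: \<alpha>_def k1)
      have eq: "sym_mat_of ((TB (TC f))({k} := - 1 / f {k})) = sweep k (sym_mat_of f)"
      proof -
        have "((TB (TC f))({k} := - 1 / f {k})) {i, j} = sweep k (sym_mat_of f) $ i $ j" for i j
        proof (cases "i = k \<or> j = k")
          case True
          then show ?thesis
            using \<open>0 < f {k}\<close> a mB[of i j] mC[of i j] by (auto simp: sweep_def TB_def TC_def insert_commute)
        next
          case False
          have "{i, j} \<noteq> {k}" using False by auto
          moreover have "f {k, fst (rep {i, j})} * f {k, snd (rep {i, j})} = f {i, k} * f {k, j}"
          proof -
            have "{i, j} = {fst (rep {i, j}), snd (rep {i, j})}" by (rule rep) (rule doubleton_in_pairs)
            then have "i = fst (rep {i, j}) \<and> j = snd (rep {i, j}) \<or> i = snd (rep {i, j}) \<and> j = fst (rep {i, j})"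
              by (simp only: doubleton_eq_iff)
            moreover have ki: "{i, k} = {k, i}" by auto
            ultimately show ?thesis unfolding ki
            proof (elim disjE conjE)
              assume e: "i = fst (rep {i, j})" "j = snd (rep {i, j})"
              show "f {k, fst (rep {i, j})} * f {k, snd (rep {i, j})} = f {k, i} * f {k, j}"
                by (simp only: e[symmetric])
            next
              assume e: "i = snd (rep {i, j})" "j = fst (rep {i, j})"
              show "f {k, fst (rep {i, j})} * f {k, snd (rep {i, j})} = f {k, i} * f {k, j}"
                by (simp only: e[symmetric] mult.commute)
            qed
          qed
          ultimately show ?thesis using False mB[of i j] mC[of i j] by (simp add: sweep_def TB_def TC_def \<gamma>_def)
        qed
        then show ?thesis unfolding vec_eq_iff sym_mat_of_nth by blast
      qed
      have r: "CARD('r) + 1 = (CARD('r) - 1) + 2" using zero_less_card_finite[where 'a='r] by linarith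
      have "(\<Prod>p\<in>B. \<bar>\<alpha> (TC f)\<bar>) * (1 / (f {k})\<^sup>2) = 1 / (f {k}) ^ (CARD('r) + 1)"
        unfolding r power_add using True by (simp add: a cardB power_one_over)
      then have "ennreal (\<Prod>p\<in>B. \<bar>\<alpha> (TC f)\<bar>) * ennreal (1 / (f {k})\<^sup>2) = ennreal (1 / (f {k}) ^ (CARD('r) + 1))"
        by (subst ennreal_mult[symmetric]) (auto intro!: prod_nonneg)
      moreover have "sym_mat_of ((TB (TC f))({k} := - (1 / f {k}))) = sweep k (sym_mat_of f)" using eq by simp
      ultimately show ?thesis using True by (simp add: G2_def G1_def k1 mult.assoc[symmetric])
    qed
  qed
  also have "\<dots> = (\<integral>\<^sup>+Y. ennreal (1 / (Y$k$k) ^ (CARD('r) + 1)) * F (sweep k Y) * indicator {0<..} (Y$k$k) \<partial>sym_lborel)"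
    by (rule nn_integral_sym_lborel[symmetric]) measurable
  finally show ?thesis ..
qed

text \<open>By homogeneity it suffices to test unit vectors, and by compactness of the sphere
  positivity means a lower bound 1 / (n + 1) for some n. This replaces an uncountable quantifier by
  a countable union of closed sets.\<close>

lemma borel_positive_forms:
  fixes Q :: "'a::topological_space \<Rightarrow> real^'r \<Rightarrow> real"
  assumes c1: "\<And>z. continuous_on UNIV (\<lambda>Y. Q Y z)" and c2: "\<And>Y. continuous_on UNIV (Q Y)"
    and hom: "\<And>Y c z. Q Y (c *\<^sub>R z) = c\<^sup>2 * Q Y z"
  shows "{Y. \<forall>z. z \<noteq> 0 \<longrightarrow> 0 < Q Y z} \<in> sets borel"
proof -
  have "{Y. \<forall>z. z \<noteq> 0 \<longrightarrow> 0 < Q Y z} = (\<Union>n. \<Inter>z\<in>sphere 0 1. {Y. 1 / real (Suc n) \<le> Q Y z})"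
  proof (intro set_eqI iffI)
    fix Y assume Y: "Y \<in> {Y. \<forall>z. z \<noteq> 0 \<longrightarrow> 0 < Q Y z}"
    have "sphere 0 1 \<noteq> ({} :: (real^'r) set)" by simp
    then obtain z0 where z0: "z0 \<in> sphere 0 1" "\<And>z. z \<in> sphere 0 1 \<Longrightarrow> Q Y z0 \<le> Q Y z"
      using continuous_attains_inf[of "sphere 0 1 :: (real^'r) set" "Q Y"] continuous_on_subset[OF c2[of Y]] by auto
    then have "z0 \<noteq> 0" by auto
    then have "0 < Q Y z0" using Y by auto
    then obtain n where "1 / real (Suc n) < Q Y z0" using nat_approx_posE by metis
    then show "Y \<in> (\<Union>n. \<Inter>z\<in>sphere 0 1. {Y. 1 / real (Suc n) \<le> Q Y z})" using z0(2) by (auto intro!: exI[of _ n] intro: order_trans[OF less_imp_le])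
  next
    fix Y assume "Y \<in> (\<Union>n. \<Inter>z\<in>sphere 0 1. {Y. 1 / real (Suc n) \<le> Q Y z})"
    then obtain n where "\<forall>z\<in>sphere 0 1. 1 / real (Suc n) \<le> Q Y z" by blast
    then have n: "\<And>z. norm z = 1 \<Longrightarrow> 1 / real (Suc n) \<le> Q Y z" by simp
    have "0 < Q Y z" if "z \<noteq> 0" for z
    proof -
      have "0 < 1 / real (Suc n)" by simp
      also have "\<dots> \<le> Q Y ((1 / norm z) *\<^sub>R z)" by (rule n) (use that in simp)
      finally have "0 < Q Y ((1 / norm z) *\<^sub>R z)" .
      then show ?thesis using that by (simp add: hom zero_less_mult_iff)
    qed
    then show "Y \<in> {Y. \<forall>z. z \<noteq> 0 \<longrightarrow> 0 < Q Y z}" by simp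
  qed
  moreover have "closed (\<Inter>z\<in>sphere 0 1. {Y. 1 / real (Suc n) \<le> Q Y z})" for n
    using c1 by (intro closed_INT ballI closed_Collect_le continuous_intros) auto
  ultimately show ?thesis
    by (simp only:) (rule sets.countable_UN, use borel_closed in blast)
qed

lemma sets_sym_pos_def [measurable]: "{A. sym_pos_def A} \<in> sets (borel :: (real^'r^'r) measure)"
proof -
  have "closed {X :: real^'r^'r. transpose X = X}"
    unfolding transpose_def by (intro closed_Collect_eq continuous_intros)
  moreover have "{A :: real^'r^'r. \<forall>z. z \<noteq> 0 \<longrightarrow> 0 < z \<bullet> (A *v z)} \<in> sets borel"
    by (rule borel_positive_forms) (auto intro!: continuous_intros simp: matrix_vector_mult_scaleR power2_eq_square)
  moreover have "{A :: real^'r^'r. sym_pos_def A} = {X. transpose X = X} \<inter> {A. \<forall>z. z \<noteq> 0 \<longrightarrow> 0 < z \<bullet> (A *v z)}"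
    by (auto simp: sym_pos_def_def)
  ultimately show ?thesis by (simp add: borel_closed)
qed

text \<open>The quadratic form of Y with the rows in K counted negatively. Sweeping preserves its
  values under the matching change of vectors, so positivity of this form is what positive
  definiteness becomes after the indices in K have been swept.\<close>

definition sweep_form :: "'r set \<Rightarrow> real^'r^'r \<Rightarrow> real^'r \<Rightarrow> real" where
  "sweep_form K Y z = (\<Sum>i\<in>UNIV. (if i \<in> K then - 1 else 1) * (z$i * (Y *v z)$i))"

definition sweep_dom :: "'r set \<Rightarrow> (real^'r^'r) set" where
  "sweep_dom K = {Y. \<forall>z. z \<noteq> 0 \<longrightarrow> 0 < sweep_form K Y z}"

lemma sets_sweep_dom [measurable]: "sweep_dom K \<in> sets borel"
  unfolding sweep_dom_def
proof (rule borel_positive_forms)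
  show "continuous_on UNIV (\<lambda>Y. sweep_form K Y z)" "continuous_on UNIV (sweep_form K Y)" for Y z
    unfolding sweep_form_def by (auto intro!: continuous_intros)
  show "sweep_form K Y (c *\<^sub>R z) = c\<^sup>2 * sweep_form K Y z" for Y c z
    unfolding sweep_form_def sum_distrib_left
    by (intro sum.cong) (auto simp: matrix_vector_mult_scaleR power2_eq_square)
qed

lemma sweep_dom_diagonal:
  assumes "Y \<in> sweep_dom K"
  shows "k \<in> K \<Longrightarrow> Y$k$k < 0" "k \<notin> K \<Longrightarrow> 0 < Y$k$k"
proof -
  have "0 < sweep_form K Y (axis k 1)" using assms by (auto simp: sweep_dom_def axis_eq_0_iff)
  also have "sweep_form K Y (axis k 1) = (\<Sum>i\<in>UNIV. if i = k then (if k \<in> K then - 1 else 1) * Y$k$k else 0)"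
    unfolding sweep_form_def matrix_vector_mult_basis by (intro sum.cong) (auto simp: axis_def column_def)
  finally have "0 < (if k \<in> K then - 1 else 1) * Y$k$k" by simp
  then show "k \<in> K \<Longrightarrow> Y$k$k < 0" "k \<notin> K \<Longrightarrow> 0 < Y$k$k" by auto
qed

text \<open>The change of variables that puts the k-th output (Y z)_k in the place of the k-th input
  z_k.\<close>

definition replace_row :: "'r \<Rightarrow> real^'r^'r \<Rightarrow> real^'r^'r" where
  "replace_row k Y = (\<chi> i j. if i = k then Y$k$j else of_bool (i = j))"

lemma replace_row_mult: "(replace_row k Y ** A) $ i = (if i = k then (Y ** A) $ k else A $ i)" for A :: "real^'n^'r"
proof -
  have "(replace_row k Y ** A) $ i $ j = (if i = k then (Y ** A) $ k $ j else A $ i $ j)" for j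
    by (simp add: replace_row_def matrix_matrix_mult_def of_bool_def if_distrib[of "\<lambda>c. c * _"] cong: if_cong)
  then show ?thesis by (simp add: vec_eq_iff)
qed

lemma replace_row_mult_vec: "(replace_row k Y *v z) $ i = (if i = k then (Y *v z) $ k else z $ i)"
  by (simp add: replace_row_def matrix_vector_mult_def of_bool_def if_distrib[of "\<lambda>c. c * _"] cong: if_cong)

lemma det_replace_row: "det (replace_row k Y) = Y$k$k"
proof -
  have "transpose (replace_row k Y) = (\<chi> i j. if j = k then (mat 1 *v (Y$k))$i else mat 1 $i$j)"
    by (simp add: vec_eq_iff replace_row_def transpose_def) (simp add: mat_def)
  then have "det (transpose (replace_row k Y)) = Y$k$k * det (mat 1 :: real^'a^'a)"
    using cramer_lemma[of k "mat 1" "Y$k"] by simp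
  then show ?thesis by simp
qed

text \<open>The principal pivot: the swept matrix exchanges the k-th input and output of Y, up to a
  sign, and keeps all other inputs and outputs. This property determines the entries of
  \<open>sweep\<close>.\<close>

lemma sweep_mult_vec:
  assumes "Y$k$k \<noteq> 0"
  shows "(sweep k Y *v (replace_row k Y *v z)) $ i = (if i = k then - z$k else (Y *v z)$i)"
proof -
  let ?w = "replace_row k Y *v z" and ?d = "Y$k$k"
  define s where "s i = (\<Sum>j\<in>UNIV - {k}. Y$i$j * z$j)" for i
  have Yz: "(Y *v z)$i = Y$i$k * z$k + s i" for i
    unfolding matrix_vector_mult_def s_def by (simp add: sum.remove[of UNIV k])
  have "(sweep k Y *v ?w)$i = sweep k Y$i$k * ?w$k + (\<Sum>j\<in>UNIV - {k}. sweep k Y$i$j * ?w$j)"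
    unfolding matrix_vector_mult_def[of "sweep k Y"] by (simp add: sum.remove[of UNIV k])
  also have "(\<Sum>j\<in>UNIV - {k}. sweep k Y$i$j * ?w$j) = (\<Sum>j\<in>UNIV - {k}. sweep k Y$i$j * z$j)"
    by (intro sum.cong) (auto simp: replace_row_mult_vec)
  also have "?w$k = ?d * z$k + s k" by (simp add: replace_row_mult_vec Yz)
  also have "sweep k Y$i$k * (?d * z$k + s k) + (\<Sum>j\<in>UNIV - {k}. sweep k Y$i$j * z$j)
      = (if i = k then - z$k else (Y *v z)$i)"
  proof (cases "i = k")
    case True
    have "(\<Sum>j\<in>UNIV - {k}. sweep k Y$k$j * z$j) = s k / ?d"
      unfolding s_def sum_divide_distrib by (intro sum.cong) (auto simp: sweep_def)
    moreover have "sweep k Y$k$k * (?d * z$k + s k) = - z$k - s k / ?d"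
      using assms by (simp add: sweep_def field_simps)
    ultimately show ?thesis using True by simp
  next
    case False
    have "(\<Sum>j\<in>UNIV - {k}. sweep k Y$i$j * z$j) = (\<Sum>j\<in>UNIV - {k}. Y$i$j * z$j - Y$i$k / ?d * (Y$k$j * z$j))"
      by (intro sum.cong) (auto simp: sweep_def False left_diff_distrib)
    also have "\<dots> = s i - Y$i$k / ?d * s k" by (simp add: s_def sum_subtractf sum_distrib_left)
    finally show ?thesis using False assms by (simp add: sweep_def Yz field_simps)
  qed
  finally show ?thesis .
qed

lemma sweep_mult:
  fixes A :: "real^'r^'r"
  assumes "Y$k$k \<noteq> 0"
  shows "(sweep k Y ** (replace_row k Y ** A)) $ i = (if i = k then - (A$k) else (Y ** A)$i)"
proof -
  have "(sweep k Y ** (replace_row k Y ** A)) $ i $ j = (if i = k then - (A$k) else (Y ** A)$i) $ j" for j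
  proof -
    have c: "(M ** B) $ i $ j = (M *v column j B) $ i" for M B :: "real^'r^'r" and i
      by (simp add: matrix_matrix_mult_def matrix_vector_mult_def column_def)
    have "column j (replace_row k Y ** A) = replace_row k Y *v column j A"
      by (simp add: vec_eq_iff column_def matrix_matrix_mult_def matrix_vector_mult_def)
    then show ?thesis unfolding c using sweep_mult_vec[OF assms, of "column j A" i]
      by (simp add: c) (simp add: column_def)
  qed
  then show ?thesis by (simp add: vec_eq_iff)
qed

text \<open>At index k the term z_k (Y z)_k turns into (Y z)_k (- z_k), and the sign attached to k
  changes at the same time.\<close>

lemma sweep_form_sweep:
  assumes k: "k \<notin> K" and d: "Y$k$k \<noteq> 0"
  shows "sweep_form (insert k K) (sweep k Y) (replace_row k Y *v z) = sweep_form K Y z"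
  unfolding sweep_form_def sweep_mult_vec[OF d] replace_row_mult_vec
  by (intro sum.cong) (use k in auto)

lemma sweep_in_sweep_dom:
  assumes k: "k \<notin> K" and d: "Y$k$k \<noteq> 0"
  shows "sweep k Y \<in> sweep_dom (insert k K) \<longleftrightarrow> Y \<in> sweep_dom K"
proof -
  have inv: "invertible (replace_row k Y)" using d by (simp add: invertible_det_nz det_replace_row)
  have nz: "replace_row k Y *v z = 0 \<longleftrightarrow> z = 0" for z
    using inj_matrix_vector_mult[OF inv] by (metis inj_eq matrix_vector_mult_0_right)
  have surj: "\<exists>z. w = replace_row k Y *v z" for w
    using matrix_inv_mult(1)[OF inv] by (metis matrix_vector_mul_assoc matrix_vector_mul_lid)
  show ?thesis
    unfolding sweep_dom_def mem_Collect_eq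
    by (metis nz surj sweep_form_sweep[OF k d])
qed

text \<open>S composes the sweeps over K. The matrix equation records the exchange of inputs and
  outputs for all of K at once, so it identifies S regardless of the order of the sweeps. The matrix
  with rows of X in K and rows of the identity elsewhere is a product of row replacements, hence its
  determinant is the product of the pivots, and their Jacobians combine into one power of
  it.\<close>

lemma nn_integral_sweep_all:
  fixes K :: "'r::finite set"
  shows "\<exists>S\<in>borel_measurable borel.
    (\<forall>X. sym_pos_def X \<longrightarrow> S X ** (\<chi> i j. if i \<in> K then X$i$j else of_bool (i = j)) = (\<chi> i j. if i \<in> K then - of_bool (i = j) else X$i$j)
       \<and> S X \<in> sweep_dom K) \<and>
    (\<forall>F\<in>borel_measurable borel.
      (\<integral>\<^sup>+X. ennreal (1 / (det (\<chi> i j. if i \<in> K then X$i$j else of_bool (i = j))) ^ (CARD('r) + 1)) * F (S X) * indicator {A. sym_pos_def A} X \<partial>sym_lborel)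
      = (\<integral>\<^sup>+Y. F Y * indicator (sweep_dom K) Y \<partial>(sym_lborel :: (real^'r^'r) measure)))"
proof -
  have "finite K" by simp
  then show ?thesis
  proof (induction K rule: finite_induct)
    case empty
    have one: "(\<chi> i j. of_bool (i = j)) = (mat 1 :: real^'r^'r)" by (simp add: mat_def vec_eq_iff)
    have q: "sweep_form {} X z = z \<bullet> (X *v z)" for X :: "real^'r^'r" and z by (simp add: sweep_form_def inner_vec_def)
    have "sym_pos_def X \<longleftrightarrow> X \<in> sweep_dom {}" if "transpose X = X" for X :: "real^'r^'r"
      using that by (auto simp: sym_pos_def_def sweep_dom_def q)
    then have "(\<integral>\<^sup>+X. F X * indicator {A. sym_pos_def A} X \<partial>sym_lborel) = (\<integral>\<^sup>+Y. F Y * indicator (sweep_dom {}) Y \<partial>(sym_lborel :: (real^'r^'r) measure))" for F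
      by (intro nn_integral_sym_cong) (simp add: indicator_def)
    then show ?case
      by (intro bexI[of _ "\<lambda>X. X"]) (auto simp: one sym_pos_def_def sweep_dom_def q)
  next
    case (insert k K)
    let ?R = "\<lambda>K X. (\<chi> i j. if i \<in> K then X$i$j else of_bool (i = j)) :: real^'r^'r"
    let ?R' = "\<lambda>K X. (\<chi> i j. if i \<in> K then - of_bool (i = j) else X$i$j) :: real^'r^'r"
    from insert obtain S where [measurable]: "S \<in> borel_measurable borel"
      and S: "\<And>X. sym_pos_def X \<Longrightarrow> S X ** ?R K X = ?R' K X" "\<And>X. sym_pos_def X \<Longrightarrow> S X \<in> sweep_dom K"
      and int: "\<And>F. F \<in> borel_measurable borel \<Longrightarrow>
        (\<integral>\<^sup>+X. ennreal (1 / (det (?R K X)) ^ (CARD('r) + 1)) * F (S X) * indicator {A. sym_pos_def A} X \<partial>sym_lborel)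
        = (\<integral>\<^sup>+Y. F Y * indicator (sweep_dom K) Y \<partial>(sym_lborel :: (real^'r^'r) measure))" by blast
    let ?S = "\<lambda>X. sweep k (S X)"
    have d: "0 < S X $ k $ k" if "sym_pos_def X" for X using sweep_dom_diagonal(2)[OF S(2)[OF that]] insert by blast
    have R: "?R (insert k K) X = replace_row k (S X) ** ?R K X" if "sym_pos_def X" for X
    proof -
      have "?R (insert k K) X $ i = (replace_row k (S X) ** ?R K X) $ i" for i
        unfolding replace_row_mult S(1)[OF that] using insert by (simp add: vec_eq_iff)
      then show ?thesis by (simp only: vec_eq_iff[of "?R (insert k K) X"]) simp
    qed
    have "?S X ** ?R (insert k K) X = ?R' (insert k K) X" if X: "sym_pos_def X" for X
    proof -
      have "(?S X ** ?R (insert k K) X) $ i = ?R' (insert k K) X $ i" for i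
        unfolding R[OF X] using d[OF X] insert
        by (subst sweep_mult) (auto simp: S(1)[OF X] vec_eq_iff)
      then show ?thesis by (simp only: vec_eq_iff[of "?S X ** ?R (insert k K) X"]) simp
    qed
    moreover have "?S X \<in> sweep_dom (insert k K)" if X: "sym_pos_def X" for X
      using sweep_in_sweep_dom[of k K "S X"] insert d[OF X] S(2)[OF X] by auto
    moreover have "(\<integral>\<^sup>+X. ennreal (1 / (det (?R (insert k K) X)) ^ (CARD('r) + 1)) * F (?S X) * indicator {A. sym_pos_def A} X \<partial>sym_lborel)
        = (\<integral>\<^sup>+Y. F Y * indicator (sweep_dom (insert k K)) Y \<partial>(sym_lborel :: (real^'r^'r) measure))"
      if F[measurable]: "F \<in> borel_measurable borel" for F
    proof -
      define F1 where "F1 Y = ennreal (1 / (Y$k$k) ^ (CARD('r) + 1)) * F (sweep k Y) * indicator {0<..} (Y$k$k)" for Y :: "real^'r^'r"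
      have [measurable]: "F1 \<in> borel_measurable borel" unfolding F1_def by measurable
      have "ennreal (1 / (det (?R (insert k K) X)) ^ (CARD('r) + 1)) * F (?S X) * indicator {A. sym_pos_def A} X
          = ennreal (1 / (det (?R K X)) ^ (CARD('r) + 1)) * F1 (S X) * indicator {A. sym_pos_def A} X" for X
      proof (cases "sym_pos_def X")
        case True
        have "det (?R (insert k K) X) = S X $ k $ k * det (?R K X)"
          unfolding R[OF True] by (simp add: det_mul det_replace_row)
        then have "1 / (det (?R (insert k K) X)) ^ (CARD('r) + 1) = 1 / (det (?R K X)) ^ (CARD('r) + 1) * (1 / (S X $ k $ k) ^ (CARD('r) + 1))"
          by (simp add: power_mult_distrib)
        then have "ennreal (1 / (det (?R (insert k K) X)) ^ (CARD('r) + 1))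
          = ennreal (1 / (det (?R K X)) ^ (CARD('r) + 1)) * ennreal (1 / (S X $ k $ k) ^ (CARD('r) + 1))"
          by (simp only:) (rule ennreal_mult'', use d[OF True] in simp)
        then show ?thesis using d[OF True] by (simp add: F1_def mult_ac)
      qed simp
      then have "(\<integral>\<^sup>+X. ennreal (1 / (det (?R (insert k K) X)) ^ (CARD('r) + 1)) * F (?S X) * indicator {A. sym_pos_def A} X \<partial>sym_lborel)
        = (\<integral>\<^sup>+Y. F1 Y * indicator (sweep_dom K) Y \<partial>(sym_lborel :: (real^'r^'r) measure))"
        using int[of F1] by simp
      also have "\<dots> = (\<integral>\<^sup>+Y. ennreal (1 / (Y$k$k) ^ (CARD('r) + 1)) * (F (sweep k Y) * indicator (sweep_dom (insert k K)) (sweep k Y)) * indicator {0<..} (Y$k$k) \<partial>sym_lborel)"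
        by (intro nn_integral_cong)
          (use insert sweep_in_sweep_dom[of k K] in \<open>auto simp: F1_def split: split_indicator\<close>)
      also have "\<dots> = (\<integral>\<^sup>+Y. (F Y * indicator (sweep_dom (insert k K)) Y) * indicator {..<0} (Y$k$k) \<partial>sym_lborel)"
        by (rule nn_integral_sweep) measurable
      also have "\<dots> = (\<integral>\<^sup>+Y. F Y * indicator (sweep_dom (insert k K)) Y \<partial>sym_lborel)"
        by (intro nn_integral_cong) (auto split: split_indicator dest: sweep_dom_diagonal(1)[of _ "insert k K" k])
      finally show ?thesis .
    qed
    ultimately show ?case by (intro bexI[of _ ?S]) auto
  qed
qed

text \<open>For K = UNIV the exchange equation reads \<open>S X ** X = - mat 1\<close> and the
  product of the pivots is det X; a reflection then removes the sign.\<close>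

theorem nn_integral_sym_pos_def_inverse:
  fixes F :: "real^'r^'r \<Rightarrow> ennreal"
  assumes F[measurable]: "F \<in> borel_measurable borel"
  shows "(\<integral>\<^sup>+X. ennreal (1 / (det X) ^ (CARD('r) + 1)) * F (matrix_inv X) * indicator {A. sym_pos_def A} X \<partial>sym_lborel)
    = (\<integral>\<^sup>+X. F X * indicator {A. sym_pos_def A} X \<partial>sym_lborel)"
proof -
  obtain S where S: "S \<in> borel_measurable borel"
    "\<And>X. sym_pos_def X \<Longrightarrow> S X ** (\<chi> i j. X$i$j) = ((\<chi> i j. - of_bool (i = j)) :: real^'r^'r)"
    "\<And>F. F \<in> borel_measurable borel \<Longrightarrow>
      (\<integral>\<^sup>+X. ennreal (1 / (det (\<chi> i j. X$i$j)) ^ (CARD('r) + 1)) * F (S X) * indicator {A. sym_pos_def A} X \<partial>sym_lborel)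
      = (\<integral>\<^sup>+Y. F Y * indicator (sweep_dom UNIV) Y \<partial>(sym_lborel :: (real^'r^'r) measure))"
    using nn_integral_sweep_all[of "UNIV :: 'r set"] by auto
  have inv: "matrix_inv X = - S X" if X: "sym_pos_def X" for X
  proof -
    have e: "(\<chi> i j. X$i$j) = X" by (simp add: vec_eq_iff)
    have "((\<chi> i j. - of_bool (i = j)) :: real^'r^'r) = - mat 1" by (simp add: vec_eq_iff mat_def)
    then have "S X ** X = - mat 1" using S(2)[OF X] by (simp add: e)
    then have "(- S X) ** X = mat 1" using scaleR_matrix_left[of "-1" "S X" X] by simp
    then have "X ** (- S X) = mat 1" by (simp add: matrix_left_right_inverse)
    then show ?thesis by (rule matrix_inv_unique)
  qed
  have dom: "- X \<in> sweep_dom UNIV \<longleftrightarrow> sym_pos_def X" if "transpose X = X" for X :: "real^'r^'r"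
  proof -
    have "sweep_form UNIV (- X) z = z \<bullet> (X *v z)" for z
    proof -
      have "- X *v z = - (X *v z)" by (simp add: vec_eq_iff matrix_vector_mult_def sum_negf)
      then show ?thesis by (simp add: sweep_form_def inner_vec_def)
    qed
    then show ?thesis using that by (simp add: sweep_dom_def sym_pos_def_def)
  qed
  have "(\<integral>\<^sup>+X. ennreal (1 / (det X) ^ (CARD('r) + 1)) * F (matrix_inv X) * indicator {A. sym_pos_def A} X \<partial>sym_lborel)
    = (\<integral>\<^sup>+X. ennreal (1 / (det (\<chi> i j. X$i$j)) ^ (CARD('r) + 1)) * F (- S X) * indicator {A. sym_pos_def A} X \<partial>sym_lborel)"
    by (intro nn_integral_cong) (auto simp: inv split: split_indicator)
  also have "\<dots> = (\<integral>\<^sup>+Y. F (- Y) * indicator (sweep_dom UNIV) Y \<partial>sym_lborel)" by (rule S(3)) measurable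
  also have "\<dots> = (\<integral>\<^sup>+Y. F (- (- Y)) * indicator (sweep_dom UNIV) (- Y) \<partial>sym_lborel)"
    by (rule nn_integral_sym_reflect[symmetric]) measurable
  also have "\<dots> = (\<integral>\<^sup>+X. F X * indicator {A. sym_pos_def A} X \<partial>sym_lborel)"
    by (intro nn_integral_sym_cong) (simp add: indicator_def dom)
  finally show ?thesis .
qed

section \<open>Finiteness of matrix beta integrals\<close>

lemma sigma_finite_sym_lborel: "sigma_finite_measure (sym_lborel :: (real^'r^'r) measure)"
proof
  define A where "A n = {X :: real^'r^'r. \<forall>i j. \<bar>X$i$j\<bar> \<le> real n}" for n
  have cl: "closed (A n)" for n
    unfolding A_def by (intro closed_Collect_all closed_Collect_le continuous_intros)
  have fin: "emeasure sym_lborel (A n) \<noteq> \<infinity>" for n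
  proof -
    have "emeasure sym_lborel (A n) = (\<integral>\<^sup>+X. indicator (A n) X \<partial>sym_lborel)"
      using cl by (simp add: borel_closed)
    also have "\<dots> = (\<integral>\<^sup>+f. indicator (A n) (sym_mat_of f) \<partial>lborel_Pi pairs)"
      using cl by (intro nn_integral_sym_lborel) (auto simp: borel_closed)
    also have "\<dots> \<le> (\<integral>\<^sup>+f. (\<Prod>p\<in>(pairs :: 'r set set). indicator {- real n..real n} (f p)) \<partial>lborel_Pi pairs)"
    proof (rule nn_integral_mono)
      fix f :: "'r set \<Rightarrow> real"
      show "indicator (A n) (sym_mat_of f) \<le> (\<Prod>p\<in>pairs. indicator {- real n..real n} (f p) :: ennreal)"
      proof (cases "sym_mat_of f \<in> A n")
        case True
        then have "f p \<in> {- real n..real n}" if "p \<in> pairs" for p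
          using that by (auto simp: A_def abs_le_iff) (metis minus_le_iff)+
        then have "(\<Prod>p\<in>(pairs :: 'r set set). indicator {- real n..real n} (f p) :: ennreal) = 1"
          by (intro prod.neutral) auto
        then show ?thesis by (simp add: indicator_def)
      qed simp
    qed
    also have "\<dots> = (\<Prod>p\<in>(pairs :: 'r set set). \<integral>\<^sup>+x. indicator {- real n..real n} x \<partial>lborel)"
      by (rule lborel_product.product_nn_integral_prod[OF finite_pairs]) auto
    also have "\<dots> < \<infinity>" by (simp add: ennreal_power)
    finally show ?thesis by simp
  qed
  have "\<exists>n. X \<in> A n" for X :: "real^'r^'r"
  proof -
    obtain n where "norm X \<le> real n" using real_arch_simple by blast
    moreover have "\<bar>X$i$j\<bar> \<le> norm X" for i j
      using component_le_norm_cart[of "X$i" j] Finite_Cartesian_Product.norm_nth_le[of X i] by linarith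
    ultimately show ?thesis by (auto simp: A_def intro: order_trans)
  qed
  then show "\<exists>A. countable A \<and> A \<subseteq> sets sym_lborel \<and> \<Union>A = space sym_lborel \<and> (\<forall>a\<in>A. emeasure (sym_lborel :: (real^'r^'r) measure) a \<noteq> \<infinity>)"
    using cl fin by (intro exI[of _ "range A"]) (auto simp: borel_closed)
qed

section \<open>Integrals over bounded coordinates\<close>

lemma prod_indicator_box:
  "finite N \<Longrightarrow> (\<Prod>p\<in>N. indicator {-1..1} (f p) :: ennreal) = indicator {f. \<forall>p\<in>N. \<bar>f p\<bar> \<le> (1::real)} f"
  by (induction N rule: finite_induct) (auto simp: indicator_def abs_le_iff)

lemma borel_measurable_box:
  assumes "finite N" "N \<subseteq> I"
  shows "(\<lambda>f. indicator {f. \<forall>p\<in>N. \<bar>f p\<bar> \<le> (1::real)} f :: ennreal) \<in> borel_measurable (lborel_Pi I)"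
  unfolding prod_indicator_box[OF assms(1), symmetric]
proof (rule borel_measurable_prod_ennreal)
  fix p assume "p \<in> N"
  then have [measurable]: "(\<lambda>f. f p) \<in> borel_measurable (lborel_Pi I)"
    using assms by (intro borel_measurable_lborel_Pi_component) auto
  show "(\<lambda>f. indicator {-1..1} (f p) :: ennreal) \<in> borel_measurable (lborel_Pi I)" by measurable
qed

text \<open>Every coordinate on which h does not depend ranges over an interval of length 2.\<close>

lemma nn_integral_bounded_coordinates:
  assumes "finite N" "finite I" "N \<inter> I = {}"
    and h: "h \<in> borel_measurable (lborel_Pi (I \<union> N))" "h \<in> borel_measurable (lborel_Pi I)"
    and dep: "\<And>f g. (\<And>i. i \<in> I \<Longrightarrow> f i = g i) \<Longrightarrow> h f = h g"
  shows "(\<integral>\<^sup>+f. h f * indicator {f. \<forall>p\<in>N. \<bar>f p\<bar> \<le> 1} f \<partial>lborel_Pi (I \<union> N)) = 2 ^ card N * (\<integral>\<^sup>+f. h f \<partial>lborel_Pi I)"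
  using assms(1,3)
proof (induction N)
  case empty
  then show ?case by simp
next
  case (insert p N)
  have hm: "h \<in> borel_measurable (lborel_Pi (I \<union> M))" if "finite M" for M
  proof -
    have "(\<lambda>f. h (restrict f I)) \<in> borel_measurable (lborel_Pi (I \<union> M))"
      by (rule measurable_compose[OF measurable_restrict_subset h(2)]) auto
    moreover have "h (restrict f I) = h f" for f by (rule dep) auto
    ultimately show ?thesis by simp
  qed
  let ?ind = "\<lambda>N f. indicator {f. \<forall>p\<in>N. \<bar>f p\<bar> \<le> 1} f :: ennreal"
  have indm: "?ind M \<in> borel_measurable (lborel_Pi (I \<union> M'))" if "M \<subseteq> M'" "finite M" for M M'
    using that by (intro borel_measurable_box) auto
  have "(\<integral>\<^sup>+f. h f * ?ind (insert p N) f \<partial>lborel_Pi (I \<union> insert p N))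
    = (\<integral>\<^sup>+f. (\<integral>\<^sup>+y. h (f(p := y)) * ?ind (insert p N) (f(p := y)) \<partial>lborel) \<partial>lborel_Pi (I \<union> N))"
    unfolding Un_insert_right
  proof (rule lborel_product.product_nn_integral_insert)
    show "finite (I \<union> N)" "p \<notin> I \<union> N" using insert assms(2) by auto
    show "(\<lambda>f. h f * ?ind (insert p N) f) \<in> borel_measurable (Pi\<^sub>M (insert p (I \<union> N)) (\<lambda>_. lborel))"
      using hm[of "insert p N"] indm[of "insert p N" "insert p N"] insert
      unfolding Un_insert_right by (intro borel_measurable_times_ennreal) auto
  qed
  also have "\<dots> = (\<integral>\<^sup>+f. 2 * (h f * ?ind N f) \<partial>lborel_Pi (I \<union> N))"
  proof (rule nn_integral_cong)
    fix f
    have "h (f(p := y)) = h f" for y by (rule dep) (use insert in auto)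
    moreover have "?ind (insert p N) (f(p := y)) = ?ind N f * indicator {-1..1} y" for y
      using insert by (auto simp: indicator_def abs_le_iff)
    ultimately have "(\<integral>\<^sup>+y. h (f(p := y)) * ?ind (insert p N) (f(p := y)) \<partial>lborel)
      = (\<integral>\<^sup>+y. (h f * ?ind N f) * indicator {-1..1} (y::real) \<partial>lborel)" by (simp add: mult.assoc)
    also have "\<dots> = (h f * ?ind N f) * 2" by (subst nn_integral_cmult) auto
    finally show "(\<integral>\<^sup>+y. h (f(p := y)) * ?ind (insert p N) (f(p := y)) \<partial>lborel) = 2 * (h f * ?ind N f)"
      by (simp add: mult.commute)
  qed
  also have "\<dots> = 2 * (\<integral>\<^sup>+f. h f * ?ind N f \<partial>lborel_Pi (I \<union> N))"
    using hm[of N] indm[of N N] insert by (intro nn_integral_cmult borel_measurable_times_ennreal) auto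
  also have "\<dots> = 2 ^ card (insert p N) * (\<integral>\<^sup>+f. h f \<partial>lborel_Pi I)"
    using insert by (simp add: mult.assoc)
  finally show ?case .
qed

text \<open>The bound is uniform in c, which will be a quotient of determinants without any bound.
  Where x + c \<le> 1 the full integral of t^s over [0, 1] dominates; elsewhere the integrand is at
  most 1 on an interval of length 2.\<close>

lemma nn_integral_powr_translate_bound:
  fixes s c :: real
  assumes s: "-1 < s" "s \<le> 0"
  shows "(\<integral>\<^sup>+x. ennreal ((x + c) powr s) * indicator {x. \<bar>x\<bar> \<le> 1 \<and> 0 < x + c} x \<partial>lborel) \<le> ennreal (1 / (s + 1) + 2)"
proof -
  have i1: "(\<integral>\<^sup>+t. ennreal (t powr s) * indicator {0..1} t \<partial>lborel) = ennreal (1 / (s + 1))"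
  proof -
    have "((\<lambda>x. x powr s) has_integral (1 powr (s + 1) / (s + 1))) {0..1}"
      by (rule has_integral_powr_from_0) (use s in auto)
    then have "(\<integral>\<^sup>+x. ennreal (indicator {0..1} x * x powr s) \<partial>lborel) = ennreal (1 powr (s + 1) / (s + 1))"
      by (intro nn_integral_has_integral_lebesgue) auto
    moreover have "ennreal (indicator {0..1} x * x powr s) = ennreal (x powr s) * indicator {0..1} x" for x
      by (simp add: indicator_def)
    ultimately show ?thesis by simp
  qed
  have "(\<integral>\<^sup>+x. ennreal ((x + c) powr s) * indicator {x. \<bar>x\<bar> \<le> 1 \<and> 0 < x + c} x \<partial>lborel)
    \<le> (\<integral>\<^sup>+x. ennreal ((c + 1 * x) powr s) * indicator {0..1} (c + 1 * x) + indicator {-1..1} x \<partial>lborel)"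
  proof (rule nn_integral_mono)
    fix x :: real
    show "ennreal ((x + c) powr s) * indicator {x. \<bar>x\<bar> \<le> 1 \<and> 0 < x + c} x
      \<le> ennreal ((c + 1 * x) powr s) * indicator {0..1} (c + 1 * x) + indicator {-1..1} x"
    proof (cases "\<bar>x\<bar> \<le> 1 \<and> 0 < x + c")
      case True
      show ?thesis
      proof (cases "x + c \<le> 1")
        case True
        then show ?thesis using \<open>\<bar>x\<bar> \<le> 1 \<and> 0 < x + c\<close> by (simp add: add.commute indicator_def)
      next
        case False
        then have "(x + c) powr s \<le> (x + c) powr 0" using s by (intro powr_mono) auto
        then have "ennreal ((x + c) powr s) \<le> 1" using False by simp
        then show ?thesis using True False by (simp add: indicator_def abs_le_iff)
      qed
    qed simp
  qed
  also have "\<dots> = (\<integral>\<^sup>+x. ennreal ((c + 1 * x) powr s) * indicator {0..1} (c + 1 * x) \<partial>lborel) + 2"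
    by (subst nn_integral_add) auto
  also have "(\<integral>\<^sup>+x. ennreal ((c + 1 * x) powr s) * indicator {0..1} (c + 1 * x) \<partial>lborel) = ennreal (1 / (s + 1))"
    using nn_integral_real_affine[of "\<lambda>t. ennreal (t powr s) * indicator {0..1} t" 1 c] by (simp add: i1)
  also have "ennreal (1 / (s + 1)) + 2 = ennreal (1 / (s + 1) + 2)"
    using s by (subst ennreal_plus) auto
  finally show ?thesis .
qed

text \<open>The principal submatrix with index set J, completed by the identity so that the matrix
  type stays fixed while J varies; its determinant is the principal minor.\<close>

definition principal :: "'r set \<Rightarrow> ('r set \<Rightarrow> real) \<Rightarrow> real^'r^'r" where
  "principal J f = (\<chi> i j. if i \<in> J \<and> j \<in> J then f {i, j} else of_bool (i = j))"

lemma principal_cong: "(\<And>i j. i \<in> J \<Longrightarrow> j \<in> J \<Longrightarrow> f {i, j} = g {i, j}) \<Longrightarrow> principal J f = principal J g"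
  by (auto simp: principal_def vec_eq_iff)

text \<open>The determinant is linear in row k. The coefficient of the diagonal entry is the
  determinant with row k replaced by a unit vector, to which only permutations fixing k contribute,
  and these give the minor of J.\<close>

lemma det_principal_upd:
  fixes J :: "'r::finite set"
  assumes k: "k \<notin> J"
  shows "det (principal (insert k J) (f({k} := x))) = x * det (principal J f) + det (principal (insert k J) (f({k} := 0)))"
proof -
  let ?M = "\<lambda>x. principal (insert k J) (f({k} := x))"
  define a where "a = ((\<chi> j. of_bool (k = j)) :: real^'r)"
  define b where "b = ?M 0 $ k"
  have sk: "{i, j} = {k} \<longleftrightarrow> i = k \<and> j = k" for i j by auto
  have M: "?M x = (\<chi> i. if i = k then x *s a + b else ?M 0 $ i)"
    by (auto simp: vec_eq_iff principal_def a_def b_def sk)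
  have M0: "?M 0 = (\<chi> i. if i = k then b else ?M 0 $ i)" by (auto simp: vec_eq_iff b_def)
  have "det (?M x) = det (\<chi> i. if i = k then x *s a else ?M 0 $ i) + det (\<chi> i. if i = k then b else ?M 0 $ i)"
    by (subst M) (rule det_row_add)
  also have "det (\<chi> i. if i = k then x *s a else ?M 0 $ i) = x * det (\<chi> i. if i = k then a else ?M 0 $ i)"
    by (rule det_row_mul)
  also have "det (\<chi> i. if i = k then a else ?M 0 $ i) = det (principal J f)"
    unfolding det_def
  proof (rule sum.cong[OF refl])
    fix p assume "p \<in> {p. p permutes (UNIV :: 'r set)}"
    then have p: "p permutes UNIV" by simp
    let ?A = "(\<chi> i. if i = k then a else ?M 0 $ i) :: real^'r^'r"
    have "(\<Prod>i\<in>UNIV. ?A $ i $ p i) = (\<Prod>i\<in>UNIV. principal J f $ i $ p i)"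
    proof (cases "p k = k")
      case True
      have "?A $ i $ p i = principal J f $ i $ p i" for i
      proof (cases "i = k")
        case True
        then show ?thesis using \<open>p k = k\<close> k by (simp add: a_def principal_def)
      next
        case False
        then have "p i \<noteq> k" using True permutes_inj[OF p] by (metis inj_eq)
        then show ?thesis using False by (auto simp: principal_def sk)
      qed
      then show ?thesis by simp
    next
      case False
      then have "?A $ k $ p k = 0" "principal J f $ k $ p k = 0" using k by (auto simp: a_def principal_def)
      then show ?thesis by (metis (no_types, lifting) UNIV_I finite_class.finite_UNIV prod_zero)
    qed
    then show "of_int (sign p) * (\<Prod>i\<in>UNIV. ?A $ i $ p i) = of_int (sign p) * (\<Prod>i\<in>UNIV. principal J f $ i $ p i)" by simp
  qed
  finally show ?thesis by (simp only: M0[symmetric])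
qed

abbreviation pairs_in :: "'r set \<Rightarrow> 'r set set" where
  "pairs_in J \<equiv> {{i, j} | i j. i \<in> J \<and> j \<in> J}"

lemma finite_pairs_in: "finite (pairs_in (J :: 'r::finite set))"
  by (rule finite_subset[OF _ finite_pairs]) auto

lemma measurable_principal:
  assumes "pairs_in J \<subseteq> I"
  shows "principal J \<in> borel_measurable (lborel_Pi I)"
  unfolding principal_def
proof (rule borel_measurable_mat_lambda)
  fix i j :: 'a
  show "(\<lambda>f. if i \<in> J \<and> j \<in> J then f {i, j} else of_bool (i = j)) \<in> borel_measurable (lborel_Pi I)"
  proof (cases "i \<in> J \<and> j \<in> J")
    case True
    then have "{i, j} \<in> I" using assms by blast
    then show ?thesis using True borel_measurable_lborel_Pi_component by simp
  next
    case False
    then have "(\<lambda>f. if i \<in> J \<and> j \<in> J then f {i, j} else of_bool (i = j)) = (\<lambda>f. of_bool (i = j) :: real)" by auto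
    then show ?thesis by simp
  qed
qed

text \<open>Positivity is asked of all minors inside J, not only of the largest, so that membership
  passes to smaller index sets in the induction.\<close>

definition principal_box :: "'r::finite set \<Rightarrow> ('r set \<Rightarrow> real) set" where
  "principal_box J = {f. (\<forall>p\<in>pairs_in J. \<bar>f p\<bar> \<le> 1) \<and> (\<forall>J'\<subseteq>J. 0 < det (principal J' f))}"

lemma borel_measurable_principal_box:
  assumes "pairs_in J \<subseteq> I"
  shows "(\<lambda>f. indicator (principal_box J) f :: ennreal) \<in> borel_measurable (lborel_Pi I)"
proof -
  have "indicator (principal_box J) f = indicator {f. \<forall>p\<in>pairs_in J. \<bar>f p\<bar> \<le> 1} f * (\<Prod>J'\<in>Pow J. indicator {0<..} (det (principal J' f)) :: ennreal)" for f
  proof (cases "\<forall>J'\<subseteq>J. 0 < det (principal J' f)")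
    case True
    then have "(\<Prod>J'\<in>Pow J. indicator {0<..} (det (principal J' f)) :: ennreal) = 1" by (intro prod.neutral) auto
    then show ?thesis using True by (simp add: principal_box_def indicator_def)
  next
    case False
    then have "(\<Prod>J'\<in>Pow J. indicator {0<..} (det (principal J' f)) :: ennreal) = 0"
      by (intro prod_zero) (auto simp: indicator_def)
    then show ?thesis using False by (simp add: principal_box_def indicator_def)
  qed
  moreover have "(\<lambda>f. indicator {f. \<forall>p\<in>pairs_in J. \<bar>f p\<bar> \<le> 1} f :: ennreal) \<in> borel_measurable (lborel_Pi I)"
    by (rule borel_measurable_box[OF finite_pairs_in assms])
  moreover have "(\<lambda>f. \<Prod>J'\<in>Pow J. indicator {0<..} (det (principal J' f)) :: ennreal) \<in> borel_measurable (lborel_Pi I)"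
  proof (intro borel_measurable_prod_ennreal)
    fix J' assume "J' \<in> Pow J"
    then have [measurable]: "principal J' \<in> borel_measurable (lborel_Pi I)"
      using assms by (intro measurable_principal) blast
    show "(\<lambda>f. indicator {0<..} (det (principal J' f)) :: ennreal) \<in> borel_measurable (lborel_Pi I)" by measurable
  qed
  ultimately show ?thesis by simp
qed

text \<open>Induction on the index set: the determinant is affine in the new diagonal entry, with slope the
  determinant of the previous principal submatrix.\<close>

lemma nn_integral_det_principal_finite:
  fixes J :: "'r::finite set"
  assumes s: "-1 < s" "s \<le> 0"
  shows "(\<integral>\<^sup>+f. ennreal (det (principal J f) powr s) * indicator (principal_box J) f \<partial>lborel_Pi (pairs_in J)) < \<infinity>"
proof -
  have "finite J" by simp
  then show ?thesis
  proof (induction J rule: finite_induct)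
    case empty
    have e: "pairs_in ({} :: 'r set) = {}" by auto
    have "(\<integral>\<^sup>+f. ennreal (det (principal {} f) powr s) * indicator (principal_box {}) f \<partial>lborel_Pi ({} :: 'r set set))
      = ennreal (det (principal {} (\<lambda>_. undefined) :: real^'r^'r) powr s) * indicator (principal_box ({} :: 'r set)) (\<lambda>_. undefined)"
      by (rule lborel_product.nn_integral_empty) simp
    also have "\<dots> < \<infinity>" by (simp add: ennreal_mult_less_top indicator_def)
    finally show ?case by (simp add: e)
  next
    case (insert k J)
    define h where "h f = ennreal (det (principal J f) powr s) * indicator (principal_box J) f" for f
    define N where "N = (\<lambda>j. {k, j}) ` J"
    let ?B = "pairs_in J \<union> N"
    have P: "pairs_in (insert k J) = insert {k} ?B" by (auto simp: N_def)
    have kB: "{k} \<notin> ?B" using insert by (auto simp: N_def)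
    have finB: "finite ?B" using finite_pairs_in[of J] by (simp add: N_def)
    have disj: "N \<inter> pairs_in J = {}" using insert by (auto simp: N_def doubleton_eq_iff)
    let ?C = "ennreal (1 / (s + 1) + 2)"
    let ?W = "\<lambda>f. ennreal (det (principal (insert k J) f) powr s) * indicator (principal_box (insert k J)) f"
    have hm: "h \<in> borel_measurable (lborel_Pi I)" if "pairs_in J \<subseteq> I" for I
    proof -
      note [measurable] = measurable_principal[OF that] borel_measurable_principal_box[OF that]
      show ?thesis unfolding h_def by measurable
    qed
    have dep: "h f = h g" if "\<And>i. i \<in> pairs_in J \<Longrightarrow> f i = g i" for f g
    proof -
      have "principal J' f = principal J' g" if "J' \<subseteq> J" for J'
        by (rule principal_cong) (use that \<open>\<And>i. i \<in> pairs_in J \<Longrightarrow> f i = g i\<close> in blast)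
      moreover have "(\<forall>p\<in>pairs_in J. \<bar>f p\<bar> \<le> 1) \<longleftrightarrow> (\<forall>p\<in>pairs_in J. \<bar>g p\<bar> \<le> 1)"
        by (rule ball_cong[OF refl]) (simp only: that)
      ultimately show ?thesis by (simp add: h_def principal_box_def indicator_def)
    qed
    have "(\<integral>\<^sup>+f. ?W f \<partial>lborel_Pi (pairs_in (insert k J)))
      = (\<integral>\<^sup>+f. (\<integral>\<^sup>+x. ?W (f({k} := x)) \<partial>lborel) \<partial>lborel_Pi ?B)"
      unfolding P
    proof (rule lborel_product.product_nn_integral_insert[OF finB kB])
      have sub: "pairs_in (insert k J) \<subseteq> insert {k} ?B" by (rule equalityD1[OF P])
      note [measurable] = measurable_principal[OF sub] borel_measurable_principal_box[OF sub]
      show "?W \<in> borel_measurable (lborel_Pi (insert {k} ?B))" by measurable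
    qed
    \<comment> \<open>The new diagonal entry is integrated out first. What remains depends on the
      entries inside J and on the bounded entries N that join k to J.\<close>
    also have "\<dots> \<le> (\<integral>\<^sup>+f. ?C * (h f * indicator {f. \<forall>p\<in>N. \<bar>f p\<bar> \<le> 1} f) \<partial>lborel_Pi ?B)"
    proof (rule nn_integral_mono)
      fix f :: "'r set \<Rightarrow> real"
      let ?D = "det (principal J f)" and ?c = "det (principal (insert k J) (f({k} := 0)))"
      have pJ: "principal J' (f({k} := x)) = principal J' f" if "J' \<subseteq> J" for J' x
        by (rule principal_cong) (use that insert in auto)
      have hx: "h (f({k} := x)) = h f" for x by (rule dep) (use kB in auto)
      show "(\<integral>\<^sup>+x. ?W (f({k} := x)) \<partial>lborel) \<le> ?C * (h f * indicator {f. \<forall>p\<in>N. \<bar>f p\<bar> \<le> 1} f)"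
      proof (cases "f \<in> principal_box J \<and> (\<forall>p\<in>N. \<bar>f p\<bar> \<le> 1)")
        case False
        have "f({k} := x) \<notin> principal_box (insert k J)" for x
        proof
          assume a: "f({k} := x) \<in> principal_box (insert k J)"
          have "\<bar>f p\<bar> \<le> 1" if "p \<in> ?B" for p
          proof -
            have "p \<in> pairs_in (insert k J)" by (subst P) (rule insertI2[OF that])
            moreover have "\<forall>p\<in>pairs_in (insert k J). \<bar>(f({k} := x)) p\<bar> \<le> 1" using a unfolding principal_box_def mem_Collect_eq by (rule conjunct1)
            ultimately have "\<bar>(f({k} := x)) p\<bar> \<le> 1" by (rule bspec[rotated])
            moreover have "p \<noteq> {k}" using that kB by metis
            ultimately show ?thesis by simp
          qed
          moreover have "0 < det (principal J' f)" if "J' \<subseteq> J" for J'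
          proof -
            have "\<forall>J'\<subseteq>insert k J. 0 < det (principal J' (f({k} := x)))"
              using a unfolding principal_box_def mem_Collect_eq by (rule conjunct2)
            then have "0 < det (principal J' (f({k} := x)))" using subset_insertI2[OF that] by blast
            then show ?thesis by (simp only: pJ[OF that])
          qed
          ultimately have "f \<in> principal_box J" "\<forall>p\<in>N. \<bar>f p\<bar> \<le> 1" unfolding principal_box_def mem_Collect_eq by blast+
          with False show False by blast
        qed
        then show ?thesis by simp
      next
        case True
        then have D: "0 < ?D" unfolding principal_box_def mem_Collect_eq by blast
        have "(\<integral>\<^sup>+x. ?W (f({k} := x)) \<partial>lborel)
          \<le> (\<integral>\<^sup>+x. ennreal (?D powr s) * (ennreal ((x + ?c / ?D) powr s) * indicator {x. \<bar>x\<bar> \<le> 1 \<and> 0 < x + ?c / ?D} x) \<partial>lborel)"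
        proof (rule nn_integral_mono)
          fix x
          show "?W (f({k} := x)) \<le> ennreal (?D powr s) * (ennreal ((x + ?c / ?D) powr s) * indicator {x. \<bar>x\<bar> \<le> 1 \<and> 0 < x + ?c / ?D} x)"
          proof (cases "f({k} := x) \<in> principal_box (insert k J)")
            case True
            \<comment> \<open>With the previous minor D factored out, the new determinant is D times
              a translate of x. The power D^s then belongs to the integrand of the induction
              hypothesis, and the power of the translate is bounded uniformly.\<close>
            have "det (principal (insert k J) (f({k} := x))) = ?D * (x + ?c / ?D)"
              using det_principal_upd[OF insert(2), of f x] D by (simp add: distrib_left mult.commute)
            moreover have "0 < det (principal (insert k J) (f({k} := x)))"
              using True unfolding principal_box_def mem_Collect_eq by blast
            moreover have "\<bar>x\<bar> \<le> 1"
            proof -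
              have "{k} \<in> pairs_in (insert k J)" by (subst P) (rule insertI1)
              moreover have "\<forall>p\<in>pairs_in (insert k J). \<bar>(f({k} := x)) p\<bar> \<le> 1" using True unfolding principal_box_def mem_Collect_eq by (rule conjunct1)
              ultimately have "\<bar>(f({k} := x)) {k}\<bar> \<le> 1" by (rule bspec[rotated])
              then show ?thesis by simp
            qed
            ultimately show ?thesis using D True
              by (simp add: powr_mult ennreal_mult zero_less_mult_iff)
          qed simp
        qed
        also have "\<dots> = ennreal (?D powr s) * (\<integral>\<^sup>+x. ennreal ((x + ?c / ?D) powr s) * indicator {x. \<bar>x\<bar> \<le> 1 \<and> 0 < x + ?c / ?D} x \<partial>lborel)"
        proof -
          have [measurable]: "{x. \<bar>x\<bar> \<le> 1 \<and> 0 < x + c} \<in> sets borel" for c :: real by measurable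
          have "(\<lambda>x. ennreal ((x + c) powr s) * indicator {x. \<bar>x\<bar> \<le> 1 \<and> 0 < x + c} x) \<in> borel_measurable lborel" for c :: real by measurable
          then show ?thesis by (rule nn_integral_cmult)
        qed
        also have "\<dots> \<le> ennreal (?D powr s) * ?C"
          by (intro mult_left_mono nn_integral_powr_translate_bound s) simp
        also have "\<dots> = ?C * (h f * indicator {f. \<forall>p\<in>N. \<bar>f p\<bar> \<le> 1} f)" using True by (simp add: h_def mult.commute)
        finally show ?thesis .
      qed
    qed
    also have "\<dots> = ?C * (\<integral>\<^sup>+f. h f * indicator {f. \<forall>p\<in>N. \<bar>f p\<bar> \<le> 1} f \<partial>lborel_Pi ?B)"
    proof (rule nn_integral_cmult)
      have "(\<lambda>f. indicator {f. \<forall>p\<in>N. \<bar>f p\<bar> \<le> 1} f :: ennreal) \<in> borel_measurable (lborel_Pi ?B)"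
        by (rule borel_measurable_box) (auto simp: N_def)
      then show "(\<lambda>f. h f * indicator {f. \<forall>p\<in>N. \<bar>f p\<bar> \<le> 1} f) \<in> borel_measurable (lborel_Pi ?B)"
        using hm[of ?B] by simp
    qed
    also have "(\<integral>\<^sup>+f. h f * indicator {f. \<forall>p\<in>N. \<bar>f p\<bar> \<le> 1} f \<partial>lborel_Pi ?B) = 2 ^ card N * (\<integral>\<^sup>+f. h f \<partial>lborel_Pi (pairs_in J))"
      by (rule nn_integral_bounded_coordinates[OF _ finite_pairs_in disj hm hm dep]) (auto simp: N_def)
    also have "?C * (2 ^ card N * (\<integral>\<^sup>+f. h f \<partial>lborel_Pi (pairs_in J))) < \<infinity>"
      using insert.IH unfolding h_def by (simp add: ennreal_mult_less_top power_less_top_ennreal)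
    finally show ?case .
  qed
qed

text \<open>The form at z is that of the full matrix at the restriction of z to J plus the squares
  of the remaining coordinates.\<close>

lemma sym_pos_def_principal:
  fixes f :: "'r::finite set \<Rightarrow> real"
  assumes "sym_pos_def (sym_mat_of f)"
  shows "sym_pos_def (principal J f)"
  unfolding sym_pos_def_def
proof (intro conjI allI impI)
  show "transpose (principal J f) = principal J f"
    by (auto simp: transpose_def principal_def vec_eq_iff insert_commute)
  fix z :: "real^'r" assume z: "z \<noteq> 0"
  define w where "w = (\<chi> i. if i \<in> J then z$i else 0)"
  have e: "z \<bullet> (principal J f *v z) = w \<bullet> (sym_mat_of f *v w) + (\<Sum>i\<in>UNIV. if i \<in> J then 0 else (z$i)\<^sup>2)"
  proof -
    have "z$i * (principal J f *v z)$i = w$i * (sym_mat_of f *v w)$i + (if i \<in> J then 0 else (z$i)\<^sup>2)" for i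
    proof (cases "i \<in> J")
      case True
      have "(principal J f *v z)$i = (sym_mat_of f *v w)$i"
        unfolding matrix_vector_mult_def using True
        by (auto simp: principal_def w_def intro!: sum.cong)
      then show ?thesis using True by (simp add: w_def)
    next
      case False
      have "(principal J f *v z)$i = z$i"
        unfolding matrix_vector_mult_def using False
        by (simp add: principal_def of_bool_def if_distrib[of "\<lambda>c. c * _"] cong: if_cong)
      then show ?thesis using False by (simp add: w_def power2_eq_square)
    qed
    then show ?thesis by (simp add: inner_vec_def sum.distrib)
  qed
  show "0 < z \<bullet> (principal J f *v z)"
  proof (cases "w = 0")
    case False
    then have "0 < w \<bullet> (sym_mat_of f *v w)" using assms by (auto simp: sym_pos_def_def)
    then show ?thesis unfolding e by (intro add_pos_nonneg sum_nonneg) auto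
  next
    case True
    obtain i where i: "z$i \<noteq> 0" using z by (auto simp: vec_eq_iff)
    then have "i \<notin> J" using True by (auto simp: w_def vec_eq_iff split: if_splits)
    then have "0 < (\<Sum>i\<in>UNIV. if i \<in> J then 0 else (z$i)\<^sup>2)"
      using i by (intro sum_pos2[of _ i]) auto
    then show ?thesis unfolding e using True by simp
  qed
qed

text \<open>The unit vectors put the diagonal entries in (0, 1); the vectors e_i + e_j and e_i - e_j
  then bound an off-diagonal entry by the mean of two diagonal ones.\<close>

lemma unit_interval_mat_entry_bound:
  fixes A :: "real^'r^'r"
  assumes "A \<in> unit_interval_mat"
  shows "\<bar>A$i$j\<bar> \<le> 1"
proof -
  have A: "sym_pos_def A" "sym_pos_def (mat 1 - A)" using assms by (auto simp: unit_interval_mat_def)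
  have sym: "A$i$j = A$j$i" for i j using sym_pos_defD(1)[OF A(1)] by (simp add: transpose_def vec_eq_iff)
  have q: "(axis i 1 + c *\<^sub>R axis j 1) \<bullet> (M *v (axis i 1 + c *\<^sub>R axis j 1)) = M$i$i + c * M$i$j + c * M$j$i + c\<^sup>2 * M$j$j"
    for M :: "real^'r^'r" and c i j
    by (simp add: matrix_vector_right_distrib matrix_vector_mult_scaleR matrix_vector_mult_basis inner_add_left inner_add_right
        inner_axis' column_def power2_eq_square algebra_simps)
  have d: "0 < A$i$i" "A$i$i < 1" for i
  proof -
    have "(axis i 1 :: real^'r) \<noteq> 0" by (simp add: axis_eq_0_iff)
    from sym_pos_defD(2)[OF A(1) this] sym_pos_defD(2)[OF A(2) this]
    show "0 < A$i$i" "A$i$i < 1" using q[of i 0 i A] q[of i 0 i "mat 1 - A"] by (auto simp: mat_def)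
  qed
  show ?thesis
  proof (cases "i = j")
    case True
    then show ?thesis using d[of i] by simp
  next
    case False
    have "0 \<le> A$i$i + c * A$i$j + c * A$j$i + c\<^sup>2 * A$j$j" for c
      using psdD(2)[OF sym_pos_def_imp_psd[OF A(1)]] q[of i c j A] by metis
    from this[of 1] this[of "-1"] show ?thesis using d[of i] d[of j] sym[of i j] by (simp add: abs_le_iff)
  qed
qed

lemma sets_unit_interval_mat [measurable]: "(unit_interval_mat :: (real^'r^'r) set) \<in> sets borel"
proof -
  have eq: "(unit_interval_mat :: (real^'r^'r) set) = {A. sym_pos_def A} \<inter> ((\<lambda>A. mat 1 - A) -` {A. sym_pos_def A} \<inter> space borel)"
    by (auto simp: unit_interval_mat_def)
  show ?thesis
    unfolding eq
    by (intro sets.Int sets_sym_pos_def measurable_sets[of _ borel borel]) auto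
qed

theorem nn_integral_det_powr_finite:
  fixes s :: real
  assumes s: "-1 < s"
  shows "(\<integral>\<^sup>+A. ennreal (det A powr s) * indicator unit_interval_mat A \<partial>(sym_lborel :: (real^'r^'r) measure)) < \<infinity>"
proof -
  \<comment> \<open>On the domain the determinant is at most 1, so lowering a positive exponent to 0
    only enlarges the integrand.\<close>
  define t where "t = min s 0"
  have t: "-1 < t" "t \<le> 0" using s by (auto simp: t_def)
  have u: "pairs_in (UNIV :: 'r set) = pairs" by auto
  have "(\<integral>\<^sup>+A. ennreal (det A powr s) * indicator unit_interval_mat A \<partial>(sym_lborel :: (real^'r^'r) measure))
    = (\<integral>\<^sup>+f. ennreal (det (sym_mat_of f :: real^'r^'r) powr s) * indicator unit_interval_mat (sym_mat_of f :: real^'r^'r) \<partial>lborel_Pi pairs)"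
    by (rule nn_integral_sym_lborel) measurable
  also have "\<dots> \<le> (\<integral>\<^sup>+f. ennreal (det (principal UNIV f :: real^'r^'r) powr t) * indicator (principal_box UNIV) f \<partial>lborel_Pi pairs)"
  proof (rule nn_integral_mono)
    fix f :: "'r set \<Rightarrow> real"
    have pr: "principal UNIV f = sym_mat_of f" by (simp add: principal_def sym_mat_of_def)
    show "ennreal (det (sym_mat_of f :: real^'r^'r) powr s) * indicator unit_interval_mat (sym_mat_of f :: real^'r^'r)
      \<le> ennreal (det (principal UNIV f :: real^'r^'r) powr t) * indicator (principal_box UNIV) f"
    proof (cases "(sym_mat_of f :: real^'r^'r) \<in> unit_interval_mat")
      case True
      then have A: "sym_pos_def (sym_mat_of f :: real^'r^'r)" "sym_pos_def (mat 1 - sym_mat_of f :: real^'r^'r)"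
        by (auto simp: unit_interval_mat_def)
      have "\<bar>f p\<bar> \<le> 1" if "p \<in> pairs" for p
        using that unit_interval_mat_entry_bound[OF True] by auto
      then have "f \<in> principal_box UNIV"
        using sym_pos_def_det[OF sym_pos_def_principal[OF A(1)]] by (auto simp: principal_box_def)
      moreover have "det (sym_mat_of f :: real^'r^'r) powr s \<le> det (sym_mat_of f :: real^'r^'r) powr t"
      proof -
        have "det (sym_mat_of f) \<le> det (sym_mat_of f + (mat 1 - sym_mat_of f) :: real^'r^'r)"
          by (intro det_mono_psd A sym_pos_def_imp_psd)
        then have "det (sym_mat_of f :: real^'r^'r) \<le> 1" by simp
        then show ?thesis using sym_pos_def_det[OF A(1)] by (intro powr_mono') (auto simp: t_def)
      qed
      ultimately show ?thesis using True by (simp add: pr ennreal_leI)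
    qed simp
  qed
  also have "\<dots> < \<infinity>" using nn_integral_det_principal_finite[OF t, of "UNIV :: 'r set"] unfolding u .
  finally show ?thesis .
qed

text \<open>A cube of free entries around one half of the identity lies in the set.\<close>

lemma emeasure_unit_interval_mat_pos: "emeasure sym_lborel (unit_interval_mat :: (real^'r^'r) set) \<noteq> 0"
proof -
  define n where "n = real CARD('r)"
  have n: "1 \<le> n" unfolding n_def using zero_less_card_finite[where 'a='r] by linarith
  \<comment> \<open>A symmetric perturbation with r^2 entries of size at most e changes the form by
    at most r^2 e |z|^2 = |z|^2 / 4, less than the |z|^2 / 2 at the centre.\<close>
  define e where "e = 1 / (4 * n\<^sup>2)"
  have e: "0 < e" using n by (simp add: e_def)
  define c where "c p = (if card p = 1 then 1 / 2 else 0 :: real)" for p :: "'r set"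
  have unit: "sym_mat_of f \<in> unit_interval_mat" if f: "\<And>p. p \<in> pairs \<Longrightarrow> \<bar>f p - c p\<bar> \<le> e" for f :: "'r set \<Rightarrow> real"
  proof -
    define E where "E = sym_mat_of f - (mat (1 / 2) :: real^'r^'r)"
    have Ee: "\<bar>E$i$j\<bar> \<le> e" for i j
      using f[OF doubleton_in_pairs[of i j]] by (cases "i = j") (auto simp: E_def mat_def c_def)
    have Eb: "\<bar>z \<bullet> (E *v z)\<bar> \<le> (z \<bullet> z) / 4" for z
    proof -
      have "z \<bullet> (E *v z) = (\<Sum>i\<in>UNIV. \<Sum>j\<in>UNIV. z$i * (E$i$j * z$j))"
        by (simp add: inner_vec_def matrix_vector_mult_def sum_distrib_left)
      then have "\<bar>z \<bullet> (E *v z)\<bar> \<le> (\<Sum>i\<in>UNIV. \<Sum>j\<in>UNIV. \<bar>z$i * (E$i$j * z$j)\<bar>)"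
        by (simp only:) (intro order_trans[OF sum_abs] sum_mono sum_abs)
      also have "\<dots> \<le> (\<Sum>i\<in>(UNIV :: 'r set). \<Sum>j\<in>(UNIV :: 'r set). norm z * (e * norm z))"
        unfolding abs_mult by (intro sum_mono mult_mono Ee component_le_norm_cart) (use e in auto)
      also have "\<dots> = n\<^sup>2 * e * (norm z)\<^sup>2" by (simp add: n_def power2_eq_square)
      also have "\<dots> = (z \<bullet> z) / 4" using n by (simp add: e_def power2_norm_eq_inner)
      finally show ?thesis .
    qed
    have A: "sym_mat_of f = E + mat (1 / 2)" by (simp add: E_def)
    have m: "mat 1 - (E + mat (1 / 2)) = mat (1 / 2) - (E :: real^'r^'r)"
      using mat_diff[of 1 "1 / 2"] by (simp add: algebra_simps)
    have t: "transpose E = E" by (simp add: E_def transpose_diff)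
    have "0 < z \<bullet> ((E + mat (1 / 2)) *v z)" "0 < z \<bullet> ((mat (1 / 2) - E) *v z)" if "z \<noteq> 0" for z
    proof -
      have "0 < z \<bullet> z" using that by simp
      moreover have "z \<bullet> ((E + mat (1 / 2)) *v z) = z \<bullet> (E *v z) + (z \<bullet> z) / 2"
        "z \<bullet> ((mat (1 / 2) - E) *v z) = (z \<bullet> z) / 2 - z \<bullet> (E *v z)"
        by (simp_all add: matrix_vector_mult_add_rdistrib matrix_vector_mult_diff_rdistrib mat_vector_mult inner_add_right inner_diff_right)
      ultimately show "0 < z \<bullet> ((E + mat (1 / 2)) *v z)" "0 < z \<bullet> ((mat (1 / 2) - E) *v z)"
        using abs_le_D1[OF Eb[of z]] abs_le_D2[OF Eb[of z]] by linarith+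
    qed
    then show ?thesis unfolding unit_interval_mat_def mem_Collect_eq A m sym_pos_def_def
      by (simp add: transpose_add transpose_diff t)
  qed
  have "0 < (\<Prod>p\<in>(pairs :: 'r set set). ennreal (2 * e))"
    using e by (simp add: ennreal_power)
  also have "\<dots> = (\<Prod>p\<in>(pairs :: 'r set set). \<integral>\<^sup>+x. indicator {c p - e..c p + e} x \<partial>lborel)"
    using e by (intro prod.cong) auto
  also have "\<dots> = (\<integral>\<^sup>+f. (\<Prod>p\<in>(pairs :: 'r set set). indicator {c p - e..c p + e} (f p)) \<partial>lborel_Pi pairs)"
    by (rule lborel_product.product_nn_integral_prod[symmetric, OF finite_pairs]) auto
  also have "\<dots> \<le> (\<integral>\<^sup>+f. indicator unit_interval_mat (sym_mat_of f) \<partial>lborel_Pi (pairs :: 'r set set))"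
  proof (rule nn_integral_mono)
    fix f :: "'r set \<Rightarrow> real"
    show "(\<Prod>p\<in>(pairs :: 'r set set). indicator {c p - e..c p + e} (f p)) \<le> (indicator unit_interval_mat (sym_mat_of f :: real^'r^'r) :: ennreal)"
    proof (cases "\<forall>p\<in>pairs. f p \<in> {c p - e..c p + e}")
      case True
      have "\<bar>f p - c p\<bar> \<le> e" if "p \<in> pairs" for p
        using bspec[OF True that] by (simp add: abs_le_iff)
      then have "(sym_mat_of f :: real^'r^'r) \<in> unit_interval_mat" by (rule unit)
      moreover have "(\<Prod>p\<in>(pairs :: 'r set set). indicator {c p - e..c p + e} (f p) :: ennreal) = 1"
      proof (rule prod.neutral, rule ballI)
        fix p :: "'r set" assume "p \<in> pairs"
        from bspec[OF True this] show "indicator {c p - e..c p + e} (f p) = (1 :: ennreal)" by (rule indicator_simps(1))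
      qed
      ultimately show ?thesis by simp
    next
      case False
      then obtain p where p: "p \<in> pairs" "f p \<notin> {c p - e..c p + e}" by (auto simp only: ball_simps)
      have "(\<Prod>p\<in>(pairs :: 'r set set). indicator {c p - e..c p + e} (f p) :: ennreal) = 0"
        by (rule prod_zero[OF finite_pairs], rule bexI[OF _ p(1)], rule indicator_simps(2)[OF p(2)])
      then show ?thesis by (simp only: zero_le)
    qed
  qed
  also have "\<dots> = emeasure sym_lborel (unit_interval_mat :: (real^'r^'r) set)"
    by (subst nn_integral_sym_lborel[symmetric]) auto
  finally show ?thesis by simp
qed

section \<open>The hierarchical prior as a mixture of normal distributions\<close>

text \<open>Cramer's rule. Unlike \<^const>\<open>matrix_inv\<close>, this is measurable on all matrices.\<close>

definition cramer_inv :: "real^'r^'r \<Rightarrow> real^'r^'r" where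
  "cramer_inv A = (\<chi> k l. det (\<chi> i j. if j = k then of_bool (i = l) else A$i$j) / det A)"

lemma measurable_cramer_inv [measurable]: "cramer_inv \<in> borel \<rightarrow>\<^sub>M borel"
  unfolding cramer_inv_def
proof (rule borel_measurable_mat_lambda)
  fix k l :: 'a
  have [measurable]: "(\<lambda>A :: real^'a^'a. \<chi> i j. if j = k then of_bool (i = l) else A$i$j) \<in> borel \<rightarrow>\<^sub>M borel"
  proof (rule borel_measurable_mat_lambda)
    fix i j :: 'a
    show "(\<lambda>A :: real^'a^'a. if j = k then of_bool (i = l) else A$i$j) \<in> borel_measurable borel"
      by (cases "j = k") auto
  qed
  show "(\<lambda>A :: real^'a^'a. det (\<chi> i j. if j = k then of_bool (i = l) else A$i$j) / det A) \<in> borel_measurable borel"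
    by measurable
qed

lemma cramer_inv_eq_matrix_inv:
  assumes "invertible A"
  shows "cramer_inv A = matrix_inv A"
proof -
  have d: "det A \<noteq> 0" using assms by (simp add: invertible_det_nz)
  have "matrix_inv A $ k $ l = cramer_inv A $ k $ l" for k l
  proof -
    have "A *v (matrix_inv A *v axis l 1) = axis l 1"
      by (simp add: matrix_vector_mul_assoc matrix_inv_mult[OF assms])
    then have "matrix_inv A *v axis l 1 = (\<chi> k. det (\<chi> i j. if j = k then axis l 1 $ i else A$i$j) / det A)"
      using cramer[OF d] by blast
    then have "(matrix_inv A *v axis l 1) $ k = det (\<chi> i j. if j = k then axis l 1 $ i else A$i$j) / det A" by simp
    moreover have "(matrix_inv A *v axis l 1) $ k = matrix_inv A $ k $ l"
      by (simp add: matrix_vector_mult_basis column_def)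
    moreover have "(\<chi> i j. if j = k then axis l 1 $ i else A$i$j) = (\<chi> i j. if j = k then of_bool (i = l) else A$i$j)"
      by (simp add: vec_eq_iff axis_def)
    ultimately show ?thesis by (simp add: cramer_inv_def)
  qed
  then show ?thesis by (simp add: vec_eq_iff)
qed

lemma sym_pos_def_cramer_inv:
  assumes "sym_pos_def A"
  shows "cramer_inv A = matrix_inv A" "cramer_inv A ** A = mat 1" "A ** cramer_inv A = mat 1"
    "sym_pos_def (cramer_inv A)" "transpose (cramer_inv A) = cramer_inv A"
  using sym_pos_def_invertible[OF assms] cramer_inv_eq_matrix_inv[of A] matrix_inv_mult[of A]
    sym_pos_def_matrix_inv[OF assms] matrix_inv_symmetric[OF assms] by auto

section \<open>Gaussian integrals with a matrix covariance\<close>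

lemma inner_self_matrix: "(D ** y) \<bullet> (D ** y) = y \<bullet> ((transpose D ** D) ** y)" for y :: "real^'q^'r"
  using inner_matrix_left[of y "transpose D" "D ** y"] by (simp add: matrix_mul_assoc inner_commute)

lemma nn_integral_gaussian_form:
  fixes P :: "real^'r^'r" and m :: "real^'q^'r"
  assumes P: "sym_pos_def P"
  shows "(\<integral>\<^sup>+y. ennreal (exp (- ((y - m) \<bullet> (P ** (y - m))) / 2)) \<partial>lborel)
    = ennreal ((2 * pi) powr (real DIM(real^'q^'r) / 2) * det P powr (- real CARD('q) / 2))"
proof -
  let ?N = "real DIM(real^'q^'r)"
  obtain C :: "real^'r^'r" where C: "P = C ** transpose C" "invertible C" by (rule sym_pos_def_factor[OF P])
  define D where "D = transpose C"
  have PD: "P = transpose D ** D" by (simp add: D_def C)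
  have dC: "det C \<noteq> 0" using C invertible_det_nz by blast
  have d: "det D \<noteq> 0" using dC by (simp add: D_def)
  have dP: "det P = (det D)\<^sup>2" by (simp add: PD det_mul power2_eq_square)
  have [measurable]: "(\<lambda>y :: real^'q^'r. D ** y) \<in> borel_measurable borel" by measurable
  have e: "exp (- (y \<bullet> (P ** y)) / 2) = (2 * pi) powr (?N / 2) * gauss 1 (D ** y)" for y :: "real^'q^'r"
    unfolding PD inner_self_matrix[symmetric]
    by (simp add: gauss_def power2_norm_eq_inner powr_minus field_simps)
  have "(\<integral>\<^sup>+y. ennreal (exp (- ((y - m) \<bullet> (P ** (y - m))) / 2)) \<partial>lborel) = (\<integral>\<^sup>+y. ennreal (exp (- (y \<bullet> (P ** (y :: real^'q^'r))) / 2)) \<partial>lborel)"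
  proof -
    have "(\<lambda>y :: real^'q^'r. ennreal (exp (- (y \<bullet> (P ** y)) / 2))) \<in> borel_measurable borel" by measurable
    from nn_integral_lborel_diff[OF this, of m] show ?thesis by simp
  qed
  also have "\<dots> = ennreal ((2 * pi) powr (?N / 2)) * (\<integral>\<^sup>+y. ennreal (gauss 1 (D ** (y :: real^'q^'r))) \<partial>lborel)"
    unfolding e by (simp add: ennreal_mult nn_integral_cmult)
  also have "(\<integral>\<^sup>+y. ennreal (gauss 1 (D ** (y :: real^'q^'r))) \<partial>lborel) = ennreal (det P powr (- real CARD('q) / 2))"
  proof -
    let ?I = "\<integral>\<^sup>+y. ennreal (gauss 1 (D ** (y :: real^'q^'r))) \<partial>lborel"
    have "ennreal (\<bar>det D\<bar> ^ CARD('q)) * ?I = 1"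
      using nn_integral_matrix_mult_left[OF d, of "\<lambda>y :: real^'q^'r. ennreal (gauss 1 y)"] by (simp add: nn_integral_gauss)
    moreover have "det P powr (- real CARD('q) / 2) = 1 / \<bar>det D\<bar> ^ CARD('q)"
    proof -
      have e2: "\<bar>det D\<bar> powr 2 = (det D)\<^sup>2" using d by simp
      have "det P powr (- real CARD('q) / 2) = (\<bar>det D\<bar> powr 2) powr (- real CARD('q) / 2)" by (simp only: dP e2)
      also have "\<dots> = \<bar>det D\<bar> powr (2 * (- real CARD('q) / 2))" by (rule powr_powr)
      finally have "det P powr (- real CARD('q) / 2) = \<bar>det D\<bar> powr (- real CARD('q))" by simp
      then show ?thesis using d by (simp add: powr_minus powr_realpow inverse_eq_divide)
    qed
    ultimately have "ennreal (det P powr (- real CARD('q) / 2)) * (ennreal (\<bar>det D\<bar> ^ CARD('q)) * ?I) = ennreal (1 / \<bar>det D\<bar> ^ CARD('q))"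
      by simp
    moreover have "ennreal (det P powr (- real CARD('q) / 2)) * (ennreal (\<bar>det D\<bar> ^ CARD('q)) * ?I) = ?I"
      using d \<open>det P powr (- real CARD('q) / 2) = 1 / \<bar>det D\<bar> ^ CARD('q)\<close>
      by (simp add: mult.assoc[symmetric] ennreal_mult[symmetric])
    ultimately show ?thesis using \<open>det P powr (- real CARD('q) / 2) = 1 / \<bar>det D\<bar> ^ CARD('q)\<close> by simp
  qed
  finally show ?thesis by (simp add: ennreal_mult)
qed

text \<open>Completing the square for an observation z of \<Theta> with noise v I when the columns
  of \<Theta> have covariance H: the posterior precision is P and the posterior mean is
  \<open>H ** B ** z\<close>. Everything follows from P = (1 / v) (v I + H) H^-1.\<close>

lemma gaussian_product_form:
  fixes H :: "real^'r^'r" and z \<Theta> :: "real^'q^'r"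
  assumes v: "0 < v" and H: "sym_pos_def H"
  defines "P \<equiv> mat (1 / v) + matrix_inv H" and "B \<equiv> matrix_inv (mat v + H)"
  shows "(norm (z - \<Theta>))\<^sup>2 / v + \<Theta> \<bullet> (matrix_inv H ** \<Theta>)
    = (\<Theta> - H ** B ** z) \<bullet> (P ** (\<Theta> - H ** B ** z)) + z \<bullet> (B ** z)"
    and "det P = det (mat v + H) / (v ^ CARD('r) * det H)" and "sym_pos_def P"
proof -
  let ?A = "matrix_inv H"
  have vH: "sym_pos_def (mat v + H)" by (rule sym_pos_def_mat_add[OF H less_imp_le[OF v]])
  have iH: "H ** ?A = mat 1" "?A ** H = mat 1" using matrix_inv_mult[OF sym_pos_def_invertible[OF H]] by auto
  have iB: "(mat v + H) ** B = mat 1" "B ** (mat v + H) = mat 1"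
    using matrix_inv_mult[OF sym_pos_def_invertible[OF vH]] by (auto simp: B_def)
  have tA: "transpose ?A = ?A" by (rule matrix_inv_symmetric[OF H])
  have Pd: "sym_pos_def P" unfolding P_def
    using sym_pos_def_add[OF sym_pos_def_mat[of "1 / v"] sym_pos_def_imp_psd[OF sym_pos_def_matrix_inv[OF H]]] v by simp
  then show "sym_pos_def P" .
  have PvH: "P = (1 / v) *\<^sub>R ((mat v + H) ** ?A)"
    using v by (simp add: P_def matrix_ring iH scaleR_add_right mat_scaleR[of "1 / v"] mat_scaleR[of v])
  have vB: "v *\<^sub>R B + H ** B = mat 1" using iB(1) by (simp add: matrix_ring)
  have PHB: "P ** (H ** B) = (1 / v) *\<^sub>R mat 1"
  proof -
    have "P ** (H ** B) = (1 / v) *\<^sub>R ((mat v + H) ** ((?A ** H) ** B))"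
      by (simp only: PvH scaleR_matrix_left matrix_mul_assoc)
    then show ?thesis by (simp add: iH iB)
  qed
  have PHBz: "P ** (H ** B ** z) = (1 / v) *\<^sub>R z"
  proof -
    have "P ** (H ** B ** z) = (P ** (H ** B)) ** z" by (simp only: matrix_mul_assoc)
    then show ?thesis by (simp add: PHB scaleR_matrix_left)
  qed
  have tP: "transpose P = P" by (rule sym_pos_defD(1)[OF Pd])
  let ?m = "H ** B ** z"
  have "(\<Theta> - ?m) \<bullet> (P ** (\<Theta> - ?m)) = \<Theta> \<bullet> (P ** \<Theta>) - 2 * (\<Theta> \<bullet> (P ** ?m)) + ?m \<bullet> (P ** ?m)"
  proof -
    have "?m \<bullet> (P ** \<Theta>) = \<Theta> \<bullet> (P ** ?m)" using inner_matrix_left[of ?m P \<Theta>] by (simp add: tP inner_commute)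
    then show ?thesis by (simp add: matrix_diff_ldistrib inner_diff_left inner_diff_right)
  qed
  also have "\<Theta> \<bullet> (P ** \<Theta>) = (\<Theta> \<bullet> \<Theta>) / v + \<Theta> \<bullet> (?A ** \<Theta>)"
    by (simp add: P_def matrix_add_rdistrib mat_mult_left inner_add_right)
  also have "\<Theta> \<bullet> (P ** ?m) = (\<Theta> \<bullet> z) / v" by (simp add: PHBz)
  also have "?m \<bullet> (P ** ?m) = (?m \<bullet> z) / v" by (simp add: PHBz)
  also have "?m \<bullet> z = z \<bullet> z - v * (z \<bullet> (B ** z))"
  proof -
    have "?m = z - v *\<^sub>R (B ** z)"
    proof -
      have "H ** B = mat 1 - v *\<^sub>R B" using vB by (simp add: algebra_simps)
      then show ?thesis by (simp add: matrix_diff_rdistrib scaleR_matrix_left)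
    qed
    then show ?thesis by (simp add: inner_diff_left inner_diff_right inner_commute)
  qed
  finally show "(norm (z - \<Theta>))\<^sup>2 / v + \<Theta> \<bullet> (?A ** \<Theta>)
    = (\<Theta> - ?m) \<bullet> (P ** (\<Theta> - ?m)) + z \<bullet> (B ** z)"
    using v by (simp add: power2_norm_eq_inner inner_diff_left inner_diff_right inner_commute[of z \<Theta>] diff_divide_distrib add_divide_distrib)
  have "det P = det ((1 / v) *\<^sub>R mat 1 :: real^'r^'r) * (det (mat v + H) * det ?A)"
    unfolding det_mul[symmetric] by (simp add: PvH scaleR_matrix_left)
  also have "det ((1 / v) *\<^sub>R mat 1 :: real^'r^'r) = (1 / v) ^ CARD('r)"
    by (simp only: mat_scaleR[symmetric]) (simp add: mat_def det_diagonal_matrix)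
  also have "det ?A = 1 / det H" using det_matrix_inv[OF sym_pos_def_invertible[OF H]] by (simp add: inverse_eq_divide)
  finally show "det P = det (mat v + H) / (v ^ CARD('r) * det H)" by (simp add: power_one_over)
qed

text \<open>Covariances v I and H add up in every column. A common factor (2 pi)^(-q r / 2) is left
  out of the matrix normal density on both sides.\<close>

lemma normal_convolution_matrix_normal:
  fixes H :: "real^'r^'r" and z :: "real^'q^'r"
  assumes v: "0 < v" and H: "sym_pos_def H"
  shows "(\<integral>\<^sup>+\<Theta>. ennreal (gauss v (z - \<Theta>)) * ennreal (det H powr (- real CARD('q) / 2) * exp (- (\<Theta> \<bullet> (matrix_inv H ** \<Theta>)) / 2)) \<partial>lborel)
    = ennreal (det (mat v + H) powr (- real CARD('q) / 2) * exp (- (z \<bullet> (matrix_inv (mat v + H) ** z)) / 2))"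
proof -
  let ?N = "real DIM(real^'q^'r)" and ?q = "real CARD('q)"
  define P where "P = mat (1 / v) + matrix_inv H"
  define B where "B = matrix_inv (mat v + H)"
  note G = gaussian_product_form[OF v H, folded P_def B_def]
  have dH: "0 < det H" and dvH: "0 < det (mat v + H)"
    using H v sym_pos_def_mat_add[OF H less_imp_le[OF v]] by (auto intro: sym_pos_def_det)
  define E where "E = (2 * pi * v) powr (- ?N / 2) * det H powr (- ?q / 2) * exp (- (z \<bullet> (B ** z)) / 2)"
  have pt: "gauss v (z - \<Theta>) * (det H powr (- ?q / 2) * exp (- (\<Theta> \<bullet> (matrix_inv H ** \<Theta>)) / 2))
    = E * exp (- ((\<Theta> - H ** B ** z) \<bullet> (P ** (\<Theta> - H ** B ** z))) / 2)" for \<Theta>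
  proof -
    have "- (norm (z - \<Theta>))\<^sup>2 / (2 * v) + - (\<Theta> \<bullet> (matrix_inv H ** \<Theta>)) / 2
      = - (z \<bullet> (B ** z)) / 2 + - ((\<Theta> - H ** B ** z) \<bullet> (P ** (\<Theta> - H ** B ** z))) / 2"
      using G(1)[of z \<Theta>] by (simp add: field_simps)
    then show ?thesis unfolding gauss_def E_def
      by (simp add: exp_add[symmetric] mult_ac)
  qed
  have "(\<integral>\<^sup>+\<Theta>. ennreal (gauss v (z - \<Theta>)) * ennreal (det H powr (- ?q / 2) * exp (- (\<Theta> \<bullet> (matrix_inv H ** \<Theta>)) / 2)) \<partial>lborel)
    = (\<integral>\<^sup>+\<Theta>. ennreal E * ennreal (exp (- ((\<Theta> - H ** B ** z) \<bullet> (P ** (\<Theta> - H ** B ** z))) / 2)) \<partial>lborel)"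
  proof (rule nn_integral_cong)
    fix \<Theta> :: "real^'q^'r"
    let ?X = "det H powr (- ?q / 2) * exp (- (\<Theta> \<bullet> (matrix_inv H ** \<Theta>)) / 2)"
    have "ennreal (gauss v (z - \<Theta>)) * ennreal ?X = ennreal (gauss v (z - \<Theta>) * ?X)" by (rule ennreal_mult[symmetric]) auto
    also have "\<dots> = ennreal E * ennreal (exp (- ((\<Theta> - H ** B ** z) \<bullet> (P ** (\<Theta> - H ** B ** z))) / 2))"
      unfolding pt by (rule ennreal_mult) (auto simp: E_def)
    finally show "ennreal (gauss v (z - \<Theta>)) * ennreal ?X
      = ennreal E * ennreal (exp (- ((\<Theta> - H ** B ** z) \<bullet> (P ** (\<Theta> - H ** B ** z))) / 2))" .
  qed
  also have "\<dots> = ennreal E * ennreal ((2 * pi) powr (?N / 2) * det P powr (- ?q / 2))"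
    by (subst nn_integral_cmult) (measurable, simp only: nn_integral_gaussian_form[OF G(3)])
  also have "\<dots> = ennreal (det (mat v + H) powr (- ?q / 2) * exp (- (z \<bullet> (B ** z)) / 2))"
  proof -
    have "det P powr (- ?q / 2) = det (mat v + H) powr (- ?q / 2) * (v powr (?N / 2) * det H powr (?q / 2))"
    proof -
      have "(v ^ CARD('r) * det H) powr (- ?q / 2) = v powr (- ?N / 2) * det H powr (- ?q / 2)"
        using v dH by (simp add: powr_mult powr_realpow[symmetric] powr_powr mult.commute)
      then show ?thesis using v dH dvH unfolding G(2)
        by (simp add: powr_divide powr_minus_divide)
    qed
    moreover have "(2 * pi * v) powr (- ?N / 2) = (2 * pi) powr (- ?N / 2) * v powr (- ?N / 2)"
      using v by (simp add: powr_mult)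
    moreover have "(2 * pi) powr (- ?N / 2) * (2 * pi) powr (?N / 2) = 1" "v powr (- ?N / 2) * v powr (?N / 2) = 1"
      "det H powr (- ?q / 2) * det H powr (?q / 2) = 1"
      using v dH by (simp_all add: powr_add[symmetric])
    ultimately have "E * ((2 * pi) powr (?N / 2) * det P powr (- ?q / 2))
      = det (mat v + H) powr (- ?q / 2) * exp (- (z \<bullet> (B ** z)) / 2)"
    proof -
      have aux: "(x1 * x2 * h1 * e) * (y1 * (d * (y2 * h2))) = d * e"
        if "x1 * y1 = 1" "x2 * y2 = 1" "h1 * h2 = 1" for x1 x2 h1 e y1 d y2 h2 :: real
      proof -
        have "(x1 * x2 * h1 * e) * (y1 * (d * (y2 * h2))) = (x1 * y1) * (x2 * y2) * (h1 * h2) * (d * e)" by (simp only: mult_ac)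
        then show ?thesis by (simp only: that mult_1_left)
      qed
      assume a: "det P powr (- ?q / 2) = det (mat v + H) powr (- ?q / 2) * (v powr (?N / 2) * det H powr (?q / 2))"
        "(2 * pi * v) powr (- ?N / 2) = (2 * pi) powr (- ?N / 2) * v powr (- ?N / 2)"
        "(2 * pi) powr (- ?N / 2) * (2 * pi) powr (?N / 2) = 1" "v powr (- ?N / 2) * v powr (?N / 2) = 1"
        "det H powr (- ?q / 2) * det H powr (?q / 2) = 1"
      show ?thesis unfolding E_def a(1,2) by (rule aux[OF a(3-5)])
    qed
    then show ?thesis by (subst ennreal_mult[symmetric]) (auto simp: E_def)
  qed
  finally show ?thesis by (simp add: B_def)
qed

text \<open>The substitution \<open>\<Omega> = v\<^sub>0 (v\<^sub>0 I + H)\<^sup>-\<^sup>1\<close>.\<close>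

lemma nn_integral_unit_interval_substitution:
  fixes G :: "real^'r^'r \<Rightarrow> ennreal"
  assumes v0: "0 < v\<^sub>0" and G[measurable]: "G \<in> borel_measurable borel"
  shows "(\<integral>\<^sup>+\<Omega>. G \<Omega> * indicator unit_interval_mat \<Omega> \<partial>sym_lborel)
    = ennreal (v\<^sub>0 powr (real CARD('r) * (real CARD('r) + 1) / 2)) *
      (\<integral>\<^sup>+H. ennreal (det (mat v\<^sub>0 + H) powr (- (real CARD('r) + 1))) * G (v\<^sub>0 *\<^sub>R cramer_inv (mat v\<^sub>0 + H)) * indicator {A. sym_pos_def A} H \<partial>sym_lborel)"
proof -
  let ?n = "real CARD('r)" and ?PD = "{A :: real^'r^'r. sym_pos_def A}"
  define F where "F X = ennreal (1 / (det X) ^ (CARD('r) + 1)) * (G (cramer_inv X) * indicator ?PD (X - mat 1))" for X :: "real^'r^'r"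
  have [measurable]: "F \<in> borel_measurable borel" unfolding F_def by measurable
  \<comment> \<open>In the spectrum of X this says that 1 / x < 1 means x > 1. The proof uses
    explicit congruences instead of a simultaneous diagonalisation.\<close>
  have unit: "matrix_inv X \<in> unit_interval_mat \<longleftrightarrow> sym_pos_def (X - mat 1)" if X: "sym_pos_def X" for X :: "real^'r^'r"
  proof -
    have iX: "X ** matrix_inv X = mat 1" "matrix_inv X ** X = mat 1" using matrix_inv_mult[OF sym_pos_def_invertible[OF X]] by auto
    have tX: "transpose X = X" "transpose (matrix_inv X) = matrix_inv X" using sym_pos_defD(1)[OF X] matrix_inv_symmetric[OF X] by auto
    obtain C :: "real^'r^'r" where C: "matrix_inv X = C ** transpose C" "invertible C"
      by (rule sym_pos_def_factor[OF sym_pos_def_matrix_inv[OF X]])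
    define D where "D = matrix_inv C"
    have DC: "D ** C = mat 1" "C ** D = mat 1" using matrix_inv_mult[OF C(2)] by (auto simp: D_def)
    have tDC: "transpose C ** transpose D = mat 1" "transpose D ** transpose C = mat 1"
      using DC by (metis matrix_transpose_mul transpose_mat)+
    have iD: "invertible (transpose D)" "invertible (transpose C)" using tDC invertible_def by blast+
    have XD: "X = transpose D ** D"
    proof -
      have "matrix_inv X ** (transpose D ** D) = C ** (transpose C ** transpose D) ** D" by (simp only: C(1) matrix_mul_assoc)
      also have "\<dots> = mat 1" by (simp add: tDC DC)
      finally have "X ** (matrix_inv X ** (transpose D ** D)) = X" by simp
      then show ?thesis by (simp add: matrix_mul_assoc iX)
    qed
    define W where "W = D ** transpose D - (mat 1 :: real^'r^'r)"
    have 1: "X - mat 1 = transpose D ** (mat 1 - transpose C ** C) ** D"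
    proof -
      have "transpose D ** (transpose C ** C) ** D = (transpose D ** transpose C) ** (C ** D)" by (simp only: matrix_mul_assoc)
      then show ?thesis by (simp add: matrix_diff_ldistrib matrix_diff_rdistrib XD tDC DC)
    qed
    have 2: "mat 1 - matrix_inv X = C ** (D ** transpose D - mat 1) ** transpose C"
    proof -
      have "C ** (D ** transpose D) ** transpose C = (C ** D) ** (transpose D ** transpose C)" by (simp only: matrix_mul_assoc)
      then show ?thesis by (simp add: matrix_diff_ldistrib matrix_diff_rdistrib C(1) tDC DC)
    qed
    have a: "sym_pos_def (mat 1 - transpose C ** C)" if s: "sym_pos_def (X - mat 1)"
    proof -
      have "transpose C ** (X - mat 1) ** transpose (transpose C) = mat 1 - transpose C ** C"
      proof -
        have "transpose C ** (transpose D ** D) ** C = (transpose C ** transpose D) ** (D ** C)" by (simp only: matrix_mul_assoc)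
        then show ?thesis by (simp add: matrix_diff_ldistrib matrix_diff_rdistrib XD tDC DC)
      qed
      then show ?thesis using sym_pos_def_congruence[OF s iD(2)] by simp
    qed
    show ?thesis
    proof
      assume "matrix_inv X \<in> unit_interval_mat"
      then have s: "sym_pos_def (mat 1 - matrix_inv X)" by (simp add: unit_interval_mat_def)
      have e: "X ** (mat 1 - matrix_inv X) = X - mat 1" by (simp add: matrix_diff_ldistrib iX)
      have "X - mat 1 = (X - mat 1) + 0" by simp
      have "0 < x \<bullet> ((X - mat 1) *v x)" if x: "x \<noteq> 0" for x
      proof -
        let ?A = "matrix_inv X"
        \<comment> \<open>The scalar model is x - 1 = (1 - 1 / x) + (x - 1)^2 / x.\<close>
        have "X - mat 1 = (mat 1 - ?A) + ((X - mat 1) ** ?A ** (X - mat 1))"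
          by (simp add: matrix_diff_ldistrib matrix_diff_rdistrib iX)
        moreover have "psd ((X - mat 1) ** ?A ** transpose (X - mat 1))"
          by (intro psd_congruence sym_pos_def_imp_psd sym_pos_def_matrix_inv X)
        moreover have "transpose (X - mat 1) = X - mat 1" by (simp add: transpose_diff tX)
        ultimately have "sym_pos_def (X - mat 1)" using sym_pos_def_add[OF s] by metis
        then show ?thesis using x by (rule sym_pos_defD(2))
      qed
      then show "sym_pos_def (X - mat 1)" by (simp add: sym_pos_def_def transpose_diff tX)
    next
      assume s: "sym_pos_def (X - mat 1)"
      let ?A = "matrix_inv X"
      have Y: "sym_pos_def (?A ** (X - mat 1) ** transpose ?A)"
        using sym_pos_def_congruence[OF s] sym_pos_def_invertible[OF sym_pos_def_matrix_inv[OF X]] by blast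
      \<comment> \<open>The scalar model is 1 - y = y^2 (1 / y - 1) + (1 - y)^2.\<close>
      have "mat 1 - ?A = ?A ** (X - mat 1) ** transpose ?A + transpose ((mat 1 - ?A)) ** (mat 1 - ?A)"
        by (simp add: matrix_diff_ldistrib matrix_diff_rdistrib iX tX transpose_diff)
      moreover have "psd (transpose (mat 1 - ?A) ** (mat 1 - ?A))"
        using psd_square[of "transpose (mat 1 - ?A)"] by simp
      ultimately have "sym_pos_def (mat 1 - ?A)" using sym_pos_def_add[OF Y] by metis
      then show "?A \<in> unit_interval_mat" using sym_pos_def_matrix_inv[OF X] by (simp add: unit_interval_mat_def)
    qed
  qed
  have "(\<integral>\<^sup>+\<Omega>. G \<Omega> * indicator unit_interval_mat \<Omega> \<partial>sym_lborel)
    = (\<integral>\<^sup>+\<Omega>. (G \<Omega> * indicator unit_interval_mat \<Omega>) * indicator ?PD \<Omega> \<partial>sym_lborel)"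
    by (intro nn_integral_cong) (auto simp: unit_interval_mat_def split: split_indicator)
  also have "\<dots> = (\<integral>\<^sup>+X. ennreal (1 / (det X) ^ (CARD('r) + 1)) * (G (matrix_inv X) * indicator unit_interval_mat (matrix_inv X)) * indicator ?PD X \<partial>sym_lborel)"
    by (rule nn_integral_sym_pos_def_inverse[symmetric]) measurable
  also have "\<dots> = (\<integral>\<^sup>+X. F X \<partial>sym_lborel)"
  proof (rule nn_integral_cong)
    fix X :: "real^'r^'r"
    have "sym_pos_def X" if "sym_pos_def (X - mat 1)"
      using sym_pos_def_mat_add[OF that, of 1] by simp
    then show "ennreal (1 / (det X) ^ (CARD('r) + 1)) * (G (matrix_inv X) * indicator unit_interval_mat (matrix_inv X)) * indicator ?PD X = F X"
      unfolding F_def using unit[of X] sym_pos_def_cramer_inv(1)[of X] by (auto split: split_indicator)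
  qed
  also have "\<dots> = (\<integral>\<^sup>+X. F (X + mat 1) \<partial>sym_lborel)"
    by (rule nn_integral_sym_translate[symmetric]) auto
  also have "\<dots> = ennreal (\<bar>det (mat (1 / sqrt v\<^sub>0) :: real^'r^'r)\<bar> ^ (CARD('r) + 1)) *
      (\<integral>\<^sup>+X. F (mat (1 / sqrt v\<^sub>0) ** X ** transpose (mat (1 / sqrt v\<^sub>0)) + mat 1) \<partial>sym_lborel)"
    by (rule nn_integral_sym_congruence[symmetric]) (use v0 in \<open>auto simp: mat_def det_diagonal_matrix\<close>)
  \<comment> \<open>The scaling by \<open>1 / v\<^sub>0\<close> is a congruence with a multiple of
    the identity and contributes the power - r (r + 1) / 2 of \<open>v\<^sub>0\<close>; the
    determinant factor of the inversion contributes r (r + 1), which leaves the power in the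
    claim.\<close>
  also have "\<bar>det (mat (1 / sqrt v\<^sub>0) :: real^'r^'r)\<bar> ^ (CARD('r) + 1) = v\<^sub>0 powr (- (?n * (?n + 1) / 2))"
  proof -
    have "\<bar>det (mat (1 / sqrt v\<^sub>0) :: real^'r^'r)\<bar> = (v\<^sub>0 powr (- 1 / 2)) ^ CARD('r)"
      using v0 by (simp add: mat_def det_diagonal_matrix powr_minus powr_half_sqrt inverse_eq_divide)
    also have "\<dots> = v\<^sub>0 powr (- ?n / 2)" using v0 by (simp add: powr_realpow[symmetric] powr_powr)
    finally have "\<bar>det (mat (1 / sqrt v\<^sub>0) :: real^'r^'r)\<bar> ^ (CARD('r) + 1) = (v\<^sub>0 powr (- ?n / 2)) powr (?n + 1)"
      using v0 by (subst powr_realpow[symmetric]) (auto simp: add.commute)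
    then show ?thesis by (simp add: powr_powr)
  qed
  also have "(\<integral>\<^sup>+X. F (mat (1 / sqrt v\<^sub>0) ** X ** transpose (mat (1 / sqrt v\<^sub>0)) + mat 1) \<partial>sym_lborel)
    = (\<integral>\<^sup>+H. ennreal (v\<^sub>0 powr (?n * (?n + 1))) * (ennreal (det (mat v\<^sub>0 + H) powr (- (?n + 1))) * G (v\<^sub>0 *\<^sub>R cramer_inv (mat v\<^sub>0 + H)) * indicator ?PD H) \<partial>sym_lborel)"
  proof (rule nn_integral_cong)
    fix H :: "real^'r^'r"
    have e: "mat (1 / sqrt v\<^sub>0) ** H ** transpose (mat (1 / sqrt v\<^sub>0)) = (1 / v\<^sub>0) *\<^sub>R H"
      using v0 by (simp add: mat_mult_left mat_mult_right scaleR_matrix_left scaleR_matrix_right)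
    have pd: "sym_pos_def ((1 / v\<^sub>0) *\<^sub>R H) \<longleftrightarrow> sym_pos_def H"
      using sym_pos_def_scaleR[of H "1 / v\<^sub>0"] sym_pos_def_scaleR[of "(1 / v\<^sub>0) *\<^sub>R H" v\<^sub>0] v0 by auto
    show "F (mat (1 / sqrt v\<^sub>0) ** H ** transpose (mat (1 / sqrt v\<^sub>0)) + mat 1)
      = ennreal (v\<^sub>0 powr (?n * (?n + 1))) * (ennreal (det (mat v\<^sub>0 + H) powr (- (?n + 1))) * G (v\<^sub>0 *\<^sub>R cramer_inv (mat v\<^sub>0 + H)) * indicator ?PD H)"
    proof (cases "sym_pos_def H")
      case False
      then show ?thesis unfolding e F_def by (simp add: pd)
    next
      case True
      let ?Q = "mat v\<^sub>0 + H"
      have Q: "sym_pos_def ?Q" by (rule sym_pos_def_mat_add[OF True less_imp_le[OF v0]])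
      have eq: "(1 / v\<^sub>0) *\<^sub>R H + mat 1 = (1 / v\<^sub>0) *\<^sub>R ?Q" using v0 by (simp add: scaleR_add_right mat_scaleR[of v\<^sub>0])
      have "((1 / v\<^sub>0) *\<^sub>R ?Q) ** (v\<^sub>0 *\<^sub>R cramer_inv ?Q) = mat 1"
        using v0 sym_pos_def_cramer_inv[OF Q] by (simp add: scaleR_matrix_left scaleR_matrix_right)
      then have ci: "cramer_inv ((1 / v\<^sub>0) *\<^sub>R ?Q) = v\<^sub>0 *\<^sub>R cramer_inv ?Q"
        using sym_pos_def_cramer_inv(1)[OF sym_pos_def_scaleR[OF Q, of "1 / v\<^sub>0"]] v0 by (simp add: matrix_inv_unique)
      have "det ((1 / v\<^sub>0) *\<^sub>R ?Q) = (1 / v\<^sub>0) ^ CARD('r) * det ?Q"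
      proof -
        have "(1 / v\<^sub>0) *\<^sub>R ?Q = mat (1 / v\<^sub>0) ** ?Q" by (simp add: mat_mult_left)
        then show ?thesis by (simp add: det_mul) (simp add: mat_def det_diagonal_matrix)
      qed
      then have "1 / (det ((1 / v\<^sub>0) *\<^sub>R ?Q)) ^ (CARD('r) + 1) = (v\<^sub>0 ^ CARD('r)) ^ (CARD('r) + 1) * (1 / (det ?Q) ^ (CARD('r) + 1))"
        by (simp add: power_mult_distrib power_one_over power_divide)
      also have "(v\<^sub>0 ^ CARD('r)) ^ (CARD('r) + 1) = v\<^sub>0 powr (?n * (?n + 1))"
      proof -
        have "v\<^sub>0 powr (?n * (?n + 1)) = v\<^sub>0 powr real (CARD('r) * (CARD('r) + 1))"
          by (simp only: of_nat_mult of_nat_add of_nat_1)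
        also have "\<dots> = v\<^sub>0 ^ (CARD('r) * (CARD('r) + 1))" by (rule powr_realpow[OF v0])
        finally show ?thesis by (simp only: power_mult)
      qed
      also have "1 / (det ?Q) ^ (CARD('r) + 1) = det ?Q powr (- (?n + 1))"
      proof -
        have "(det ?Q) ^ (CARD('r) + 1) = det ?Q powr (?n + 1)" using sym_pos_def_det[OF Q] by (subst powr_realpow[symmetric]) (auto simp: add.commute)
        then show ?thesis by (simp only: powr_minus_divide)
      qed
      finally have "ennreal (1 / (det ((1 / v\<^sub>0) *\<^sub>R ?Q)) ^ (CARD('r) + 1)) = ennreal (v\<^sub>0 powr (?n * (?n + 1))) * ennreal (det ?Q powr (- (?n + 1)))"
        by (simp only: ennreal_mult''[OF powr_ge_zero])
      moreover have "indicator ?PD ((1 / v\<^sub>0) *\<^sub>R ?Q - mat 1) = (1 :: ennreal)"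
        unfolding eq[symmetric] using True pd by simp
      ultimately show ?thesis unfolding e F_def eq ci using True by (simp add: mult.assoc)
    qed
  qed
  also have "\<dots> = ennreal (v\<^sub>0 powr (?n * (?n + 1))) * (\<integral>\<^sup>+H. ennreal (det (mat v\<^sub>0 + H) powr (- (?n + 1))) * G (v\<^sub>0 *\<^sub>R cramer_inv (mat v\<^sub>0 + H)) * indicator ?PD H \<partial>sym_lborel)"
    by (rule nn_integral_cmult) measurable
  also have "ennreal (v\<^sub>0 powr (- (?n * (?n + 1) / 2))) * (ennreal (v\<^sub>0 powr (?n * (?n + 1))) * x) = ennreal (v\<^sub>0 powr (?n * (?n + 1) / 2)) * x" for x
    using v0 by (simp add: mult.assoc[symmetric] ennreal_mult[symmetric] powr_add[symmetric])
  finally show ?thesis .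
qed

text \<open>The matrix normal density at z with column covariance v I + H, without its power of 2
  pi, times the weight of H. In the application \<beta> = b / 2 - 1, and \<kappa> = a / 2 + \<beta>
  + r collects the exponents (a / 2 - 1) + \<beta> from the second-stage density and r + 1 from the
  Jacobian of \<Omega> \<mapsto> H.\<close>

definition mix_density :: "real \<Rightarrow> real \<Rightarrow> real \<Rightarrow> real \<Rightarrow> real^'q^'r \<Rightarrow> real^'r^'r \<Rightarrow> real" where
  "mix_density v\<^sub>0 \<kappa> \<beta> v z H = det (mat v + H) powr (- real CARD('q) / 2)
    * exp (- (z \<bullet> (cramer_inv (mat v + H) ** z)) / 2) * (det (mat v\<^sub>0 + H) powr (- \<kappa>) * det H powr \<beta>)"

definition mix_marginal :: "real \<Rightarrow> real \<Rightarrow> real \<Rightarrow> real \<Rightarrow> real^'q^'r \<Rightarrow> ennreal" where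
  "mix_marginal v\<^sub>0 \<kappa> \<beta> v z =
    (\<integral>\<^sup>+H. ennreal (mix_density v\<^sub>0 \<kappa> \<beta> v z H) * indicator {A. sym_pos_def A} H \<partial>sym_lborel)"

lemma measurable_mix_density [measurable]: "mix_density v\<^sub>0 \<kappa> \<beta> v z \<in> borel_measurable borel"
  unfolding mix_density_def by measurable

definition prior_stage1_measurable :: "real \<Rightarrow> real^'r^'r \<Rightarrow> real^'q^'r \<Rightarrow> real" where
  "prior_stage1_measurable v\<^sub>0 \<Omega> \<Theta> =
     (2 * pi * v\<^sub>0) powr (- (real CARD('q) * real CARD('r)) / 2)
     * det (\<Omega> ** cramer_inv (mat 1 - \<Omega>)) powr (real CARD('q) / 2)
     * exp (- (1 / (2 * v\<^sub>0)) * (\<Theta> \<bullet> (\<Omega> ** cramer_inv (mat 1 - \<Omega>) ** \<Theta>)))"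

lemma prior_stage1_eq:
  assumes "\<Omega> \<in> unit_interval_mat"
  shows "prior_stage1 v\<^sub>0 \<Omega> \<Theta> = prior_stage1_measurable v\<^sub>0 \<Omega> \<Theta>"
proof -
  have "cramer_inv (mat 1 - \<Omega>) = matrix_inv (mat 1 - \<Omega>)"
    using assms by (simp add: unit_interval_mat_def sym_pos_def_cramer_inv)
  moreover have "trace (M ** \<Theta> ** transpose \<Theta>) = \<Theta> \<bullet> (M ** \<Theta>)" for M
    using inner_matrix_right[of "mat 1" "M ** \<Theta>" "transpose \<Theta>"] by (simp add: inner_mat_one)
  ultimately show ?thesis by (simp add: prior_stage1_def prior_stage1_measurable_def)
qed

lemma prior_hier_eq:
  "prior_hier v\<^sub>0 K a b \<Theta> = (\<integral>\<^sup>+\<Omega>. ennreal (prior_stage1_measurable v\<^sub>0 \<Omega> \<Theta> * prior_GB K a b \<Omega>) * indicator unit_interval_mat \<Omega> \<partial>sym_lborel)"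
  unfolding prior_hier_def by (intro nn_integral_cong) (auto simp: prior_stage1_eq split: split_indicator)

lemma measurable_prior_hier [measurable]: "(prior_hier v\<^sub>0 K a b :: real^'q^'r \<Rightarrow> ennreal) \<in> borel_measurable borel"
proof -
  interpret sigma_finite_measure "sym_lborel :: (real^'r^'r) measure" by (rule sigma_finite_sym_lborel)
  have "(\<lambda>(\<Theta> :: real^'q^'r, \<Omega>). ennreal (prior_stage1_measurable v\<^sub>0 \<Omega> \<Theta> * prior_GB K a b \<Omega>) * indicator unit_interval_mat \<Omega>)
    \<in> borel_measurable (borel \<Otimes>\<^sub>M (sym_lborel :: (real^'r^'r) measure))"
    unfolding prior_stage1_measurable_def prior_GB_def split_beta' by measurable
  then show ?thesis unfolding prior_hier_eq by (rule borel_measurable_nn_integral)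
qed

text \<open>With R the inverse of \<open>mat v\<^sub>0 + H\<close>, one has \<Omega> =
  \<open>v\<^sub>0\<close> R and I - \<Omega> = H R, so \<Omega> (I - \<Omega>)^-1 =
  \<open>v\<^sub>0\<close> H^-1: given \<Omega>, the columns of \<Theta> are normal with covariance
  H.\<close>

lemma prior_in_covariance_coordinates:
  fixes H :: "real^'r^'r" and \<Theta> :: "real^'q^'r"
  assumes v0: "0 < v\<^sub>0" and H: "sym_pos_def H"
  defines "\<Omega> \<equiv> v\<^sub>0 *\<^sub>R cramer_inv (mat v\<^sub>0 + H)"
  shows "prior_stage1_measurable v\<^sub>0 \<Omega> \<Theta> = (2 * pi) powr (- (real CARD('q) * real CARD('r)) / 2)
      * (det H powr (- real CARD('q) / 2) * exp (- (\<Theta> \<bullet> (matrix_inv H ** \<Theta>)) / 2))"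
    and "prior_GB K a b \<Omega> = K * v\<^sub>0 powr (real CARD('r) * (a / 2 - 1))
      * (det (mat v\<^sub>0 + H) powr (- (a / 2 - 1) - (b / 2 - 1)) * det H powr (b / 2 - 1))"
proof -
  let ?Q = "mat v\<^sub>0 + H" and ?n = "real CARD('r)" and ?q = "real CARD('q)"
  let ?R = "cramer_inv ?Q"
  have Q: "sym_pos_def ?Q" by (rule sym_pos_def_mat_add[OF H less_imp_le[OF v0]])
  note R = sym_pos_def_cramer_inv[OF Q]
  have dQ: "0 < det ?Q" and dH: "0 < det H" using Q H by (auto intro: sym_pos_def_det)
  have iH: "H ** matrix_inv H = mat 1" "matrix_inv H ** H = mat 1" using matrix_inv_mult[OF sym_pos_def_invertible[OF H]] by auto
  have vR: "v\<^sub>0 *\<^sub>R ?R + H ** ?R = mat 1" using R(3) by (simp add: matrix_add_rdistrib mat_mult_left)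
  then have IO: "mat 1 - \<Omega> = H ** ?R" by (simp add: \<Omega>_def algebra_simps)
  have "(H ** ?R) ** (?Q ** matrix_inv H) = mat 1"
  proof -
    have "(H ** ?R) ** (?Q ** matrix_inv H) = H ** (?R ** ?Q) ** matrix_inv H" by (simp only: matrix_mul_assoc)
    then show ?thesis by (simp only: R(2) matrix_mul_rid iH)
  qed
  then have inv: "invertible (H ** ?R)" and mi: "matrix_inv (H ** ?R) = ?Q ** matrix_inv H"
    by (auto simp: invertible_right_inverse intro: matrix_inv_unique)
  have OI: "\<Omega> ** cramer_inv (mat 1 - \<Omega>) = v\<^sub>0 *\<^sub>R matrix_inv H"
  proof -
    have "\<Omega> ** cramer_inv (mat 1 - \<Omega>) = v\<^sub>0 *\<^sub>R ((?R ** ?Q) ** matrix_inv H)"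
      unfolding IO cramer_inv_eq_matrix_inv[OF inv] mi by (simp only: \<Omega>_def scaleR_matrix_left matrix_mul_assoc)
    then show ?thesis by (simp only: R(2) matrix_mul_lid)
  qed
  have ds: "det (c *\<^sub>R M) = c ^ CARD('r) * det M" for c and M :: "real^'r^'r"
  proof -
    have "c *\<^sub>R M = mat c ** M" by (simp add: mat_mult_left)
    then show ?thesis by (simp add: det_mul) (simp add: mat_def det_diagonal_matrix)
  qed
  have vp: "(v\<^sub>0 ^ CARD('r)) powr x = v\<^sub>0 powr (?n * x)" for x using v0 by (simp add: powr_realpow[symmetric] powr_powr)
  have "det (v\<^sub>0 *\<^sub>R matrix_inv H) powr (?q / 2) = v\<^sub>0 powr (?n * (?q / 2)) * det H powr (- ?q / 2)"
    using v0 dH by (simp add: ds det_matrix_inv[OF sym_pos_def_invertible[OF H]] powr_mult vp powr_minus inverse_powr)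
  moreover have "(2 * pi * v\<^sub>0) powr (- (?q * ?n) / 2) = (2 * pi) powr (- (?q * ?n) / 2) * v\<^sub>0 powr (- (?q * ?n) / 2)"
    using v0 by (simp add: powr_mult)
  moreover have "v\<^sub>0 powr (- (?q * ?n) / 2) * v\<^sub>0 powr (?n * (?q / 2)) = 1"
    using v0 by (simp add: powr_add[symmetric] mult.commute)
  moreover have "- (1 / (2 * v\<^sub>0)) * (\<Theta> \<bullet> (v\<^sub>0 *\<^sub>R matrix_inv H ** \<Theta>)) = - (\<Theta> \<bullet> (matrix_inv H ** \<Theta>)) / 2"
    using v0 by (simp add: scaleR_matrix_left)
  ultimately show "prior_stage1_measurable v\<^sub>0 \<Omega> \<Theta> = (2 * pi) powr (- (?q * ?n) / 2)
      * (det H powr (- ?q / 2) * exp (- (\<Theta> \<bullet> (matrix_inv H ** \<Theta>)) / 2))"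
    unfolding prior_stage1_measurable_def OI
    by (simp only: mult.assoc) (simp only: mult.assoc[symmetric] mult_1_right)?
  have "det \<Omega> powr (a / 2 - 1) = v\<^sub>0 powr (?n * (a / 2 - 1)) * det ?Q powr (- (a / 2 - 1))"
    unfolding powr_minus using v0 dQ det_matrix_inv[OF sym_pos_def_invertible[OF Q]]
    by (simp add: \<Omega>_def ds R(1) powr_mult vp inverse_powr)
  moreover have "det (mat 1 - \<Omega>) powr (b / 2 - 1) = det H powr (b / 2 - 1) * det ?Q powr (- (b / 2 - 1))"
    unfolding IO powr_minus using dQ dH det_matrix_inv[OF sym_pos_def_invertible[OF Q]]
    by (simp add: det_mul R(1) powr_mult inverse_powr)
  moreover have "det ?Q powr (- (a / 2 - 1) - (b / 2 - 1)) = det ?Q powr (- (a / 2 - 1)) * det ?Q powr (- (b / 2 - 1))"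
    by (simp add: powr_add[symmetric])
  ultimately show "prior_GB K a b \<Omega> = K * v\<^sub>0 powr (?n * (a / 2 - 1))
      * (det ?Q powr (- (a / 2 - 1) - (b / 2 - 1)) * det H powr (b / 2 - 1))"
    unfolding prior_GB_def by (simp only: mult_ac)
qed

text \<open>Exchanging the integrals over \<Theta> and \<Omega>, substituting H for \<Omega> and
  convolving the two normal densities. One constant c serves all v and z, so it drops out of
  comparisons between different variances.\<close>

theorem marginal_eq_mix_marginal:
  fixes K v\<^sub>0 a b :: real
  assumes v0: "0 < v\<^sub>0" and K: "0 < K"
  shows "\<exists>c>0. \<forall>v>0. \<forall>z :: real^'q^'r.
    (\<integral>\<^sup>+\<Theta>. ennreal (gauss v (z - \<Theta>)) * prior_hier v\<^sub>0 K a b \<Theta> \<partial>lborel)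
    = ennreal c * mix_marginal v\<^sub>0 (a / 2 + (b / 2 - 1) + real CARD('r)) (b / 2 - 1) v z"
proof -
  let ?n = "real CARD('r)" and ?q = "real CARD('q)" and ?PD = "{A :: real^'r^'r. sym_pos_def A}"
  let ?\<beta> = "b / 2 - 1"
  define c1 where "c1 = (2 * pi) powr (- (?q * ?n) / 2) * (K * v\<^sub>0 powr (?n * (a / 2 - 1)))"
  define c2 where "c2 = v\<^sub>0 powr (?n * (?n + 1) / 2)"
  have c: "0 < c1" "0 < c2" using K v0 by (auto simp: c1_def c2_def)
  interpret S: sigma_finite_measure "sym_lborel :: (real^'r^'r) measure" by (rule sigma_finite_sym_lborel)
  interpret P: pair_sigma_finite "sym_lborel :: (real^'r^'r) measure" "lborel :: (real^'q^'r) measure"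
    by (intro pair_sigma_finite.intro sigma_finite_sym_lborel lborel.sigma_finite_measure_axioms)
  have "(\<integral>\<^sup>+\<Theta>. ennreal (gauss v (z - \<Theta>)) * prior_hier v\<^sub>0 K a b \<Theta> \<partial>lborel)
    = ennreal (c2 * c1) * mix_marginal v\<^sub>0 (a / 2 + ?\<beta> + ?n) ?\<beta> v z" if v: "0 < v" for v and z :: "real^'q^'r"
  proof -
    define g where "g \<Omega> \<Theta> = ennreal (prior_stage1_measurable v\<^sub>0 \<Omega> \<Theta> * prior_GB K a b \<Omega>)" for \<Omega> :: "real^'r^'r" and \<Theta> :: "real^'q^'r"
    have gm: "(\<lambda>x. g (fst x) (snd x)) \<in> borel_measurable (borel \<Otimes>\<^sub>M borel)"
      unfolding g_def prior_stage1_measurable_def prior_GB_def by measurable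
    have [measurable (raw)]: "(\<lambda>x. g (f1 x) (f2 x)) \<in> borel_measurable M"
      if [measurable]: "f1 \<in> borel_measurable M" "f2 \<in> borel_measurable M" for f1 f2 and M :: "'z measure"
      using measurable_compose[OF measurable_Pair[OF that] gm] by simp
    define G where "G \<Omega> = (\<integral>\<^sup>+\<Theta>. ennreal (gauss v (z - \<Theta>)) * g \<Omega> \<Theta> \<partial>lborel)" for \<Omega> :: "real^'r^'r"
    have gm2: "(\<lambda>(\<Omega>, \<Theta>). ennreal (gauss v (z - \<Theta>)) * g \<Omega> \<Theta>) \<in> borel_measurable (borel \<Otimes>\<^sub>M lborel)" by measurable
    have Gm[measurable]: "G \<in> borel_measurable borel"
      unfolding G_def by (rule lborel.borel_measurable_nn_integral[OF gm2])
    have "(\<integral>\<^sup>+\<Theta>. ennreal (gauss v (z - \<Theta>)) * prior_hier v\<^sub>0 K a b \<Theta> \<partial>lborel)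
      = (\<integral>\<^sup>+\<Theta>. (\<integral>\<^sup>+\<Omega>. ennreal (gauss v (z - \<Theta>)) * g \<Omega> \<Theta> * indicator unit_interval_mat \<Omega> \<partial>sym_lborel) \<partial>lborel)"
      unfolding prior_hier_eq g_def[symmetric]
      by (intro nn_integral_cong, subst nn_integral_cmult[symmetric]) (auto simp: mult.assoc)
    also have "\<dots> = (\<integral>\<^sup>+\<Omega>. (\<integral>\<^sup>+\<Theta>. ennreal (gauss v (z - \<Theta>)) * g \<Omega> \<Theta> * indicator unit_interval_mat \<Omega> \<partial>lborel) \<partial>sym_lborel)"
      by (rule P.Fubini') measurable
    also have "\<dots> = (\<integral>\<^sup>+\<Omega>. G \<Omega> * indicator unit_interval_mat \<Omega> \<partial>sym_lborel)"
      unfolding G_def by (intro nn_integral_cong nn_integral_multc) measurable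
    also have "\<dots> = ennreal c2 * (\<integral>\<^sup>+H. ennreal (det (mat v\<^sub>0 + H) powr (- (?n + 1))) * G (v\<^sub>0 *\<^sub>R cramer_inv (mat v\<^sub>0 + H)) * indicator ?PD H \<partial>sym_lborel)"
      unfolding c2_def by (rule nn_integral_unit_interval_substitution[OF v0 Gm])
    also have "(\<integral>\<^sup>+H. ennreal (det (mat v\<^sub>0 + H) powr (- (?n + 1))) * G (v\<^sub>0 *\<^sub>R cramer_inv (mat v\<^sub>0 + H)) * indicator ?PD H \<partial>sym_lborel)
      = (\<integral>\<^sup>+H. ennreal c1 * (ennreal (mix_density v\<^sub>0 (a / 2 + ?\<beta> + ?n) ?\<beta> v z H) * indicator ?PD H) \<partial>sym_lborel)"
    proof (rule nn_integral_cong)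
      fix H :: "real^'r^'r"
      show "ennreal (det (mat v\<^sub>0 + H) powr (- (?n + 1))) * G (v\<^sub>0 *\<^sub>R cramer_inv (mat v\<^sub>0 + H)) * indicator ?PD H
        = ennreal c1 * (ennreal (mix_density v\<^sub>0 (a / 2 + ?\<beta> + ?n) ?\<beta> v z H) * indicator ?PD H)"
      proof (cases "sym_pos_def H")
        case True
        let ?Q = "mat v\<^sub>0 + H"
        define w where "w = det ?Q powr (- (a / 2 - 1) - ?\<beta>) * det H powr ?\<beta>"
        have vH: "sym_pos_def (mat v + H)" by (rule sym_pos_def_mat_add[OF True less_imp_le[OF v]])
        have g: "g (v\<^sub>0 *\<^sub>R cramer_inv ?Q) \<Theta>
          = ennreal (c1 * w) * ennreal (det H powr (- ?q / 2) * exp (- (\<Theta> \<bullet> (matrix_inv H ** \<Theta>)) / 2))" for \<Theta>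
        proof -
          have "prior_stage1_measurable v\<^sub>0 (v\<^sub>0 *\<^sub>R cramer_inv ?Q) \<Theta> * prior_GB K a b (v\<^sub>0 *\<^sub>R cramer_inv ?Q)
            = (c1 * w) * (det H powr (- ?q / 2) * exp (- (\<Theta> \<bullet> (matrix_inv H ** \<Theta>)) / 2))"
            unfolding prior_in_covariance_coordinates[OF v0 True] c1_def w_def by (simp only: mult_ac)
          then show ?thesis unfolding g_def by (simp only: ennreal_mult''[OF mult_nonneg_nonneg[OF powr_ge_zero exp_ge_zero]])
        qed
        have "G (v\<^sub>0 *\<^sub>R cramer_inv ?Q) = ennreal (c1 * w) * (\<integral>\<^sup>+\<Theta>. ennreal (gauss v (z - \<Theta>)) *
            ennreal (det H powr (- ?q / 2) * exp (- (\<Theta> \<bullet> (matrix_inv H ** \<Theta>)) / 2)) \<partial>lborel)"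
          unfolding G_def g by (subst nn_integral_cmult[symmetric]) (auto simp: mult_ac)
        also have "\<dots> = ennreal (c1 * w) * ennreal (det (mat v + H) powr (- ?q / 2) * exp (- (z \<bullet> (cramer_inv (mat v + H) ** z)) / 2))"
          unfolding normal_convolution_matrix_normal[OF v True] sym_pos_def_cramer_inv(1)[OF vH] ..
        finally have "ennreal (det ?Q powr (- (?n + 1))) * G (v\<^sub>0 *\<^sub>R cramer_inv ?Q)
          = ennreal (det ?Q powr (- (?n + 1)) * ((c1 * w) * (det (mat v + H) powr (- ?q / 2) * exp (- (z \<bullet> (cramer_inv (mat v + H) ** z)) / 2))))"
          using c by (simp add: ennreal_mult w_def)
        also have "det ?Q powr (- (?n + 1)) * ((c1 * w) * (det (mat v + H) powr (- ?q / 2) * exp (- (z \<bullet> (cramer_inv (mat v + H) ** z)) / 2)))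
          = c1 * mix_density v\<^sub>0 (a / 2 + ?\<beta> + ?n) ?\<beta> v z H"
        proof -
          have e: "- (a / 2 + ?\<beta> + ?n) = - (?n + 1) + (- (a / 2 - 1) - ?\<beta>)" by simp
          have "det ?Q powr (- (a / 2 + ?\<beta> + ?n)) = det ?Q powr (- (?n + 1)) * det ?Q powr (- (a / 2 - 1) - ?\<beta>)"
            unfolding e by (rule powr_add)
          then show ?thesis unfolding mix_density_def w_def by (simp only: mult_ac)
        qed
        finally show ?thesis using True c by (simp add: ennreal_mult mix_density_def)
      qed simp
    qed
    also have "\<dots> = ennreal c1 * mix_marginal v\<^sub>0 (a / 2 + ?\<beta> + ?n) ?\<beta> v z"
      unfolding mix_marginal_def by (rule nn_integral_cmult) measurable
    finally show ?thesis using c by (simp add: ennreal_mult mult.assoc)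
  qed
  then show ?thesis using c by (intro exI[of _ "c2 * c1"]) auto
qed

text \<open>For each \<Omega> the first stage integrates to 1. Since b > 2, the factor of I -
  \<Omega> is at most 1, and a > 0 puts the exponent a / 2 - 1 of det \<Omega> above -1.\<close>

theorem prior_hier_proper:
  fixes K v\<^sub>0 a b :: real
  assumes v0: "0 < v\<^sub>0" and K: "0 < K" and a: "0 < a" and b: "2 < b"
  shows "(\<integral>\<^sup>+\<Theta>. prior_hier v\<^sub>0 K a b (\<Theta> :: real^'q^'r) \<partial>lborel) \<noteq> \<top>"
proof -
  let ?n = "real CARD('r)" and ?q = "real CARD('q)"
  interpret P: pair_sigma_finite "sym_lborel :: (real^'r^'r) measure" "lborel :: (real^'q^'r) measure"
    by (intro pair_sigma_finite.intro sigma_finite_sym_lborel lborel.sigma_finite_measure_axioms)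
  define g where "g \<Omega> \<Theta> = ennreal (prior_stage1_measurable v\<^sub>0 \<Omega> \<Theta> * prior_GB K a b \<Omega>)" for \<Omega> :: "real^'r^'r" and \<Theta> :: "real^'q^'r"
  have "(\<integral>\<^sup>+\<Theta>. prior_hier v\<^sub>0 K a b (\<Theta> :: real^'q^'r) \<partial>lborel)
    = (\<integral>\<^sup>+\<Theta>. (\<integral>\<^sup>+\<Omega>. g \<Omega> \<Theta> * indicator unit_interval_mat \<Omega> \<partial>sym_lborel) \<partial>lborel)"
    unfolding prior_hier_eq g_def ..
  also have "\<dots> = (\<integral>\<^sup>+\<Omega>. (\<integral>\<^sup>+\<Theta>. g \<Omega> \<Theta> * indicator unit_interval_mat \<Omega> \<partial>lborel) \<partial>sym_lborel)"
    by (rule P.Fubini') (unfold g_def prior_stage1_measurable_def prior_GB_def split_beta', measurable)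
  also have "\<dots> \<le> (\<integral>\<^sup>+\<Omega>. ennreal K * (ennreal (det \<Omega> powr (a / 2 - 1)) * indicator unit_interval_mat \<Omega>) \<partial>(sym_lborel :: (real^'r^'r) measure))"
  proof (rule nn_integral_mono)
    fix \<Omega> :: "real^'r^'r"
    show "(\<integral>\<^sup>+\<Theta>. g \<Omega> \<Theta> * indicator unit_interval_mat \<Omega> \<partial>lborel) \<le> ennreal K * (ennreal (det \<Omega> powr (a / 2 - 1)) * indicator unit_interval_mat \<Omega>)"
    proof (cases "\<Omega> \<in> unit_interval_mat")
      case True
      then have O: "sym_pos_def \<Omega>" "sym_pos_def (mat 1 - \<Omega>)" by (auto simp: unit_interval_mat_def)
      let ?T = "matrix_inv \<Omega>"
      have T: "sym_pos_def ?T" "\<Omega> ** ?T = mat 1" "?T ** \<Omega> = mat 1"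
        using sym_pos_def_matrix_inv[OF O(1)] matrix_inv_mult[OF sym_pos_def_invertible[OF O(1)]] by auto
      \<comment> \<open>Solves \<Omega> = \<open>v\<^sub>0\<close> (\<open>v\<^sub>0\<close> I +
        H)^-1, so that the first stage becomes an explicit normal density with covariance H.\<close>
      define H where "H = v\<^sub>0 *\<^sub>R (?T - mat 1)"
      have H: "sym_pos_def H"
      proof -
        have "sym_pos_def (?T ** (mat 1 - \<Omega>) ** transpose ?T)"
          by (rule sym_pos_def_congruence[OF O(2) sym_pos_def_invertible[OF T(1)]])
        moreover have "psd ((?T - mat 1) ** transpose (?T - mat 1))" by (rule psd_square)
        moreover have "?T ** (mat 1 - \<Omega>) ** transpose ?T = ?T ** ?T - ?T"
          using sym_pos_defD(1)[OF T(1)] by (simp add: matrix_diff_ldistrib matrix_diff_rdistrib T)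
        ultimately have "sym_pos_def (?T ** ?T - ?T)" by simp
        moreover have "?T ** ?T - ?T = (?T - mat 1) ** ?T" by (simp add: matrix_diff_rdistrib)
        ultimately have s: "sym_pos_def ((?T - mat 1) ** ?T)" by simp
        obtain C :: "real^'r^'r" where C: "\<Omega> = C ** transpose C" "invertible C" by (rule sym_pos_def_factor[OF O(1)])
        \<comment> \<open>The scalar model is 1 / x - 1 = (1 - x) + (1 - x)^2 / x.\<close>
        have "?T - mat 1 = (mat 1 - \<Omega>) + (mat 1 - \<Omega>) ** ?T ** transpose (mat 1 - \<Omega>)"
          using sym_pos_defD(1)[OF O(1)] by (simp add: transpose_diff matrix_diff_ldistrib matrix_diff_rdistrib T)
        moreover have "psd ((mat 1 - \<Omega>) ** ?T ** transpose (mat 1 - \<Omega>))" by (intro psd_congruence sym_pos_def_imp_psd T)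
        ultimately have "sym_pos_def (?T - mat 1)" using sym_pos_def_add[OF O(2)] by metis
        then show ?thesis unfolding H_def by (rule sym_pos_def_scaleR[OF _ v0])
      qed
      have vH: "mat v\<^sub>0 + H = v\<^sub>0 *\<^sub>R ?T" by (simp add: H_def scaleR_diff_right mat_scaleR[of v\<^sub>0])
      have O2: "\<Omega> = v\<^sub>0 *\<^sub>R cramer_inv (mat v\<^sub>0 + H)"
      proof -
        have "(v\<^sub>0 *\<^sub>R ?T) ** ((1 / v\<^sub>0) *\<^sub>R \<Omega>) = mat 1" using v0 by (simp add: scaleR_matrix_left scaleR_matrix_right T)
        then have "matrix_inv (v\<^sub>0 *\<^sub>R ?T) = (1 / v\<^sub>0) *\<^sub>R \<Omega>" by (rule matrix_inv_unique)
        then show ?thesis unfolding vH using v0 sym_pos_def_cramer_inv(1)[OF sym_pos_def_scaleR[OF T(1) v0]] by simp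
      qed
      have iH: "sym_pos_def (matrix_inv H)" by (rule sym_pos_def_matrix_inv[OF H])
      have dH: "0 < det H" by (rule sym_pos_def_det[OF H])
      have one: "(\<integral>\<^sup>+\<Theta>. ennreal (prior_stage1_measurable v\<^sub>0 \<Omega> (\<Theta> :: real^'q^'r)) \<partial>lborel) = 1"
      proof -
        let ?N = "real DIM(real^'q^'r)"
        have "(\<integral>\<^sup>+\<Theta>. ennreal (prior_stage1_measurable v\<^sub>0 \<Omega> (\<Theta> :: real^'q^'r)) \<partial>lborel)
          = (\<integral>\<^sup>+\<Theta>. ennreal ((2 * pi) powr (- ?N / 2) * det H powr (- ?q / 2)) * ennreal (exp (- (((\<Theta> :: real^'q^'r) - 0) \<bullet> (matrix_inv H ** (\<Theta> - 0))) / 2)) \<partial>lborel)"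
          unfolding O2 prior_in_covariance_coordinates(1)[OF v0 H] by (simp add: ennreal_mult[symmetric] mult_ac)
        also have "\<dots> = ennreal ((2 * pi) powr (- ?N / 2) * det H powr (- ?q / 2)) * ennreal ((2 * pi) powr (?N / 2) * det (matrix_inv H) powr (- ?q / 2))"
        proof -
          have [measurable]: "(\<lambda>\<Theta> :: real^'q^'r. matrix_inv H ** (\<Theta> - 0)) \<in> borel_measurable borel" by measurable
          show ?thesis by (subst nn_integral_cmult) (measurable, simp only: nn_integral_gaussian_form[OF iH])
        qed
        also have "\<dots> = 1"
        proof -
          have "det (matrix_inv H) powr (- ?q / 2) = det H powr (?q / 2)"
            using dH by (simp add: det_matrix_inv[OF sym_pos_def_invertible[OF H]] inverse_powr powr_minus)
          moreover have "(2 * pi) powr (- ?N / 2) * (2 * pi) powr (?N / 2) = 1" "det H powr (- ?q / 2) * det H powr (?q / 2) = 1"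
            using dH by (simp_all add: powr_add[symmetric])
          moreover have "(A * h) * (B * h') = 1" if "A * B = 1" "h * h' = 1" for A B h h' :: real
          proof -
            have "(A * h) * (B * h') = (A * B) * (h * h')" by (simp only: mult_ac)
            then show ?thesis by (simp only: that mult_1_right)
          qed
          ultimately have "((2 * pi) powr (- ?N / 2) * det H powr (- ?q / 2)) * ((2 * pi) powr (?N / 2) * det (matrix_inv H) powr (- ?q / 2)) = 1"
            by (simp only:)
          then show ?thesis by (subst ennreal_mult[symmetric]) auto
        qed
        finally show ?thesis .
      qed
      have gb: "0 \<le> prior_GB K a b \<Omega>" "prior_GB K a b \<Omega> \<le> K * det \<Omega> powr (a / 2 - 1)"
      proof -
        show "0 \<le> prior_GB K a b \<Omega>" using K by (simp add: prior_GB_def)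
        have "det (mat 1 - \<Omega>) \<le> det ((mat 1 - \<Omega>) + \<Omega>)" by (intro det_mono_psd O sym_pos_def_imp_psd)
        then have "det (mat 1 - \<Omega>) powr (b / 2 - 1) \<le> 1 powr (b / 2 - 1)"
          using sym_pos_def_det[OF O(2)] b by (intro powr_mono2) auto
        then show "prior_GB K a b \<Omega> \<le> K * det \<Omega> powr (a / 2 - 1)" using K
          unfolding prior_GB_def by (intro mult_left_le) auto
      qed
      have "(\<integral>\<^sup>+\<Theta>. g \<Omega> \<Theta> * indicator unit_interval_mat \<Omega> \<partial>lborel) = (\<integral>\<^sup>+\<Theta>. ennreal (prior_stage1_measurable v\<^sub>0 \<Omega> (\<Theta> :: real^'q^'r)) * ennreal (prior_GB K a b \<Omega>) \<partial>lborel)"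
        using True gb by (simp add: g_def ennreal_mult'')
      also have "\<dots> = ennreal (prior_GB K a b \<Omega>)"
      proof -
        have "(\<lambda>\<Theta>. ennreal (prior_stage1_measurable v\<^sub>0 \<Omega> (\<Theta> :: real^'q^'r))) \<in> borel_measurable lborel"
          unfolding prior_stage1_measurable_def by measurable
        then show ?thesis by (simp add: nn_integral_multc one)
      qed
      also have "\<dots> \<le> ennreal (K * det \<Omega> powr (a / 2 - 1))" by (rule ennreal_leI[OF gb(2)])
      finally show ?thesis using True K by (simp add: ennreal_mult)
    qed simp
  qed
  also have "\<dots> = ennreal K * (\<integral>\<^sup>+\<Omega>. ennreal (det \<Omega> powr (a / 2 - 1)) * indicator unit_interval_mat \<Omega> \<partial>(sym_lborel :: (real^'r^'r) measure))"
    by (rule nn_integral_cmult) measurable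
  also have "\<dots> < \<infinity>"
    using nn_integral_det_powr_finite[of "a / 2 - 1", where 'r = 'r] a by (simp add: ennreal_mult_less_top)
  finally show ?thesis by simp
qed

section \<open>Resolvents of positive definite matrices\<close>

lemma inner_entry: "A$i$j = A \<bullet> (\<chi> a b. of_bool (a = i \<and> b = j))" for A :: "real^'m^'n"
proof -
  have "A \<bullet> (\<chi> a b. of_bool (a = i \<and> b = j)) = (\<Sum>a\<in>UNIV. \<Sum>b\<in>UNIV. if a = i then (if b = j then A$a$b else 0) else 0)"
    unfolding inner_vec_def by (intro sum.cong) auto
  also have "\<dots> = (\<Sum>a\<in>UNIV. if a = i then A$a$j else 0)" by (intro sum.cong) auto
  finally show ?thesis by simp
qed

lemma inner_matrix_vector_outer: "x \<bullet> (A *v y) = A \<bullet> (\<chi> i j. x$i * y$j)" for A :: "real^'m^'n"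
  by (simp add: inner_vec_def matrix_vector_mult_def sum_distrib_left mult_ac)

text \<open>This exhibits a quadratic form as a linear functional of its matrix, so that averages of
  the matrix can be moved inside.\<close>

lemma inner_matrix_outer: "u \<bullet> (A ** w) = A \<bullet> (u ** transpose w)" for u w :: "real^'q^'n"
  using inner_matrix_right[of u A w] by (simp add: inner_commute)

lemma inner_matrix_mult_mat1: "(A ** B) \<bullet> mat 1 = transpose A \<bullet> B" for A B :: "real^'n^'n"
  using inner_matrix_left[of "mat 1" A B] by (simp add: inner_commute)

text \<open>Entries and values of the quadratic form are inner products with fixed matrices, and
  these commute with the integral.\<close>

lemma psd_integral:
  fixes \<Phi> :: "'a \<Rightarrow> real^'n^'n"
  assumes int: "integrable M \<Phi>" and ae: "AE x in M. psd (\<Phi> x)"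
  shows "psd (integral\<^sup>L M \<Phi>)"
proof -
  let ?A = "integral\<^sup>L M \<Phi>"
  have inner: "?A \<bullet> X = (\<integral>x. \<Phi> x \<bullet> X \<partial>M)" for X using int by simp
  have "?A$i$j = ?A$j$i" for i j
    unfolding inner_entry[of ?A] inner
  proof (rule integral_cong_AE)
    show "AE x in M. \<Phi> x \<bullet> (\<chi> a b. of_bool (a = i \<and> b = j)) = \<Phi> x \<bullet> (\<chi> a b. of_bool (a = j \<and> b = i))"
      using ae
    proof eventually_elim
      case (elim x)
      have "\<Phi> x = transpose (\<Phi> x)" using psdD(1)[OF elim] by simp
      then have "\<Phi> x $ i $ j = transpose (\<Phi> x) $ i $ j" by (rule arg_cong)
      also have "\<dots> = \<Phi> x $ j $ i" by (simp add: transpose_def)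
      finally show ?case by (simp only: inner_entry[of "\<Phi> x"])
    qed
  qed (use int in \<open>auto intro!: borel_measurable_inner borel_measurable_integrable\<close>)
  then have "transpose ?A = ?A" by (simp add: transpose_def vec_eq_iff)
  moreover have "0 \<le> x \<bullet> (?A *v x)" for x
    unfolding inner_matrix_vector_outer[of x ?A] inner
  proof (rule integral_nonneg_AE)
    show "AE h in M. 0 \<le> \<Phi> h \<bullet> (\<chi> i j. x$i * x$j)"
      using ae by eventually_elim (simp add: inner_matrix_vector_outer[symmetric] psdD(2))
  qed
  ultimately show ?thesis by (simp add: psd_def)
qed

abbreviation resolvent :: "real \<Rightarrow> real^'r^'r \<Rightarrow> real^'r^'r" where
  "resolvent c H \<equiv> cramer_inv (mat c + H)"

lemma resolvent:
  assumes c: "0 < c" and H: "sym_pos_def H"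
  shows "sym_pos_def (mat c + H)" "resolvent c H = matrix_inv (mat c + H)"
    "resolvent c H ** (mat c + H) = mat 1" "(mat c + H) ** resolvent c H = mat 1"
    "sym_pos_def (resolvent c H)" "transpose (resolvent c H) = resolvent c H" "psd (resolvent c H)"
proof -
  show s: "sym_pos_def (mat c + H)" by (rule sym_pos_def_mat_add[OF H less_imp_le[OF c]])
  note F = sym_pos_def_cramer_inv[OF s]
  show "resolvent c H = matrix_inv (mat c + H)"
    "resolvent c H ** (mat c + H) = mat 1" "(mat c + H) ** resolvent c H = mat 1"
    "sym_pos_def (resolvent c H)" "transpose (resolvent c H) = resolvent c H" by (rule F)+
  show "psd (resolvent c H)" by (rule sym_pos_def_imp_psd[OF F(4)])
qed

text \<open>With L H = I - c L, the difference is the sum of two congruences: I / c - L = L H L + (1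
  / c) (L H) (L H)^T.\<close>

lemma psd_resolvent_bound:
  assumes c: "0 < c" and H: "sym_pos_def H"
  shows "psd (mat (1 / c) - resolvent c H)"
proof -
  let ?L = "resolvent c H"
  note L = resolvent[OF c H]
  have LH: "?L ** H = mat 1 - c *\<^sub>R ?L" "H ** ?L = mat 1 - c *\<^sub>R ?L"
    using L(3,4) by (simp_all add: matrix_add_ldistrib matrix_add_rdistrib mat_mult_left mat_mult_right algebra_simps)
  have "?L ** H ** transpose ?L + (1 / c) *\<^sub>R ((?L ** H) ** transpose (?L ** H))
    = (mat 1 - c *\<^sub>R ?L) ** ?L + (1 / c) *\<^sub>R ((mat 1 - c *\<^sub>R ?L) ** (mat 1 - c *\<^sub>R ?L))"
    by (simp only: L(6) LH transpose_diff transpose_scaleR transpose_mat)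
  also have "\<dots> = mat (1 / c) - ?L"
  proof -
    have "(mat 1 - c *\<^sub>R ?L) ** ?L = ?L - c *\<^sub>R (?L ** ?L)"
      by (simp only: matrix_diff_rdistrib scaleR_matrix_left matrix_mul_lid)
    moreover have "(mat 1 - c *\<^sub>R ?L) ** (mat 1 - c *\<^sub>R ?L) = mat 1 - c *\<^sub>R ?L - (c *\<^sub>R ?L - c *\<^sub>R (c *\<^sub>R (?L ** ?L)))"
      by (simp only: matrix_diff_rdistrib matrix_diff_ldistrib scaleR_matrix_left scaleR_matrix_right matrix_mul_lid matrix_mul_rid scaleR_diff_right)
    moreover have "L - c *\<^sub>R M + (1 / c) *\<^sub>R (I - c *\<^sub>R L - (c *\<^sub>R L - c *\<^sub>R (c *\<^sub>R M))) = (1 / c) *\<^sub>R I - L" for L M I :: "real^'a^'a"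
      using c by (simp add: scaleR_diff_right scaleR_add_right)
    ultimately show ?thesis by (simp only: mat_scaleR[of "1 / c"])
  qed
  finally have eq: "mat (1 / c) - ?L = ?L ** H ** transpose ?L + (1 / c) *\<^sub>R ((?L ** H) ** transpose (?L ** H))" ..
  show ?thesis unfolding eq
    using c by (intro psd_add psd_scaleR psd_square psd_congruence sym_pos_def_imp_psd H) auto
qed

text \<open>Monotonicity of the trace form, applied to each factor in turn, gives L . L \<le> L . I
  / c \<le> r / c^2. The bound is uniform in H, hence resolvents are integrable under every
  posterior.\<close>

lemma norm_resolvent_bound:
  fixes H :: "real^'r^'r"
  assumes c: "0 < c" and H: "sym_pos_def H"
  shows "norm (resolvent c H) \<le> sqrt (real CARD('r)) / c"
proof -
  let ?L = "resolvent c H" and ?I = "mat (1 / c) :: real^'r^'r"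
  have "?L \<bullet> ?L \<le> ?L \<bullet> ?I"
    by (intro psd_inner_mono resolvent(7)[OF c H] psd_resolvent_bound[OF c H])
  also have "\<dots> = ?I \<bullet> ?L" by (rule inner_commute)
  also have "\<dots> \<le> ?I \<bullet> ?I" using c by (intro psd_inner_mono psd_mat psd_resolvent_bound[OF c H]) auto
  also have "\<dots> = real CARD('r) / c\<^sup>2"
    by (simp add: mat_scaleR[of "1 / c"] inner_mat_one trace_I power2_eq_square)
  finally have "(norm ?L)\<^sup>2 \<le> (sqrt (real CARD('r)) / c)\<^sup>2" by (simp add: power2_norm_eq_inner power_divide)
  then show ?thesis by (rule power2_le_imp_le) (use c in auto)
qed

lemma resolvent_identity:
  assumes a: "0 < a" and b: "0 < b" and H: "sym_pos_def H"
  shows "resolvent a H = resolvent b H + (b - a) *\<^sub>R (resolvent a H ** resolvent b H)"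
proof -
  let ?A = "resolvent a H" and ?B = "resolvent b H"
  note A = resolvent[OF a H] and B = resolvent[OF b H]
  have "?A ** ((mat b + H) - (mat a + H)) ** ?B = ?A ** ((mat b + H) ** ?B) - (?A ** (mat a + H)) ** ?B"
    by (simp only: matrix_diff_ldistrib matrix_diff_rdistrib matrix_mul_assoc)
  also have "\<dots> = ?A - ?B" by (simp add: A(3) B(4))
  also have "(mat b + H) - (mat a + H) = mat (b - a)" by (simp add: mat_diff)
  finally have "(b - a) *\<^sub>R (?A ** ?B) = ?A - ?B" by (simp only: mat_mult_right scaleR_matrix_left)
  then show ?thesis by simp
qed

lemma resolvent_identity_trace:
  assumes a: "0 < a" and b: "0 < b" and H: "sym_pos_def H"
  shows "resolvent a H \<bullet> mat 1 = resolvent b H \<bullet> mat 1 + (b - a) * (resolvent a H \<bullet> resolvent b H)"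
  by (subst resolvent_identity[OF assms])
    (simp add: inner_add_left inner_matrix_mult_mat1 resolvent(6)[OF a H])

lemma norm_resolvent_mult:
  fixes x :: "real^'q^'r"
  assumes c: "0 < c" and H: "sym_pos_def H"
  shows "norm (resolvent c H ** x) \<le> norm x / c"
proof -
  let ?y = "resolvent c H ** x"
  have x: "(mat c + H) ** ?y = x" by (simp add: matrix_mul_assoc resolvent(4)[OF c H])
  have "c * (norm ?y)\<^sup>2 \<le> c * (?y \<bullet> ?y) + ?y \<bullet> (H ** ?y)"
    using psd_quadratic_nonneg[OF sym_pos_def_imp_psd[OF H]] by (simp add: power2_norm_eq_inner)
  also have "\<dots> = ?y \<bullet> ((mat c + H) ** ?y)" by (simp only: matrix_add_rdistrib mat_mult_left inner_add_right inner_scaleR_right)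
  also have "\<dots> = ?y \<bullet> x" by (simp only: x)
  also have "\<dots> \<le> norm ?y * norm x" by (rule norm_cauchy_schwarz)
  finally have "norm ?y * (c * norm ?y) \<le> norm ?y * norm x" by (simp add: power2_eq_square mult_ac)
  then have "c * norm ?y \<le> norm x" by (cases "norm ?y = 0") (auto simp: mult_le_cancel_left)
  then show ?thesis using c by (simp add: field_simps)
qed

section \<open>Scalar inequalities: Jensen, first variation, exponential\<close>

lemma (in prob_space) jensen_exp:
  assumes int: "integrable M l"
  shows "ennreal (exp (expectation l)) \<le> (\<integral>\<^sup>+x. ennreal (exp (l x)) \<partial>M)"
proof (cases "(\<integral>\<^sup>+x. ennreal (exp (l x)) \<partial>M) = \<infinity>")
  case False
  have [measurable]: "l \<in> borel_measurable M" using int by simp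
  have ie: "integrable M (\<lambda>x. exp (l x))" using False by (intro integrableI_bounded) (auto simp: less_top)
  let ?m = "expectation l"
  have "exp ?m * (1 + (l x - ?m)) \<le> exp (l x)" for x
  proof -
    have "exp ?m * (1 + (l x - ?m)) \<le> exp ?m * exp (l x - ?m)" by (intro mult_left_mono exp_ge_add_one_self) auto
    then show ?thesis by (simp add: exp_add[symmetric])
  qed
  then have "expectation (\<lambda>x. exp ?m * (1 + (l x - ?m))) \<le> expectation (\<lambda>x. exp (l x))"
    using int ie by (intro integral_mono) auto
  moreover have "expectation (\<lambda>x. exp ?m * (1 + (l x - ?m))) = exp ?m" using int by (simp add: prob_space)
  ultimately have "exp ?m \<le> expectation (\<lambda>x. exp (l x))" by simp
  then show ?thesis using ie by (simp add: nn_integral_eq_integral ennreal_leI)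
qed simp

lemma zero_coeff_if_locally_nonneg:
  fixes a B s\<^sub>0 :: real
  assumes s0: "0 < s\<^sub>0" and nn: "\<And>s. \<bar>s\<bar> \<le> s\<^sub>0 \<Longrightarrow> 0 \<le> s * a + s\<^sup>2 * B"
  shows "a = 0"
proof -
  have le: "\<bar>a\<bar> \<le> e" if e: "0 < e" for e
  proof -
    define s where "s = min s\<^sub>0 (e / (\<bar>B\<bar> + 1))"
    have s: "0 < s" "s \<le> s\<^sub>0" using s0 e by (auto simp: s_def)
    have "s * \<bar>B\<bar> \<le> e"
    proof -
      have "s * \<bar>B\<bar> \<le> (e / (\<bar>B\<bar> + 1)) * \<bar>B\<bar>" by (intro mult_right_mono) (auto simp: s_def)
      also have "\<dots> \<le> e" using e by (simp add: field_simps)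
      finally show ?thesis .
    qed
    moreover have "s * B \<le> s * \<bar>B\<bar>" using s by (intro mult_left_mono) auto
    ultimately have sB: "s * B \<le> e" by simp
    have "0 \<le> s * (a + s * B)" "0 \<le> s * (- a + s * B)"
      using nn[of s] nn[of "- s"] s by (auto simp: power2_eq_square algebra_simps)
    then have "0 \<le> a + s * B" "0 \<le> - a + s * B" using s by (auto simp: zero_le_mult_iff)
    then show ?thesis using sB by linarith
  qed
  show ?thesis
  proof (rule ccontr)
    assume "a \<noteq> 0"
    then show False using le[of "\<bar>a\<bar> / 2"] by simp
  qed
qed

text \<open>From (1 - x) exp x \<le> 1, because (1 - x) (1 + x + 2 x^2) = 1 + x^2 (1 - 2 x) is at
  least 1.\<close>

lemma exp_le_quadratic: "x \<le> 1 / 2 \<Longrightarrow> exp x \<le> 1 + x + 2 * x\<^sup>2" for x :: real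
proof -
  assume x: "x \<le> 1 / 2"
  have "(1 - x) * exp x \<le> exp (- x) * exp x"
    using exp_ge_add_one_self[of "- x"] by (intro mult_right_mono) auto
  then have "(1 - x) * exp x \<le> 1" by (simp add: exp_add[symmetric])
  also have "1 \<le> (1 - x) * (1 + x + 2 * x\<^sup>2)"
  proof -
    have "(1 - x) * (1 + x + 2 * x\<^sup>2) = 1 + x\<^sup>2 * (1 - 2 * x)" by (simp add: power2_eq_square algebra_simps)
    then show ?thesis using x by simp
  qed
  finally show ?thesis using x by (simp add: mult_le_cancel_left)
qed

section \<open>The posterior distribution of the covariance matrix\<close>

text \<open>The parameter \<open>type\<close> fixes the dimensions, which the real parameters do not
  mention. Finiteness and positivity of the marginals make the posterior a probability
  measure.\<close>

locale normal_mixture =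
  fixes v\<^sub>0 \<kappa> \<beta> :: real and type :: "(real^'q^'r) itself"
  assumes v0: "0 < v\<^sub>0" and \<kappa>: "0 \<le> \<kappa>" and \<beta>: "0 \<le> \<beta>"
    and finite_marginal: "\<And>v (z :: real^'q^'r). 0 < v \<Longrightarrow> mix_marginal v\<^sub>0 \<kappa> \<beta> v z \<noteq> \<top>"
    and nonzero_marginal: "\<And>v (z :: real^'q^'r). 0 < v \<Longrightarrow> mix_marginal v\<^sub>0 \<kappa> \<beta> v z \<noteq> 0"
begin

abbreviation dens :: "real \<Rightarrow> real^'q^'r \<Rightarrow> real^'r^'r \<Rightarrow> real" where
  "dens \<equiv> mix_density v\<^sub>0 \<kappa> \<beta>"

abbreviation marg :: "real \<Rightarrow> real^'q^'r \<Rightarrow> ennreal" where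
  "marg \<equiv> mix_marginal v\<^sub>0 \<kappa> \<beta>"

abbreviation PD :: "(real^'r^'r) set" where
  "PD \<equiv> {A. sym_pos_def A}"

text \<open>The conditional law of H when u is observed with column covariance v I + H and H has
  weight det(\<open>v\<^sub>0\<close> I + H)^(-\<kappa>) det(H)^\<beta>.\<close>

definition post :: "real \<Rightarrow> real^'q^'r \<Rightarrow> (real^'r^'r) measure" where
  "post v u = density sym_lborel (\<lambda>H. ennreal (dens v u H) * indicator PD H / marg v u)"

lemma dens_nonneg [simp]: "0 \<le> dens v u H"
  by (simp add: mix_density_def)

lemma sets_post [simp, measurable_cong]: "sets (post v u) = sets borel"
  by (simp add: post_def)

lemma space_post [simp]: "space (post v u) = UNIV"
  by (simp add: post_def)

lemma nn_integral_post:
  assumes v: "0 < v" and [measurable]: "F \<in> borel_measurable borel"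
  shows "(\<integral>\<^sup>+H. ennreal (dens v u H) * indicator PD H * F H \<partial>sym_lborel) = marg v u * (\<integral>\<^sup>+H. F H \<partial>post v u)"
proof -
  let ?f = "\<lambda>H. ennreal (dens v u H) * indicator PD H"
  have "(\<integral>\<^sup>+H. F H \<partial>post v u) = (\<integral>\<^sup>+H. (?f H / marg v u) * F H \<partial>sym_lborel)"
    unfolding post_def by (rule nn_integral_density) measurable
  also have "\<dots> = (\<integral>\<^sup>+H. (?f H * F H) * (1 / marg v u) \<partial>sym_lborel)"
    by (intro nn_integral_cong) (simp add: ennreal_times_divide mult_ac)
  also have "\<dots> = (\<integral>\<^sup>+H. ?f H * F H \<partial>sym_lborel) * (1 / marg v u)" by (rule nn_integral_multc) measurable
  finally have "marg v u * (\<integral>\<^sup>+H. F H \<partial>post v u) = marg v u * ((\<integral>\<^sup>+H. ?f H * F H \<partial>sym_lborel) * (1 / marg v u))"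
    by (rule arg_cong)
  also have "\<dots> = (\<integral>\<^sup>+H. ?f H * F H \<partial>sym_lborel) * (marg v u / marg v u)"
    by (subst mult.left_commute) (simp add: ennreal_times_divide)
  also have "marg v u / marg v u = 1"
    using finite_marginal[OF v, of u] nonzero_marginal[OF v, of u] by (simp add: ennreal_divide_self less_top)
  finally show ?thesis by simp
qed

lemma prob_space_post: "0 < v \<Longrightarrow> prob_space (post v u)"
proof
  assume v: "0 < v"
  have "marg v u = marg v u * (\<integral>\<^sup>+H. 1 \<partial>post v u)"
    using nn_integral_post[OF v, of "\<lambda>_. 1" u] by (simp add: mix_marginal_def)
  then have "marg v u * emeasure (post v u) (space (post v u)) = marg v u * 1" by simp
  then show "emeasure (post v u) (space (post v u)) = 1"
    using finite_marginal[OF v, of u] nonzero_marginal[OF v, of u] by (subst (asm) ennreal_mult_cancel_left) auto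
qed

lemma AE_post: "AE H in post v u. sym_pos_def H"
proof -
  have "AE H in sym_lborel. 0 < ennreal (dens v u H) * indicator PD H / marg v u \<longrightarrow> sym_pos_def H"
    by (rule AE_I2) (auto simp: indicator_def)
  then show ?thesis unfolding post_def by (subst AE_density) auto
qed

lemma integrable_post:
  fixes f :: "real^'r^'r \<Rightarrow> 'b::{banach, second_countable_topology}"
  assumes v: "0 < v" and f: "f \<in> borel_measurable borel" and B: "\<And>H. sym_pos_def H \<Longrightarrow> norm (f H) \<le> B"
  shows "integrable (post v u) f"
proof -
  interpret prob_space "post v u" by (rule prob_space_post[OF v])
  have "AE H in post v u. norm (f H) \<le> B" using AE_post[of v u] by eventually_elim (rule B)
  then show ?thesis using f by (intro integrable_const_bound) auto
qed

text \<open>For c = v, this matrix applied to u is minus the gradient of ln m_v at u. For c =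
  \<open>v\<^sub>0\<close> it comes from the derivative of the logarithm of the weight
  det(\<open>v\<^sub>0\<close> I + H)^(-\<kappa>).\<close>

definition mean_resolvent :: "real \<Rightarrow> real \<Rightarrow> real^'q^'r \<Rightarrow> real^'r^'r" where
  "mean_resolvent c v u = (\<integral>H. resolvent c H \<partial>post v u)"

lemma integrable_resolvent: "0 < v \<Longrightarrow> 0 < c \<Longrightarrow> integrable (post v u) (resolvent c)"
  by (rule integrable_post[OF _ _ norm_resolvent_bound]) auto

lemma integrable_resolvent_inner: "0 < v \<Longrightarrow> 0 < c \<Longrightarrow> integrable (post v u) (\<lambda>H. resolvent c H \<bullet> X)"
  using integrable_resolvent[of v c u] by simp

lemma mean_resolvent_inner:
  "0 < v \<Longrightarrow> 0 < c \<Longrightarrow> (\<integral>H. resolvent c H \<bullet> X \<partial>post v u) = mean_resolvent c v u \<bullet> X"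
  unfolding mean_resolvent_def using integrable_resolvent[of v c u] by simp

lemma psd_mean_resolvent: "0 < v \<Longrightarrow> 0 < c \<Longrightarrow> psd (mean_resolvent c v u)"
  unfolding mean_resolvent_def
  by (rule psd_integral[OF integrable_resolvent]) (use AE_post[of v u] in \<open>auto elim!: eventually_mono intro: resolvent(7)\<close>)

lemma psd_mean_resolvent_bound:
  assumes v: "0 < v" and c: "0 < c"
  shows "psd (mat (1 / c) - mean_resolvent c v u)"
proof -
  interpret prob_space "post v u" by (rule prob_space_post[OF v])
  have "mat (1 / c) - mean_resolvent c v u = (\<integral>H. mat (1 / c) - resolvent c H \<partial>post v u)"
    unfolding mean_resolvent_def using integrable_resolvent[OF v c, of u] by (simp add: prob_space[simplified])
  moreover have "psd (\<integral>H. mat (1 / c) - resolvent c H \<partial>post v u)"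
    by (rule psd_integral) (use integrable_resolvent[OF v c, of u] AE_post[of v u] c
        in \<open>auto elim!: eventually_mono intro: psd_resolvent_bound\<close>)
  ultimately show ?thesis by simp
qed

text \<open>A pointwise comparison of integrands bounds the quotient of m and the marginal by a
  posterior mean of exp l. Jensen's inequality replaces it by the exponential of a posterior mean,
  where only averaged resolvents remain.\<close>

lemma marg_ratio_lower_bound:
  assumes v': "0 < v'" and l: "integrable (post v' u) l" "l \<in> borel_measurable borel"
    and le: "ennreal e * (\<integral>\<^sup>+H. ennreal (dens v' u H) * indicator PD H * ennreal (exp (l H)) \<partial>sym_lborel) \<le> m"
  shows "marg v' u * ennreal (e * exp (\<integral>H. l H \<partial>post v' u)) \<le> m"
proof -
  interpret prob_space "post v' u" by (rule prob_space_post[OF v'])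
  have "marg v' u * ennreal (e * exp (\<integral>H. l H \<partial>post v' u)) = ennreal e * (marg v' u * ennreal (exp (\<integral>H. l H \<partial>post v' u)))"
    by (simp add: ennreal_mult'' mult_ac)
  also have "\<dots> \<le> ennreal e * (marg v' u * (\<integral>\<^sup>+H. ennreal (exp (l H)) \<partial>post v' u))"
    by (intro mult_left_mono jensen_exp l) auto
  also have "\<dots> = ennreal e * (\<integral>\<^sup>+H. ennreal (dens v' u H) * indicator PD H * ennreal (exp (l H)) \<partial>sym_lborel)"
    using l(2) by (subst nn_integral_post[OF v']) auto
  finally show ?thesis using le by simp
qed

text \<open>The substitution H \<mapsto> H + 2h I turns v I + H into (v + 2h) I + H, so the normal
  determinant matches exactly and only the quadratic form and the two weights change. The weights
  are controlled by tangents of ln det: at \<open>mat v\<^sub>0 + H\<close> from above for the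
  negative power, at the shifted point for the positive one.\<close>

lemma dens_shift_lower_bound:
  assumes v: "0 < v" and h: "0 < h" and H: "sym_pos_def H"
  shows "dens (v + 2 * h) u H * exp ((u \<bullet> (resolvent (v + 2 * h) H ** u) - w \<bullet> (resolvent (v + 2 * h) H ** w)) / 2
      - 2 * h * \<kappa> * (resolvent v\<^sub>0 H \<bullet> mat 1) + 2 * h * \<beta> * (resolvent (v + 2 * h) H \<bullet> mat 1))
    \<le> dens v w (H + mat (2 * h))"
proof -
  let ?v' = "v + 2 * h" and ?S = "mat (v + 2 * h) + H" and ?Q = "mat v\<^sub>0 + H"
  have v': "0 < ?v'" using v h by simp
  have e1: "mat v + (H + mat (2 * h)) = ?S" using mat_add[of v "2 * h"] by (simp add: algebra_simps)
  have Q: "sym_pos_def ?Q" by (rule resolvent(1)[OF v0 H])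
  have Q2: "sym_pos_def (?Q + mat (2 * h))" using h by (intro sym_pos_def_add[OF Q] psd_mat) auto
  have H2: "sym_pos_def (mat (2 * h) + H)" using h by (intro sym_pos_def_mat_add[OF H]) auto
  note d = sym_pos_def_det[OF Q] sym_pos_def_det[OF Q2] sym_pos_def_det[OF H2] sym_pos_def_det[OF H]
  have m2: "X \<bullet> mat (2 * h) = 2 * h * (X \<bullet> mat 1)" for X :: "real^'r^'r" by (simp add: mat_scaleR[of "2 * h"])
  have "ln (det (?Q + mat (2 * h))) \<le> ln (det ?Q) + matrix_inv ?Q \<bullet> ((?Q + mat (2 * h)) - ?Q)"
    by (rule ln_det_tangent[OF Q2 Q])
  then have 1: "ln (det (?Q + mat (2 * h))) \<le> ln (det ?Q) + 2 * h * (resolvent v\<^sub>0 H \<bullet> mat 1)"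
    by (simp add: resolvent(2)[OF v0 H] m2)
  have k: "det ?Q powr (- \<kappa>) * exp (- 2 * h * \<kappa> * (resolvent v\<^sub>0 H \<bullet> mat 1)) \<le> det (?Q + mat (2 * h)) powr (- \<kappa>)"
  proof -
    have "- \<kappa> * ln (det ?Q) + (- 2 * h * \<kappa> * (resolvent v\<^sub>0 H \<bullet> mat 1)) \<le> - \<kappa> * ln (det (?Q + mat (2 * h)))"
      using mult_left_mono[OF 1 \<kappa>] by (simp add: algebra_simps)
    then show ?thesis using d by (simp add: powr_def exp_add[symmetric])
  qed
  have "ln (det H) \<le> ln (det (mat (2 * h) + H)) + matrix_inv (mat (2 * h) + H) \<bullet> (H - (mat (2 * h) + H))"
    by (rule ln_det_tangent[OF H H2])
  then have 2: "ln (det H) + 2 * h * (resolvent (2 * h) H \<bullet> mat 1) \<le> ln (det (mat (2 * h) + H))"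
    using h by (simp add: resolvent(2)[OF _ H] m2)
  \<comment> \<open>The tangent at H + 2h I produces the resolvent at 2h. Resolvents decrease in the
    parameter and 2h < v + 2h, so it may be replaced by the resolvent at v + 2h, the one that occurs
    in the quadratic form.\<close>
  have "resolvent ?v' H \<bullet> mat 1 \<le> resolvent (2 * h) H \<bullet> mat 1"
    using resolvent_identity_trace[OF _ v' H, of "2 * h"] h v
      psd_inner_nonneg[OF resolvent(7)[OF _ H, of "2 * h"] resolvent(7)[OF v' H]] by simp
  then have "2 * h * (resolvent ?v' H \<bullet> mat 1) \<le> 2 * h * (resolvent (2 * h) H \<bullet> mat 1)" using h by simp
  with 2 have 3: "ln (det H) + 2 * h * (resolvent ?v' H \<bullet> mat 1) \<le> ln (det (mat (2 * h) + H))" by linarith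
  have b: "det H powr \<beta> * exp (2 * h * \<beta> * (resolvent ?v' H \<bullet> mat 1)) \<le> det (H + mat (2 * h)) powr \<beta>"
  proof -
    have "\<beta> * ln (det H) + 2 * h * \<beta> * (resolvent ?v' H \<bullet> mat 1) \<le> \<beta> * ln (det (mat (2 * h) + H))"
      using mult_left_mono[OF 3 \<beta>] by (simp add: algebra_simps)
    then show ?thesis using d by (simp add: powr_def exp_add[symmetric] add.commute)
  qed
  let ?a = "det ?S powr (- real CARD('q) / 2)" and ?eu = "exp (- (u \<bullet> (resolvent ?v' H ** u)) / 2)" and ?ew = "exp (- (w \<bullet> (resolvent ?v' H ** w)) / 2)"
  have "dens ?v' u H * exp ((u \<bullet> (resolvent ?v' H ** u) - w \<bullet> (resolvent ?v' H ** w)) / 2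
      - 2 * h * \<kappa> * (resolvent v\<^sub>0 H \<bullet> mat 1) + 2 * h * \<beta> * (resolvent ?v' H \<bullet> mat 1))
    = ?a * ?ew * ((det ?Q powr (- \<kappa>) * exp (- 2 * h * \<kappa> * (resolvent v\<^sub>0 H \<bullet> mat 1))) * (det H powr \<beta> * exp (2 * h * \<beta> * (resolvent ?v' H \<bullet> mat 1))))"
  proof -
    have "?eu * exp ((u \<bullet> (resolvent ?v' H ** u) - w \<bullet> (resolvent ?v' H ** w)) / 2
      - 2 * h * \<kappa> * (resolvent v\<^sub>0 H \<bullet> mat 1) + 2 * h * \<beta> * (resolvent ?v' H \<bullet> mat 1))
      = ?ew * exp (- 2 * h * \<kappa> * (resolvent v\<^sub>0 H \<bullet> mat 1)) * exp (2 * h * \<beta> * (resolvent ?v' H \<bullet> mat 1))"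
      unfolding exp_add[symmetric] by (rule arg_cong[of _ _ exp]) (simp add: field_simps)
    moreover have "a * e * (k * b) * x = a * w' * ((k * x1) * (b * x2))" if "e * x = w' * x1 * x2" for a e k b x w' x1 x2 :: real
    proof -
      have "a * e * (k * b) * x = a * (k * b) * (e * x)" by (simp only: mult_ac)
      then show ?thesis unfolding that by (simp only: mult_ac)
    qed
    ultimately show ?thesis unfolding mix_density_def by blast
  qed
  also have "\<dots> \<le> ?a * ?ew * (det (?Q + mat (2 * h)) powr (- \<kappa>) * det (H + mat (2 * h)) powr \<beta>)"
    by (intro mult_left_mono mult_mono k b) auto
  also have "\<dots> = dens v w (H + mat (2 * h))" unfolding mix_density_def e1 by (simp add: add.assoc)
  finally show ?thesis .
qed

text \<open>E is chosen such that v I + (N X N + E) = N S N with S = (v + 2h) I + X. At the point N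
  u the quadratic form is then the one at u for S, so nothing is gained or lost there; the
  determinant of N and the weight at \<open>v\<^sub>0\<close> account for the whole exponent. The
  hypothesis \<open>dom\<close> says that N^-2 is at most I + c A.\<close>

lemma dens_congruence_lower_bound:
  assumes v: "0 < v" and h: "0 < h" and X: "sym_pos_def X"
    and N: "sym_pos_def N" and E: "psd E" and E_eq: "E = (v + 2 * h) *\<^sub>R (N ** N) - mat v"
    and \<gamma>: "0 \<le> v\<^sub>0 - v" and A: "psd A" and c: "0 \<le> c"
    and dom: "psd (N ** (mat 1 + c *\<^sub>R A) ** N - mat 1)"
  shows "dens (v + 2 * h) u X * exp ((- real CARD('q) + 2 * \<beta> - 2 * \<kappa>) * ln (det N)
      - \<kappa> * (2 * h * (resolvent v\<^sub>0 X \<bullet> mat 1) + (v\<^sub>0 - v) * c * (resolvent v\<^sub>0 X \<bullet> A)))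
    \<le> dens v (N ** u) (N ** X ** N + E)"
proof -
  let ?v' = "v + 2 * h" and ?S = "mat (v + 2 * h) + X" and ?Q = "mat v\<^sub>0 + X" and ?\<gamma> = "v\<^sub>0 - v"
  have v': "0 < ?v'" using v h by simp
  have tN: "transpose N = N" by (rule sym_pos_defD(1)[OF N])
  have iN: "invertible N" by (rule sym_pos_def_invertible[OF N])
  have dN: "0 < det N" by (rule sym_pos_def_det[OF N])
  have S: "sym_pos_def ?S" by (rule resolvent(1)[OF v' X])
  have Q: "sym_pos_def ?Q" by (rule resolvent(1)[OF v0 X])
  have NSN: "sym_pos_def (N ** ?S ** N)" using sym_pos_def_congruence[OF S iN] by (simp add: tN)
  have NXN: "sym_pos_def (N ** X ** N)" using sym_pos_def_congruence[OF X iN] by (simp add: tN)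
  have e1: "mat v + (N ** X ** N + E) = N ** ?S ** N"
    by (simp add: E_eq matrix_add_ldistrib matrix_add_rdistrib mat_mult_right scaleR_matrix_left)
  have e2: "mat v\<^sub>0 + (N ** X ** N + E) = mat ?\<gamma> + N ** ?S ** N"
  proof -
    have "mat v\<^sub>0 = (mat ?\<gamma> + mat v :: real^'r^'r)" by (simp add: mat_add)
    then show ?thesis unfolding e1[symmetric] by (simp add: add.assoc)
  qed
  let ?Y = "cramer_inv (N ** ?S ** N)"
  have Y: "?Y ** (N ** ?S ** N) = mat 1" by (rule sym_pos_def_cramer_inv(2)[OF NSN])
  have NYN: "N ** ?Y ** N = resolvent ?v' X"
  proof -
    have "(N ** ?Y ** N) ** ?S ** N = N ** (?Y ** (N ** ?S ** N))" by (simp only: matrix_mul_assoc)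
    also have "\<dots> = N" by (simp add: Y)
    finally have "((N ** ?Y ** N) ** ?S ** N) ** matrix_inv N = N ** matrix_inv N" by simp
    moreover have "((N ** ?Y ** N) ** ?S ** N) ** matrix_inv N = (N ** ?Y ** N) ** ?S ** (N ** matrix_inv N)"
      by (simp only: matrix_mul_assoc)
    ultimately have "(N ** ?Y ** N) ** ?S = mat 1" by (simp add: matrix_inv_mult[OF iN])
    then have "(N ** ?Y ** N) ** (?S ** resolvent ?v' X) = resolvent ?v' X" by (simp add: matrix_mul_assoc)
    then show ?thesis by (simp add: resolvent(4)[OF v' X])
  qed
  have q: "(N ** u) \<bullet> (?Y ** (N ** u)) = u \<bullet> (resolvent ?v' X ** u)"
  proof -
    have "(N ** u) \<bullet> (?Y ** (N ** u)) = u \<bullet> (N ** (?Y ** (N ** u)))"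
      using inner_matrix_left[of u N "?Y ** (N ** u)"] by (simp add: tN)
    also have "N ** (?Y ** (N ** u)) = (N ** ?Y ** N) ** u" by (simp only: matrix_mul_assoc)
    finally show ?thesis by (simp only: NYN)
  qed
  have dS: "0 < det ?S" and dQ: "0 < det ?Q" and dX: "0 < det X" using S Q X by (auto intro: sym_pos_def_det)
  have lndet: "ln (det (N ** M ** N)) = 2 * ln (det N) + ln (det M)" if "0 < det M" for M :: "real^'r^'r"
    using dN that by (simp add: det_mul ln_mult)
  have p1: "det (N ** ?S ** N) powr (- real CARD('q) / 2) = det ?S powr (- real CARD('q) / 2) * exp (- real CARD('q) * ln (det N))"
  proof -
    have "a powr (- q / 2) = b powr (- q / 2) * exp (- q * n)" if "0 < a" "0 < b" "ln a = 2 * n + ln b" for a b n q :: real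
      using that(1,2) by (simp add: powr_def exp_add[symmetric] that(3) algebra_simps)
    from this[OF sym_pos_def_det[OF NSN] dS lndet[OF dS]] show ?thesis .
  qed
  have p2: "det X powr \<beta> * exp (2 * \<beta> * ln (det N)) \<le> det (N ** X ** N + E) powr \<beta>"
  proof -
    have "det X powr \<beta> * exp (2 * \<beta> * ln (det N)) = det (N ** X ** N) powr \<beta>"
      using sym_pos_def_det[OF NXN] dX by (simp add: powr_def lndet[OF dX] exp_add[symmetric] algebra_simps)
    also have "\<dots> \<le> det (N ** X ** N + E) powr \<beta>"
      using sym_pos_def_det[OF NXN] det_mono_psd[OF NXN E] \<beta> by (intro powr_mono2) auto
    finally show ?thesis .
  qed
  \<comment> \<open>Here (\<open>v\<^sub>0\<close> - v) I is replaced by the larger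
    (\<open>v\<^sub>0\<close> - v) N (I + c A) N, so that a full congruence can be pulled out of the
    determinant.\<close>
  let ?R = "?S + ?\<gamma> *\<^sub>R (mat 1 + c *\<^sub>R A)"
  have psdR: "psd (?\<gamma> *\<^sub>R (mat 1 + c *\<^sub>R A))" using \<gamma> c by (intro psd_scaleR psd_add psd_mat A) auto
  have R: "sym_pos_def ?R" by (rule sym_pos_def_add[OF S psdR])
  have "det (mat ?\<gamma> + N ** ?S ** N) \<le> det (N ** ?R ** N)"
  proof -
    have "N ** ?R ** N = (mat ?\<gamma> + N ** ?S ** N) + ?\<gamma> *\<^sub>R (N ** (mat 1 + c *\<^sub>R A) ** N - mat 1)"
    proof -
      have "N ** (T + g *\<^sub>R M) ** N = (mat g + N ** T ** N) + g *\<^sub>R (N ** M ** N - mat 1)" for T M :: "real^'r^'r" and g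
        by (simp add: matrix_add_ldistrib matrix_add_rdistrib scaleR_matrix_left scaleR_matrix_right
            mat_scaleR[of g] scaleR_diff_right)
      then show ?thesis .
    qed
    moreover have "sym_pos_def (mat ?\<gamma> + N ** ?S ** N)" by (rule sym_pos_def_mat_add[OF NSN \<gamma>])
    ultimately show ?thesis using det_mono_psd[OF _ psd_scaleR[OF dom \<gamma>]] by metis
  qed
  moreover have dg: "0 < det (mat ?\<gamma> + N ** ?S ** N)" by (rule sym_pos_def_det[OF sym_pos_def_mat_add[OF NSN \<gamma>]])
  ultimately have "ln (det (mat ?\<gamma> + N ** ?S ** N)) \<le> ln (det (N ** ?R ** N))" by simp
  also have "\<dots> = 2 * ln (det N) + ln (det ?R)" by (rule lndet[OF sym_pos_def_det[OF R]])
  also have "ln (det ?R) \<le> ln (det ?Q) + matrix_inv ?Q \<bullet> (?R - ?Q)" by (rule ln_det_tangent[OF R Q])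
  \<comment> \<open>The multiples of the identity combine as (v + 2h) - \<open>v\<^sub>0\<close> +
    (\<open>v\<^sub>0\<close> - v) = 2h.\<close>
  also have "?R - ?Q = (2 * h) *\<^sub>R mat 1 + (?\<gamma> * c) *\<^sub>R A"
    by (simp only: mat_scaleR[of "v + 2 * h"] mat_scaleR[of v\<^sub>0]) (simp add: algebra_simps)
  finally have l: "ln (det (mat ?\<gamma> + N ** ?S ** N)) \<le> 2 * ln (det N) + ln (det ?Q)
      + (2 * h * (resolvent v\<^sub>0 X \<bullet> mat 1) + ?\<gamma> * c * (resolvent v\<^sub>0 X \<bullet> A))"
    by (simp add: resolvent(2)[OF v0 X] inner_add_right)
  have p3: "det ?Q powr (- \<kappa>) * exp (- 2 * \<kappa> * ln (det N) - \<kappa> * (2 * h * (resolvent v\<^sub>0 X \<bullet> mat 1) + ?\<gamma> * c * (resolvent v\<^sub>0 X \<bullet> A)))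
    \<le> det (mat ?\<gamma> + N ** ?S ** N) powr (- \<kappa>)"
  proof -
    have "- \<kappa> * ln (det ?Q) + (- 2 * \<kappa> * ln (det N) - \<kappa> * (2 * h * (resolvent v\<^sub>0 X \<bullet> mat 1) + ?\<gamma> * c * (resolvent v\<^sub>0 X \<bullet> A)))
      \<le> - \<kappa> * ln (det (mat ?\<gamma> + N ** ?S ** N))"
      using mult_left_mono[OF l \<kappa>] by (simp add: algebra_simps)
    then show ?thesis using dQ dg by (simp add: powr_def exp_add[symmetric])
  qed
  let ?K = "- \<kappa> * (2 * h * (resolvent v\<^sub>0 X \<bullet> mat 1) + ?\<gamma> * c * (resolvent v\<^sub>0 X \<bullet> A))"
  let ?ee = "exp (- (u \<bullet> (resolvent ?v' X ** u)) / 2)"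
  have "dens ?v' u X * exp ((- real CARD('q) + 2 * \<beta> - 2 * \<kappa>) * ln (det N)
      - \<kappa> * (2 * h * (resolvent v\<^sub>0 X \<bullet> mat 1) + ?\<gamma> * c * (resolvent v\<^sub>0 X \<bullet> A)))
    = (det ?S powr (- real CARD('q) / 2) * exp (- real CARD('q) * ln (det N))) * ?ee *
      ((det ?Q powr (- \<kappa>) * exp (- 2 * \<kappa> * ln (det N) - \<kappa> * (2 * h * (resolvent v\<^sub>0 X \<bullet> mat 1) + ?\<gamma> * c * (resolvent v\<^sub>0 X \<bullet> A))))
        * (det X powr \<beta> * exp (2 * \<beta> * ln (det N))))"
  proof -
    have "exp ((- real CARD('q) + 2 * \<beta> - 2 * \<kappa>) * ln (det N) - \<kappa> * (2 * h * (resolvent v\<^sub>0 X \<bullet> mat 1) + ?\<gamma> * c * (resolvent v\<^sub>0 X \<bullet> A)))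
      = exp (- real CARD('q) * ln (det N)) * exp (- 2 * \<kappa> * ln (det N) - \<kappa> * (2 * h * (resolvent v\<^sub>0 X \<bullet> mat 1) + ?\<gamma> * c * (resolvent v\<^sub>0 X \<bullet> A)))
        * exp (2 * \<beta> * ln (det N))"
      unfolding exp_add[symmetric] by (rule arg_cong[of _ _ exp]) (simp add: algebra_simps)
    moreover have "a * e * (k * b) * x = (a * x1) * e * ((k * x2) * (b * x3))" if "x = x1 * x2 * x3" for a e k b x x1 x2 x3 :: real
      unfolding that by (simp only: mult_ac)
    ultimately show ?thesis unfolding mix_density_def by blast
  qed
  also have "\<dots> \<le> det (N ** ?S ** N) powr (- real CARD('q) / 2) * ?ee *
      (det (mat ?\<gamma> + N ** ?S ** N) powr (- \<kappa>) * det (N ** X ** N + E) powr \<beta>)"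
    unfolding p1 by (intro mult_left_mono mult_mono p2 p3) auto
  also have "\<dots> = dens v (N ** u) (N ** X ** N + E)"
    unfolding mix_density_def e1 e2 q ..
  finally show ?thesis .
qed

text \<open>These bound the loss from the weight at \<open>v\<^sub>0\<close>, measured by B, in
  terms of the trace of A. The variance v' = v + 2h may exceed \<open>v\<^sub>0\<close> by up to h
  at the end of the path, which costs the factor 1 - h / v'. For v' < \<open>v\<^sub>0\<close> the
  second inequality is a Jensen inequality for the matrix inverse.\<close>

lemma mean_resolvent_inequalities:
  fixes u :: "real^'q^'r"
  assumes v': "0 < v'" and h: "0 < h" "h < v'" and d: "- h \<le> v\<^sub>0 - v'"
  defines "A \<equiv> mean_resolvent v' v' u" and "B \<equiv> mean_resolvent v\<^sub>0 v' u"
  shows "(1 - h / v') * (B \<bullet> mat 1) \<le> A \<bullet> mat 1"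
    and "(1 - h / v') * (B \<bullet> mat 1 + (v\<^sub>0 - v') * (B \<bullet> A)) \<le> A \<bullet> mat 1"
    and "0 \<le> B \<bullet> A" and "v' * (B \<bullet> A) \<le> B \<bullet> mat 1" and "0 \<le> A \<bullet> mat 1"
proof -
  interpret prob_space "post v' u" by (rule prob_space_post[OF v'])
  let ?\<delta> = "v\<^sub>0 - v'" and ?\<epsilon> = "h / v'"
  have \<epsilon>: "0 < ?\<epsilon>" "?\<epsilon> < 1" using v' h by auto
  have A: "psd A" "psd (mat (1 / v') - A)" and B: "psd B"
    unfolding A_def B_def using v' v0 by (auto intro: psd_mean_resolvent psd_mean_resolvent_bound)
  show BA: "0 \<le> B \<bullet> A" by (rule psd_inner_nonneg[OF B A(1)])
  have "0 \<le> mat 1 \<bullet> A" by (intro psd_inner_nonneg psd_mat A) auto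
  then show t0: "0 \<le> A \<bullet> mat 1" by (simp add: inner_commute)
  have "0 \<le> mat 1 \<bullet> B" by (intro psd_inner_nonneg psd_mat B) auto
  then have b0: "0 \<le> B \<bullet> mat 1" by (simp add: inner_commute)
  have "B \<bullet> A \<le> B \<bullet> mat (1 / v')" by (rule psd_inner_mono[OF B A(2)])
  then have "B \<bullet> A \<le> (1 / v') * (B \<bullet> mat 1)" by (simp add: mat_scaleR[of "1 / v'"])
  then show "v' * (B \<bullet> A) \<le> B \<bullet> mat 1" using v' by (simp add: field_simps)
  have intA: "integrable (post v' u) (\<lambda>H. resolvent v' H \<bullet> X)" and intB: "integrable (post v' u) (\<lambda>H. resolvent v\<^sub>0 H \<bullet> X)" for X
    using v' v0 by (auto intro: integrable_resolvent_inner)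
  have eA: "expectation (\<lambda>H. resolvent v' H \<bullet> X) = A \<bullet> X" and eB: "expectation (\<lambda>H. resolvent v\<^sub>0 H \<bullet> X) = B \<bullet> X" for X
    unfolding A_def B_def using v' v0 by (auto intro: mean_resolvent_inner)
  show F2: "(1 - ?\<epsilon>) * (B \<bullet> mat 1) \<le> A \<bullet> mat 1"
  proof -
    have "(1 - ?\<epsilon>) * (B \<bullet> mat 1) = expectation (\<lambda>H. (1 - ?\<epsilon>) * (resolvent v\<^sub>0 H \<bullet> mat 1))"
      by (simp add: eB)
    also have "\<dots> \<le> expectation (\<lambda>H. resolvent v' H \<bullet> mat 1)"
    proof (rule integral_mono_AE)
      show "AE H in post v' u. (1 - ?\<epsilon>) * (resolvent v\<^sub>0 H \<bullet> mat 1) \<le> resolvent v' H \<bullet> mat 1"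
        using AE_post[of v' u]
      proof eventually_elim
        case (elim H)
        let ?x = "resolvent v\<^sub>0 H \<bullet> mat 1" and ?y = "resolvent v\<^sub>0 H \<bullet> resolvent v' H"
        have eq: "?x = resolvent v' H \<bullet> mat 1 - ?\<delta> * ?y"
          using resolvent_identity_trace[OF v0 v' elim] by (simp add: algebra_simps)
        have "0 \<le> ?y" by (intro psd_inner_nonneg resolvent(7) v0 v' elim)
        have "0 \<le> mat 1 \<bullet> resolvent v\<^sub>0 H" by (intro psd_inner_nonneg psd_mat resolvent(7) v0 elim) auto
        then have x0: "0 \<le> ?x" by (simp add: inner_commute)
        have "?y \<le> resolvent v\<^sub>0 H \<bullet> mat (1 / v')"
          by (intro psd_inner_mono resolvent(7) v0 elim psd_resolvent_bound v')
        then have y: "?y \<le> ?x / v'" by (simp add: mat_scaleR[of "1 / v'"])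
        \<comment> \<open>When v' exceeds \<open>v\<^sub>0\<close> the resolvent at
          \<open>v\<^sub>0\<close> is the larger one, but by a relative amount of at most h /
          v'.\<close>
        have "- ?\<delta> * ?y \<le> h * ?y" using d \<open>0 \<le> ?y\<close> by (intro mult_right_mono) auto
        also have "\<dots> \<le> h * (?x / v')" using h y by (intro mult_left_mono) auto
        finally have "- ?\<delta> * ?y \<le> ?\<epsilon> * ?x" by simp
        then have "?x \<le> resolvent v' H \<bullet> mat 1 + ?\<epsilon> * ?x" using eq by linarith
        then show ?case by (simp add: algebra_simps)
      qed
    qed (use intA intB in auto)
    finally show ?thesis by (simp add: eA)
  qed
  show "(1 - ?\<epsilon>) * (B \<bullet> mat 1 + ?\<delta> * (B \<bullet> A)) \<le> A \<bullet> mat 1"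
  proof (cases "?\<delta> \<le> 0")
    case True
    then have "?\<delta> * (B \<bullet> A) \<le> 0" using BA by (rule mult_nonpos_nonneg)
    then have "(1 - ?\<epsilon>) * (B \<bullet> mat 1 + ?\<delta> * (B \<bullet> A)) \<le> (1 - ?\<epsilon>) * (B \<bullet> mat 1)"
      using \<epsilon> by (intro mult_left_mono) auto
    then show ?thesis using F2 by simp
  next
    case False
    then have \<delta>: "0 < ?\<delta>" by simp
    let ?n = "real CARD('r)"
    \<comment> \<open>G is the posterior mean of P = I + \<delta> (v' I + H)^-1, whose inverse is I
      - \<delta> (\<open>v\<^sub>0\<close> I + H)^-1. The claim is equivalent to tr (E[P^-1] G)
      \<ge> r.\<close>
    define G where "G = mat 1 + ?\<delta> *\<^sub>R A"
    have G: "sym_pos_def G" unfolding G_def using \<delta> by (intro sym_pos_def_add sym_pos_def_mat psd_scaleR A) auto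
    have "2 * ?n \<le> expectation (\<lambda>H. (mat 1 \<bullet> G - ?\<delta> * (resolvent v\<^sub>0 H \<bullet> G)) + (matrix_inv G \<bullet> mat 1 + ?\<delta> * (resolvent v' H \<bullet> matrix_inv G)))"
    proof -
      have "expectation (\<lambda>H. 2 * ?n) \<le> expectation (\<lambda>H. (mat 1 \<bullet> G - ?\<delta> * (resolvent v\<^sub>0 H \<bullet> G)) + (matrix_inv G \<bullet> mat 1 + ?\<delta> * (resolvent v' H \<bullet> matrix_inv G)))"
      proof (rule integral_mono_AE)
        show "AE H in post v' u. 2 * ?n \<le> (mat 1 \<bullet> G - ?\<delta> * (resolvent v\<^sub>0 H \<bullet> G)) + (matrix_inv G \<bullet> mat 1 + ?\<delta> * (resolvent v' H \<bullet> matrix_inv G))"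
          using AE_post[of v' u]
        proof eventually_elim
          case (elim H)
          let ?L = "resolvent v' H" and ?Q = "resolvent v\<^sub>0 H"
          define P where "P = mat 1 + ?\<delta> *\<^sub>R ?L"
          have P: "sym_pos_def P" unfolding P_def using \<delta>
            by (intro sym_pos_def_add sym_pos_def_mat psd_scaleR resolvent(7) v' elim) auto
          have "?Q = ?L - ?\<delta> *\<^sub>R (?Q ** ?L)"
            using resolvent_identity[OF v0 v' elim] by (simp add: algebra_simps)
          then have "?L - ?Q - ?\<delta> *\<^sub>R (?Q ** ?L) = 0" by (simp add: algebra_simps)
          moreover have "(mat 1 - ?\<delta> *\<^sub>R ?Q) ** P = mat 1 + ?\<delta> *\<^sub>R (?L - ?Q - ?\<delta> *\<^sub>R (?Q ** ?L))"
            unfolding P_def by (simp add: matrix_add_ldistrib matrix_diff_rdistrib scaleR_matrix_left scaleR_matrix_right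
                scaleR_diff_right)
          ultimately have "(mat 1 - ?\<delta> *\<^sub>R ?Q) ** P = mat 1" by simp
          then have iP: "matrix_inv P = mat 1 - ?\<delta> *\<^sub>R ?Q" by (intro matrix_inv_unique) (simp add: matrix_left_right_inverse)
          \<comment> \<open>Adding the tangent inequalities in both directions gives tr (P^-1 G) +
            tr (G^-1 P) \<ge> 2 r for every H. In the mean the second trace equals r.\<close>
          have "ln (det P) \<le> ln (det G) + matrix_inv G \<bullet> (P - G)" "ln (det G) \<le> ln (det P) + matrix_inv P \<bullet> (G - P)"
            by (rule ln_det_tangent[OF P G], rule ln_det_tangent[OF G P])
          then have "2 * ?n \<le> matrix_inv P \<bullet> G + matrix_inv G \<bullet> P"
            using matrix_inv_inner_self[OF P] matrix_inv_inner_self[OF G] by (simp add: inner_diff_right)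
          then show ?case unfolding iP by (simp add: P_def inner_add_right inner_diff_left inner_commute[of "matrix_inv G" ?L])
        qed
      qed (use intA intB in auto)
      then show ?thesis by (simp add: prob_space[simplified])
    qed
    also have "\<dots> = (mat 1 \<bullet> G - ?\<delta> * (B \<bullet> G)) + (matrix_inv G \<bullet> mat 1 + ?\<delta> * (A \<bullet> matrix_inv G))"
      using intA intB by (simp add: eA eB prob_space[simplified])
    also have "matrix_inv G \<bullet> mat 1 + ?\<delta> * (A \<bullet> matrix_inv G) = matrix_inv G \<bullet> G"
      by (simp add: G_def inner_add_right inner_commute[of A])
    also have "\<dots> = ?n" by (rule matrix_inv_inner_self[OF G])
    also have "mat 1 \<bullet> G - ?\<delta> * (B \<bullet> G) = ?n + ?\<delta> * (A \<bullet> mat 1 - (B \<bullet> mat 1 + ?\<delta> * (B \<bullet> A)))"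
      by (simp add: G_def inner_add_right inner_mat_one trace_I inner_commute[of A] algebra_simps)
    finally have "0 \<le> ?\<delta> * (A \<bullet> mat 1 - (B \<bullet> mat 1 + ?\<delta> * (B \<bullet> A)))" by simp
    then have le: "B \<bullet> mat 1 + ?\<delta> * (B \<bullet> A) \<le> A \<bullet> mat 1" using \<delta> by (simp add: zero_le_mult_iff)
    have "0 \<le> B \<bullet> mat 1 + ?\<delta> * (B \<bullet> A)" using b0 BA \<delta> by simp
    then have "(1 - ?\<epsilon>) * (B \<bullet> mat 1 + ?\<delta> * (B \<bullet> A)) \<le> 1 * (B \<bullet> mat 1 + ?\<delta> * (B \<bullet> A))"
      using \<epsilon> by (intro mult_right_mono) auto
    then show ?thesis using le by simp
  qed
qed

end

section \<open>One step of the marginal in the variance\<close>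

context normal_mixture
begin

lemma nn_integral_shifted_dens_le:
  assumes S: "psd S" and m: "\<And>H. sym_pos_def H \<Longrightarrow> g H \<le> ennreal (dens v w (H + S))"
  shows "(\<integral>\<^sup>+H. g H * indicator PD H \<partial>sym_lborel) \<le> marg v w"
proof -
  have "(\<integral>\<^sup>+H. g H * indicator PD H \<partial>sym_lborel) \<le> (\<integral>\<^sup>+H. ennreal (dens v w (H + S)) * indicator PD (H + S) \<partial>sym_lborel)"
  proof (rule nn_integral_mono)
    fix H :: "real^'r^'r"
    show "g H * indicator PD H \<le> ennreal (dens v w (H + S)) * indicator PD (H + S)"
      using m[of H] sym_pos_def_add[OF _ S, of H] by (cases "sym_pos_def H") auto
  qed
  also have "\<dots> = marg v w"
    unfolding mix_marginal_def
    by (rule nn_integral_sym_translate[where F = "\<lambda>H. ennreal (dens v w H) * indicator PD H"])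
      (use psdD(1)[OF S] in auto)
  finally show ?thesis .
qed

text \<open>The exponent of \<open>dens_shift_lower_bound\<close> is linear in the two resolvents,
  so its posterior mean has the same form with A and B in their place.\<close>

lemma marg_shift_lower_bound:
  fixes u w :: "real^'q^'r"
  assumes v: "0 < v" and h: "0 < h"
  defines "A \<equiv> mean_resolvent (v + 2 * h) (v + 2 * h) u" and "B \<equiv> mean_resolvent v\<^sub>0 (v + 2 * h) u"
  shows "marg (v + 2 * h) u * ennreal (exp ((u \<bullet> (A ** u) - w \<bullet> (A ** w)) / 2
    - 2 * h * \<kappa> * (B \<bullet> mat 1) + 2 * h * \<beta> * (A \<bullet> mat 1))) \<le> marg v w"
proof -
  let ?v' = "v + 2 * h"
  have v': "0 < ?v'" using v h by simp
  \<comment> \<open>X and Y are the coefficient matrices of the resolvents at v + 2h and at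
    \<open>v\<^sub>0\<close>.\<close>
  define X where "X = (1 / 2) *\<^sub>R (u ** transpose u - w ** transpose w) + (2 * h * \<beta>) *\<^sub>R mat 1"
  define Y where "Y = (2 * h * \<kappa>) *\<^sub>R (mat 1 :: real^'r^'r)"
  define l where "l H = resolvent ?v' H \<bullet> X - resolvent v\<^sub>0 H \<bullet> Y" for H :: "real^'r^'r"
  have lin: "P \<bullet> X - Q \<bullet> Y = (u \<bullet> (P ** u) - w \<bullet> (P ** w)) / 2
      - 2 * h * \<kappa> * (Q \<bullet> mat 1) + 2 * h * \<beta> * (P \<bullet> mat 1)" for P Q :: "real^'r^'r"
    unfolding X_def Y_def inner_matrix_outer by (simp add: inner_add_right inner_diff_right)
  have [measurable]: "l \<in> borel_measurable borel" unfolding l_def by measurable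
  have int: "integrable (post ?v' u) l"
    unfolding l_def using v' v0 by (intro Bochner_Integration.integrable_diff integrable_resolvent_inner)
  have mean: "(\<integral>H. l H \<partial>post ?v' u) = A \<bullet> X - B \<bullet> Y"
    unfolding l_def A_def B_def using v' v0
    by (simp add: Bochner_Integration.integral_diff integrable_resolvent_inner mean_resolvent_inner)
  have "(\<integral>\<^sup>+H. ennreal (dens ?v' u H) * ennreal (exp (l H)) * indicator PD H \<partial>sym_lborel) \<le> marg v w"
  proof (rule nn_integral_shifted_dens_le)
    show "psd (mat (2 * h))" using h by (intro psd_mat) auto
    fix H :: "real^'r^'r" assume "sym_pos_def H"
    then show "ennreal (dens ?v' u H) * ennreal (exp (l H)) \<le> ennreal (dens v w (H + mat (2 * h)))"
      using dens_shift_lower_bound[OF v h, of H u w] unfolding l_def lin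
      by (simp only: ennreal_mult''[symmetric] exp_ge_zero ennreal_leI)
  qed
  then have "ennreal 1 * (\<integral>\<^sup>+H. ennreal (dens ?v' u H) * indicator PD H * ennreal (exp (l H)) \<partial>sym_lborel) \<le> marg v w"
    by (simp add: mult_ac)
  from marg_ratio_lower_bound[OF v' int _ this]
  show ?thesis unfolding mean lin by simp
qed

text \<open>The Jacobian of H \<mapsto> N H N is det(N)^(r + 1), which adds r + 1 to the exponent of
  det N. The translation by E maps definite matrices to definite ones.\<close>

lemma marg_congruence_lower_bound:
  fixes u :: "real^'q^'r"
  assumes v: "0 < v" and h: "0 < h"
    and N: "sym_pos_def N" and E: "psd ((v + 2 * h) *\<^sub>R (N ** N) - mat v)"
    and \<gamma>: "0 \<le> v\<^sub>0 - v" and A: "psd A" and c: "0 \<le> c"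
    and dom: "psd (N ** (mat 1 + c *\<^sub>R A) ** N - mat 1)"
  defines "B \<equiv> mean_resolvent v\<^sub>0 (v + 2 * h) u"
  shows "marg (v + 2 * h) u * ennreal (exp ((- real CARD('q) + real CARD('r) + 1 + 2 * \<beta> - 2 * \<kappa>) * ln (det N)
      - \<kappa> * (2 * h * (B \<bullet> mat 1) + (v\<^sub>0 - v) * c * (B \<bullet> A)))) \<le> marg v (N ** u)"
proof -
  let ?v' = "v + 2 * h" and ?E = "(v + 2 * h) *\<^sub>R (N ** N) - mat v" and ?w = "N ** u"
  let ?k = "- real CARD('q) + 2 * \<beta> - 2 * \<kappa>" and ?n = "real CARD('r)"
  have v': "0 < ?v'" using v h by simp
  have tN: "transpose N = N" by (rule sym_pos_defD(1)[OF N])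
  have dN: "0 < det N" by (rule sym_pos_def_det[OF N])
  define l where "l H = ?k * ln (det N)
      - \<kappa> * (2 * h * (resolvent v\<^sub>0 H \<bullet> mat 1) + (v\<^sub>0 - v) * c * (resolvent v\<^sub>0 H \<bullet> A))" for H :: "real^'r^'r"
  interpret prob_space "post ?v' u" by (rule prob_space_post[OF v'])
  have [measurable]: "l \<in> borel_measurable borel" unfolding l_def by measurable
  have int: "integrable (post ?v' u) l"
    unfolding l_def using integrable_resolvent_inner[OF v' v0] by auto
  have mean: "(\<integral>H. l H \<partial>post ?v' u) = ?k * ln (det N) - \<kappa> * (2 * h * (B \<bullet> mat 1) + (v\<^sub>0 - v) * c * (B \<bullet> A))"
    unfolding l_def B_def using integrable_resolvent_inner[OF v' v0]
    by (simp add: mean_resolvent_inner[OF v' v0] prob_space[simplified])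
  define F where "F H = ennreal (dens v ?w (H + ?E)) * indicator PD (H + ?E)" for H :: "real^'r^'r"
  have F[measurable]: "F \<in> borel_measurable borel" unfolding F_def by measurable
  have "ennreal (exp ((?n + 1) * ln (det N))) * (\<integral>\<^sup>+H. ennreal (dens ?v' u H) * indicator PD H * ennreal (exp (l H)) \<partial>sym_lborel)
    \<le> ennreal (\<bar>det N\<bar> ^ (CARD('r) + 1)) * (\<integral>\<^sup>+H. F (N ** H ** transpose N) \<partial>sym_lborel)"
  proof (rule mult_mono)
    have "exp ((?n + 1) * ln (det N)) = \<bar>det N\<bar> ^ (CARD('r) + 1)"
      using dN by (simp add: powr_realpow[symmetric] powr_def algebra_simps exp_add)
    then show "ennreal (exp ((?n + 1) * ln (det N))) \<le> ennreal (\<bar>det N\<bar> ^ (CARD('r) + 1))" by simp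
    show "(\<integral>\<^sup>+H. ennreal (dens ?v' u H) * indicator PD H * ennreal (exp (l H)) \<partial>sym_lborel)
      \<le> (\<integral>\<^sup>+H. F (N ** H ** transpose N) \<partial>sym_lborel)"
    proof (rule nn_integral_mono)
      fix H :: "real^'r^'r"
      show "ennreal (dens ?v' u H) * indicator PD H * ennreal (exp (l H)) \<le> F (N ** H ** transpose N)"
      proof (cases "sym_pos_def H")
        case True
        have "sym_pos_def (N ** H ** N)"
          using sym_pos_def_congruence[OF True sym_pos_def_invertible[OF N]] by (simp add: tN)
        then have "sym_pos_def (N ** H ** N + ?E)" by (rule sym_pos_def_add[OF _ E])
        then show ?thesis
          using dens_congruence_lower_bound[OF v h True N E refl \<gamma> A c dom, of u] True unfolding l_def F_def tN
          by (simp only: ennreal_mult''[symmetric] exp_ge_zero ennreal_leI indicator_def of_bool_def mem_Collect_eq if_True mult_1_right)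
      qed simp
    qed
  qed auto
  also have "\<dots> = (\<integral>\<^sup>+H. F H \<partial>sym_lborel)" by (rule nn_integral_sym_congruence) (use dN F in auto)
  also have "\<dots> = marg v ?w"
    unfolding F_def mix_marginal_def
    by (rule nn_integral_sym_translate[where F = "\<lambda>H. ennreal (dens v ?w H) * indicator PD H"])
      (use psdD(1)[OF E] in auto)
  finally have "marg ?v' u * ennreal (exp ((?n + 1) * ln (det N)) * exp (\<integral>H. l H \<partial>post ?v' u)) \<le> marg v ?w"
    by (intro marg_ratio_lower_bound[OF v' int]) auto
  moreover have "exp ((?n + 1) * ln (det N)) * exp (\<integral>H. l H \<partial>post ?v' u)
    = exp ((- real CARD('q) + ?n + 1 + 2 * \<beta> - 2 * \<kappa>) * ln (det N)
      - \<kappa> * (2 * h * (B \<bullet> mat 1) + (v\<^sub>0 - v) * c * (B \<bullet> A)))"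
    unfolding mean exp_add[symmetric] by (rule arg_cong[of _ _ exp]) (simp add: algebra_simps)
  ultimately show ?thesis by simp
qed

text \<open>Put v' = v + 2h. All matrices here are polynomials in A, hence commute. In terms of A
  and D = I / v' - A, both semidefinite, the differences to be shown semidefinite become sums of
  semidefinite terms. In particular v' N^2 - v I has the constant term h^2 / v', since v' (1 - h /
  v')^2 - v = h^2 / v'.\<close>

lemma contraction_psd:
  fixes A :: "real^'r^'r"
  assumes v: "0 < v" and h: "0 < h" and A: "psd A" "psd (mat (1 / (v + 2 * h)) - A)"
  defines "N \<equiv> mat 1 - h *\<^sub>R A" and "c \<equiv> 2 * h / (1 - 2 * (h / (v + 2 * h)))"
  shows "sym_pos_def N" "psd ((v + 2 * h) *\<^sub>R (N ** N) - mat v)" "0 \<le> c"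
    "psd (N ** (mat 1 + c *\<^sub>R A) ** N - mat 1)" "ln (det N) \<le> - h * (A \<bullet> mat 1)"
proof -
  define v' where "v' = v + 2 * h"
  define D where "D = mat (1 / v') - A"
  have v': "0 < v'" "v < v'" "2 * h < v'" using v h by (auto simp: v'_def)
  have D: "psd D" using A(2) by (simp add: D_def v'_def)
  have tA: "transpose A = A" and tD: "transpose D = D" using psdD(1)[OF A(1)] psdD(1)[OF D] .
  have AD: "A = mat (1 / v') - D" by (simp add: D_def)
  have N_eq: "N = mat (1 - h / v') + h *\<^sub>R D"
  proof -
    have "h *\<^sub>R mat (1 / v') = (mat (h / v') :: real^'r^'r)" by (simp add: mat_scaleR[of "1 / v'"] mat_scaleR[of "h / v'"])
    moreover have "mat 1 - mat (h / v') = (mat (1 - h / v') :: real^'r^'r)" by (rule mat_diff)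
    ultimately show ?thesis unfolding N_def AD by (simp add: scaleR_diff_right algebra_simps)
  qed
  have \<epsilon>: "0 < h / v'" "h / v' < 1 / 2" using v' h by (auto simp: field_simps)
  have hD: "psd (h *\<^sub>R D)" using h by (intro psd_scaleR D) auto
  show N: "sym_pos_def N" unfolding N_eq using \<epsilon> by (intro sym_pos_def_add hD sym_pos_def_mat) linarith
  show c0: "0 \<le> c" unfolding c_def v'_def[symmetric] using \<epsilon> h by (intro divide_nonneg_pos) linarith+
  have "ln (det N) \<le> ln (det (mat 1 :: real^'r^'r)) + matrix_inv (mat 1) \<bullet> (N - mat 1)"
    by (rule ln_det_tangent[OF N sym_pos_def_mat]) simp
  moreover have "matrix_inv (mat 1 :: real^'r^'r) = mat 1" by (rule matrix_inv_unique) auto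
  ultimately show "ln (det N) \<le> - h * (A \<bullet> mat 1)" by (simp add: N_def inner_commute)
  have "(v' *\<^sub>R (N ** N) - mat v) = mat (h\<^sup>2 / v') + ((2 * h * (1 - h / v') * v') *\<^sub>R D + (v' * h\<^sup>2) *\<^sub>R (D ** transpose D))"
  proof -
    have e: "v' * (1 - h / v')\<^sup>2 - v = h\<^sup>2 / v'"
    proof -
      have "v' * (1 - h / v')\<^sup>2 = v' - 2 * h + h\<^sup>2 / v'" using v' by (simp add: power2_eq_square field_simps)
      then show ?thesis by (simp add: v'_def)
    qed
    have "N ** N = (1 - h / v')\<^sup>2 *\<^sub>R mat 1 + ((2 * h * (1 - h / v')) *\<^sub>R D + h\<^sup>2 *\<^sub>R (D ** D))"
    proof -
      have "(mat a + h *\<^sub>R D) ** (mat a + h *\<^sub>R D) = a\<^sup>2 *\<^sub>R mat 1 + ((2 * h * a) *\<^sub>R D + h\<^sup>2 *\<^sub>R (D ** D))" for a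
      proof -
        have "(mat a + h *\<^sub>R D) ** (mat a + h *\<^sub>R D) = (a *\<^sub>R a *\<^sub>R mat 1 + a *\<^sub>R h *\<^sub>R D) + (h *\<^sub>R a *\<^sub>R D + h *\<^sub>R h *\<^sub>R (D ** D))"
          by (simp only: mat_scaleR[of a] matrix_add_ldistrib matrix_add_rdistrib scaleR_matrix_left scaleR_matrix_right
              matrix_mul_lid matrix_mul_rid scaleR_add_right)
        also have "\<dots> = a\<^sup>2 *\<^sub>R mat 1 + ((a * h) *\<^sub>R D + (a * h) *\<^sub>R D + h\<^sup>2 *\<^sub>R (D ** D))"
          by (simp add: power2_eq_square mult.commute)
        also have "(a * h) *\<^sub>R D + (a * h) *\<^sub>R D = (2 * h * a) *\<^sub>R D" unfolding scaleR_left_distrib[symmetric] by simp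
        finally show ?thesis .
      qed
      then show ?thesis unfolding N_eq .
    qed
    then have "v' *\<^sub>R (N ** N) - mat v = (v' * (1 - h / v')\<^sup>2 - v) *\<^sub>R mat 1 + ((2 * h * (1 - h / v') * v') *\<^sub>R D + (v' * h\<^sup>2) *\<^sub>R (D ** D))"
      by (simp only: mat_scaleR[of v] scaleR_add_right scaleR_scaleR scaleR_left_diff_distrib mult_ac) simp
    then show ?thesis unfolding e tD by (simp only: mat_scaleR[of "h\<^sup>2 / v'"])
  qed
  moreover have "psd \<dots>"
    using v' h \<epsilon> by (intro psd_add psd_mat psd_scaleR psd_square D) (auto intro!: mult_nonneg_nonneg)
  ultimately show "psd ((v + 2 * h) *\<^sub>R (N ** N) - mat v)" by (simp add: v'_def)
  have comm: "A ** D = D ** A"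
    unfolding D_def by (simp add: matrix_diff_ldistrib matrix_diff_rdistrib mat_mult_left mat_mult_right)
  \<comment> \<open>A product of commuting semidefinite matrices is semidefinite: inserting v' (A +
    D) = I writes it as a sum of congruences.\<close>
  have ADe: "A ** D = v' *\<^sub>R (A ** D ** A + D ** A ** D)"
  proof -
    have "A ** D = v' *\<^sub>R (A ** D ** mat (1 / v'))" using v' by (simp add: mat_mult_right)
    also have "mat (1 / v') = A + D" by (simp add: D_def)
    also have "A ** D ** (A + D) = A ** D ** A + D ** A ** D" by (simp add: matrix_add_ldistrib comm)
    finally show ?thesis .
  qed
  have psdAD: "psd (A ** D)"
    using v' psd_congruence[OF D, of A] psd_congruence[OF A(1), of D]
    by (subst ADe, intro psd_scaleR psd_add) (simp_all add: tA tD)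
  \<comment> \<open>The choice of c: with it the linear and quadratic terms in A contain exactly 2 h
    c (A / v' - A^2) = 2 h c A D, and what is left has nonnegative coefficients.\<close>
  have cc: "c - 2 * h = 2 * h * c / v'"
    using \<epsilon> v' h unfolding c_def v'_def[symmetric] by (simp add: field_simps)
  have "N ** (mat 1 + c *\<^sub>R A) ** N - mat 1
    = (2 * h * c) *\<^sub>R (A ** D) + (h\<^sup>2 *\<^sub>R (A ** transpose A) + (h\<^sup>2 * c) *\<^sub>R (A ** A ** transpose A))"
  proof -
    have "N ** (mat 1 + c *\<^sub>R A) ** N = mat 1 + (c - 2 * h) *\<^sub>R A + (h\<^sup>2 - 2 * h * c) *\<^sub>R (A ** A) + (h\<^sup>2 * c) *\<^sub>R (A ** A ** A)"
    proof -
      have "N ** (mat 1 + c *\<^sub>R A) = mat 1 + (c - h) *\<^sub>R A - (h * c) *\<^sub>R (A ** A)"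
        unfolding N_def by (simp add: matrix_add_ldistrib matrix_diff_rdistrib scaleR_matrix_left scaleR_matrix_right
            scaleR_left_diff_distrib scaleR_diff_right mult.commute[of c])
      then have "N ** (mat 1 + c *\<^sub>R A) ** N = (mat 1 + (c - h) *\<^sub>R A - (h * c) *\<^sub>R (A ** A)) ** (mat 1 - h *\<^sub>R A)"
        by (simp only: N_def)
      also have "\<dots> = (mat 1 + (c - h) *\<^sub>R A - (h * c) *\<^sub>R (A ** A)) - h *\<^sub>R (A + (c - h) *\<^sub>R (A ** A) - (h * c) *\<^sub>R (A ** A ** A))"
        by (simp only: matrix_diff_ldistrib matrix_mul_rid scaleR_matrix_right matrix_add_rdistrib matrix_diff_rdistrib
            matrix_mul_lid scaleR_matrix_left)
      also have "\<dots> = mat 1 + (c - 2 * h) *\<^sub>R A + (h\<^sup>2 - 2 * h * c) *\<^sub>R (A ** A) + (h\<^sup>2 * c) *\<^sub>R (A ** A ** A)"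
      proof -
        have "(I + (c - h) *\<^sub>R P - (h * c) *\<^sub>R Q) - h *\<^sub>R (P + (c - h) *\<^sub>R Q - (h * c) *\<^sub>R R)
          = I + (c - 2 * h) *\<^sub>R P + (h\<^sup>2 - 2 * h * c) *\<^sub>R Q + (h\<^sup>2 * c) *\<^sub>R R" for I P Q R :: "real^'r^'r"
          by (simp add: vec_eq_iff algebra_simps power2_eq_square)
        then show ?thesis .
      qed
      finally show ?thesis .
    qed
    moreover have "A ** D = (1 / v') *\<^sub>R A - A ** A" unfolding D_def by (simp add: matrix_diff_ldistrib mat_mult_right)
    moreover have "I + (2 * h * c / v') *\<^sub>R P + (h\<^sup>2 - 2 * h * c) *\<^sub>R Q + (h\<^sup>2 * c) *\<^sub>R R - I
      = (2 * h * c) *\<^sub>R ((1 / v') *\<^sub>R P - Q) + (h\<^sup>2 *\<^sub>R Q + (h\<^sup>2 * c) *\<^sub>R R)" for I P Q R :: "real^'r^'r"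
      by (simp add: vec_eq_iff algebra_simps)
    ultimately show ?thesis by (simp only: cc tA)
  qed
  moreover have "psd \<dots>"
  proof -
    have "psd (A ** A ** transpose A)" by (rule psd_congruence[OF A(1)])
    then show ?thesis using h c0 by (intro psd_add psd_scaleR psdAD psd_square) auto
  qed
  ultimately show "psd (N ** (mat 1 + c *\<^sub>R A) ** N - mat 1)" by simp
qed

text \<open>Both substitutions bound the same quotient, with exponents \<open>E0\<close> and
  \<open>EJ\<close>; \<open>E0\<close> contains about h |p|^2 and a multiple of the trace of A,
  \<open>EJ\<close> only a multiple of that trace. Their maximum is at least any weighted mean, and
  the hypothesis \<psi> makes the coefficient of the trace in a suitable one nonnegative.\<close>

lemma marg_contraction_lower_bound:
  fixes u :: "real^'q^'r"
  assumes v: "0 < v" and h: "0 < h" and d: "- h \<le> v\<^sub>0 - (v + 2 * h)" and \<gamma>: "v \<le> v\<^sub>0"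
    and s: "0 \<le> real CARD('q) - real CARD('r) - 1 - 2 * \<beta> + 2 * \<kappa>"
    and \<psi>: "\<And>\<epsilon>. \<epsilon> = h / (v + 2 * h) \<Longrightarrow> 0 \<le> 2 * \<beta> - 2 * \<kappa> / (1 - \<epsilon>)
      + (1 - \<epsilon>) * (real CARD('q) - real CARD('r) - 1 - 2 * \<beta> + 2 * \<kappa>) - 2 * \<kappa> / (1 - 2 * \<epsilon>)"
  defines "p \<equiv> mean_resolvent (v + 2 * h) (v + 2 * h) u ** u"
  shows "marg (v + 2 * h) u * ennreal (exp (h * (norm p)\<^sup>2 / 2)) \<le> marg v (u - h *\<^sub>R p)"
proof -
  define v' where "v' = v + 2 * h"
  define A where "A = mean_resolvent v' v' u"
  define B where "B = mean_resolvent v\<^sub>0 v' u"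
  define N where "N = mat 1 - h *\<^sub>R A"
  define \<epsilon> where "\<epsilon> = h / v'"
  define c where "c = 2 * h / (1 - 2 * \<epsilon>)"
  define s where "s = real CARD('q) - real CARD('r) - 1 - 2 * \<beta> + 2 * \<kappa>"
  define t\<^sub>0 where "t\<^sub>0 = A \<bullet> mat 1"
  define b\<^sub>0 where "b\<^sub>0 = B \<bullet> mat 1"
  define b\<^sub>1 where "b\<^sub>1 = B \<bullet> A"
  have v': "0 < v'" "h < v'" using v h by (auto simp: v'_def)
  have \<epsilon>: "0 < \<epsilon>" "\<epsilon> < 1 / 2" using v h by (auto simp: \<epsilon>_def v'_def field_simps)
  have A: "psd A" "psd (mat (1 / v') - A)" unfolding A_def using v' by (auto intro: psd_mean_resolvent psd_mean_resolvent_bound)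
  note C = contraction_psd[OF v h A[unfolded v'_def], folded v'_def, folded N_def \<epsilon>_def, folded c_def]
  have "- h \<le> v\<^sub>0 - v'" using d by (simp add: v'_def)
  note R = mean_resolvent_inequalities[OF v'(1) h v'(2) this, of u, folded A_def B_def \<epsilon>_def, folded t\<^sub>0_def b\<^sub>0_def b\<^sub>1_def]
  have p: "p = A ** u" by (simp add: p_def A_def v'_def)
  have w: "N ** u = u - h *\<^sub>R p" by (simp add: N_def p matrix_diff_rdistrib scaleR_matrix_left)
  let ?w = "u - h *\<^sub>R p"
  define E0 where "E0 = (u \<bullet> (A ** u) - ?w \<bullet> (A ** ?w)) / 2 - 2 * h * \<kappa> * b\<^sub>0 + 2 * h * \<beta> * t\<^sub>0"
  define EJ where "EJ = - s * ln (det N) - \<kappa> * (2 * h * b\<^sub>0 + (v\<^sub>0 - v) * c * b\<^sub>1)"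
  have L0: "marg v' u * ennreal (exp E0) \<le> marg v ?w"
    using marg_shift_lower_bound[OF v h, of u ?w] unfolding E0_def A_def B_def b\<^sub>0_def t\<^sub>0_def v'_def .
  have LJ: "marg v' u * ennreal (exp EJ) \<le> marg v ?w"
  proof -
    have "- real CARD('q) + real CARD('r) + 1 + 2 * \<beta> - 2 * \<kappa> = - s" by (simp add: s_def)
    then show ?thesis
      using marg_congruence_lower_bound[OF v h C(1) C(2)[unfolded v'_def] _ A(1) C(3,4), of u, folded v'_def] \<gamma>
      unfolding EJ_def b\<^sub>0_def b\<^sub>1_def B_def w by simp
  qed
  have P: "0 \<le> (norm p)\<^sup>2" by simp
  \<comment> \<open>With w = u - h p and p = A u, the difference of the forms is 2 h |p|^2 - h^2 p .
    A p, and A \<le> I / v' bounds the second-order term by \<epsilon> h |p|^2.\<close>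
  have q: "h * (norm p)\<^sup>2 * (1 - \<epsilon> / 2) \<le> (u \<bullet> (A ** u) - ?w \<bullet> (A ** ?w)) / 2"
  proof -
    have tA: "transpose A = A" by (rule psdD(1)[OF A(1)])
    have uAp: "u \<bullet> (A ** p) = (norm p)\<^sup>2"
      using inner_matrix_left[of u A p] by (simp add: tA p[symmetric] power2_norm_eq_inner)
    have pAu: "p \<bullet> (A ** u) = (norm p)\<^sup>2" by (simp add: p[symmetric] power2_norm_eq_inner)
    have "0 \<le> p \<bullet> ((mat (1 / v') - A) ** p)" by (rule psd_quadratic_nonneg[OF A(2)])
    then have pAp: "p \<bullet> (A ** p) \<le> (norm p)\<^sup>2 / v'"
      by (simp add: matrix_diff_rdistrib mat_mult_left inner_diff_right power2_norm_eq_inner)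
    have "?w \<bullet> (A ** ?w) = u \<bullet> (A ** u) - 2 * h * (norm p)\<^sup>2 + h\<^sup>2 * (p \<bullet> (A ** p))"
      by (simp add: matrix_diff_ldistrib scaleR_matrix_right inner_diff_left inner_diff_right uAp pAu power2_eq_square algebra_simps)
    moreover have "h\<^sup>2 * (p \<bullet> (A ** p)) \<le> h\<^sup>2 * ((norm p)\<^sup>2 / v')" using pAp by (intro mult_left_mono) auto
    moreover have "h\<^sup>2 * ((norm p)\<^sup>2 / v') = h * (norm p)\<^sup>2 * \<epsilon>" by (simp add: \<epsilon>_def power2_eq_square)
    ultimately show ?thesis by (simp add: algebra_simps)
  qed
  have b0: "b\<^sub>0 \<le> t\<^sub>0 / (1 - \<epsilon>)" using R(1) \<epsilon> by (simp add: field_simps)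
  have i0: "h * (norm p)\<^sup>2 * (1 - \<epsilon> / 2) + h * t\<^sub>0 * (2 * \<beta> - 2 * \<kappa> / (1 - \<epsilon>)) \<le> E0"
  proof -
    have "2 * h * \<kappa> * b\<^sub>0 \<le> 2 * h * \<kappa> * (t\<^sub>0 / (1 - \<epsilon>))" using b0 h \<kappa> by (intro mult_left_mono) auto
    moreover have "h * t\<^sub>0 * (2 * \<beta> - 2 * \<kappa> / (1 - \<epsilon>)) = 2 * h * \<beta> * t\<^sub>0 - 2 * h * \<kappa> * (t\<^sub>0 / (1 - \<epsilon>))"
      by (simp add: algebra_simps)
    moreover have "x + e \<le> d - a + b" if "x \<le> d" "a \<le> c" "e = b - c" for a b c d e x :: real
      using that by linarith
    ultimately show ?thesis unfolding E0_def using q by blast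
  qed
  have iJ: "h * t\<^sub>0 * (s - 2 * \<kappa> / ((1 - 2 * \<epsilon>) * (1 - \<epsilon>))) \<le> EJ"
  proof -
    have "2 * h * b\<^sub>0 + (v\<^sub>0 - v) * c * b\<^sub>1 = c * ((1 - 2 * \<epsilon>) * b\<^sub>0 + (v\<^sub>0 - v) * b\<^sub>1)"
      unfolding c_def using \<epsilon> by (simp add: field_simps)
    also have "\<dots> \<le> c * (t\<^sub>0 / (1 - \<epsilon>))"
    proof (rule mult_left_mono[OF _ C(3)])
      \<comment> \<open>Since \<open>v\<^sub>0\<close> - v = (\<open>v\<^sub>0\<close> - v') + 2h,
        the surplus 2 h \<open>b\<^sub>1\<close> is at most 2 \<epsilon> \<open>b\<^sub>0\<close>,
        which restores the full coefficient of \<open>b\<^sub>0\<close>.\<close>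
      have "h * b\<^sub>1 = \<epsilon> * (v' * b\<^sub>1)" using v' by (simp add: \<epsilon>_def)
      also have "\<dots> \<le> \<epsilon> * b\<^sub>0" using R(4) \<epsilon> by (intro mult_left_mono) auto
      finally have "(1 - 2 * \<epsilon>) * b\<^sub>0 + (v\<^sub>0 - v) * b\<^sub>1 \<le> b\<^sub>0 + (v\<^sub>0 - v') * b\<^sub>1"
        by (simp add: v'_def algebra_simps)
      also have "\<dots> \<le> t\<^sub>0 / (1 - \<epsilon>)" using R(2) \<epsilon> by (simp add: pos_le_divide_eq mult.commute)
      finally show "(1 - 2 * \<epsilon>) * b\<^sub>0 + (v\<^sub>0 - v) * b\<^sub>1 \<le> t\<^sub>0 / (1 - \<epsilon>)" .
    qed
    finally have "\<kappa> * (2 * h * b\<^sub>0 + (v\<^sub>0 - v) * c * b\<^sub>1) \<le> \<kappa> * (c * (t\<^sub>0 / (1 - \<epsilon>)))" using \<kappa> by (rule mult_left_mono)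
    moreover have "\<kappa> * (c * (t\<^sub>0 / (1 - \<epsilon>))) = h * t\<^sub>0 * (2 * \<kappa> / ((1 - 2 * \<epsilon>) * (1 - \<epsilon>)))"
      by (simp add: c_def)
    moreover have "s * (h * t\<^sub>0) \<le> s * - ln (det N)"
      using C(5) assms(5) by (intro mult_left_mono) (auto simp: t\<^sub>0_def s_def)
    ultimately show ?thesis unfolding EJ_def by (simp add: algebra_simps)
  qed
  have \<psi>': "0 \<le> 2 * \<beta> - 2 * \<kappa> / (1 - \<epsilon>) + (1 - \<epsilon>) * (s - 2 * \<kappa> / ((1 - 2 * \<epsilon>) * (1 - \<epsilon>)))"
  proof -
    have "(1 - \<epsilon>) * (s - 2 * \<kappa> / ((1 - 2 * \<epsilon>) * (1 - \<epsilon>))) = (1 - \<epsilon>) * s - 2 * \<kappa> / (1 - 2 * \<epsilon>)"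
    proof -
      have "x * (a - b / (y * x)) = x * a - b / y" if "x \<noteq> 0" for x y a b :: real
        using that by (simp add: right_diff_distrib)
      then show ?thesis using \<epsilon> by simp
    qed
    then show ?thesis using \<psi>[of \<epsilon>] by (simp add: \<epsilon>_def v'_def s_def)
  qed
  \<comment> \<open>Weights 1 for \<open>E0\<close> and 1 - \<epsilon> for \<open>EJ\<close>, of
    total 2 - \<epsilon>: then h |p|^2 (1 - \<epsilon> / 2) divided by the total is exactly h |p|^2
    / 2.\<close>
  have "h * (norm p)\<^sup>2 / 2 \<le> max E0 EJ"
  proof -
    let ?x = "2 * \<beta> - 2 * \<kappa> / (1 - \<epsilon>)" and ?y = "s - 2 * \<kappa> / ((1 - 2 * \<epsilon>) * (1 - \<epsilon>))"
    have "(2 - \<epsilon>) * (h * (norm p)\<^sup>2 / 2) \<le> (h * (norm p)\<^sup>2 * (1 - \<epsilon> / 2) + h * t\<^sub>0 * ?x) + (1 - \<epsilon>) * (h * t\<^sub>0 * ?y)"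
    proof -
      have "0 \<le> h * t\<^sub>0 * (?x + (1 - \<epsilon>) * ?y)" using h R(5) \<psi>' by (intro mult_nonneg_nonneg) auto
      moreover have "(2 - \<epsilon>) * (X / 2) \<le> (X * (1 - \<epsilon> / 2) + Y * x) + (1 - \<epsilon>) * (Y * y)"
        if "0 \<le> Y * (x + (1 - \<epsilon>) * y)" for X Y x y :: real
        using that by (simp add: field_simps)
      ultimately show ?thesis by blast
    qed
    also have "\<dots> \<le> max E0 EJ + (1 - \<epsilon>) * max E0 EJ"
      using i0 iJ \<epsilon> by (intro add_mono mult_left_mono) auto
    also have "\<dots> = (2 - \<epsilon>) * max E0 EJ" by (simp add: algebra_simps)
    finally show ?thesis using \<epsilon> by (simp only: mult_le_cancel_left_pos)
  qed
  moreover have "marg v' u * ennreal (exp (max E0 EJ)) \<le> marg v ?w" using L0 LJ by (simp add: max_def)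
  ultimately show ?thesis unfolding v'_def[symmetric]
    by (meson ennreal_leI exp_le_cancel_iff mult_left_mono order_trans zero_le)
qed

section \<open>Regularity of the logarithm of the marginal\<close>

abbreviation rmarg :: "real \<Rightarrow> real^'q^'r \<Rightarrow> real" where
  "rmarg v u \<equiv> enn2real (marg v u)"

lemma rmarg: "0 < v \<Longrightarrow> marg v u = ennreal (rmarg v u)" "0 < v \<Longrightarrow> 0 < rmarg v u"
  using finite_marginal[of v u] nonzero_marginal[of v u]
  by (auto simp: less_top enn2real_positive_iff zero_less_iff_neq_zero)

lemma inner_resolvent_le:
  fixes x y :: "real^'q^'r"
  assumes c: "0 < c" and H: "sym_pos_def H"
  shows "\<bar>x \<bullet> (resolvent c H ** y)\<bar> \<le> norm x * norm y / c"
proof -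
  have "\<bar>x \<bullet> (resolvent c H ** y)\<bar> \<le> norm x * norm (resolvent c H ** y)" by (rule Cauchy_Schwarz_ineq2)
  also have "\<dots> \<le> norm x * (norm y / c)" by (intro mult_left_mono norm_resolvent_mult[OF c H]) auto
  finally show ?thesis by simp
qed

text \<open>The difference of the quadratic forms at u and at u_0 is the bilinear form at u - u_0
  and u + u_0, bounded by the norms over v uniformly in H. With the roles exchanged it yields
  continuity, and with u_0 = 0 at most quadratic decay of ln m.\<close>

lemma log_marg_lower_bound:
  assumes v: "0 < v"
  shows "ln (rmarg v u\<^sub>0) - norm (u - u\<^sub>0) * norm (u + u\<^sub>0) / (2 * v) \<le> ln (rmarg v u)"
proof -
  let ?e = "exp (- (norm (u - u\<^sub>0) * norm (u + u\<^sub>0) / (2 * v)))"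
  have "marg v u\<^sub>0 * ennreal ?e = (\<integral>\<^sup>+H. ennreal (dens v u\<^sub>0 H) * indicator PD H * ennreal ?e \<partial>sym_lborel)"
    unfolding mix_marginal_def by (rule nn_integral_multc[symmetric]) measurable
  also have "\<dots> \<le> marg v u"
    unfolding mix_marginal_def
  proof (rule nn_integral_mono)
    fix H :: "real^'r^'r"
    show "ennreal (dens v u\<^sub>0 H) * indicator PD H * ennreal ?e \<le> ennreal (dens v u H) * indicator PD H"
    proof (cases "sym_pos_def H")
      case True
      let ?R = "resolvent v H"
      have "u \<bullet> (?R ** u\<^sub>0) = u\<^sub>0 \<bullet> (?R ** u)"
        using inner_matrix_left[of u ?R u\<^sub>0] by (simp add: resolvent(6)[OF v True] inner_commute)
      then have "u \<bullet> (?R ** u) - u\<^sub>0 \<bullet> (?R ** u\<^sub>0) = (u - u\<^sub>0) \<bullet> (?R ** (u + u\<^sub>0))"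
        by (simp add: matrix_add_ldistrib inner_add_right inner_diff_left)
      also have "\<dots> \<le> norm (u - u\<^sub>0) * norm (u + u\<^sub>0) / v" using inner_resolvent_le[OF v True, of "u - u\<^sub>0" "u + u\<^sub>0"] by simp
      finally have "exp (- (u\<^sub>0 \<bullet> (?R ** u\<^sub>0)) / 2) * ?e \<le> exp (- (u \<bullet> (?R ** u)) / 2)"
        unfolding exp_add[symmetric] by (simp add: field_simps)
      then have "a * (exp (- (u\<^sub>0 \<bullet> (?R ** u\<^sub>0)) / 2) * ?e) * b \<le> a * exp (- (u \<bullet> (?R ** u)) / 2) * b" if "0 \<le> a" "0 \<le> b" for a b
        using that by (intro mult_right_mono mult_left_mono) auto
      from this[of "det (mat v + H) powr (- real CARD('q) / 2)" "det (mat v\<^sub>0 + H) powr (- \<kappa>) * det H powr \<beta>"]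
      have "dens v u\<^sub>0 H * ?e \<le> dens v u H" unfolding mix_density_def by (simp add: mult_ac)
      then show ?thesis using True by (simp add: ennreal_mult''[symmetric] ennreal_leI)
    qed simp
  qed
  finally have "rmarg v u\<^sub>0 * ?e \<le> rmarg v u"
    using rmarg[OF v] by (metis ennreal_le_iff ennreal_mult'' exp_ge_zero less_imp_le)
  then have "ln (rmarg v u\<^sub>0 * ?e) \<le> ln (rmarg v u)" using rmarg(2)[OF v] by simp
  then show ?thesis using rmarg(2)[OF v, of u\<^sub>0] by (simp add: ln_mult)
qed

lemma continuous_log_marg:
  assumes v: "0 < v"
  shows "continuous_on UNIV (\<lambda>u. ln (rmarg v u))"
proof (rule continuous_at_imp_continuous_on, rule ballI)
  fix u\<^sub>0 :: "real^'q^'r"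
  let ?g = "\<lambda>u. norm (u - u\<^sub>0) * norm (u + u\<^sub>0) / (2 * v)"
  have "(?g \<longlongrightarrow> norm (u\<^sub>0 - u\<^sub>0) * norm (u\<^sub>0 + u\<^sub>0) / (2 * v)) (at u\<^sub>0)"
    using v by (intro tendsto_intros) auto
  then have g: "(?g \<longlongrightarrow> 0) (at u\<^sub>0)" by simp
  have "\<bar>ln (rmarg v u) - ln (rmarg v u\<^sub>0)\<bar> \<le> ?g u" for u
    using log_marg_lower_bound[OF v, of u\<^sub>0 u] log_marg_lower_bound[OF v, of u u\<^sub>0]
    by (simp add: norm_minus_commute add.commute abs_le_iff)
  then have "((\<lambda>u. ln (rmarg v u) - ln (rmarg v u\<^sub>0)) \<longlongrightarrow> 0) (at u\<^sub>0)"
    by (intro Lim_null_comparison[OF _ g]) (auto intro!: always_eventually)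
  then show "isCont (\<lambda>u. ln (rmarg v u)) u\<^sub>0" unfolding isCont_def by (rule LIM_zero_cancel)
qed

text \<open>A one-sided second-order expansion, valid for both signs of s, which is enough for a
  first variation at a minimum. The quadratic term in d only decreases the density and is dropped;
  what remains is the exponential of a term linear in s. The bound on s keeps that term in
  [- 1 / 2, 1 / 2], where \<open>exp_le_quadratic\<close> applies and its right-hand side is
  nonnegative.\<close>

lemma log_marg_directional_bound:
  assumes v: "0 < v" and s: "\<bar>s\<bar> * (norm d * norm u / v) \<le> 1 / 2"
  shows "ln (rmarg v (u + s *\<^sub>R d))
    \<le> ln (rmarg v u) - s * (d \<bullet> (mean_resolvent v v u ** u)) + 2 * (s * (norm d * norm u / v))\<^sup>2"
proof -
  interpret prob_space "post v u" by (rule prob_space_post[OF v])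
  let ?K = "2 * (s * (norm d * norm u / v))\<^sup>2"
  define l where "l H = - s * (resolvent v H \<bullet> (d ** transpose u))" for H :: "real^'r^'r"
  have [measurable]: "l \<in> borel_measurable borel" unfolding l_def by measurable
  have int: "integrable (post v u) l"
    unfolding l_def using integrable_resolvent_inner[OF v v] by auto
  have mean: "expectation l = - s * (d \<bullet> (mean_resolvent v v u ** u))"
    unfolding l_def inner_matrix_outer using integrable_resolvent_inner[OF v v]
    by (simp add: mean_resolvent_inner[OF v v])
  have l: "\<bar>l H\<bar> \<le> \<bar>s\<bar> * (norm d * norm u / v)" if "sym_pos_def H" for H
    using inner_resolvent_le[OF v that, of d u] unfolding l_def inner_matrix_outer[symmetric] abs_mult abs_minus
    by (intro mult_left_mono) auto
  have le: "marg v (u + s *\<^sub>R d) \<le> (\<integral>\<^sup>+H. ennreal (dens v u H) * indicator PD H * ennreal (exp (l H)) \<partial>sym_lborel)"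
    unfolding mix_marginal_def
  proof (rule nn_integral_mono)
    fix H :: "real^'r^'r"
    show "ennreal (dens v (u + s *\<^sub>R d) H) * indicator PD H \<le> ennreal (dens v u H) * indicator PD H * ennreal (exp (l H))"
    proof (cases "sym_pos_def H")
      case True
      let ?R = "resolvent v H"
      have "u \<bullet> (?R ** d) = d \<bullet> (?R ** u)"
        using inner_matrix_left[of u ?R d] by (simp add: resolvent(6)[OF v True] inner_commute)
      then have e: "(u + s *\<^sub>R d) \<bullet> (?R ** (u + s *\<^sub>R d)) = u \<bullet> (?R ** u) + 2 * s * (d \<bullet> (?R ** u)) + s\<^sup>2 * (d \<bullet> (?R ** d))"
        by (simp add: matrix_add_ldistrib scaleR_matrix_right inner_add_right inner_add_left power2_eq_square algebra_simps)
      have "0 \<le> s\<^sup>2 * (d \<bullet> (?R ** d))" by (intro mult_nonneg_nonneg psd_quadratic_nonneg resolvent(7) v True) auto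
      then have "exp (- ((u + s *\<^sub>R d) \<bullet> (?R ** (u + s *\<^sub>R d))) / 2) \<le> exp (- (u \<bullet> (?R ** u)) / 2) * exp (l H)"
        unfolding exp_add[symmetric] e l_def inner_matrix_outer[symmetric] by (simp add: field_simps)
      then have "a * exp (- ((u + s *\<^sub>R d) \<bullet> (?R ** (u + s *\<^sub>R d))) / 2) * b \<le> a * (exp (- (u \<bullet> (?R ** u)) / 2) * exp (l H)) * b"
        if "0 \<le> a" "0 \<le> b" for a b
        using that by (intro mult_right_mono mult_left_mono) auto
      from this[of "det (mat v + H) powr (- real CARD('q) / 2)" "det (mat v\<^sub>0 + H) powr (- \<kappa>) * det H powr \<beta>"]
      have "dens v (u + s *\<^sub>R d) H \<le> dens v u H * exp (l H)" unfolding mix_density_def by (simp add: mult_ac)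
      then show ?thesis using True by (simp add: ennreal_mult''[symmetric] ennreal_leI)
    qed simp
  qed
  have AE: "AE H in post v u. \<bar>l H\<bar> \<le> \<bar>s\<bar> * (norm d * norm u / v)" using AE_post[of v u] by eventually_elim (rule l)
  have "(\<integral>\<^sup>+H. ennreal (exp (l H)) \<partial>post v u) \<le> (\<integral>\<^sup>+H. ennreal (1 + l H + ?K) \<partial>post v u)"
  proof (rule nn_integral_mono_AE)
    show "AE H in post v u. ennreal (exp (l H)) \<le> ennreal (1 + l H + ?K)"
      using AE
    proof eventually_elim
      case (elim H)
      have "l H \<le> 1 / 2" using elim s by linarith
      then have "exp (l H) \<le> 1 + l H + 2 * (l H)\<^sup>2" by (rule exp_le_quadratic)
      also have "(l H)\<^sup>2 \<le> (s * (norm d * norm u / v))\<^sup>2"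
        unfolding abs_le_square_iff[symmetric] using elim v by (simp add: abs_mult)
      finally show ?case by (simp add: ennreal_leI)
    qed
  qed
  also have "\<dots> = ennreal (expectation (\<lambda>H. 1 + l H + ?K))"
  proof (rule nn_integral_eq_integral)
    show "AE H in post v u. 0 \<le> 1 + l H + ?K"
      using AE
    proof eventually_elim
      case (elim H)
      have "- 1 / 2 \<le> l H" using elim s by linarith
      then show ?case by simp
    qed
  qed (use int in auto)
  also have "expectation (\<lambda>H. 1 + l H + ?K) = 1 + (expectation l + ?K)"
    using int by (simp add: prob_space[simplified])
  also have "ennreal (1 + (expectation l + ?K)) \<le> ennreal (exp (expectation l + ?K))"
    by (intro ennreal_leI exp_ge_add_one_self)
  finally have "marg v u * (\<integral>\<^sup>+H. ennreal (exp (l H)) \<partial>post v u) \<le> marg v u * ennreal (exp (expectation l + ?K))"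
    by (intro mult_left_mono) auto
  then have "marg v (u + s *\<^sub>R d) \<le> marg v u * ennreal (exp (expectation l + ?K))"
    using le nn_integral_post[OF v, of "\<lambda>H. ennreal (exp (l H))" u] by auto
  then have "rmarg v (u + s *\<^sub>R d) \<le> rmarg v u * exp (expectation l + ?K)"
    using rmarg[OF v] by (metis ennreal_le_iff ennreal_mult'' exp_ge_zero less_imp_le mult_nonneg_nonneg)
  then have "ln (rmarg v (u + s *\<^sub>R d)) \<le> ln (rmarg v u * exp (expectation l + ?K))" using rmarg(2)[OF v] by simp
  then show ?thesis using rmarg(2)[OF v, of u] by (simp add: ln_mult mean)
qed

text \<open>A preimage of \<open>w\<close> under \<open>u \<mapsto> u - h A u\<close> is a critical point of the coercive function
  \<open>ln m(u) + |u - w|\<^sup>2 / (2 h)\<close>.\<close>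

lemma ex_contraction_preimage:
  fixes w :: "real^'q^'r"
  assumes v: "0 < v" and h: "0 < h" and vh: "2 * h < v"
  shows "\<exists>u. w = u - h *\<^sub>R (mean_resolvent v v u ** u)"
proof -
  define f where "f u = ln (rmarg v u) + (norm (u - w))\<^sup>2 / (2 * h)" for u
  \<comment> \<open>Outside the ball of radius 4 |w| the function is at least f 0: as 2h < v, half
    of the growth of |x|^2 / (2h) outweighs the possible decay |x|^2 / (2v) of ln m, and the other
    half outweighs the cross term with w.\<close>
  have "continuous_on (cball 0 (4 * norm w)) f"
    unfolding f_def using h by (intro continuous_intros continuous_on_subset[OF continuous_log_marg[OF v]]) auto
  then obtain u where u: "u \<in> cball 0 (4 * norm w)" "\<And>x. x \<in> cball 0 (4 * norm w) \<Longrightarrow> f u \<le> f x"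
    using continuous_attains_inf[of "cball 0 (4 * norm w)" f] by auto
  have min: "f u \<le> f x" for x
  proof (cases "x \<in> cball 0 (4 * norm w)")
    case False
    then have x: "4 * norm w < norm x" by simp
    have "f u \<le> f 0" using u(2) by simp
    also have "\<dots> \<le> f x"
    proof -
      have "ln (rmarg v 0) - norm x * norm x / (2 * v) \<le> ln (rmarg v x)"
        using log_marg_lower_bound[OF v, of 0 x] by simp
      moreover have "norm x * norm x / (2 * v) \<le> norm x * norm x / (4 * h)"
        using v h vh by (intro divide_left_mono) auto
      moreover have "(norm w)\<^sup>2 / (2 * h) + norm x * norm x / (4 * h) \<le> (norm (x - w))\<^sup>2 / (2 * h)"
      proof -
        have "(norm x - norm w)\<^sup>2 \<le> (norm (x - w))\<^sup>2"
          using x norm_triangle_ineq2[of x w] norm_ge_zero[of w] by (intro power_mono) linarith+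
        moreover have "(norm x - norm w)\<^sup>2 = norm x * norm x / 2 + (norm w)\<^sup>2 + norm x * (norm x - 4 * norm w) / 2"
          by (simp add: power2_eq_square field_simps)
        moreover have "0 \<le> norm x * (norm x - 4 * norm w) / 2" using x by simp
        ultimately have "(norm w)\<^sup>2 + norm x * norm x / 2 \<le> (norm (x - w))\<^sup>2" by linarith
        then have "((norm w)\<^sup>2 + norm x * norm x / 2) / (2 * h) \<le> (norm (x - w))\<^sup>2 / (2 * h)"
          using h by (intro divide_right_mono) auto
        then show ?thesis by (simp add: add_divide_distrib)
      qed
      ultimately show ?thesis by (simp add: f_def)
    qed
    finally show ?thesis .
  qed (rule u(2))
  let ?p = "mean_resolvent v v u ** u"
  have "d \<bullet> ((1 / h) *\<^sub>R (u - w) - ?p) = 0" for d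
  proof (rule zero_coeff_if_locally_nonneg)
    let ?k = "norm d * norm u / v"
    have k: "0 \<le> ?k" using v by simp
    show "0 < 1 / (2 * (?k + 1))" using k by simp
    fix s assume s: "\<bar>s\<bar> \<le> 1 / (2 * (?k + 1))"
    have "\<bar>s\<bar> * ?k \<le> 1 / (2 * (?k + 1)) * ?k" by (rule mult_right_mono[OF s k])
    also have "\<dots> \<le> 1 / 2"
    proof -
      have "1 / (2 * (k + 1)) * k \<le> 1 / 2" if "0 \<le> k" for k :: real using that by (simp add: field_simps)
      then show ?thesis using k .
    qed
    finally have b: "\<bar>s\<bar> * ?k \<le> 1 / 2" .
    have "(norm (u + s *\<^sub>R d - w))\<^sup>2 = (norm (u - w))\<^sup>2 + (2 * s * (d \<bullet> (u - w)) + s\<^sup>2 * (norm d)\<^sup>2)"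
    proof -
      have "u + s *\<^sub>R d - w = (u - w) + s *\<^sub>R d" by simp
      then show ?thesis unfolding power2_norm_eq_inner
        by (simp only: inner_add_left inner_add_right inner_scaleR_left inner_scaleR_right inner_commute[of "u - w" d])
          (simp add: power2_eq_square algebra_simps)
    qed
    then have "(norm (u + s *\<^sub>R d - w))\<^sup>2 / (2 * h)
      = (norm (u - w))\<^sup>2 / (2 * h) + (s * (d \<bullet> ((1 / h) *\<^sub>R (u - w))) + s\<^sup>2 * ((norm d)\<^sup>2 / (2 * h)))"
      using h by (simp add: add_divide_distrib)
    then have "f (u + s *\<^sub>R d) \<le> f u + (s * (d \<bullet> ((1 / h) *\<^sub>R (u - w))) + s\<^sup>2 * ((norm d)\<^sup>2 / (2 * h)))
      - s * (d \<bullet> ?p) + 2 * (s * ?k)\<^sup>2"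
      unfolding f_def using log_marg_directional_bound[OF v b] by linarith
    also have "\<dots> = f u + (s * (d \<bullet> ((1 / h) *\<^sub>R (u - w) - ?p)) + s\<^sup>2 * ((norm d)\<^sup>2 / (2 * h) + 2 * ?k\<^sup>2))"
      by (simp add: inner_diff_right algebra_simps power_mult_distrib power_divide)
    finally show "0 \<le> s * (d \<bullet> ((1 / h) *\<^sub>R (u - w) - ?p)) + s\<^sup>2 * ((norm d)\<^sup>2 / (2 * h) + 2 * ?k\<^sup>2)"
      using min[of "u + s *\<^sub>R d"] by linarith
  qed
  from this[of "(1 / h) *\<^sub>R (u - w) - ?p"] have p: "?p = (1 / h) *\<^sub>R (u - w)" by simp
  have "h *\<^sub>R ?p = u - w" unfolding p using h by simp
  then show ?thesis by (intro exI[of _ u]) simp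
qed

text \<open>For the preimage u of w one has w + h p = u, so the contraction bound is read at a
  prescribed w.\<close>

lemma marg_heat_step:
  fixes w :: "real^'q^'r"
  assumes v: "0 < v" and h: "0 < h" and d: "- h \<le> v\<^sub>0 - (v + 2 * h)" and \<gamma>: "v \<le> v\<^sub>0"
    and s: "0 \<le> real CARD('q) - real CARD('r) - 1 - 2 * \<beta> + 2 * \<kappa>"
    and \<psi>: "\<And>\<epsilon>. \<epsilon> = h / (v + 2 * h) \<Longrightarrow> 0 \<le> 2 * \<beta> - 2 * \<kappa> / (1 - \<epsilon>)
      + (1 - \<epsilon>) * (real CARD('q) - real CARD('r) - 1 - 2 * \<beta> + 2 * \<kappa>) - 2 * \<kappa> / (1 - 2 * \<epsilon>)"
  shows "\<exists>p. marg (v + 2 * h) (w + h *\<^sub>R p) * ennreal (exp (h * (norm p)\<^sup>2 / 2)) \<le> marg v w"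
proof -
  obtain u where u: "w = u - h *\<^sub>R (mean_resolvent (v + 2 * h) (v + 2 * h) u ** u)"
    using ex_contraction_preimage[of "v + 2 * h" h w] v h by auto
  show ?thesis
    using marg_contraction_lower_bound[OF assms, of u] u
    by (intro exI[of _ "mean_resolvent (v + 2 * h) (v + 2 * h) u ** u"]) simp
qed

text \<open>Both the determinant factor and the exponential are largest at the smaller variance and
  at z = 0. This supplies the constant C that keeps ln C - ln m nonnegative.\<close>

lemma marg_le_at_zero:
  assumes v: "0 < v" "v \<le> v'"
  shows "rmarg v' z \<le> rmarg v 0"
proof -
  have v': "0 < v'" using v by simp
  have "marg v' z \<le> marg v 0"
    unfolding mix_marginal_def
  proof (rule nn_integral_mono)
    fix H :: "real^'r^'r"
    show "ennreal (dens v' z H) * indicator PD H \<le> ennreal (dens v 0 H) * indicator PD H"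
    proof (cases "sym_pos_def H")
      case True
      have S: "sym_pos_def (mat v + H)" by (rule resolvent(1)[OF v(1) True])
      have "det (mat v + H) \<le> det (mat v' + H)"
      proof (rule det_mono_psd[OF S, of "mat (v' - v)", THEN order_trans])
        show "psd (mat (v' - v))" using v by (intro psd_mat) auto
        show "det (mat v + H + mat (v' - v)) \<le> det (mat v' + H)"
          using mat_add[of v "v' - v", where 'n = 'r] by (simp add: algebra_simps)
      qed
      then have "det (mat v' + H) powr (- real CARD('q) / 2) \<le> det (mat v + H) powr (- real CARD('q) / 2)"
        using sym_pos_def_det[OF S] by (intro powr_mono2') auto
      moreover have "exp (- (z \<bullet> (resolvent v' H ** z)) / 2) \<le> exp (- (0 \<bullet> (resolvent v H ** (0 :: real^'q^'r))) / 2)"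
        using psd_quadratic_nonneg[OF resolvent(7)[OF v' True], of z] by simp
      ultimately have "dens v' z H \<le> dens v 0 H"
        unfolding mix_density_def by (intro mult_right_mono mult_mono) auto
      then show ?thesis by (intro mult_right_mono ennreal_leI) auto
    qed simp
  qed
  then show ?thesis using rmarg[OF v(1), of 0] by (intro enn2real_mono) (auto simp: less_top[symmetric])
qed

end

section \<open>Monotonicity of the expected logarithm of the marginal\<close>

lemma nn_integral_gauss_tilt:
  fixes p w :: "'a::euclidean_space"
  assumes h: "0 < h" and [measurable]: "F \<in> borel_measurable borel"
  shows "(\<integral>\<^sup>+\<eta>. ennreal (gauss h \<eta> * exp (p \<bullet> \<eta>)) * F \<eta> \<partial>lborel)
    = ennreal (exp (h * (norm p)\<^sup>2 / 2)) * (\<integral>\<^sup>+\<eta>. ennreal (gauss h \<eta>) * F (\<eta> + h *\<^sub>R p) \<partial>lborel)"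
proof -
  have "(\<integral>\<^sup>+\<eta>. ennreal (gauss h \<eta> * exp (p \<bullet> \<eta>)) * F \<eta> \<partial>lborel)
    = (\<integral>\<^sup>+\<eta>. ennreal (exp (h * (norm p)\<^sup>2 / 2)) * (ennreal (gauss h (\<eta> - h *\<^sub>R p)) * F \<eta>) \<partial>lborel)"
    by (simp only: gauss_tilt[OF h] ennreal_mult[OF exp_ge_zero gauss_nonneg] mult.assoc)
  also have "\<dots> = ennreal (exp (h * (norm p)\<^sup>2 / 2)) * (\<integral>\<^sup>+\<eta>. ennreal (gauss h (\<eta> - h *\<^sub>R p)) * F \<eta> \<partial>lborel)"
    by (rule nn_integral_cmult) measurable
  also have "(\<integral>\<^sup>+\<eta>. ennreal (gauss h (\<eta> - h *\<^sub>R p)) * F \<eta> \<partial>lborel) = (\<integral>\<^sup>+\<eta>. ennreal (gauss h \<eta>) * F (\<eta> + h *\<^sub>R p) \<partial>lborel)"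
    using nn_integral_lborel_translate[of "\<lambda>\<eta>. ennreal (gauss h (\<eta> - h *\<^sub>R p)) * F \<eta>" "h *\<^sub>R p"] by simp
  finally show ?thesis .
qed

text \<open>Jensen's inequality for the measure tilted by \<open>exp (p \<bullet> \<eta>)\<close>: the linear term integrates to zero.\<close>

lemma log_tilted_mean_bound:
  fixes w p :: "'a::euclidean_space" and m :: "'a \<Rightarrow> real"
  assumes h: "0 < h" and m[measurable]: "m \<in> borel_measurable borel"
    and pos: "\<And>z. 0 < m z" and C: "\<And>z. m z \<le> C" and K: "0 < K" "K \<le> C"
    and key: "ennreal (exp (h * (norm p)\<^sup>2 / 2)) * (\<integral>\<^sup>+\<eta>. ennreal (gauss h \<eta>) * ennreal (m (w + h *\<^sub>R p + \<eta>)) \<partial>lborel) \<le> ennreal K"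
  shows "ennreal (ln C - ln K) \<le> (\<integral>\<^sup>+\<eta>. ennreal (gauss h \<eta>) * ennreal (ln C - ln (m (w + \<eta>))) \<partial>lborel)" (is "_ \<le> ?U")
proof -
  let ?T = "\<lambda>a. \<integral>\<^sup>+\<eta>. ennreal (gauss h \<eta>) * ennreal (a \<bullet> \<eta>) \<partial>lborel"
  let ?g = "\<lambda>\<eta>. ennreal (gauss h \<eta>)"
  \<comment> \<open>The positive and negative parts of p . \<eta> have the same finite mean, so the
    linear term cancels without a signed integral.\<close>
  have sym: "?T (- p) = ?T p"
    using nn_integral_lborel_reflect[of "\<lambda>\<eta>. ?g \<eta> * ennreal (p \<bullet> \<eta>)" 0] by simp
  have "?T p \<le> (\<integral>\<^sup>+\<eta>. ennreal (gauss h \<eta> * exp (p \<bullet> \<eta>)) * 1 \<partial>lborel)"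
  proof (rule nn_integral_mono)
    fix \<eta> :: 'a
    have "p \<bullet> \<eta> \<le> exp (p \<bullet> \<eta>)" using exp_ge_add_one_self[of "p \<bullet> \<eta>"] by linarith
    then show "?g \<eta> * ennreal (p \<bullet> \<eta>) \<le> ennreal (gauss h \<eta> * exp (p \<bullet> \<eta>)) * 1"
      by (simp add: ennreal_mult mult_left_mono ennreal_leI)
  qed
  also have "\<dots> = ennreal (exp (h * (norm p)\<^sup>2 / 2))"
    by (subst nn_integral_gauss_tilt[OF h]) (simp_all add: nn_integral_gauss[OF h])
  finally have T: "?T p \<noteq> \<top>" by (auto simp: top_unique)
  have m1: "(\<integral>\<^sup>+\<eta>. ennreal (gauss h \<eta> * exp (p \<bullet> \<eta>)) * ennreal (m (w + \<eta>)) \<partial>lborel) \<le> ennreal K"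
    by (subst nn_integral_gauss_tilt[OF h]) (use key in \<open>simp_all add: add_ac\<close>)
  have pt: "ennreal (ln C - ln K) * ?g \<eta> + ?g \<eta> + ?g \<eta> * ennreal (p \<bullet> \<eta>)
    \<le> ?g \<eta> * ennreal (ln C - ln (m (w + \<eta>))) + ennreal (1 / K) * (ennreal (gauss h \<eta> * exp (p \<bullet> \<eta>)) * ennreal (m (w + \<eta>)))
      + ?g \<eta> * ennreal (- p \<bullet> \<eta>)" for \<eta>
  proof -
    let ?x = "p \<bullet> \<eta>" and ?m = "m (w + \<eta>)"
    have L: "0 \<le> ln C - ln K" "0 \<le> ln C - ln ?m" using K pos[of "w + \<eta>"] C[of "w + \<eta>"] by simp_all
    have e: "0 < ?m * exp ?x / K" using pos[of "w + \<eta>"] K by simp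
    \<comment> \<open>The pointwise form of Jensen's inequality for the tilted measure: the tangent
      of ln at K, where K bounds the tilted mean of m.\<close>
    have "ln (?m * exp ?x / K) \<le> ?m * exp ?x / K - 1" by (rule ln_le_minus_one[OF e])
    moreover have "ln (?m * exp ?x / K) = ln ?m + ?x - ln K"
      using pos[of "w + \<eta>"] K by (simp add: ln_div ln_mult)
    ultimately have r: "(ln C - ln K) + 1 + ?x \<le> (ln C - ln ?m) + ?m * exp ?x / K" by linarith
    have "ennreal (ln C - ln K) + 1 + ennreal ?x \<le> ennreal (ln C - ln ?m) + ennreal (?m * exp ?x / K) + ennreal (- ?x)"
    proof (cases "0 \<le> ?x")
      case True
      have "ennreal ((ln C - ln K) + 1 + ?x) \<le> ennreal ((ln C - ln ?m) + ?m * exp ?x / K)"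
        using r by (intro ennreal_leI) simp
      then show ?thesis using True L e by (simp add: ennreal_neg)
    next
      case False
      have "ennreal ((ln C - ln K) + 1) \<le> ennreal ((ln C - ln ?m) + ?m * exp ?x / K + - ?x)"
        using r by (intro ennreal_leI) simp
      moreover have "ennreal (u + y + - x) = ennreal u + ennreal y + ennreal (- x)" if "0 \<le> u" "0 \<le> y" "x \<le> 0" for u y x
        using that by (simp add: ennreal_plus[symmetric] del: ennreal_plus)
      ultimately show ?thesis using False L e by (simp add: ennreal_neg)
    qed
    then have "?g \<eta> * (ennreal (ln C - ln K) + 1 + ennreal ?x) \<le> ?g \<eta> * (ennreal (ln C - ln ?m) + ennreal (?m * exp ?x / K) + ennreal (- ?x))"
      by (rule mult_left_mono) simp
    moreover have "?g \<eta> * ennreal (?m * exp ?x / K) = ennreal (1 / K) * (ennreal (gauss h \<eta> * exp ?x) * ennreal ?m)"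
      using K pos[of "w + \<eta>"] by (simp add: ennreal_mult''[symmetric] ennreal_mult'[symmetric] mult_ac)
    ultimately show ?thesis by (simp add: distrib_left mult_ac)
  qed
  have "ennreal (ln C - ln K) + 1 + ?T p = ennreal (ln C - ln K) * (\<integral>\<^sup>+\<eta>. ?g \<eta> \<partial>(lborel :: 'a measure)) + (\<integral>\<^sup>+\<eta>. ?g \<eta> \<partial>(lborel :: 'a measure)) + ?T p"
    unfolding nn_integral_gauss[OF h] by simp
  also have "\<dots> = (\<integral>\<^sup>+\<eta>. ennreal (ln C - ln K) * ?g \<eta> + ?g \<eta> + ?g \<eta> * ennreal (p \<bullet> \<eta>) \<partial>lborel)"
    by (simp add: nn_integral_add nn_integral_cmult)
  also have "\<dots> \<le> (\<integral>\<^sup>+\<eta>. ?g \<eta> * ennreal (ln C - ln (m (w + \<eta>))) + ennreal (1 / K) * (ennreal (gauss h \<eta> * exp (p \<bullet> \<eta>)) * ennreal (m (w + \<eta>)))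
      + ?g \<eta> * ennreal (- p \<bullet> \<eta>) \<partial>lborel)"
    by (rule nn_integral_mono[OF pt])
  also have "\<dots> = ?U + ennreal (1 / K) * (\<integral>\<^sup>+\<eta>. ennreal (gauss h \<eta> * exp (p \<bullet> \<eta>)) * ennreal (m (w + \<eta>)) \<partial>lborel) + ?T (- p)"
    by (subst nn_integral_add, measurable, subst nn_integral_add, measurable, subst nn_integral_cmult, measurable)
  also have "\<dots> \<le> ?U + ennreal (1 / K) * ennreal K + ?T p"
    unfolding sym using m1 by (intro add_mono mult_left_mono) auto
  also have "ennreal (1 / K) * ennreal K = 1" using K by (simp add: ennreal_mult[symmetric])
  finally have "(1 + ?T p) + ennreal (ln C - ln K) \<le> (1 + ?T p) + ?U" by (simp add: add_ac)
  then show ?thesis using T by (subst (asm) ennreal_add_left_cancel_le) auto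
qed

text \<open>One step combines \<open>log_tilted_mean_bound\<close> for m (v + h) with the semigroup
  property of Gaussians: averaging m (v + h) over noise of variance h gives m (v + 2h), where
  \<open>step\<close> applies, while averaging the resulting bound under N(\<Theta>, v) gives the
  expectation under N(\<Theta>, v + h). Equal steps shorter than \<open>h\<^sub>0\<close> then lead
  from s to t.\<close>

lemma expected_log_mono:
  fixes m :: "real \<Rightarrow> 'a::euclidean_space \<Rightarrow> real" and \<Theta> :: 'a
  assumes s: "0 < s" and t: "s < t"
    and m[measurable]: "\<And>v. m v \<in> borel_measurable borel" and pos: "\<And>v z. 0 < v \<Longrightarrow> 0 < m v z"
    and C: "\<And>v z. s \<le> v \<Longrightarrow> m v z \<le> C"
    and conv: "\<And>v h z. 0 < v \<Longrightarrow> 0 < h \<Longrightarrow> (\<integral>\<^sup>+\<eta>. ennreal (gauss h \<eta>) * ennreal (m v (z + \<eta>)) \<partial>lborel) = ennreal (m (v + h) z)"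
    and h0: "0 < h\<^sub>0"
    and step: "\<And>h v w. 0 < h \<Longrightarrow> h < h\<^sub>0 \<Longrightarrow> s \<le> v \<Longrightarrow> v + h \<le> t
      \<Longrightarrow> \<exists>p. exp (h * (norm p)\<^sup>2 / 2) * m (v + 2 * h) (w + h *\<^sub>R p) \<le> m v w"
  shows "(\<integral>\<^sup>+z. ennreal (gauss s (z - \<Theta>)) * ennreal (ln C - ln (m s z)) \<partial>lborel)
    \<le> (\<integral>\<^sup>+z. ennreal (gauss t (z - \<Theta>)) * ennreal (ln C - ln (m t z)) \<partial>lborel)"
proof -
  define F where "F v = (\<integral>\<^sup>+z. ennreal (gauss v (z - \<Theta>)) * ennreal (ln C - ln (m v z)) \<partial>lborel)" for v
  have F_step: "F v \<le> F (v + h)" if h: "0 < h" "h < h\<^sub>0" and v: "s \<le> v" "v + h \<le> t" for v h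
  proof -
    have v0: "0 < v" using s v by simp
    let ?U = "\<lambda>z. ennreal (ln C - ln (m (v + h) z))"
    have le: "ennreal (ln C - ln (m v z)) \<le> (\<integral>\<^sup>+\<eta>. ennreal (gauss h \<eta>) * ?U (z + \<eta>) \<partial>lborel)" for z
    proof -
      obtain p where p: "exp (h * (norm p)\<^sup>2 / 2) * m (v + 2 * h) (z + h *\<^sub>R p) \<le> m v z" using step[OF h v] by blast
      have e: "v + h + h = v + 2 * h" by simp
      have "(\<integral>\<^sup>+\<eta>. ennreal (gauss h \<eta>) * ennreal (m (v + h) (z + h *\<^sub>R p + \<eta>)) \<partial>lborel) = ennreal (m (v + 2 * h) (z + h *\<^sub>R p))"
        unfolding e[symmetric] using v0 h by (intro conv) auto
      then have key: "ennreal (exp (h * (norm p)\<^sup>2 / 2)) * (\<integral>\<^sup>+\<eta>. ennreal (gauss h \<eta>) * ennreal (m (v + h) (z + h *\<^sub>R p + \<eta>)) \<partial>lborel) \<le> ennreal (m v z)"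
        using p by (simp add: ennreal_mult'[symmetric] ennreal_leI)
      show ?thesis
        by (rule log_tilted_mean_bound[OF h(1) m _ _ _ _ key]) (use v0 v h pos C in auto)
    qed
    have "F v \<le> (\<integral>\<^sup>+z. ennreal (gauss v (z - \<Theta>)) * (\<integral>\<^sup>+\<eta>. ennreal (gauss h \<eta>) * ?U (z + \<eta>) \<partial>lborel) \<partial>lborel)"
      unfolding F_def by (intro nn_integral_mono mult_left_mono le) auto
    also have "\<dots> = (\<integral>\<^sup>+z. (\<integral>\<^sup>+y. ennreal (gauss v (z - \<Theta>)) * (ennreal (gauss h (y - z)) * ?U y) \<partial>lborel) \<partial>lborel)"
    proof (rule nn_integral_cong)
      fix z :: 'a
      have "(\<integral>\<^sup>+\<eta>. ennreal (gauss h \<eta>) * ?U (z + \<eta>) \<partial>lborel) = (\<integral>\<^sup>+y. ennreal (gauss h (y - z)) * ?U y \<partial>lborel)"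
        using nn_integral_lborel_diff[of "\<lambda>\<eta>. ennreal (gauss h \<eta>) * ?U (z + \<eta>)" z] by simp
      then show "ennreal (gauss v (z - \<Theta>)) * (\<integral>\<^sup>+\<eta>. ennreal (gauss h \<eta>) * ?U (z + \<eta>) \<partial>lborel)
        = (\<integral>\<^sup>+y. ennreal (gauss v (z - \<Theta>)) * (ennreal (gauss h (y - z)) * ?U y) \<partial>lborel)"
        by (simp add: nn_integral_cmult)
    qed
    also have "\<dots> = (\<integral>\<^sup>+y. (\<integral>\<^sup>+z. ennreal (gauss v (z - \<Theta>)) * (ennreal (gauss h (y - z)) * ?U y) \<partial>lborel) \<partial>lborel)"
      by (rule lborel_pair.Fubini') measurable
    also have "\<dots> = (\<integral>\<^sup>+y. ennreal (gauss (v + h) (y - \<Theta>)) * ?U y \<partial>lborel)"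
    proof (rule nn_integral_cong)
      fix y :: 'a
      have "(\<integral>\<^sup>+z. ennreal (gauss v (z - \<Theta>)) * (ennreal (gauss h (y - z)) * ?U y) \<partial>lborel)
        = (\<integral>\<^sup>+z. (ennreal (gauss h (y - z)) * ennreal (gauss v (z - \<Theta>))) * ?U y \<partial>lborel)"
        by (simp only: mult_ac)
      also have "\<dots> = ennreal (gauss (v + h) (y - \<Theta>)) * ?U y"
        by (simp add: nn_integral_multc gauss_convolution[OF h(1) v0] add.commute)
      finally show "(\<integral>\<^sup>+z. ennreal (gauss v (z - \<Theta>)) * (ennreal (gauss h (y - z)) * ?U y) \<partial>lborel)
        = ennreal (gauss (v + h) (y - \<Theta>)) * ?U y" .
    qed
    finally show ?thesis by (simp add: F_def)
  qed
  obtain n :: nat where n: "(t - s) / h\<^sub>0 < real n" using reals_Archimedean2 by blast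
  then have n0: "0 < real n" using h0 t by (meson divide_pos_pos diff_gt_0_iff_gt less_trans)
  define h where "h = (t - s) / real n"
  have h: "0 < h" "h < h\<^sub>0" using n n0 h0 t by (auto simp: h_def field_simps)
  have "F s \<le> F (s + real k * h)" if "k \<le> n" for k
    using that
  proof (induction k)
    case (Suc k)
    have "s + real k * h + h \<le> t"
    proof -
      have "real (Suc k) * h \<le> real n * h" using Suc.prems h by (intro mult_right_mono) auto
      also have "real n * h = t - s" using n0 by (simp add: h_def)
      finally show ?thesis by (simp add: algebra_simps)
    qed
    then have "F (s + real k * h) \<le> F (s + real k * h + h)" using h by (intro F_step) auto
    moreover have "s + real k * h + h = s + real (Suc k) * h" by (simp add: algebra_simps)
    ultimately show ?case using Suc by simp
  qed simp
  from this[of n] have "F s \<le> F t" using n0 by (simp add: h_def)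
  then show ?thesis by (simp add: F_def)
qed

section \<open>The Bayesian predictive density\<close>

locale smoothed_prior =
  fixes \<pi> :: "real^'q^'r \<Rightarrow> ennreal" and m :: "real \<Rightarrow> real^'q^'r \<Rightarrow> real"
  assumes measurable_prior [measurable]: "\<pi> \<in> borel_measurable borel"
    and smooth: "\<And>v z. 0 < v \<Longrightarrow> (\<integral>\<^sup>+\<Theta>. ennreal (gauss v (z - \<Theta>)) * \<pi> \<Theta> \<partial>lborel) = ennreal (m v z)"
    and m_pos: "\<And>v z. 0 < v \<Longrightarrow> 0 < m v z"
    and measurable_m [measurable]: "\<And>v. m v \<in> borel_measurable borel"
begin

lemma m_convolution:
  assumes v: "0 < v" and h: "0 < h"
  shows "(\<integral>\<^sup>+\<eta>. ennreal (gauss h \<eta>) * ennreal (m v (z + \<eta>)) \<partial>lborel) = ennreal (m (v + h) z)"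
proof -
  have "(\<integral>\<^sup>+\<eta>. ennreal (gauss h \<eta>) * ennreal (m v (z + \<eta>)) \<partial>lborel) = (\<integral>\<^sup>+y. ennreal (gauss h (y - z)) * ennreal (m v y) \<partial>lborel)"
    using nn_integral_lborel_diff[of "\<lambda>\<eta>. ennreal (gauss h \<eta>) * ennreal (m v (z + \<eta>))" z] by simp
  also have "\<dots> = (\<integral>\<^sup>+y. (\<integral>\<^sup>+\<Theta>. ennreal (gauss h (y - z)) * (ennreal (gauss v (y - \<Theta>)) * \<pi> \<Theta>) \<partial>lborel) \<partial>lborel)"
    by (simp add: smooth[OF v, symmetric] nn_integral_cmult)
  also have "\<dots> = (\<integral>\<^sup>+\<Theta>. (\<integral>\<^sup>+y. ennreal (gauss h (y - z)) * (ennreal (gauss v (y - \<Theta>)) * \<pi> \<Theta>) \<partial>lborel) \<partial>lborel)"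
    by (rule lborel_pair.Fubini') measurable
  also have "\<dots> = (\<integral>\<^sup>+\<Theta>. ennreal (gauss (v + h) (z - \<Theta>)) * \<pi> \<Theta> \<partial>lborel)"
  proof (rule nn_integral_cong)
    fix \<Theta> :: "real^'q^'r"
    have "(\<integral>\<^sup>+y. ennreal (gauss h (y - z)) * (ennreal (gauss v (y - \<Theta>)) * \<pi> \<Theta>) \<partial>lborel)
      = (\<integral>\<^sup>+y. (ennreal (gauss h (z - y)) * ennreal (gauss v (y - \<Theta>))) * \<pi> \<Theta> \<partial>lborel)"
      by (simp only: gauss_commute[of h _ z] mult.assoc)
    then show "(\<integral>\<^sup>+y. ennreal (gauss h (y - z)) * (ennreal (gauss v (y - \<Theta>)) * \<pi> \<Theta>) \<partial>lborel) = ennreal (gauss (v + h) (z - \<Theta>)) * \<pi> \<Theta>"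
      by (simp add: nn_integral_multc gauss_convolution[OF h v] add.commute)
  qed
  also have "\<dots> = ennreal (m (v + h) z)" using v h by (intro smooth) simp
  finally show ?thesis .
qed

text \<open>The precision-weighted mean of X and Y, a sufficient statistic for \<Theta> from both,
  with noise variance \<open>v\<^sub>w\<close>.\<close>

definition pooled :: "real \<Rightarrow> real \<Rightarrow> real^'q^'r \<Rightarrow> real^'q^'r \<Rightarrow> real^'q^'r" where
  "pooled v\<^sub>x v\<^sub>y X Y = (1 / (v\<^sub>x + v\<^sub>y)) *\<^sub>R (v\<^sub>y *\<^sub>R X + v\<^sub>x *\<^sub>R Y)"

text \<open>The predictive density of the uniform prior times a quotient of marginals: the product
  of the two likelihoods factors into a density of Y - X, free of \<Theta>, and the likelihood of
  the pooled observation.\<close>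

definition pred :: "real \<Rightarrow> real \<Rightarrow> real^'q^'r \<Rightarrow> real^'q^'r \<Rightarrow> real" where
  "pred v\<^sub>x v\<^sub>y X Y = gauss (v\<^sub>x + v\<^sub>y) (Y - X) * m (v\<^sub>x * v\<^sub>y / (v\<^sub>x + v\<^sub>y)) (pooled v\<^sub>x v\<^sub>y X Y) / m v\<^sub>x X"

context
  fixes v\<^sub>x v\<^sub>y v\<^sub>w :: real
  assumes vx: "0 < v\<^sub>x" and vy: "0 < v\<^sub>y" and vw: "v\<^sub>w = v\<^sub>x * v\<^sub>y / (v\<^sub>x + v\<^sub>y)"
begin

lemma vw_pos: "0 < v\<^sub>w"
  unfolding vw using vx vy by simp

lemma measurable_pooled [measurable (raw)]:
  assumes [measurable]: "f \<in> borel_measurable M" "g \<in> borel_measurable M"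
  shows "(\<lambda>x. pooled v\<^sub>x v\<^sub>y (f x) (g x)) \<in> borel_measurable M"
  unfolding pooled_def by measurable

lemma gauss_mult_pooled:
  "gauss v\<^sub>x (X - \<Theta>) * gauss v\<^sub>y (Y - \<Theta>) = gauss (v\<^sub>x + v\<^sub>y) (Y - X) * gauss v\<^sub>w (pooled v\<^sub>x v\<^sub>y X Y - \<Theta>)"
  using gauss_mult[OF vx vy, of X \<Theta> Y] by (simp add: pooled_def vw gauss_commute)

lemma pred_pos: "0 < pred v\<^sub>x v\<^sub>y X Y"
  unfolding pred_def vw[symmetric] using vx vy vw_pos by (intro divide_pos_pos mult_pos_pos gauss_pos m_pos) auto

lemma pred_bayes:
  "(\<integral>\<^sup>+\<Theta>. ennreal (gauss v\<^sub>x (X - \<Theta>)) * ennreal (gauss v\<^sub>y (Y - \<Theta>)) * \<pi> \<Theta> \<partial>lborel) = ennreal (m v\<^sub>x X) * ennreal (pred v\<^sub>x v\<^sub>y X Y)"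
proof -
  have "(\<integral>\<^sup>+\<Theta>. ennreal (gauss v\<^sub>x (X - \<Theta>)) * ennreal (gauss v\<^sub>y (Y - \<Theta>)) * \<pi> \<Theta> \<partial>lborel)
    = (\<integral>\<^sup>+\<Theta>. ennreal (gauss (v\<^sub>x + v\<^sub>y) (Y - X)) * (ennreal (gauss v\<^sub>w (pooled v\<^sub>x v\<^sub>y X Y - \<Theta>)) * \<pi> \<Theta>) \<partial>lborel)"
    by (simp only: ennreal_mult[OF gauss_nonneg gauss_nonneg, symmetric] gauss_mult_pooled mult.assoc[symmetric])
  also have "\<dots> = ennreal (gauss (v\<^sub>x + v\<^sub>y) (Y - X)) * ennreal (m v\<^sub>w (pooled v\<^sub>x v\<^sub>y X Y))"
    by (simp add: nn_integral_cmult smooth[OF vw_pos])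
  also have "\<dots> = ennreal (m v\<^sub>x X) * ennreal (pred v\<^sub>x v\<^sub>y X Y)"
    using m_pos[OF vx, of X] m_pos[OF vw_pos, of "pooled v\<^sub>x v\<^sub>y X Y"] pred_pos[of X Y]
    by (simp add: ennreal_mult[symmetric] pred_def vw[symmetric])
  finally show ?thesis .
qed

lemma bayes_predictive_eq_pred: "bayes_predictive v\<^sub>x v\<^sub>y \<pi> = pred v\<^sub>x v\<^sub>y"
proof (intro ext)
  fix X Y
  show "bayes_predictive v\<^sub>x v\<^sub>y \<pi> X Y = pred v\<^sub>x v\<^sub>y X Y"
    unfolding bayes_predictive_def normal_density_mat_eq_gauss pred_bayes smooth[OF vx]
    using m_pos[OF vx, of X] pred_pos[of X Y] by (simp add: ennreal_mult[symmetric] divide_ennreal)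
qed

lemma predictive_density_pred: "predictive_density (pred v\<^sub>x v\<^sub>y)"
  unfolding predictive_density_def
proof (intro conjI allI)
  show "(\<lambda>(X, Y). pred v\<^sub>x v\<^sub>y X Y) \<in> borel_measurable (borel \<Otimes>\<^sub>M borel)"
    unfolding pred_def split_beta' by measurable
  show "0 \<le> pred v\<^sub>x v\<^sub>y X Y" for X Y using pred_pos[of X Y] by simp
  show "(\<integral>\<^sup>+Y. ennreal (pred v\<^sub>x v\<^sub>y X Y) \<partial>lborel) = 1" for X
  proof -
    have [measurable]: "(\<lambda>Y. pred v\<^sub>x v\<^sub>y X Y) \<in> borel_measurable borel" unfolding pred_def by measurable
    have "ennreal (m v\<^sub>x X) * (\<integral>\<^sup>+Y. ennreal (pred v\<^sub>x v\<^sub>y X Y) \<partial>lborel)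
      = (\<integral>\<^sup>+Y. (\<integral>\<^sup>+\<Theta>. ennreal (gauss v\<^sub>x (X - \<Theta>)) * ennreal (gauss v\<^sub>y (Y - \<Theta>)) * \<pi> \<Theta> \<partial>lborel) \<partial>lborel)"
      by (simp add: pred_bayes nn_integral_cmult)
    also have "\<dots> = (\<integral>\<^sup>+\<Theta>. (\<integral>\<^sup>+Y. ennreal (gauss v\<^sub>x (X - \<Theta>)) * ennreal (gauss v\<^sub>y (Y - \<Theta>)) * \<pi> \<Theta> \<partial>lborel) \<partial>lborel)"
      by (rule lborel_pair.Fubini') measurable
    also have "\<dots> = (\<integral>\<^sup>+\<Theta>. ennreal (gauss v\<^sub>x (X - \<Theta>)) * \<pi> \<Theta> \<partial>lborel)"
      by (simp add: nn_integral_multc nn_integral_cmult nn_integral_gauss_diff[OF vy])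
    also have "\<dots> = ennreal (m v\<^sub>x X) * 1" by (simp add: smooth[OF vx])
    finally show ?thesis
      using m_pos[OF vx, of X] by (subst (asm) ennreal_mult_cancel_left) auto
  qed
qed

text \<open>Given \<Theta>, the pooled observation has law N(\<Theta>, \<open>v\<^sub>w\<close> I):
  by \<open>gauss_mult_pooled\<close> the joint density is a product in d = Y - X and the pooled
  value, and for fixed d the latter is a translate of X.\<close>

lemma nn_integral_pooled:
  assumes [measurable]: "F \<in> borel_measurable borel"
  shows "(\<integral>\<^sup>+X. ennreal (gauss v\<^sub>x (X - \<Theta>)) * (\<integral>\<^sup>+Y. ennreal (gauss v\<^sub>y (Y - \<Theta>)) * F (pooled v\<^sub>x v\<^sub>y X Y) \<partial>lborel) \<partial>lborel)
    = (\<integral>\<^sup>+z. ennreal (gauss v\<^sub>w (z - \<Theta>)) * F z \<partial>lborel)"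
proof -
  let ?c = "v\<^sub>x / (v\<^sub>x + v\<^sub>y)" and ?g = "\<lambda>d. ennreal (gauss (v\<^sub>x + v\<^sub>y) (d :: real^'q^'r))"
  have W: "pooled v\<^sub>x v\<^sub>y X (d + X) = X + ?c *\<^sub>R d" for X d
  proof -
    have "pooled v\<^sub>x v\<^sub>y X (d + X) = (1 / (v\<^sub>x + v\<^sub>y)) *\<^sub>R ((v\<^sub>x + v\<^sub>y) *\<^sub>R X + v\<^sub>x *\<^sub>R d)"
      by (simp add: pooled_def scaleR_add_right scaleR_add_left add_ac)
    then show ?thesis using vx vy by (simp add: scaleR_add_right)
  qed
  have "(\<integral>\<^sup>+X. ennreal (gauss v\<^sub>x (X - \<Theta>)) * (\<integral>\<^sup>+Y. ennreal (gauss v\<^sub>y (Y - \<Theta>)) * F (pooled v\<^sub>x v\<^sub>y X Y) \<partial>lborel) \<partial>lborel)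
    = (\<integral>\<^sup>+X. (\<integral>\<^sup>+d. ?g d * (ennreal (gauss v\<^sub>w (X + ?c *\<^sub>R d - \<Theta>)) * F (X + ?c *\<^sub>R d)) \<partial>lborel) \<partial>lborel)"
  proof (rule nn_integral_cong)
    fix X :: "real^'q^'r"
    have "ennreal (gauss v\<^sub>x (X - \<Theta>)) * (\<integral>\<^sup>+Y. ennreal (gauss v\<^sub>y (Y - \<Theta>)) * F (pooled v\<^sub>x v\<^sub>y X Y) \<partial>lborel)
      = (\<integral>\<^sup>+Y. ennreal (gauss v\<^sub>x (X - \<Theta>)) * (ennreal (gauss v\<^sub>y (Y - \<Theta>)) * F (pooled v\<^sub>x v\<^sub>y X Y)) \<partial>lborel)"
      by (rule nn_integral_cmult[symmetric]) measurable
    also have "\<dots> = (\<integral>\<^sup>+Y. ?g (Y - X) * (ennreal (gauss v\<^sub>w (pooled v\<^sub>x v\<^sub>y X Y - \<Theta>)) * F (pooled v\<^sub>x v\<^sub>y X Y)) \<partial>lborel)"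
      by (simp only: mult.assoc[symmetric] ennreal_mult[OF gauss_nonneg gauss_nonneg, symmetric] gauss_mult_pooled)
    also have "\<dots> = (\<integral>\<^sup>+d. ?g (d + X - X) * (ennreal (gauss v\<^sub>w (pooled v\<^sub>x v\<^sub>y X (d + X) - \<Theta>)) * F (pooled v\<^sub>x v\<^sub>y X (d + X))) \<partial>lborel)"
      by (rule nn_integral_lborel_translate[symmetric]) measurable
    finally show "ennreal (gauss v\<^sub>x (X - \<Theta>)) * (\<integral>\<^sup>+Y. ennreal (gauss v\<^sub>y (Y - \<Theta>)) * F (pooled v\<^sub>x v\<^sub>y X Y) \<partial>lborel)
      = (\<integral>\<^sup>+d. ?g d * (ennreal (gauss v\<^sub>w (X + ?c *\<^sub>R d - \<Theta>)) * F (X + ?c *\<^sub>R d)) \<partial>lborel)"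
      by (simp only: W add_diff_cancel_right')
  qed
  also have "\<dots> = (\<integral>\<^sup>+d. (\<integral>\<^sup>+X. ?g d * (ennreal (gauss v\<^sub>w (X + ?c *\<^sub>R d - \<Theta>)) * F (X + ?c *\<^sub>R d)) \<partial>lborel) \<partial>lborel)"
    by (rule lborel_pair.Fubini') measurable
  also have "\<dots> = (\<integral>\<^sup>+d. ?g d * (\<integral>\<^sup>+z. ennreal (gauss v\<^sub>w (z - \<Theta>)) * F z \<partial>lborel) \<partial>lborel)"
  proof (rule nn_integral_cong)
    fix d :: "real^'q^'r"
    have "(\<integral>\<^sup>+X. ?g d * (ennreal (gauss v\<^sub>w (X + ?c *\<^sub>R d - \<Theta>)) * F (X + ?c *\<^sub>R d)) \<partial>lborel)
      = ?g d * (\<integral>\<^sup>+X. ennreal (gauss v\<^sub>w (X + ?c *\<^sub>R d - \<Theta>)) * F (X + ?c *\<^sub>R d) \<partial>lborel)"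
      by (rule nn_integral_cmult) measurable
    also have "(\<integral>\<^sup>+X. ennreal (gauss v\<^sub>w (X + ?c *\<^sub>R d - \<Theta>)) * F (X + ?c *\<^sub>R d) \<partial>lborel) = (\<integral>\<^sup>+z. ennreal (gauss v\<^sub>w (z - \<Theta>)) * F z \<partial>lborel)"
      by (rule nn_integral_lborel_translate) measurable
    finally show "(\<integral>\<^sup>+X. ?g d * (ennreal (gauss v\<^sub>w (X + ?c *\<^sub>R d - \<Theta>)) * F (X + ?c *\<^sub>R d)) \<partial>lborel)
      = ?g d * (\<integral>\<^sup>+z. ennreal (gauss v\<^sub>w (z - \<Theta>)) * F z \<partial>lborel)" .
  qed
  also have "\<dots> = (\<integral>\<^sup>+z. ennreal (gauss v\<^sub>w (z - \<Theta>)) * F z \<partial>lborel)"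
    using vx vy by (subst nn_integral_multc) (auto simp: nn_integral_gauss)
  finally show ?thesis .
qed

text \<open>Logarithms of the factorization in \<open>pred\<close>, integrated. Only the laws of X
  and of the pooled observation enter, so the risks differ by the expected logarithm of the marginal
  at the variances \<open>v\<^sub>w\<close> and \<open>v\<^sub>x\<close>.\<close>

lemma kl_risk_pred:
  fixes \<Theta> :: "real^'q^'r"
  assumes Cx: "\<And>z. m v\<^sub>x z \<le> C" and Cw: "\<And>z. m v\<^sub>w z \<le> C"
  shows "kl_risk v\<^sub>x v\<^sub>y \<Theta> (pred v\<^sub>x v\<^sub>y) + (\<integral>\<^sup>+z. ennreal (gauss v\<^sub>x (z - \<Theta>)) * ennreal (ln C - ln (m v\<^sub>x z)) \<partial>lborel)
    = kl_risk v\<^sub>x v\<^sub>y \<Theta> (\<lambda>X Y. gauss (v\<^sub>x + v\<^sub>y) (Y - X)) + (\<integral>\<^sup>+z. ennreal (gauss v\<^sub>w (z - \<Theta>)) * ennreal (ln C - ln (m v\<^sub>w z)) \<partial>lborel)"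
proof -
  note [measurable (raw)] = predictive_densityD(1)[OF predictive_density_pred]
  let ?U = "\<lambda>v z. ennreal (ln C - ln (m v z))" and ?\<phi> = "\<lambda>Y. gauss v\<^sub>y (Y - \<Theta>)"
  let ?g = "\<lambda>X Y :: real^'q^'r. gauss (v\<^sub>x + v\<^sub>y) (Y - X)" and ?p = "pred v\<^sub>x v\<^sub>y"
  have vxy: "0 < v\<^sub>x + v\<^sub>y" using vx vy by simp
  have pt: "kl (?\<phi> Y) (?p X Y) + ennreal (?g X Y) + ennreal (?\<phi> Y) * ?U v\<^sub>x X
    = kl (?\<phi> Y) (?g X Y) + ennreal (?p X Y) + ennreal (?\<phi> Y) * ?U v\<^sub>w (pooled v\<^sub>x v\<^sub>y X Y)" for X Y
  proof -
    let ?W = "pooled v\<^sub>x v\<^sub>y X Y"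
    have f: "0 < ?\<phi> Y" and g: "0 < ?g X Y" and p: "0 < ?p X Y" using gauss_pos vy vxy pred_pos by auto
    have mx: "0 < m v\<^sub>x X" and mw: "0 < m v\<^sub>w ?W" using m_pos vx vw_pos by auto
    have U: "0 \<le> ln C - ln (m v\<^sub>x X)" "0 \<le> ln C - ln (m v\<^sub>w ?W)" using mx mw Cx[of X] Cw[of ?W] by auto
    have lp: "ln (?p X Y) = ln (?g X Y) + ln (m v\<^sub>w ?W) - ln (m v\<^sub>x X)"
      unfolding pred_def vw[symmetric] using g mx mw by (simp add: ln_div ln_mult)
    have e: "(?\<phi> Y * ln (?\<phi> Y / ?p X Y) - ?\<phi> Y + ?p X Y) + ?g X Y + ?\<phi> Y * (ln C - ln (m v\<^sub>x X))
      = (?\<phi> Y * ln (?\<phi> Y / ?g X Y) - ?\<phi> Y + ?g X Y) + ?p X Y + ?\<phi> Y * (ln C - ln (m v\<^sub>w ?W))"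
      using f g p by (simp add: ln_div lp algebra_simps)
    have k: "kl (?\<phi> Y) x = ennreal (?\<phi> Y * ln (?\<phi> Y / x) - ?\<phi> Y + x)" "0 \<le> ?\<phi> Y * ln (?\<phi> Y / x) - ?\<phi> Y + x" if "0 < x" for x
      using that kl_real_nonneg[OF f that] by (auto simp: kl_def)
    show ?thesis
      unfolding k(1)[OF g] k(1)[OF p] using e k(2)[OF g] k(2)[OF p] f g p U
      by (simp add: ennreal_mult[symmetric] ennreal_plus[symmetric] del: ennreal_plus)
  qed
  have inner: "(\<integral>\<^sup>+Y. kl (?\<phi> Y) (?p X Y) \<partial>lborel) + ?U v\<^sub>x X
    = (\<integral>\<^sup>+Y. kl (?\<phi> Y) (?g X Y) \<partial>lborel) + (\<integral>\<^sup>+Y. ennreal (?\<phi> Y) * ?U v\<^sub>w (pooled v\<^sub>x v\<^sub>y X Y) \<partial>lborel)" for X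
  proof -
    have "(\<integral>\<^sup>+Y. kl (?\<phi> Y) (?p X Y) + ennreal (?g X Y) + ennreal (?\<phi> Y) * ?U v\<^sub>x X \<partial>lborel)
      = (\<integral>\<^sup>+Y. kl (?\<phi> Y) (?p X Y) \<partial>lborel) + 1 + ?U v\<^sub>x X"
      by (simp add: nn_integral_add nn_integral_multc nn_integral_gauss_diff vy vxy)
    moreover have "(\<integral>\<^sup>+Y. kl (?\<phi> Y) (?g X Y) + ennreal (?p X Y) + ennreal (?\<phi> Y) * ?U v\<^sub>w (pooled v\<^sub>x v\<^sub>y X Y) \<partial>lborel)
      = (\<integral>\<^sup>+Y. kl (?\<phi> Y) (?g X Y) \<partial>lborel) + 1 + (\<integral>\<^sup>+Y. ennreal (?\<phi> Y) * ?U v\<^sub>w (pooled v\<^sub>x v\<^sub>y X Y) \<partial>lborel)"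
      by (simp add: nn_integral_add predictive_densityD(3)[OF predictive_density_pred])
    ultimately have "(\<integral>\<^sup>+Y. kl (?\<phi> Y) (?p X Y) \<partial>lborel) + 1 + ?U v\<^sub>x X
      = (\<integral>\<^sup>+Y. kl (?\<phi> Y) (?g X Y) \<partial>lborel) + 1 + (\<integral>\<^sup>+Y. ennreal (?\<phi> Y) * ?U v\<^sub>w (pooled v\<^sub>x v\<^sub>y X Y) \<partial>lborel)"
      by (simp only: pt)
    then have "1 + ((\<integral>\<^sup>+Y. kl (?\<phi> Y) (?p X Y) \<partial>lborel) + ?U v\<^sub>x X)
      = 1 + ((\<integral>\<^sup>+Y. kl (?\<phi> Y) (?g X Y) \<partial>lborel) + (\<integral>\<^sup>+Y. ennreal (?\<phi> Y) * ?U v\<^sub>w (pooled v\<^sub>x v\<^sub>y X Y) \<partial>lborel))"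
      by (simp only: add_ac)
    then show ?thesis by (subst (asm) ennreal_add_left_cancel) auto
  qed
  have "kl_risk v\<^sub>x v\<^sub>y \<Theta> ?p + (\<integral>\<^sup>+z. ennreal (gauss v\<^sub>x (z - \<Theta>)) * ?U v\<^sub>x z \<partial>lborel)
    = (\<integral>\<^sup>+X. ennreal (gauss v\<^sub>x (X - \<Theta>)) * ((\<integral>\<^sup>+Y. kl (?\<phi> Y) (?p X Y) \<partial>lborel) + ?U v\<^sub>x X) \<partial>lborel)"
    unfolding kl_risk_def distrib_left by (rule nn_integral_add[symmetric]) measurable
  also have "\<dots> = (\<integral>\<^sup>+X. ennreal (gauss v\<^sub>x (X - \<Theta>)) * (\<integral>\<^sup>+Y. kl (?\<phi> Y) (?g X Y) \<partial>lborel)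
      + ennreal (gauss v\<^sub>x (X - \<Theta>)) * (\<integral>\<^sup>+Y. ennreal (?\<phi> Y) * ?U v\<^sub>w (pooled v\<^sub>x v\<^sub>y X Y) \<partial>lborel) \<partial>lborel)"
    unfolding inner distrib_left ..
  also have "\<dots> = kl_risk v\<^sub>x v\<^sub>y \<Theta> ?g
      + (\<integral>\<^sup>+X. ennreal (gauss v\<^sub>x (X - \<Theta>)) * (\<integral>\<^sup>+Y. ennreal (?\<phi> Y) * ?U v\<^sub>w (pooled v\<^sub>x v\<^sub>y X Y) \<partial>lborel) \<partial>lborel)"
    unfolding kl_risk_def by (rule nn_integral_add) measurable
  finally show ?thesis by (subst (asm) nn_integral_pooled) auto
qed

end

end

section \<open>Application to the hierarchical prior\<close>

lemma mix_marginal_neq_0: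
  fixes z :: "real^'q^'r"
  assumes v: "0 < v" and v0: "0 < v\<^sub>0"
  shows "mix_marginal v\<^sub>0 \<kappa> \<beta> v z \<noteq> 0"
proof
  assume "mix_marginal v\<^sub>0 \<kappa> \<beta> v z = 0"
  then have "AE H in sym_lborel. ennreal (mix_density v\<^sub>0 \<kappa> \<beta> v z H) * indicator {A. sym_pos_def A} H = 0"
    unfolding mix_marginal_def by (subst (asm) nn_integral_0_iff_AE) auto
  then have "AE H in sym_lborel. H \<notin> (unit_interval_mat :: (real^'r^'r) set)"
  proof eventually_elim
    case (elim H)
    show ?case
    proof
      assume "H \<in> unit_interval_mat"
      then have H: "sym_pos_def H" by (simp add: unit_interval_mat_def)
      have "0 < det H" "0 < det (mat v + H)" "0 < det (mat v\<^sub>0 + H)"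
        using H v v0 by (auto intro!: sym_pos_def_det sym_pos_def_mat_add)
      then have "0 < mix_density v\<^sub>0 \<kappa> \<beta> v z H" by (simp add: mix_density_def)
      then show False using elim H by simp
    qed
  qed
  then have "(unit_interval_mat :: (real^'r^'r) set) \<in> null_sets sym_lborel"
    by (subst AE_iff_null_sets) auto
  then show False using emeasure_unit_interval_mat_pos by auto
qed

lemma measurable_mix_marginal [measurable]:
  "(mix_marginal v\<^sub>0 \<kappa> \<beta> v :: real^'q^'r \<Rightarrow> ennreal) \<in> borel_measurable borel"
proof -
  interpret sigma_finite_measure "sym_lborel :: (real^'r^'r) measure" by (rule sigma_finite_sym_lborel)
  have "(\<lambda>(z :: real^'q^'r, H). ennreal (mix_density v\<^sub>0 \<kappa> \<beta> v z H) * indicator {A. sym_pos_def A} H)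
    \<in> borel_measurable (borel \<Otimes>\<^sub>M (sym_lborel :: (real^'r^'r) measure))"
    unfolding mix_density_def split_beta' by measurable
  then show ?thesis unfolding mix_marginal_def by (rule borel_measurable_nn_integral)
qed

text \<open>In terms of the mixture, \<open>slack\<close> reads 2 \<kappa> < q - r - 1. Its
  strictness leaves room for the errors of order h / v in every step of the path from
  \<open>v\<^sub>w\<close> to \<open>v\<^sub>x\<close>.\<close>

theorem p_GB_admissible_minimax:
  fixes v\<^sub>x v\<^sub>y v\<^sub>0 K a b :: real
  assumes vx: "0 < v\<^sub>x" and vy: "0 < v\<^sub>y" and v0: "v\<^sub>x \<le> v\<^sub>0" and K: "0 < K" and a: "0 < a" and b: "2 < b"
    and slack: "a + b + 2 * real CARD('r) - 2 < real CARD('q) - real CARD('r) - 1"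
  shows "KL_admissible v\<^sub>x v\<^sub>y (p_GB v\<^sub>x v\<^sub>y v\<^sub>0 K a b :: real^'q^'r \<Rightarrow> real^'q^'r \<Rightarrow> real)"
    and "KL_minimax v\<^sub>x v\<^sub>y (p_GB v\<^sub>x v\<^sub>y v\<^sub>0 K a b :: real^'q^'r \<Rightarrow> real^'q^'r \<Rightarrow> real)"
proof -
  let ?q = "real CARD('q)" and ?n = "real CARD('r)"
  let ?\<pi> = "prior_hier v\<^sub>0 K a b :: real^'q^'r \<Rightarrow> ennreal"
  define \<beta> where "\<beta> = b / 2 - 1"
  define \<kappa> where "\<kappa> = a / 2 + \<beta> + ?n"
  define s where "s = ?q - ?n - 1 - 2 * \<beta> + 2 * \<kappa>"
  define v\<^sub>w where "v\<^sub>w = v\<^sub>x * v\<^sub>y / (v\<^sub>x + v\<^sub>y)"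
  have v0p: "0 < v\<^sub>0" using vx v0 by simp
  have \<beta>: "0 < \<beta>" and \<kappa>: "0 < \<kappa>" using a b by (auto simp: \<beta>_def \<kappa>_def intro!: add_pos_nonneg)
  have slack': "2 * \<kappa> < ?q - ?n - 1" using slack by (simp add: \<kappa>_def \<beta>_def field_simps)
  have s: "0 \<le> s" using slack' \<kappa> a by (simp add: s_def \<kappa>_def)
  have vw: "0 < v\<^sub>w" "v\<^sub>w < v\<^sub>x" using vx vy by (auto simp: v\<^sub>w_def field_simps)
  obtain c where c: "0 < c" and marginal: "\<And>v z. 0 < v \<Longrightarrow>
      (\<integral>\<^sup>+\<Theta>. ennreal (gauss v (z - \<Theta>)) * ?\<pi> \<Theta> \<partial>lborel) = ennreal c * mix_marginal v\<^sub>0 \<kappa> \<beta> v z"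
    using marginal_eq_mix_marginal[OF v0p K, of a b, where 'q = 'q and 'r = 'r] unfolding \<kappa>_def \<beta>_def by blast
  have fin: "(\<integral>\<^sup>+\<Theta>. ?\<pi> \<Theta> \<partial>lborel) \<noteq> \<top>" by (rule prior_hier_proper[OF v0p K a b])
  have fin_marg: "mix_marginal v\<^sub>0 \<kappa> \<beta> v z \<noteq> \<top>" if v: "0 < v" for v and z :: "real^'q^'r"
  proof
    assume "mix_marginal v\<^sub>0 \<kappa> \<beta> v z = \<top>"
    then have "\<top> = (\<integral>\<^sup>+\<Theta>. ennreal (gauss v (z - \<Theta>)) * ?\<pi> \<Theta> \<partial>lborel)"
      using c by (simp add: marginal[OF v] ennreal_mult_top)
    also have "\<dots> \<le> (\<integral>\<^sup>+\<Theta>. ennreal ((2 * pi * v) powr (- real DIM(real^'q^'r) / 2)) * ?\<pi> \<Theta> \<partial>lborel)"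
    proof (intro nn_integral_mono mult_right_mono ennreal_leI)
      fix \<Theta> :: "real^'q^'r"
      show "gauss v (z - \<Theta>) \<le> (2 * pi * v) powr (- real DIM(real^'q^'r) / 2)"
        unfolding gauss_def using v by (intro mult_left_le) auto
    qed auto
    also have "\<dots> = ennreal ((2 * pi * v) powr (- real DIM(real^'q^'r) / 2)) * (\<integral>\<^sup>+\<Theta>. ?\<pi> \<Theta> \<partial>lborel)"
      by (rule nn_integral_cmult) measurable
    also have "\<dots> < \<top>" using fin by (intro ennreal_mult_less_top[THEN iffD2] disjI2) (auto simp: less_top)
    finally show False by simp
  qed
  have "mix_marginal v\<^sub>0 \<kappa> \<beta> v z \<noteq> 0" if "0 < v" for v and z :: "real^'q^'r"
    by (rule mix_marginal_neq_0[OF that v0p])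
  then interpret N: normal_mixture v\<^sub>0 \<kappa> \<beta> "TYPE(real^'q^'r)"
    by unfold_locales (use v0p \<kappa> \<beta> fin_marg in auto)
  define m where "m v z = c * enn2real (mix_marginal v\<^sub>0 \<kappa> \<beta> v z)" for v and z :: "real^'q^'r"
  interpret S: smoothed_prior ?\<pi> m
  proof
    show "?\<pi> \<in> borel_measurable borel" by measurable
    show "m v \<in> borel_measurable borel" for v unfolding m_def by measurable
    show "0 < m v z" if "0 < v" for v z using c N.rmarg(2)[OF that, of z] by (simp add: m_def)
    show "(\<integral>\<^sup>+\<Theta>. ennreal (gauss v (z - \<Theta>)) * ?\<pi> \<Theta> \<partial>lborel) = ennreal (m v z)" if "0 < v" for v z
      using c N.rmarg(1)[OF that, of z] by (simp add: marginal[OF that] m_def ennreal_mult)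
  qed
  \<comment> \<open>An upper bound for the marginals at all variances from \<open>v\<^sub>w\<close>
    on, as they are largest at the smallest variance and at the origin.\<close>
  define C where "C = m v\<^sub>w 0"
  have C: "m v z \<le> C" if "v\<^sub>w \<le> v" for v z
    using N.marg_le_at_zero[OF vw(1) that, of z] c by (simp add: C_def m_def)
  \<comment> \<open>The coefficient required by \<open>marg_heat_step\<close>. At \<epsilon> = 0 it
    equals 2 \<beta> - 4 \<kappa> + s = q - r - 1 - 2 \<kappa>, which is positive, so it stays
    positive for small \<epsilon>.\<close>
  define \<psi> where "\<psi> \<epsilon> = 2 * \<beta> - 2 * \<kappa> / (1 - \<epsilon>) + (1 - \<epsilon>) * s - 2 * \<kappa> / (1 - 2 * \<epsilon>)" for \<epsilon>
  have "(\<psi> \<longlongrightarrow> 2 * \<beta> - 2 * \<kappa> / (1 - 0) + (1 - 0) * s - 2 * \<kappa> / (1 - 2 * 0)) (at 0)"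
    unfolding \<psi>_def by (intro tendsto_intros) auto
  moreover have "0 < 2 * \<beta> - 2 * \<kappa> / (1 - 0) + (1 - 0) * s - 2 * \<kappa> / (1 - 2 * 0)"
    using slack' by (simp add: s_def)
  ultimately have "eventually (\<lambda>\<epsilon>. 0 < \<psi> \<epsilon>) (at 0)" by (rule order_tendstoD(1))
  then obtain \<epsilon>\<^sub>0 where \<epsilon>0: "0 < \<epsilon>\<^sub>0" "\<And>\<epsilon>. 0 < \<epsilon> \<Longrightarrow> \<epsilon> < \<epsilon>\<^sub>0 \<Longrightarrow> 0 < \<psi> \<epsilon>"
    unfolding eventually_at by (auto simp: dist_real_def)
  have step: "\<exists>p. exp (h * (norm p)\<^sup>2 / 2) * m (v + 2 * h) (w + h *\<^sub>R p) \<le> m v w"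
    if h: "0 < h" "h < \<epsilon>\<^sub>0 * v\<^sub>w" and v: "v\<^sub>w \<le> v" "v + h \<le> v\<^sub>x" for h v w
  proof -
    have vp: "0 < v" "0 < v + 2 * h" using v vw h by auto
    have "\<epsilon>\<^sub>0 * v\<^sub>w \<le> \<epsilon>\<^sub>0 * (v + 2 * h)" using \<epsilon>0 v h by (intro mult_left_mono) auto
    then have "h < \<epsilon>\<^sub>0 * (v + 2 * h)" using h by simp
    then have e: "0 < h / (v + 2 * h)" "h / (v + 2 * h) < \<epsilon>\<^sub>0" using vp h by (auto simp: pos_divide_less_eq)
    \<comment> \<open>From v + h \<le> \<open>v\<^sub>x\<close> \<le> \<open>v\<^sub>0\<close>: the
      variance v + 2h overshoots \<open>v\<^sub>0\<close> by at most h.\<close>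
    have d: "- h \<le> v\<^sub>0 - (v + 2 * h)" and vle: "v \<le> v\<^sub>0" using v v0 h by auto
    obtain p where "mix_marginal v\<^sub>0 \<kappa> \<beta> (v + 2 * h) (w + h *\<^sub>R p) * ennreal (exp (h * (norm p)\<^sup>2 / 2)) \<le> mix_marginal v\<^sub>0 \<kappa> \<beta> v w"
      using N.marg_heat_step[OF vp(1) h(1) d vle, of w] s \<epsilon>0(2)[OF e] unfolding s_def \<psi>_def by (auto intro: less_imp_le)
    then have "N.rmarg (v + 2 * h) (w + h *\<^sub>R p) * exp (h * (norm p)\<^sup>2 / 2) \<le> N.rmarg v w"
      using N.rmarg(1)[OF vp(1), of w] N.rmarg(1)[OF vp(2), of "w + h *\<^sub>R p"] N.rmarg(2)[OF vp(1), of w]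
      by (metis ennreal_le_iff ennreal_mult'' exp_ge_zero less_imp_le)
    then have "c * (N.rmarg (v + 2 * h) (w + h *\<^sub>R p) * exp (h * (norm p)\<^sup>2 / 2)) \<le> c * N.rmarg v w"
      using c by (intro mult_left_mono) auto
    then show ?thesis unfolding m_def by (intro exI[of _ p]) (simp add: mult_ac)
  qed
  let ?E = "\<lambda>v \<Theta> :: real^'q^'r. \<integral>\<^sup>+z. ennreal (gauss v (z - \<Theta>)) * ennreal (ln C - ln (m v z)) \<partial>lborel"
  have mono: "?E v\<^sub>w \<Theta> \<le> ?E v\<^sub>x \<Theta>" for \<Theta>
    by (rule expected_log_mono[where h\<^sub>0 = "\<epsilon>\<^sub>0 * v\<^sub>w"])
      (use vw \<epsilon>0(1) S.m_pos C S.m_convolution step in auto)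
  \<comment> \<open>The expectation at \<open>v\<^sub>x\<close> will be cancelled from both sides of
    the risk identity. It is finite because ln m decreases at most quadratically.\<close>
  have E_fin: "?E v\<^sub>x \<Theta> \<noteq> \<top>" for \<Theta>
  proof -
    define A where "A = ln C - ln (m v\<^sub>x 0)"
    have A: "0 \<le> A" unfolding A_def using C[of v\<^sub>x 0] vw S.m_pos[OF vx, of 0] by simp
    have le: "ln C - ln (m v\<^sub>x z) \<le> A + (norm z)\<^sup>2 / (2 * v\<^sub>x)" for z
      using N.log_marg_lower_bound[OF vx, of 0 z] c N.rmarg(2)[OF vx, of 0] N.rmarg(2)[OF vx, of z]
      by (simp add: A_def m_def ln_mult power2_eq_square)
    have "?E v\<^sub>x \<Theta> \<le> (\<integral>\<^sup>+z. ennreal A * ennreal (gauss v\<^sub>x (z - \<Theta>)) + ennreal (1 / (2 * v\<^sub>x)) * ennreal (gauss v\<^sub>x (z - \<Theta>) * (norm (z - 0))\<^sup>2) \<partial>lborel)"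
    proof (rule nn_integral_mono)
      fix z :: "real^'q^'r"
      have "gauss v\<^sub>x (z - \<Theta>) * (ln C - ln (m v\<^sub>x z)) \<le> gauss v\<^sub>x (z - \<Theta>) * (A + (norm z)\<^sup>2 / (2 * v\<^sub>x))"
        by (rule mult_left_mono[OF le]) simp
      also have "\<dots> = A * gauss v\<^sub>x (z - \<Theta>) + 1 / (2 * v\<^sub>x) * (gauss v\<^sub>x (z - \<Theta>) * (norm (z - 0))\<^sup>2)" by (simp add: algebra_simps)
      finally show "ennreal (gauss v\<^sub>x (z - \<Theta>)) * ennreal (ln C - ln (m v\<^sub>x z))
        \<le> ennreal A * ennreal (gauss v\<^sub>x (z - \<Theta>)) + ennreal (1 / (2 * v\<^sub>x)) * ennreal (gauss v\<^sub>x (z - \<Theta>) * (norm (z - 0))\<^sup>2)"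
        using A vx by (simp add: ennreal_mult'[symmetric] ennreal_plus[symmetric] ennreal_leI del: ennreal_plus)
    qed
    also have "\<dots> = ennreal A * 1 + ennreal (1 / (2 * v\<^sub>x)) * ennreal (DIM(real^'q^'r) * v\<^sub>x + (norm (\<Theta> - 0))\<^sup>2)"
      using vx by (simp only: nn_integral_gauss_shifted_square[OF vx, symmetric] nn_integral_gauss_diff(1)[OF vx, of \<Theta>, symmetric])
        (subst nn_integral_add, measurable, simp add: nn_integral_cmult)
    also have "\<dots> < \<top>" by (simp add: ennreal_mult_less_top)
    finally show ?thesis by (simp add: less_top)
  qed
  note P = vx vy v\<^sub>w_def
  have p: "p_GB v\<^sub>x v\<^sub>y v\<^sub>0 K a b = S.pred v\<^sub>x v\<^sub>y"
    unfolding p_GB_def by (rule S.bayes_predictive_eq_pred[OF P])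
  have bound: "kl_risk v\<^sub>x v\<^sub>y \<Theta> (S.pred v\<^sub>x v\<^sub>y) \<le> ennreal (real DIM(real^'q^'r) / 2 * ln ((v\<^sub>x + v\<^sub>y) / v\<^sub>y))" for \<Theta> :: "real^'q^'r"
  proof -
    have "kl_risk v\<^sub>x v\<^sub>y \<Theta> (S.pred v\<^sub>x v\<^sub>y) + ?E v\<^sub>x \<Theta>
      = ennreal (real DIM(real^'q^'r) / 2 * ln ((v\<^sub>x + v\<^sub>y) / v\<^sub>y)) + ?E v\<^sub>w \<Theta>"
      unfolding kl_risk_uniform_prior[OF vx vy, of \<Theta>, symmetric]
      by (rule S.kl_risk_pred[OF P]) (use C vw in auto)
    also have "\<dots> \<le> ennreal (real DIM(real^'q^'r) / 2 * ln ((v\<^sub>x + v\<^sub>y) / v\<^sub>y)) + ?E v\<^sub>x \<Theta>" by (intro add_left_mono mono)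
    finally have "?E v\<^sub>x \<Theta> + kl_risk v\<^sub>x v\<^sub>y \<Theta> (S.pred v\<^sub>x v\<^sub>y) \<le> ?E v\<^sub>x \<Theta> + ennreal (real DIM(real^'q^'r) / 2 * ln ((v\<^sub>x + v\<^sub>y) / v\<^sub>y))"
      by (simp only: add.commute)
    then show ?thesis using E_fin[of \<Theta>] by (subst (asm) ennreal_add_left_cancel_le) auto
  qed
  show "KL_minimax v\<^sub>x v\<^sub>y (p_GB v\<^sub>x v\<^sub>y v\<^sub>0 K a b :: real^'q^'r \<Rightarrow> real^'q^'r \<Rightarrow> real)"
    unfolding p by (rule minimax_if_bounded_by_uniform_prior[OF vx vy S.predictive_density_pred[OF P] bound])
  show "KL_admissible v\<^sub>x v\<^sub>y (p_GB v\<^sub>x v\<^sub>y v\<^sub>0 K a b :: real^'q^'r \<Rightarrow> real^'q^'r \<Rightarrow> real)"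
    unfolding p
  proof (rule proper_bayes_admissible[OF vx vy _ fin S.predictive_density_pred[OF P] S.pred_pos[OF P] _ _ bound])
    show "?\<pi> \<in> borel_measurable borel" by measurable
    show "(\<integral>\<^sup>+\<Theta>. ennreal (gauss v\<^sub>x (X - \<Theta>)) * ennreal (gauss v\<^sub>y (Y - \<Theta>)) * ?\<pi> \<Theta> \<partial>lborel)
      = (\<integral>\<^sup>+\<Theta>. ennreal (gauss v\<^sub>x (X - \<Theta>)) * ?\<pi> \<Theta> \<partial>lborel) * ennreal (S.pred v\<^sub>x v\<^sub>y X Y)" for X Y
      unfolding S.smooth[OF vx] by (rule S.pred_bayes[OF P])
    show "(\<integral>\<^sup>+\<Theta>. ennreal (gauss v\<^sub>x (X - \<Theta>)) * ?\<pi> \<Theta> \<partial>lborel) \<noteq> 0" for X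
      unfolding S.smooth[OF vx] using S.m_pos[OF vx, of X] by simp
  qed
qed

theorem corollary3p1:
  fixes q r :: nat and v\<^sub>x v\<^sub>y v\<^sub>0 v\<^sub>w :: real
  assumes "CARD('q::finite) = q" and "CARD('r::finite) = r"
    and "q \<ge> r" and "r \<ge> 1"
    and "v\<^sub>x > 0" and "v\<^sub>y > 0" and "v\<^sub>0 \<ge> v\<^sub>x"
    and "v\<^sub>w = inverse (1 / v\<^sub>x + 1 / v\<^sub>y)"
    and "real q - real r - 1 > 0"
  shows "(\<forall>a b K :: real.
            K > 0 \<and> a > 0 \<and> b > 2 \<and>
            a + b \<le> (real q - real r - 1) / (2 - v\<^sub>w / v\<^sub>0) - 2 * real r + 2 \<longrightarrow>
            KL_admissible v\<^sub>x v\<^sub>y (p_GB v\<^sub>x v\<^sub>y v\<^sub>0 K a b :: real^'q^'r \<Rightarrow> real^'q^'r \<Rightarrow> real) \<and>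
            KL_minimax v\<^sub>x v\<^sub>y (p_GB v\<^sub>x v\<^sub>y v\<^sub>0 K a b :: real^'q^'r \<Rightarrow> real^'q^'r \<Rightarrow> real)) \<and>
         ((- real q + 5 * real r + 1) / (2 * real r) < v\<^sub>w / v\<^sub>0 \<and> v\<^sub>w / v\<^sub>0 < 1 \<longrightarrow>
            (\<exists>a b :: real. a > 0 \<and> b > 2 \<and>
               a + b \<le> (real q - real r - 1) / (2 - v\<^sub>w / v\<^sub>0) - 2 * real r + 2))"
proof (intro conjI allI impI)
  define \<rho> where "\<rho> = v\<^sub>w / v\<^sub>0"
  have "v\<^sub>w < v\<^sub>x"
  proof -
    have "inverse (1 / v\<^sub>x + 1 / v\<^sub>y) < inverse (1 / v\<^sub>x)"
      using assms(5,6) by (intro less_imp_inverse_less) auto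
    then show ?thesis using assms(8) by simp
  qed
  then have \<rho>: "\<rho> < 1" using assms(5,7) by (simp add: \<rho>_def)
  {
    fix a b K :: real
    assume H: "K > 0 \<and> a > 0 \<and> b > 2 \<and> a + b \<le> (real q - real r - 1) / (2 - v\<^sub>w / v\<^sub>0) - 2 * real r + 2"
    \<comment> \<open>The denominator 2 - \<rho> exceeds 1 and q - r - 1 > 0, so the assumed bound
      is strictly below the one with denominator 1; this is the slack required above.\<close>
    have "(real q - real r - 1) / (2 - \<rho>) < (real q - real r - 1) / 1"
      using \<rho> assms(9) by (intro divide_strict_left_mono) auto
    then have "a + b + 2 * real CARD('r) - 2 < real CARD('q) - real CARD('r) - 1"
      using H unfolding \<rho>_def assms(1,2) by simp
    note main = p_GB_admissible_minimax[OF assms(5,6,7) _ _ _ this]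
    show "KL_admissible v\<^sub>x v\<^sub>y (p_GB v\<^sub>x v\<^sub>y v\<^sub>0 K a b :: real^'q^'r \<Rightarrow> real^'q^'r \<Rightarrow> real)"
      "KL_minimax v\<^sub>x v\<^sub>y (p_GB v\<^sub>x v\<^sub>y v\<^sub>0 K a b :: real^'q^'r \<Rightarrow> real^'q^'r \<Rightarrow> real)"
      using H by (auto intro: main)
  next
    assume H: "(- real q + 5 * real r + 1) / (2 * real r) < v\<^sub>w / v\<^sub>0 \<and> v\<^sub>w / v\<^sub>0 < 1"
    define B where "B = (real q - real r - 1) / (2 - \<rho>) - 2 * real r + 2"
    \<comment> \<open>The lower bound on \<rho> is equivalent to 2 r (2 - \<rho>) < q - r - 1, that
      is, to B > 2, which leaves room for a > 0 and b > 2 with a + b = B.\<close>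
    have "- real q + 5 * real r + 1 < \<rho> * (2 * real r)"
      using H assms(4) by (simp add: \<rho>_def pos_divide_less_eq)
    then have "2 * real r * (2 - \<rho>) < real q - real r - 1" by (simp add: algebra_simps)
    then have "2 * real r < (real q - real r - 1) / (2 - \<rho>)" using \<rho> by (simp add: pos_less_divide_eq)
    then have "2 < B" by (simp add: B_def)
    \<comment> \<open>The excess of B over 2 is shared equally between a and b - 2.\<close>
    then have "(B - 2) / 2 > 0 \<and> 2 + (B - 2) / 2 > 2 \<and> (B - 2) / 2 + (2 + (B - 2) / 2) \<le> B" by (simp add: field_simps)
    then show "\<exists>a b :: real. a > 0 \<and> b > 2 \<and> a + b \<le> (real q - real r - 1) / (2 - v\<^sub>w / v\<^sub>0) - 2 * real r + 2"
      unfolding B_def \<rho>_def by blast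
  }
qed

end
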